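(* Let $N\in\mathbb{Z}$ and $\alpha\in\overline{\mathbb{Q}}$. If $T\in\overline{\mathbb{Q}}[x]$ is such that $\deg T\leq N$ and $T(\alpha)\neq 0$, then $$U(N,\alpha,T)=U(N,\alpha,1)=-N\,h(\alpha).$$
   Context: For a number field $K$ and a place $v$ of $K$ dividing the place $p$ of $\mathbb{Q}$ (with $p$ a prime or $\infty$), let $K_v$ and $\mathbb{Q}_p$ be the completions ($\mathbb{Q}_\infty=\mathbb{R}$), let $\|\cdot\|_v$ be the unique absolute value on $K_v$ extending the $p$-adic (for $p=\infty$, the usual) absolute value on $\mathbb{Q}_p$, and set $|\cdot|_v=\|\cdot\|_v^{[K_v:\mathbb{Q}_p]/[K:\mathbb{Q}]}$. Let $\Omega_v$ be the completion of an algebraic closure of $K_v$, with $|\cdot|_v$ extended to $\Omega_v$. Write $\log^+ t=\max\{0,\log t\}$ and $\log 0=-\infty$. The logarithmic Weil height of $\alpha\in K$ is $h(\alpha)=\sum_v\log^+|\alpha|_v$, the sum over all places $v$ of $K$; it is independent of the choice of $K\ni\alpha$, so $h$ is defined on $\overline{\mathbb{Q}}$. For $T\in\Omega_v[x]$ let $\nu_v(T)=\log\sup\{|T(z)|_v: z\in\Omega_v,\ |z|_v=1\}$. For $\alpha\in\Omega_v$, $N\in\mathbb{Z}$ and $T\in\Omega_v[x]$ with $\deg T\leq N$ let $$U_v(N,\alpha,T)=\inf\{\nu_v(T-f): f\in\Omega_v[x],\ f(\alpha)=0,\ \deg f\leq N\}$$ (the zero polynomial is allowed as $f$). For $\alpha\in\overline{\mathbb{Q}}$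 and $T\in\overline{\mathbb{Q}}[x]$ with $\deg T\le N$ and $T(\alpha)\neq0$, let $K$ be any number field containing $\alpha$ and the coefficients of $T$, and define $U(N,\alpha,T)=\sum_v U_v(N,\alpha,T)$, the sum over all places $v$ of $K$; all but finitely many terms vanish, and the value does not depend on $K$. *)

theory Defs
  imports
    "HOL-Analysis.Infinite_Sum"
    "HOL-Library.Extended_Real"
    "HOL-Algebra.Algebraic_Closure"
    "HOL-Computational_Algebra.Computational_Algebra"
begin

section \<open>Absolute values and completions\<close>

text \<open>
  Absolute values are functions that are \<^const>\<open>undefined\<close> outside the carrier, so that
  two absolute values which agree on the carrier are equal.
\<close>

definition absolute_values :: "('a, 'b) ring_scheme \<Rightarrow> ('a \<Rightarrow> real) set" where
  "absolute_values R = {n \<in> carrier R \<rightarrow>\<^sub>E {0..}.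
     (\<forall>x\<in>carrier R. n x = 0 \<longleftrightarrow> x = \<zero>\<^bsub>R\<^esub>) \<and>
     (\<forall>x\<in>carrier R. \<forall>y\<in>carrier R. n (x \<otimes>\<^bsub>R\<^esub> y) = n x * n y) \<and>
     (\<forall>x\<in>carrier R. \<forall>y\<in>carrier R. n (x \<oplus>\<^bsub>R\<^esub> y) \<le> n x + n y)}"

definition nontrivial_absolute_values :: "('a, 'b) ring_scheme \<Rightarrow> ('a \<Rightarrow> real) set" where
  "nontrivial_absolute_values R =
     {n \<in> absolute_values R. \<exists>x\<in>carrier R - {\<zero>\<^bsub>R\<^esub>}. n x \<noteq> 1}"

definition equivalent_absolute_values ::
    "('a, 'b) ring_scheme \<Rightarrow> (('a \<Rightarrow> real) \<times> ('a \<Rightarrow> real)) set" where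
  "equivalent_absolute_values R =
     {(m, n). m \<in> nontrivial_absolute_values R \<and> n \<in> nontrivial_absolute_values R \<and>
       (\<exists>s>0. \<forall>x\<in>carrier R. n x = m x powr s)}"

text \<open>
  The completion of a field \<open>R\<close> at an absolute value \<open>n\<close>: Cauchy sequences modulo
  null sequences.
\<close>

definition cauchy_seqs :: "('a, 'b) ring_scheme \<Rightarrow> ('a \<Rightarrow> real) \<Rightarrow> (nat \<Rightarrow> 'a) set" where
  "cauchy_seqs R n = {s. range s \<subseteq> carrier R \<and>
     (\<forall>e>0. \<exists>M. \<forall>i\<ge>M. \<forall>j\<ge>M. n (s i \<ominus>\<^bsub>R\<^esub> s j) < e)}"

definition cauchy_ring :: "('a, 'b) ring_scheme \<Rightarrow> ('a \<Rightarrow> real) \<Rightarrow> (nat \<Rightarrow> 'a) ring" where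
  "cauchy_ring R n =
     \<lparr>carrier = cauchy_seqs R n,
      mult = (\<lambda>s t k. s k \<otimes>\<^bsub>R\<^esub> t k), one = (\<lambda>k. \<one>\<^bsub>R\<^esub>),
      zero = (\<lambda>k. \<zero>\<^bsub>R\<^esub>), add = (\<lambda>s t k. s k \<oplus>\<^bsub>R\<^esub> t k)\<rparr>"

definition null_seqs :: "('a, 'b) ring_scheme \<Rightarrow> ('a \<Rightarrow> real) \<Rightarrow> (nat \<Rightarrow> 'a) set" where
  "null_seqs R n = {s. range s \<subseteq> carrier R \<and> (\<lambda>k. n (s k)) \<longlonglongrightarrow> 0}"

definition completion :: "('a, 'b) ring_scheme \<Rightarrow> ('a \<Rightarrow> real) \<Rightarrow> (nat \<Rightarrow> 'a) set ring" where
  "completion R n = cauchy_ring R n Quot null_seqs R n"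

definition to_completion ::
    "('a, 'b) ring_scheme \<Rightarrow> ('a \<Rightarrow> real) \<Rightarrow> 'a \<Rightarrow> (nat \<Rightarrow> 'a) set" where
  "to_completion R n x = null_seqs R n +>\<^bsub>cauchy_ring R n\<^esub> (\<lambda>k. x)"

definition completion_abs ::
    "('a, 'b) ring_scheme \<Rightarrow> ('a \<Rightarrow> real) \<Rightarrow> (nat \<Rightarrow> 'a) set \<Rightarrow> real" where
  "completion_abs R n =
     (\<lambda>c\<in>carrier (completion R n). THE l. \<forall>s\<in>c. (\<lambda>k. n (s k)) \<longlonglongrightarrow> l)"


section \<open>Number fields and their places\<close>

text \<open>
  The algebraic closure of \<open>\<rat>\<close> is taken inside the complex numbers, and number fields are
  subfields of the complex numbers.
\<close>

definition num_ring :: "complex set \<Rightarrow> complex ring" where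
  "num_ring K = \<lparr>carrier = K, mult = (*), one = 1, zero = 0, add = (+)\<rparr>"

definition number_field :: "complex set \<Rightarrow> bool" where
  "number_field K \<longleftrightarrow>
     subfield K (num_ring UNIV) \<and> ring.finite_dimension (num_ring UNIV) \<rat> K"

definition field_degree :: "complex set \<Rightarrow> nat" where
  "field_degree K = ring.dim (num_ring UNIV) \<rat> K"

type_synonym place = "(complex \<Rightarrow> real) set"

definition places :: "complex set \<Rightarrow> place set" where
  "places K =
     nontrivial_absolute_values (num_ring K) // equivalent_absolute_values (num_ring K)"

definition padic_abs :: "nat \<Rightarrow> rat \<Rightarrow> real" where
  "padic_abs p r = (if r = 0 then 0 else
     (case quotient_of r of (a, b) \<Rightarrow>
        real p powi (int (multiplicity (int p) b) - int (multiplicity (int p) a))))"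

text \<open>The places of \<open>\<rat>\<close> are indexed by the primes and \<open>\<infinity>\<close>.\<close>

definition rat_place :: "enat \<Rightarrow> bool" where
  "rat_place p \<longleftrightarrow> p = \<infinity> \<or> (\<exists>q. Factorial_Ring.prime q \<and> p = enat q)"

definition rat_abs :: "enat \<Rightarrow> rat \<Rightarrow> real" where
  "rat_abs p r = (case p of enat q \<Rightarrow> padic_abs q r | \<infinity> \<Rightarrow> \<bar>of_rat r\<bar>)"

definition place_divides :: "place \<Rightarrow> enat \<Rightarrow> bool" where
  "place_divides v p \<longleftrightarrow> (\<exists>n\<in>v. \<exists>s>0. \<forall>r. n (of_rat r) = rat_abs p r powr s)"

definition place_below :: "place \<Rightarrow> enat" where
  "place_below v = (THE p. rat_place p \<and> place_divides v p)"


section \<open>The local fields\<close>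

text \<open>
  Equivalent absolute values have the same Cauchy sequences and the same null sequences, so
  \<open>K\<^sub>v\<close> does not depend on the chosen representative of \<open>v\<close>.
\<close>

definition place_rep :: "place \<Rightarrow> complex \<Rightarrow> real" where
  "place_rep v = (SOME n. n \<in> v)"

definition local_field :: "complex set \<Rightarrow> place \<Rightarrow> (nat \<Rightarrow> complex) set ring" where
  "local_field K v = completion (num_ring K) (place_rep v)"

definition to_local_field :: "complex set \<Rightarrow> place \<Rightarrow> complex \<Rightarrow> (nat \<Rightarrow> complex) set" where
  "to_local_field K v = to_completion (num_ring K) (place_rep v)"

text \<open>
  The copy of \<open>\<rat>\<^sub>p\<close> inside \<open>K\<^sub>v\<close> consists of the classes of rational Cauchy sequences.
  The absolute value of \<open>\<rat>\<^sub>p\<close> at such a class is the limit of the absolute values along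
  the sequence.
\<close>

definition local_rationals :: "complex set \<Rightarrow> place \<Rightarrow> (nat \<Rightarrow> complex) set set" where
  "local_rationals K v =
     {c \<in> carrier (local_field K v). \<exists>s :: nat \<Rightarrow> rat. (\<lambda>k. of_rat (s k)) \<in> c}"

definition local_degree :: "complex set \<Rightarrow> place \<Rightarrow> nat" where
  "local_degree K v =
     ring.dim (local_field K v) (local_rationals K v) (carrier (local_field K v))"

text \<open>
  \<open>local_norm\<close> is \<open>\<parallel>\<cdot>\<parallel>\<^sub>v\<close>, and \<open>local_abs\<close> is the power \<open>|\<cdot>|\<^sub>v\<close> of it.
\<close>

definition local_norm :: "complex set \<Rightarrow> place \<Rightarrow> (nat \<Rightarrow> complex) set \<Rightarrow> real" where
  "local_norm K v = (THE n. n \<in> absolute_values (local_field K v) \<and>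
     (\<forall>c\<in>carrier (local_field K v). \<forall>s :: nat \<Rightarrow> rat. (\<lambda>k. of_rat (s k)) \<in> c \<longrightarrow>
        (\<lambda>k. rat_abs (place_below v) (s k)) \<longlonglongrightarrow> n c))"

definition local_abs :: "complex set \<Rightarrow> place \<Rightarrow> (nat \<Rightarrow> complex) set \<Rightarrow> real" where
  "local_abs K v = (\<lambda>c\<in>carrier (local_field K v).
     local_norm K v c powr (real (local_degree K v) / real (field_degree K)))"

type_synonym local_closure_elem =
  "((nat \<Rightarrow> complex) set list \<times> nat) multiset \<Rightarrow> (nat \<Rightarrow> complex) set"

definition local_closure :: "complex set \<Rightarrow> place \<Rightarrow> local_closure_elem ring" where
  "local_closure K v = field.alg_closure (local_field K v)"

definition to_local_closure ::
    "complex set \<Rightarrow> place \<Rightarrow> (nat \<Rightarrow> complex) set \<Rightarrow> local_closure_elem" where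
  "to_local_closure K v = ring.indexed_const (local_field K v)"

definition local_closure_abs :: "complex set \<Rightarrow> place \<Rightarrow> local_closure_elem \<Rightarrow> real" where
  "local_closure_abs K v = (THE n. n \<in> absolute_values (local_closure K v) \<and>
     (\<forall>c\<in>carrier (local_field K v). n (to_local_closure K v c) = local_abs K v c))"

definition Omega :: "complex set \<Rightarrow> place \<Rightarrow> (nat \<Rightarrow> local_closure_elem) set ring" where
  "Omega K v = completion (local_closure K v) (local_closure_abs K v)"

definition Omega_abs ::
    "complex set \<Rightarrow> place \<Rightarrow> (nat \<Rightarrow> local_closure_elem) set \<Rightarrow> real" where
  "Omega_abs K v = completion_abs (local_closure K v) (local_closure_abs K v)"

definition to_Omega ::
    "complex set \<Rightarrow> place \<Rightarrow> complex \<Rightarrow> (nat \<Rightarrow> local_closure_elem) set" where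
  "to_Omega K v x = to_completion (local_closure K v) (local_closure_abs K v)
     (to_local_closure K v (to_local_field K v x))"

text \<open>
  Polynomials over \<open>\<Omega>\<^sub>v\<close> are the coefficient lists of \<^theory>\<open>HOL-Algebra.Polynomials\<close>,
  with the leading coefficient first; the zero polynomial is the empty list.
\<close>

definition poly_to_Omega ::
    "complex set \<Rightarrow> place \<Rightarrow> complex poly \<Rightarrow> (nat \<Rightarrow> local_closure_elem) set list" where
  "poly_to_Omega K v T = map (to_Omega K v) (rev (coeffs T))"


section \<open>Heights and the quantity \<open>U\<close>\<close>

text \<open>
  The sum over all places is \<^const>\<open>infsum\<close>; only finitely many terms are nonzero.
  Since \<open>ln 0 = 0\<close> in Isabelle, \<open>max 0 (ln t)\<close> is \<open>log\<^sup>+ t\<close> for \<open>t = 0\<close> as well.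
\<close>

definition height_over :: "complex set \<Rightarrow> complex \<Rightarrow> real" where
  "height_over K \<alpha> =
     infsum (\<lambda>v. max 0 (ln (local_abs K v (to_local_field K v \<alpha>)))) (places K)"

text \<open>The common value of the sum for all number fields containing \<open>\<alpha>\<close>.\<close>

definition weil_height :: "complex \<Rightarrow> real" where
  "weil_height \<alpha> = (THE h. \<forall>K. number_field K \<and> \<alpha> \<in> K \<longrightarrow> height_over K \<alpha> = h)"

definition ext_log :: "real \<Rightarrow> ereal" where
  "ext_log t = (if t = 0 then -\<infinity> else ereal (ln t))"

definition nu ::
    "complex set \<Rightarrow> place \<Rightarrow> (nat \<Rightarrow> local_closure_elem) set list \<Rightarrow> ereal" where
  "nu K v T = ext_log (SUP z\<in>{z \<in> carrier (Omega K v). Omega_abs K v z = 1}.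
     Omega_abs K v (ring.eval (Omega K v) T z))"

definition U_local ::
    "complex set \<Rightarrow> place \<Rightarrow> int \<Rightarrow> (nat \<Rightarrow> local_closure_elem) set \<Rightarrow>
     (nat \<Rightarrow> local_closure_elem) set list \<Rightarrow> ereal" where
  "U_local K v N a T =
     (INF f\<in>{f \<in> carrier (poly_ring (Omega K v)).
               ring.eval (Omega K v) f a = \<zero>\<^bsub>Omega K v\<^esub> \<and>
               (f = [] \<or> int (Polynomials.degree f) \<le> N)}.
        nu K v (T \<ominus>\<^bsub>poly_ring (Omega K v)\<^esub> f))"

definition U_over :: "complex set \<Rightarrow> int \<Rightarrow> complex \<Rightarrow> complex poly \<Rightarrow> ereal" where
  "U_over K N \<alpha> T =
     infsum (\<lambda>v. U_local K v N (to_Omega K v \<alpha>) (poly_to_Omega K v T)) (places K)"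

text \<open>
  The common value of the sum for all number fields containing \<open>\<alpha>\<close> and the coefficients
  of \<open>T\<close>.
\<close>

definition U :: "int \<Rightarrow> complex \<Rightarrow> complex poly \<Rightarrow> ereal" where
  "U N \<alpha> T = (THE u. \<forall>K. number_field K \<and> \<alpha> \<in> K \<and> (\<forall>i. Polynomial.coeff T i \<in> K) \<longrightarrow>
     U_over K N \<alpha> T = u)"

end

theory Submission
  imports Defs
begin

text \<open>
  The local quantity is \<open>U\<^sub>v(N, \<alpha>, T) = log |T(\<alpha>)|\<^sub>v - N log\<^sup>+ |\<alpha>|\<^sub>v\<close>. Indeed, if \<open>f(\<alpha>) = 0\<close> then
  \<open>g = T - f\<close> satisfies \<open>g(\<alpha>) = T(\<alpha>)\<close>, and \<open>|g(\<alpha>)| \<le> max(1, |\<alpha>|)\<^sup>N sup |g(z)|\<close> over \<open>|z| = 1\<close>,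
  with equality for \<open>g = T(\<alpha>)\<close> if \<open>|\<alpha>| \<le> 1\<close> and for \<open>g = T(\<alpha>) (x/\<alpha>)\<^sup>N\<close> otherwise. A proof of the
  inequality that does not distinguish the archimedean from the other places: averages over square
  roots bound each coefficient of a polynomial with at most \<open>2\<^sup>k\<close> coefficients by \<open>(2/|2|)\<^sup>k\<close> times its
  supremum on the unit circle, and the constant disappears on passing to high powers of \<open>g\<close>.
  In the sum over all \<open>v\<close> the terms \<open>log |T(\<alpha>)|\<^sub>v\<close> cancel by the product formula.

  For the product formula and the independence of the height from \<open>K\<close>, fix an algebraically closed
  valued field \<open>C\<close> containing \<open>\<rat>\<^sub>p\<close>. The \<open>[K : \<rat>]\<close> embeddings of \<open>K\<close> into \<open>C\<close> are partitioned
  according to the place of \<open>K\<close> that they induce, with \<open>[K\<^sub>v : \<rat>\<^sub>p]\<close> embeddings above \<open>v\<close>. Hence a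
  weighted sum over the places above \<open>p\<close> of a function of \<open>\<parallel>x\<parallel>\<^sub>v\<close> is the mean of this function over
  the conjugates of \<open>x\<close> in \<open>C\<close>. This mean does not involve \<open>K\<close>, and the product of the conjugates is, up
  to sign, the constant coefficient of the minimal polynomial of \<open>x\<close>, which reduces the product
  formula to \<open>\<rat>\<close>.

  The extension of an absolute value from a complete field to an algebraic extension is obtained as a
  spectral radius.
\<close>

section \<open>Valued fields and their completions\<close>

text \<open>Most notions of the statement are definite descriptions: \<open>place_below\<close>,
  \<open>local_norm\<close>, \<open>local_closure_abs\<close>, \<open>weil_height\<close> and
  \<open>U\<close>. Nothing can be computed with them before existence and uniqueness are known;
  this is the reason for proving Ostrowski's theorem and for treating extensions of absolute values
  together with their uniqueness. One device recurs: an estimate whose constant stays bounded, or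
  grows only polynomially in the exponent, when the estimate is applied to powers improves to an
  estimate without constant. It yields uniqueness and multiplicativity of extensions, the triangle
  inequality for rescaled absolute values, Ostrowski's theorem and the extremal inequality. The
  absolute value on \<open>\<Omega>\<^sub>v\<close> extends a power of the natural one on
  \<open>K\<^sub>v\<close>. It obeys the triangle inequality because the exponent is at most 1, and
  this in turn comes from counting embeddings. Square roots on the unit circle are taken in the
  algebraic closure of \<open>K\<^sub>v\<close>, before the second completion.\<close>

lemma metric_null: "\<forall>\<^sub>F k in F. norm (f k :: real) \<le> g k \<Longrightarrow> (g \<longlongrightarrow> 0) F \<Longrightarrow> (f \<longlongrightarrow> 0) F"
  by (rule tendsto_rabs_zero_cancel, rule tendsto_sandwich[of "\<lambda>_. 0" _ _ g]) (auto elim!: eventually_mono)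

text \<open>\<open>absolute_values\<close> without extensionality. Constructed functions, such as
  powers of an absolute value or the spectral radius, satisfy this as they are; extensionality
  returns only where a definite description requires two functions to be equal.\<close>

definition is_abs :: "('a, 'b) ring_scheme \<Rightarrow> ('a \<Rightarrow> real) \<Rightarrow> bool" where
  "is_abs R n \<longleftrightarrow>
     (\<forall>x\<in>carrier R. 0 \<le> n x \<and> (n x = 0 \<longleftrightarrow> x = \<zero>\<^bsub>R\<^esub>)) \<and>
     (\<forall>x\<in>carrier R. \<forall>y\<in>carrier R. n (x \<otimes>\<^bsub>R\<^esub> y) = n x * n y) \<and>
     (\<forall>x\<in>carrier R. \<forall>y\<in>carrier R. n (x \<oplus>\<^bsub>R\<^esub> y) \<le> n x + n y)"

lemma absolute_values_iff:
  "n \<in> absolute_values R \<longleftrightarrow> n \<in> extensional (carrier R) \<and> is_abs R n"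
  by (auto simp: absolute_values_def is_abs_def PiE_def)

lemma is_abs_cong: "(\<And>x. x \<in> carrier R \<Longrightarrow> n x = m x) \<Longrightarrow> ring R \<Longrightarrow> is_abs R n \<longleftrightarrow> is_abs R m"
  unfolding is_abs_def by (simp add: ring.ring_simprules cong: ball_cong)

lemma is_abs_restrict: "ring R \<Longrightarrow> is_abs R n \<Longrightarrow> restrict n (carrier R) \<in> absolute_values R"
  unfolding absolute_values_iff using is_abs_cong[of R n "restrict n (carrier R)"] by auto

locale valued_field = field R for R (structure) +
  fixes n :: "'a \<Rightarrow> real"
  assumes abs: "is_abs R n"
begin

lemma n_nonneg [simp]: "x \<in> carrier R \<Longrightarrow> 0 \<le> n x"
  and n_eq_0_iff [simp]: "x \<in> carrier R \<Longrightarrow> n x = 0 \<longleftrightarrow> x = \<zero>"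
  and n_mult [simp]: "x \<in> carrier R \<Longrightarrow> y \<in> carrier R \<Longrightarrow> n (x \<otimes> y) = n x * n y"
  and n_add: "x \<in> carrier R \<Longrightarrow> y \<in> carrier R \<Longrightarrow> n (x \<oplus> y) \<le> n x + n y"
  using abs unfolding is_abs_def by blast+

lemma n_zero [simp]: "n \<zero> = 0"
  by simp

lemma n_pos: "x \<in> carrier R \<Longrightarrow> x \<noteq> \<zero> \<Longrightarrow> 0 < n x"
  using n_nonneg[of x] n_eq_0_iff[of x] by linarith

lemma n_one [simp]: "n \<one> = 1"
  using n_mult[of \<one> \<one>] n_pos[of \<one>] by simp

lemma n_uminus [simp]: assumes "x \<in> carrier R" shows "n (\<ominus> x) = n x"
proof -
  have "n (\<ominus> \<one>) * n (\<ominus> \<one>) = n (\<ominus> \<one> \<otimes> \<ominus> \<one>)" by (subst n_mult) auto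
  also have "\<dots> = 1" by (simp add: l_minus)
  finally have "n (\<ominus> \<one>) = 1"
    using n_nonneg[of "\<ominus> \<one>"] by (metis abs_of_nonneg abs_square_eq_1 a_inv_closed one_closed power2_eq_square)
  moreover have "\<ominus> x = \<ominus> \<one> \<otimes> x" using assms by (simp add: l_minus)
  ultimately show ?thesis using assms by simp
qed

lemma n_minus: "x \<in> carrier R \<Longrightarrow> y \<in> carrier R \<Longrightarrow> n (x \<ominus> y) \<le> n x + n y"
  using n_add[of x "\<ominus> y"] by (simp add: a_minus_def)

lemma n_minus_commute: "x \<in> carrier R \<Longrightarrow> y \<in> carrier R \<Longrightarrow> n (x \<ominus> y) = n (y \<ominus> x)"
  using n_uminus[of "x \<ominus> y"] by (simp add: minus_eq minus_add a_comm)

lemma n_dist: "x \<in> carrier R \<Longrightarrow> y \<in> carrier R \<Longrightarrow> z \<in> carrier R \<Longrightarrow> n (x \<ominus> z) \<le> n (x \<ominus> y) + n (y \<ominus> z)"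
proof -
  assume a: "x \<in> carrier R" "y \<in> carrier R" "z \<in> carrier R"
  then have "x \<ominus> z = (x \<ominus> y) \<oplus> (y \<ominus> z)" by algebra
  then show ?thesis using n_add[of "x \<ominus> y" "y \<ominus> z"] a by simp
qed

lemma n_diff: "x \<in> carrier R \<Longrightarrow> y \<in> carrier R \<Longrightarrow> \<bar>n x - n y\<bar> \<le> n (x \<ominus> y)"
proof -
  assume a: "x \<in> carrier R" "y \<in> carrier R"
  have "x = (x \<ominus> y) \<oplus> y" "y = (y \<ominus> x) \<oplus> x" using a by algebra+
  then have "n x \<le> n (x \<ominus> y) + n y" "n y \<le> n (y \<ominus> x) + n x"
    using n_add[of "x \<ominus> y" y] n_add[of "y \<ominus> x" x] a by auto
  then show ?thesis using n_minus_commute[OF a] by linarith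
qed

lemma n_pow [simp]: "x \<in> carrier R \<Longrightarrow> n (x [^] (k::nat)) = n x ^ k"
  by (induction k) (auto simp: mult.commute)

lemma n_inv [simp]: assumes "x \<in> carrier R" "x \<noteq> \<zero>" shows "n (inv x) = inverse (n x)"
proof -
  have x: "x \<in> Units R" using assms by (simp add: field_Units)
  then have "n x * n (inv x) = 1" using assms n_mult[of x "inv x"] by (simp add: Units_r_inv)
  then show ?thesis using n_pos[OF assms] by (simp add: field_simps)
qed

lemma abs_subfield: "subfield K R \<Longrightarrow> valued_field (R\<lparr>carrier := K\<rparr>) n"
  unfolding valued_field_def valued_field_axioms_def
  using subfield_iff(2)[of K] subfieldE(3)[of K R] abs unfolding is_abs_def by (simp add: subset_iff)

section \<open>Convergence and Cauchy sequences in a valued field\<close>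

definition conv :: "(nat \<Rightarrow> 'a) \<Rightarrow> 'a \<Rightarrow> bool" where
  "conv s l \<longleftrightarrow> (\<lambda>k. n (s k \<ominus> l)) \<longlonglongrightarrow> 0"

text \<open>Relative to a subset that also has to contain the limit: both a whole completion and the
  closure of \<rat> inside it will be complete in this sense.\<close>

definition complete_on :: "'a set \<Rightarrow> bool" where
  "complete_on S \<longleftrightarrow> (\<forall>s\<in>cauchy_seqs R n. range s \<subseteq> S \<longrightarrow> (\<exists>l\<in>S. conv s l))"

lemma cauchy_seqsD: "s \<in> cauchy_seqs R n \<Longrightarrow> s k \<in> carrier R"
  unfolding cauchy_seqs_def by auto

lemma cauchy_seqsD2: "s \<in> cauchy_seqs R n \<Longrightarrow> e > 0 \<Longrightarrow> \<exists>M. \<forall>i\<ge>M. \<forall>j\<ge>M. n (s i \<ominus> s j) < e"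
  unfolding cauchy_seqs_def by auto

lemma conv_n: assumes "conv s l" "range s \<subseteq> carrier R" "l \<in> carrier R" shows "(\<lambda>k. n (s k)) \<longlonglongrightarrow> n l"
proof -
  have "(\<lambda>k. n (s k) - n l) \<longlonglongrightarrow> 0"
    using assms(1)[unfolded conv_def]
    by (rule metric_null[rotated]) (use assms in \<open>auto intro!: always_eventually n_diff\<close>)
  then show ?thesis by (simp add: LIM_zero_iff)
qed

lemma conv_unique: assumes "conv s l" "conv s m" "range s \<subseteq> carrier R" "l \<in> carrier R" "m \<in> carrier R" shows "l = m"
proof -
  have "(\<lambda>k. n (s k \<ominus> l) + n (s k \<ominus> m)) \<longlonglongrightarrow> 0 + 0"
    using assms(1,2) unfolding conv_def by (rule tendsto_add)
  moreover have "n (l \<ominus> m) \<le> n (s k \<ominus> l) + n (s k \<ominus> m)" for k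
    using n_dist[of l "s k" m] n_minus_commute[of l "s k"] assms by auto
  ultimately have "n (l \<ominus> m) \<le> 0 + 0" by (intro LIMSEQ_le_const) auto
  moreover have "n (l \<ominus> m) \<ge> 0" using assms by (intro n_nonneg) auto
  ultimately have "n (l \<ominus> m) = 0" by simp
  then have "l \<ominus> m = \<zero>" using assms n_eq_0_iff[of "l \<ominus> m"] by simp
  then show ?thesis using assms(4,5) by (simp add: r_right_minus_eq)
qed

lemma conv_const: "l \<in> carrier R \<Longrightarrow> conv (\<lambda>_. l) l"
  unfolding conv_def by (simp add: r_right_minus_eq[THEN iffD2])

lemma conv_add: assumes "conv s l" "conv t m" "range s \<subseteq> carrier R" "range t \<subseteq> carrier R" "l \<in> carrier R" "m \<in> carrier R"
  shows "conv (\<lambda>k. s k \<oplus> t k) (l \<oplus> m)"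
proof -
  have "(\<lambda>k. n (s k \<ominus> l) + n (t k \<ominus> m)) \<longlonglongrightarrow> 0 + 0"
    using assms(1,2) unfolding conv_def by (rule tendsto_add)
  then have lim: "(\<lambda>k. n (s k \<ominus> l) + n (t k \<ominus> m)) \<longlonglongrightarrow> 0" by simp
  have "n ((s k \<oplus> t k) \<ominus> (l \<oplus> m)) \<le> n (s k \<ominus> l) + n (t k \<ominus> m)" for k
  proof -
    have c: "s k \<in> carrier R" "t k \<in> carrier R" using assms by auto
    then have "(s k \<oplus> t k) \<ominus> (l \<oplus> m) = (s k \<ominus> l) \<oplus> (t k \<ominus> m)" using assms(5,6) by algebra
    then show ?thesis using n_add[of "s k \<ominus> l" "t k \<ominus> m"] assms c by auto
  qed
  then show ?thesis unfolding conv_def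
    by (intro metric_null[OF _ lim]) (use assms in \<open>auto intro!: always_eventually simp: range_subsetD\<close>)
qed

lemma conv_mult: assumes "conv s l" "conv t m" "range s \<subseteq> carrier R" "range t \<subseteq> carrier R" "l \<in> carrier R" "m \<in> carrier R"
  shows "conv (\<lambda>k. s k \<otimes> t k) (l \<otimes> m)"
proof -
  have "(\<lambda>k. n (s k) * n (t k \<ominus> m) + n (s k \<ominus> l) * n m) \<longlonglongrightarrow> n l * 0 + 0 * n m"
    using assms(1,2) conv_n[OF assms(1)] assms(3-) unfolding conv_def by (intro tendsto_intros) auto
  then have lim: "(\<lambda>k. n (s k) * n (t k \<ominus> m) + n (s k \<ominus> l) * n m) \<longlonglongrightarrow> 0" by simp
  have "n ((s k \<otimes> t k) \<ominus> (l \<otimes> m)) \<le> n (s k) * n (t k \<ominus> m) + n (s k \<ominus> l) * n m" for k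
  proof -
    have c: "s k \<in> carrier R" "t k \<in> carrier R" using assms by auto
    then have "(s k \<otimes> t k) \<ominus> (l \<otimes> m) = s k \<otimes> (t k \<ominus> m) \<oplus> (s k \<ominus> l) \<otimes> m" using assms(5,6) by algebra
    then show ?thesis using n_add[of "s k \<otimes> (t k \<ominus> m)" "(s k \<ominus> l) \<otimes> m"] assms c by auto
  qed
  then show ?thesis unfolding conv_def
    by (intro metric_null[OF _ lim]) (use assms in \<open>auto intro!: always_eventually simp: range_subsetD\<close>)
qed

lemma conv_imp_cauchy: assumes "conv s l" "range s \<subseteq> carrier R" "l \<in> carrier R" shows "s \<in> cauchy_seqs R n"
  unfolding cauchy_seqs_def
proof (intro CollectI conjI allI impI assms(2))
  fix e :: real assume e: "e > 0"
  then obtain M where M: "\<And>k. k \<ge> M \<Longrightarrow> n (s k \<ominus> l) < e / 2"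
    using assms(1) unfolding conv_def LIMSEQ_iff by (metis abs_less_iff diff_zero half_gt_zero real_norm_def)
  have "n (s i \<ominus> s j) < e" if "i \<ge> M" "j \<ge> M" for i j
    using n_dist[of "s i" l "s j"] n_minus_commute[of l "s j"] M[OF that(1)] M[OF that(2)] assms
    by (auto simp: range_subsetD)
  then show "\<exists>M. \<forall>i\<ge>M. \<forall>j\<ge>M. n (s i \<ominus> s j) < e" by blast
qed

lemma cauchy_n_convergent: assumes "s \<in> cauchy_seqs R n" shows "convergent (\<lambda>k. n (s k))"
  unfolding Cauchy_convergent_iff[symmetric]
proof (rule CauchyI)
  fix e :: real assume "e > 0"
  then obtain M where M: "\<forall>i\<ge>M. \<forall>j\<ge>M. n (s i \<ominus> s j) < e" using cauchy_seqsD2[OF assms] by blast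
  have "norm (n (s m) - n (s k)) < e" if "m \<ge> M" "k \<ge> M" for m k
    using n_diff[OF cauchy_seqsD[OF assms] cauchy_seqsD[OF assms], of m k] M[rule_format, OF that] by simp
  then show "\<exists>M. \<forall>m\<ge>M. \<forall>k\<ge>M. norm (n (s m) - n (s k)) < e" by blast
qed

lemma cauchy_bounded: assumes "s \<in> cauchy_seqs R n" obtains B where "(B::real) > 0" "\<And>k. n (s k) \<le> B"
proof -
  obtain B where B: "B > 0" "\<And>k. norm (n (s k)) \<le> B"
    using cauchy_n_convergent[OF assms] convergent_imp_Bseq BseqE by metis
  have "n (s k) \<le> B" for k using B(2)[of k] by simp
  with B(1) show ?thesis by (rule that)
qed

lemma null_iff_conv: "s \<in> null_seqs R n \<longleftrightarrow> range s \<subseteq> carrier R \<and> conv s \<zero>"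
proof -
  have "range s \<subseteq> carrier R \<Longrightarrow> (\<lambda>k. n (s k \<ominus> \<zero>)) = (\<lambda>k. n (s k))"
    by (auto simp: minus_eq range_subsetD)
  then show ?thesis unfolding null_seqs_def conv_def by auto
qed

lemma null_subset_cauchy: "null_seqs R n \<subseteq> cauchy_seqs R n"
  using conv_imp_cauchy null_iff_conv by blast

lemma cauchy_add: assumes "s \<in> cauchy_seqs R n" "t \<in> cauchy_seqs R n" shows "(\<lambda>k. s k \<oplus> t k) \<in> cauchy_seqs R n"
proof -
  note c = cauchy_seqsD[OF assms(1)] cauchy_seqsD[OF assms(2)]
  have "\<exists>M. \<forall>i\<ge>M. \<forall>j\<ge>M. n ((s i \<oplus> t i) \<ominus> (s j \<oplus> t j)) < e" if epos: "e > 0" for e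
  proof -
    obtain M1 where M1: "\<forall>i\<ge>M1. \<forall>j\<ge>M1. n (s i \<ominus> s j) < e/2" using cauchy_seqsD2[OF assms(1), of "e/2"] epos by auto
    obtain M2 where M2: "\<forall>i\<ge>M2. \<forall>j\<ge>M2. n (t i \<ominus> t j) < e/2" using cauchy_seqsD2[OF assms(2), of "e/2"] epos by auto
    have "n ((s i \<oplus> t i) \<ominus> (s j \<oplus> t j)) < e" if "i \<ge> max M1 M2" "j \<ge> max M1 M2" for i j
    proof -
      have "(s i \<oplus> t i) \<ominus> (s j \<oplus> t j) = (s i \<ominus> s j) \<oplus> (t i \<ominus> t j)"
        using c(1)[of i] c(1)[of j] c(2)[of i] c(2)[of j] by algebra
      moreover have "n (s i \<ominus> s j) < e/2" "n (t i \<ominus> t j) < e/2" using M1 M2 that by auto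
      ultimately show ?thesis using n_add[of "s i \<ominus> s j" "t i \<ominus> t j"] c by auto
    qed
    then show ?thesis by blast
  qed
  with c show ?thesis unfolding cauchy_seqs_def by auto
qed

lemma cauchy_mult: assumes "s \<in> cauchy_seqs R n" "t \<in> cauchy_seqs R n" shows "(\<lambda>k. s k \<otimes> t k) \<in> cauchy_seqs R n"
proof -
  note c = cauchy_seqsD[OF assms(1)] cauchy_seqsD[OF assms(2)]
  obtain A where A: "A > 0" "\<And>k. n (s k) \<le> A" using cauchy_bounded[OF assms(1)] by blast
  obtain B where B: "B > 0" "\<And>k. n (t k) \<le> B" using cauchy_bounded[OF assms(2)] by blast
  have "\<exists>M. \<forall>i\<ge>M. \<forall>j\<ge>M. n ((s i \<otimes> t i) \<ominus> (s j \<otimes> t j)) < e" if epos: "e > 0" for e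
  proof -
    obtain M1 where M1: "\<forall>i\<ge>M1. \<forall>j\<ge>M1. n (s i \<ominus> s j) < e/2/B"
      using cauchy_seqsD2[OF assms(1), of "e/2/B"] epos B by auto
    obtain M2 where M2: "\<forall>i\<ge>M2. \<forall>j\<ge>M2. n (t i \<ominus> t j) < e/2/A"
      using cauchy_seqsD2[OF assms(2), of "e/2/A"] epos A by auto
    have "n ((s i \<otimes> t i) \<ominus> (s j \<otimes> t j)) < e" if "i \<ge> max M1 M2" "j \<ge> max M1 M2" for i j
    proof -
      have "(s i \<otimes> t i) \<ominus> (s j \<otimes> t j) = s i \<otimes> (t i \<ominus> t j) \<oplus> (s i \<ominus> s j) \<otimes> t j"
        using c(1)[of i] c(1)[of j] c(2)[of i] c(2)[of j] by algebra
      then have "n ((s i \<otimes> t i) \<ominus> (s j \<otimes> t j)) \<le> n (s i) * n (t i \<ominus> t j) + n (s i \<ominus> s j) * n (t j)"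
        using n_add[of "s i \<otimes> (t i \<ominus> t j)" "(s i \<ominus> s j) \<otimes> t j"] c by auto
      also have "\<dots> \<le> A * n (t i \<ominus> t j) + n (s i \<ominus> s j) * B"
        using A(2) B(2) c by (intro add_mono mult_mono) (auto intro: less_imp_le[OF A(1)])
      also have "\<dots> < A * (e/2/A) + (e/2/B) * B"
        using M1 M2 that A B by (intro add_strict_mono mult_strict_left_mono mult_strict_right_mono) auto
      also have "\<dots> = e" using A B by simp
      finally show ?thesis .
    qed
    then show ?thesis by blast
  qed
  with c show ?thesis unfolding cauchy_seqs_def by auto
qed

lemma cauchy_const: "x \<in> carrier R \<Longrightarrow> (\<lambda>k. x) \<in> cauchy_seqs R n"
  using conv_imp_cauchy[OF conv_const] by auto

lemma cauchy_minus: "s \<in> cauchy_seqs R n \<Longrightarrow> (\<lambda>k. \<ominus> s k) \<in> cauchy_seqs R n"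
  using cauchy_mult[OF cauchy_const[of "\<ominus> \<one>"], of s] cauchy_seqsD[of s]
  by (simp add: l_minus)

section \<open>The completion as the ring of Cauchy sequences modulo null sequences\<close>

abbreviation "CR \<equiv> cauchy_ring R n"
abbreviation "NS \<equiv> null_seqs R n"
abbreviation "RC \<equiv> completion R n"
abbreviation "nC \<equiv> completion_abs R n"
abbreviation "\<iota> \<equiv> to_completion R n"

lemma CR_simps [simp]:
  "carrier CR = cauchy_seqs R n" "\<one>\<^bsub>CR\<^esub> = (\<lambda>k. \<one>)" "\<zero>\<^bsub>CR\<^esub> = (\<lambda>k. \<zero>)"
  "s \<otimes>\<^bsub>CR\<^esub> t = (\<lambda>k. s k \<otimes> t k)" "s \<oplus>\<^bsub>CR\<^esub> t = (\<lambda>k. s k \<oplus> t k)"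
  by (simp_all add: cauchy_ring_def)

lemma CR_cring: "cring CR"
proof (rule cringI)
  show "abelian_group CR"
  proof (rule abelian_groupI)
    fix x assume x: "x \<in> carrier CR"
    show "\<exists>y\<in>carrier CR. y \<oplus>\<^bsub>CR\<^esub> x = \<zero>\<^bsub>CR\<^esub>"
      using x cauchy_minus[of x] by (intro bexI[of _ "\<lambda>k. \<ominus> x k"]) (auto simp: l_neg cauchy_seqsD)
  qed (auto simp: cauchy_add cauchy_const cauchy_seqsD a_ac)
  show "comm_monoid CR"
    by (rule comm_monoidI) (auto simp: cauchy_mult cauchy_const cauchy_seqsD m_ac)
qed (auto simp: cauchy_seqsD l_distr)

sublocale CR: cring CR by (rule CR_cring)

lemma CR_uminus: "s \<in> cauchy_seqs R n \<Longrightarrow> \<ominus>\<^bsub>CR\<^esub> s = (\<lambda>k. \<ominus> s k)"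
  using CR.minus_equality[of "\<lambda>k. \<ominus> s k" s] cauchy_minus[of s] by (auto simp: l_neg cauchy_seqsD)

lemma CR_minus: "s \<in> cauchy_seqs R n \<Longrightarrow> t \<in> cauchy_seqs R n \<Longrightarrow> s \<ominus>\<^bsub>CR\<^esub> t = (\<lambda>k. s k \<ominus> t k)"
  by (simp add: a_minus_def CR_uminus)

text \<open>Absorption holds because a Cauchy sequence is bounded, and a bounded multiple of a null
  sequence is null.\<close>

lemma NS_ideal: "ideal NS CR"
proof (rule idealI)
  have minus: "(\<lambda>k. \<ominus> s k) \<in> NS" if "s \<in> NS" for s
    using that by (auto simp: null_seqs_def range_subsetD)
  show "subgroup NS (add_monoid CR)"
  proof (rule CR.add.subgroupI)
    show "NS \<subseteq> carrier CR" using null_subset_cauchy by simp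
    have "(\<lambda>k. \<zero>) \<in> NS" by (simp add: null_seqs_def)
    then show "NS \<noteq> {}" by blast
    show "\<ominus>\<^bsub>CR\<^esub> a \<in> NS" if "a \<in> NS" for a using that minus CR_uminus null_subset_cauchy by auto
    show "a \<oplus>\<^bsub>CR\<^esub> b \<in> NS" if "a \<in> NS" "b \<in> NS" for a b
      using that conv_add[of a \<zero> b \<zero>] by (auto simp: null_iff_conv)
  qed
  have mult: "(\<lambda>k. x k \<otimes> a k) \<in> NS" if a: "a \<in> NS" and x: "x \<in> cauchy_seqs R n" for a x
  proof -
    obtain B where B: "B > 0" "\<And>k. n (x k) \<le> B" using cauchy_bounded[OF x] by blast
    have ac: "a k \<in> carrier R" for k using a by (auto simp: null_seqs_def)
    have "(\<lambda>k. B * n (a k)) \<longlonglongrightarrow> B * 0"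
      using a by (intro tendsto_intros) (auto simp: null_seqs_def)
    then have lim: "(\<lambda>k. B * n (a k)) \<longlonglongrightarrow> 0" by simp
    have "norm (n (x k \<otimes> a k)) \<le> B * n (a k)" for k
      using B(2)[of k] ac[of k] cauchy_seqsD[OF x, of k] by (simp add: mult_right_mono)
    then have "(\<lambda>k. n (x k \<otimes> a k)) \<longlonglongrightarrow> 0"
      by (intro metric_null[OF always_eventually lim]) simp
    then show ?thesis using ac cauchy_seqsD[OF x] by (auto simp: null_seqs_def)
  qed
  show "x \<otimes>\<^bsub>CR\<^esub> a \<in> NS" if "a \<in> NS" "x \<in> carrier CR" for a x using that mult by simp
  show "a \<otimes>\<^bsub>CR\<^esub> x \<in> NS" if "a \<in> NS" "x \<in> carrier CR" for a x
  proof -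
    have "a \<otimes>\<^bsub>CR\<^esub> x = x \<otimes>\<^bsub>CR\<^esub> a"
      using that null_subset_cauchy by (intro CR.m_comm) auto
    then show ?thesis using that mult by simp
  qed
qed (rule CR.ring_axioms)

sublocale NS: ideal NS CR by (rule NS_ideal)

abbreviation cls where "cls s \<equiv> NS +>\<^bsub>CR\<^esub> s"

lemma cls_eq_iff: "s \<in> cauchy_seqs R n \<Longrightarrow> t \<in> cauchy_seqs R n \<Longrightarrow> cls s = cls t \<longleftrightarrow> (\<lambda>k. s k \<ominus> t k) \<in> NS"
  using CR.quotient_eq_iff_same_a_r_cos[OF NS_ideal, of s t] by (simp add: CR_minus)

lemma RC_carrier: "carrier RC = cls ` cauchy_seqs R n"
  by (auto simp: completion_def FactRing_def A_RCOSETS_defs a_r_coset_def)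

lemma RC_mult: "s \<in> cauchy_seqs R n \<Longrightarrow> t \<in> cauchy_seqs R n \<Longrightarrow> cls s \<otimes>\<^bsub>RC\<^esub> cls t = cls (\<lambda>k. s k \<otimes> t k)"
  using NS.rcoset_mult_add[of s t] by (simp add: completion_def FactRing_def)

lemma RC_add: "s \<in> cauchy_seqs R n \<Longrightarrow> t \<in> cauchy_seqs R n \<Longrightarrow> cls s \<oplus>\<^bsub>RC\<^esub> cls t = cls (\<lambda>k. s k \<oplus> t k)"
  using NS.a_rcos_sum[of s t] by (simp add: completion_def FactRing_def)

lemma RC_cring: "cring RC"
  unfolding completion_def by (rule NS.quotient_is_cring[OF CR_cring])

sublocale RC: cring RC by (rule RC_cring)

lemma RC_one: "\<one>\<^bsub>RC\<^esub> = cls (\<lambda>k. \<one>)" and RC_zero: "\<zero>\<^bsub>RC\<^esub> = cls (\<lambda>k. \<zero>)"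
proof -
  show "\<one>\<^bsub>RC\<^esub> = cls (\<lambda>k. \<one>)" by (simp add: completion_def FactRing_def)
  have "\<zero>\<^bsub>RC\<^esub> = NS" by (simp add: completion_def FactRing_def)
  also have "\<dots> = cls \<zero>\<^bsub>CR\<^esub>" using CR.a_coset_add_zero[of NS] null_subset_cauchy by simp
  finally show "\<zero>\<^bsub>RC\<^esub> = cls (\<lambda>k. \<zero>)" by simp
qed

lemma cls_zero_iff: "s \<in> cauchy_seqs R n \<Longrightarrow> cls s = \<zero>\<^bsub>RC\<^esub> \<longleftrightarrow> s \<in> NS"
  unfolding RC_zero by (subst cls_eq_iff) (auto simp: cauchy_const cauchy_seqsD minus_eq)

lemma cls_mem: "s \<in> cauchy_seqs R n \<Longrightarrow> t \<in> cls s \<longleftrightarrow> t \<in> cauchy_seqs R n \<and> cls t = cls s"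
proof
  assume s: "s \<in> cauchy_seqs R n" and t: "t \<in> cls s"
  have "cls s \<subseteq> carrier CR" using s null_subset_cauchy by (intro CR.a_r_coset_subset_G) auto
  with t have "t \<in> cauchy_seqs R n" by auto
  moreover have "cls t = cls s" using NS.a_repr_independence'[of t s] t s by simp
  ultimately show "t \<in> cauchy_seqs R n \<and> cls t = cls s" by simp
next
  assume s: "s \<in> cauchy_seqs R n" and t: "t \<in> cauchy_seqs R n \<and> cls t = cls s"
  then show "t \<in> cls s" using NS.a_rcos_self[of t] by simp
qed

lemma RC_mem: "c \<in> carrier RC \<Longrightarrow> s \<in> c \<longleftrightarrow> s \<in> cauchy_seqs R n \<and> cls s = c"
  unfolding RC_carrier using cls_mem by blast

lemma RC_elem: assumes "c \<in> carrier RC" obtains s where "s \<in> c" "s \<in> cauchy_seqs R n" "c = cls s"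
  using assms unfolding RC_carrier using cls_mem by blast

lemma cls_in: "s \<in> cauchy_seqs R n \<Longrightarrow> cls s \<in> carrier RC"
  unfolding RC_carrier by blast

text \<open>Two representatives differ by a null sequence, so their absolute values have a common
  limit. Hence the description in \<open>completion_abs\<close> denotes this limit, and any
  representative may be used to compute it.\<close>

lemma nC_tendsto: assumes c: "c \<in> carrier RC" and s: "s \<in> c" shows "(\<lambda>k. n (s k)) \<longlonglongrightarrow> nC c"
proof -
  have sC: "s \<in> cauchy_seqs R n" "cls s = c" using RC_mem[OF c] s by auto
  obtain l where l: "(\<lambda>k. n (s k)) \<longlonglongrightarrow> l"
    using cauchy_n_convergent[OF sC(1)] by (auto simp: convergent_def)
  have all: "(\<lambda>k. n (t k)) \<longlonglongrightarrow> l" if "t \<in> c" for t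
  proof -
    have t: "t \<in> cauchy_seqs R n" "cls t = cls s" using that RC_mem[OF c] sC by auto
    then have "(\<lambda>k. n (t k \<ominus> s k)) \<longlonglongrightarrow> 0" using cls_eq_iff[OF t(1) sC(1)] by (auto simp: null_seqs_def)
    then have "(\<lambda>k. n (t k) - n (s k)) \<longlonglongrightarrow> 0"
      by (rule metric_null[rotated]) (use cauchy_seqsD[OF t(1)] cauchy_seqsD[OF sC(1)] in \<open>auto intro!: always_eventually n_diff\<close>)
    from tendsto_add[OF this l] show ?thesis by simp
  qed
  have "nC c = (THE l. \<forall>s\<in>c. (\<lambda>k. n (s k)) \<longlonglongrightarrow> l)" using c by (simp add: completion_abs_def)
  also have "\<dots> = l" using all s LIMSEQ_unique by (intro the_equality) blast+
  finally show ?thesis using l by simp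
qed

lemma RC_field: "field RC"
proof (rule RC.cring_fieldI2)
  show "\<zero>\<^bsub>RC\<^esub> \<noteq> \<one>\<^bsub>RC\<^esub>"
  proof
    assume "\<zero>\<^bsub>RC\<^esub> = \<one>\<^bsub>RC\<^esub>"
    then have "(\<lambda>k. \<one>) \<in> NS" using cls_zero_iff[of "\<lambda>k. \<one>"] RC_one cauchy_const by auto
    then show False by (simp add: null_seqs_def LIMSEQ_const_iff)
  qed
next
  fix a assume a: "a \<in> carrier RC" "a \<noteq> \<zero>\<^bsub>RC\<^esub>"
  obtain s where s: "s \<in> a" "s \<in> cauchy_seqs R n" "a = cls s" using RC_elem[OF a(1)] .
  note sc = cauchy_seqsD[OF s(2)]
  have l: "(\<lambda>k. n (s k)) \<longlonglongrightarrow> nC a" using nC_tendsto[OF a(1) s(1)] .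
  have "s \<notin> NS" using cls_zero_iff[OF s(2)] a s by auto
  then have "nC a \<noteq> 0" using l sc by (auto simp: null_seqs_def)
  moreover have "nC a \<ge> 0" using LIMSEQ_le_const[OF l] sc by auto
  ultimately have pos: "nC a > 0" by simp
  define c where "c = nC a / 2"
  have c: "c > 0" using pos by (simp add: c_def)
  obtain M where M: "\<And>k. k \<ge> M \<Longrightarrow> n (s k) > c"
    using order_tendstoD(1)[OF l, of c] pos unfolding c_def eventually_sequentially by auto
  \<comment> \<open>A Cauchy sequence that is not null stays above \<open>c\<close> from some index
    \<open>M\<close> on. The finitely many earlier terms may vanish; they are replaced by zero,
    which does not affect the class.\<close>
  define t where "t = (\<lambda>k. if k < M then \<zero> else inv (s k))"
  have sU: "s k \<noteq> \<zero>" if "k \<ge> M" for k using M[OF that] c by auto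
  have tc: "t k \<in> carrier R" for k using sc sU[of k] by (auto simp: t_def field_Units)
  have inv1: "s k \<otimes> t k = \<one>" if "k \<ge> M" for k
    using that sc[of k] sU[of k] by (auto simp: t_def field_Units)
  have tC: "t \<in> cauchy_seqs R n"
  proof -
    have "\<exists>M. \<forall>i\<ge>M. \<forall>j\<ge>M. n (t i \<ominus> t j) < e" if epos: "e > 0" for e
    proof -
      \<comment> \<open>The difference of the inverses of \<open>s i\<close> and \<open>s j\<close>
        is \<open>s j - s i\<close> divided by \<open>s i * s j\<close>, and both factors of the
        denominator exceed \<open>c\<close> in absolute value; hence the tolerance
        \<open>e * (c * c)\<close>.\<close>
      obtain M' where M': "\<forall>i\<ge>M'. \<forall>j\<ge>M'. n (s i \<ominus> s j) < e * (c * c)"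
        using cauchy_seqsD2[OF s(2), of "e * (c * c)"] epos c by auto
      have "n (t i \<ominus> t j) < e" if ij: "i \<ge> max M M'" "j \<ge> max M M'" for i j
      proof -
        have eqs: "s i \<otimes> t i = \<one>" "s j \<otimes> t j = \<one>" using inv1 ij by auto
        have "(s i \<otimes> s j) \<otimes> (t i \<ominus> t j) = (s i \<otimes> t i) \<otimes> s j \<ominus> s i \<otimes> (s j \<otimes> t j)"
          using tc[of i] tc[of j] sc[of i] sc[of j] by algebra
        also have "\<dots> = s j \<ominus> s i" using sc eqs by simp
        finally have "n (s i) * n (s j) * n (t i \<ominus> t j) = n (s j \<ominus> s i)"
          using tc sc by (metis n_mult m_closed minus_closed)
        moreover have "c * c * n (t i \<ominus> t j) \<le> n (s i) * n (s j) * n (t i \<ominus> t j)"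
          using M[of i] M[of j] ij c tc sc by (intro mult_right_mono mult_mono) auto
        moreover have "n (s j \<ominus> s i) < e * (c * c)" using M' ij by auto
        ultimately have "c * c * n (t i \<ominus> t j) < c * c * e" by (simp add: mult.commute)
        then show ?thesis using c by (simp add: mult_less_cancel_left_pos)
      qed
      then show ?thesis by blast
    qed
    then show ?thesis using tc unfolding cauchy_seqs_def by auto
  qed
  have "(\<lambda>k. n (s k \<otimes> t k \<ominus> \<one>)) \<longlonglongrightarrow> 0"
    by (rule tendsto_eventually) (auto simp: eventually_sequentially inv1 r_right_minus_eq[THEN iffD2] intro!: exI[of _ M])
  then have "(\<lambda>k. s k \<otimes> t k \<ominus> \<one>) \<in> NS" using sc tc by (auto simp: null_seqs_def)
  then have "cls s \<otimes>\<^bsub>RC\<^esub> cls t = \<one>\<^bsub>RC\<^esub>"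
    unfolding RC_mult[OF s(2) tC] RC_one using cls_eq_iff cauchy_mult s(2) tC cauchy_const by auto
  then show "\<exists>b\<in>carrier RC. a \<otimes>\<^bsub>RC\<^esub> b = \<one>\<^bsub>RC\<^esub>" using s(3) cls_in[OF tC] by blast
qed

lemma nC_abs: "nC \<in> absolute_values RC"
  unfolding absolute_values_iff is_abs_def
proof (intro conjI ballI)
  show "nC \<in> extensional (carrier RC)" by (simp add: completion_abs_def)
next
  fix x assume x: "x \<in> carrier RC"
  obtain s where s: "s \<in> x" "s \<in> cauchy_seqs R n" "x = cls s" using RC_elem[OF x] .
  note ls = nC_tendsto[OF x s(1)]
  show "0 \<le> nC x" by (rule LIMSEQ_le_const[OF ls]) (auto simp: cauchy_seqsD[OF s(2)])
  have "range s \<subseteq> carrier R" using s(2) by (simp add: cauchy_seqs_def)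
  then have "x = \<zero>\<^bsub>RC\<^esub> \<longleftrightarrow> (\<lambda>k. n (s k)) \<longlonglongrightarrow> 0"
    using cls_zero_iff[OF s(2)] s(3) by (simp add: null_seqs_def)
  moreover have "(\<lambda>k. n (s k)) \<longlonglongrightarrow> 0 \<longleftrightarrow> nC x = 0"
    using ls LIMSEQ_unique[OF ls, of 0] by metis
  ultimately show "nC x = 0 \<longleftrightarrow> x = \<zero>\<^bsub>RC\<^esub>" by simp
next
  fix x y assume x: "x \<in> carrier RC" and y: "y \<in> carrier RC"
  obtain s where s: "s \<in> x" "s \<in> cauchy_seqs R n" "x = cls s" using RC_elem[OF x] .
  obtain t where t: "t \<in> y" "t \<in> cauchy_seqs R n" "y = cls t" using RC_elem[OF y] .
  note sc = cauchy_seqsD[OF s(2)] and tc = cauchy_seqsD[OF t(2)]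
  note ls = nC_tendsto[OF x s(1)] and lt = nC_tendsto[OF y t(1)]
  have "(\<lambda>k. n (s k \<otimes> t k)) \<longlonglongrightarrow> nC (x \<otimes>\<^bsub>RC\<^esub> y)"
    using RC_mult[OF s(2) t(2)] s(3) t(3) cauchy_mult[OF s(2) t(2)] by (intro nC_tendsto) (auto simp: cls_mem cls_in)
  moreover have "(\<lambda>k. n (s k \<otimes> t k)) \<longlonglongrightarrow> nC x * nC y" using tendsto_mult[OF ls lt] sc tc by simp
  ultimately show "nC (x \<otimes>\<^bsub>RC\<^esub> y) = nC x * nC y" by (rule LIMSEQ_unique)
  have "(\<lambda>k. n (s k \<oplus> t k)) \<longlonglongrightarrow> nC (x \<oplus>\<^bsub>RC\<^esub> y)"
    using RC_add[OF s(2) t(2)] s(3) t(3) cauchy_add[OF s(2) t(2)] by (intro nC_tendsto) (auto simp: cls_mem cls_in)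
  then show "nC (x \<oplus>\<^bsub>RC\<^esub> y) \<le> nC x + nC y"
    by (rule LIMSEQ_le[OF _ tendsto_add[OF ls lt]]) (use sc tc n_add in auto)
qed

lemma RC_valued_field: "valued_field RC nC"
  using RC_field nC_abs by (simp add: valued_field_def valued_field_axioms_def absolute_values_iff)

interpretation RC: valued_field RC nC by (rule RC_valued_field)

lemma iota_cls: "\<iota> x = cls (\<lambda>k. x)"
  by (simp add: to_completion_def)

lemma iota_hom: "\<iota> \<in> ring_hom R RC"
  by (rule ring_hom_memI) (auto simp: iota_cls cls_in cauchy_const RC_mult RC_add RC_one)

lemma iota_closed: "x \<in> carrier R \<Longrightarrow> \<iota> x \<in> carrier RC"
  by (simp add: iota_cls cls_in cauchy_const)

lemma nC_iota: assumes "x \<in> carrier R" shows "nC (\<iota> x) = n x"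
proof -
  have "(\<lambda>k. n x) \<longlonglongrightarrow> nC (\<iota> x)"
    using assms by (intro nC_tendsto[where s = "\<lambda>k. x"]) (auto simp: iota_cls cls_in cauchy_const cls_mem)
  then show ?thesis by (simp add: LIMSEQ_const_iff)
qed

lemma iota_dense: assumes c: "c \<in> carrier RC" and s: "s \<in> c" shows "RC.conv (\<lambda>k. \<iota> (s k)) c"
proof -
  have sC: "s \<in> cauchy_seqs R n" "cls s = c" using RC_mem[OF c] s by auto
  note sc = cauchy_seqsD[OF sC(1)]
  have d: "(\<lambda>i. n (s k \<ominus> s i)) \<longlonglongrightarrow> nC (\<iota> (s k) \<ominus>\<^bsub>RC\<^esub> c)" for k
  proof -
    have "\<ominus>\<^bsub>RC\<^esub> c = cls (\<lambda>k. \<ominus> s k)"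
      using RC_add[OF cauchy_minus[OF sC(1)] sC(1)] sC cauchy_minus[OF sC(1)]
      by (intro RC.minus_equality) (auto simp: RC_zero l_neg cauchy_seqsD cls_in)
    then have "\<iota> (s k) \<ominus>\<^bsub>RC\<^esub> c = cls (\<lambda>i. s k \<ominus> s i)"
      using RC_add[OF cauchy_const[OF sc] cauchy_minus[OF sC(1)]] by (simp add: a_minus_def iota_cls)
    moreover have "(\<lambda>i. s k \<ominus> s i) \<in> cauchy_seqs R n"
      using cauchy_add[OF cauchy_const[OF sc] cauchy_minus[OF sC(1)]] by (simp add: a_minus_def)
    ultimately show ?thesis by (intro nC_tendsto) (auto simp: cls_mem cls_in)
  qed
  show ?thesis unfolding RC.conv_def LIMSEQ_iff
  proof (intro allI impI)
    fix e :: real assume "e > 0"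
    then obtain M where M: "\<forall>i\<ge>M. \<forall>j\<ge>M. n (s i \<ominus> s j) < e / 2" using cauchy_seqsD2[OF sC(1), of "e/2"] by auto
    have "nC (\<iota> (s k) \<ominus>\<^bsub>RC\<^esub> c) \<le> e / 2" if "k \<ge> M" for k
      by (rule LIMSEQ_le_const2[OF d]) (use M that in \<open>auto intro!: exI[of _ M] less_imp_le\<close>)
    then show "\<exists>no. \<forall>k\<ge>no. norm (nC (\<iota> (s k) \<ominus>\<^bsub>RC\<^esub> c) - 0) < e"
      using \<open>e > 0\<close> sc c by (intro exI[of _ M]) (fastforce simp: iota_closed)
  qed
qed

lemma iota_conv_cls: "s \<in> cauchy_seqs R n \<Longrightarrow> RC.conv (\<lambda>k. \<iota> (s k)) (cls s)"
  by (rule iota_dense) (auto simp: cls_in cls_mem)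

text \<open>The topological closure of \<open>S\<close> in the completion, described through
  representatives. For \<open>S\<close> equal to \<rat> it becomes
  \<open>local_rationals\<close>.\<close>

definition seq_closure :: "'a set \<Rightarrow> (nat \<Rightarrow> 'a) set set" where
  "seq_closure S = {c \<in> carrier RC. \<exists>s\<in>c. range s \<subseteq> S}"

text \<open>Each term \<sigma> k is within 1/(k+1) of an element x k of \<open>S\<close>. The
  sequence x is then Cauchy in the original field, so it represents an element of the completion;
  this element is the limit and lies in the closure of \<open>S\<close> by construction.\<close>

lemma RC_complete_on: assumes "S \<subseteq> carrier R" shows "RC.complete_on (seq_closure S)"
  unfolding RC.complete_on_def
proof (intro ballI impI)
  fix \<sigma> assume \<sigma>: "\<sigma> \<in> cauchy_seqs RC nC" and r: "range \<sigma> \<subseteq> seq_closure S"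
  note \<sigma>c = RC.cauchy_seqsD[OF \<sigma>]
  have "\<exists>x\<in>S. nC (\<sigma> k \<ominus>\<^bsub>RC\<^esub> \<iota> x) < inverse (real (Suc k))" for k
  proof -
    have "\<sigma> k \<in> seq_closure S" using r by blast
    then obtain s where s: "s \<in> \<sigma> k" "range s \<subseteq> S" unfolding seq_closure_def by blast
    have "(\<lambda>i. nC (\<iota> (s i) \<ominus>\<^bsub>RC\<^esub> \<sigma> k)) \<longlonglongrightarrow> 0" using iota_dense[OF \<sigma>c s(1)] by (simp add: RC.conv_def)
    then have "\<exists>i. nC (\<iota> (s i) \<ominus>\<^bsub>RC\<^esub> \<sigma> k) < inverse (real (Suc k))"
      using order_tendstoD(2)[of _ 0 sequentially "inverse (real (Suc k))"] eventually_happens'[OF sequentially_bot] by fastforce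
    then obtain i where i: "nC (\<iota> (s i) \<ominus>\<^bsub>RC\<^esub> \<sigma> k) < inverse (real (Suc k))" ..
    have sS: "s i \<in> S" using s(2) by (simp add: range_subsetD)
    then have "s i \<in> carrier R" using assms by (rule subsetD[rotated])
    then have "nC (\<sigma> k \<ominus>\<^bsub>RC\<^esub> \<iota> (s i)) < inverse (real (Suc k))"
      using i RC.n_minus_commute[OF iota_closed \<sigma>c, of "s i" k] by simp
    with sS show ?thesis by (intro bexI)
  qed
  then obtain x where x: "\<And>k. x k \<in> S" "\<And>k. nC (\<sigma> k \<ominus>\<^bsub>RC\<^esub> \<iota> (x k)) < inverse (real (Suc k))" by metis
  have xc: "x k \<in> carrier R" for k using x assms by auto
  note ixc = iota_closed[OF xc]
  interpret io: ring_hom_ring R RC \<iota> using iota_hom by (intro ring_hom_ringI2 ring_axioms RC.ring_axioms)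
  have small: "\<exists>M. \<forall>k\<ge>M. inverse (real (Suc k)) < e" if epos: "e > 0" for e
    using order_tendstoD(2)[OF LIMSEQ_inverse_real_of_nat epos] by (simp add: eventually_sequentially)
  have xC: "x \<in> cauchy_seqs R n"
  proof -
    have "\<exists>M. \<forall>i\<ge>M. \<forall>j\<ge>M. n (x i \<ominus> x j) < e" if epos: "e > 0" for e
    proof -
      obtain M1 where M1: "\<forall>i\<ge>M1. \<forall>j\<ge>M1. nC (\<sigma> i \<ominus>\<^bsub>RC\<^esub> \<sigma> j) < e/3"
        using RC.cauchy_seqsD2[OF \<sigma>, of "e/3"] epos by auto
      obtain M2 where M2: "\<forall>k\<ge>M2. inverse (real (Suc k)) < e/3" using small[of "e/3"] epos by auto
      have "n (x i \<ominus> x j) < e" if ij: "i \<ge> max M1 M2" "j \<ge> max M1 M2" for i j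
      proof -
        have "n (x i \<ominus> x j) = nC (\<iota> (x i) \<ominus>\<^bsub>RC\<^esub> \<iota> (x j))"
          using nC_iota[of "x i \<ominus> x j"] xc by (simp add: a_minus_def)
        also have "\<dots> \<le> nC (\<iota> (x i) \<ominus>\<^bsub>RC\<^esub> \<sigma> i) + nC (\<sigma> i \<ominus>\<^bsub>RC\<^esub> \<iota> (x j))" using RC.n_dist ixc \<sigma>c by simp
        also have "\<dots> \<le> nC (\<iota> (x i) \<ominus>\<^bsub>RC\<^esub> \<sigma> i) + (nC (\<sigma> i \<ominus>\<^bsub>RC\<^esub> \<sigma> j) + nC (\<sigma> j \<ominus>\<^bsub>RC\<^esub> \<iota> (x j)))"
          using RC.n_dist[OF \<sigma>c \<sigma>c ixc] by simp
        also have "\<dots> < e/3 + (e/3 + e/3)"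
        proof (intro add_strict_mono)
          show "nC (\<iota> (x i) \<ominus>\<^bsub>RC\<^esub> \<sigma> i) < e/3"
            using RC.n_minus_commute[OF ixc \<sigma>c, of i i] x(2)[of i] M2[rule_format, of i] ij(1) by simp
          show "nC (\<sigma> i \<ominus>\<^bsub>RC\<^esub> \<sigma> j) < e/3" using M1 ij by simp
          show "nC (\<sigma> j \<ominus>\<^bsub>RC\<^esub> \<iota> (x j)) < e/3"
            using x(2)[of j] M2[rule_format, of j] ij(2) by simp
        qed
        finally show ?thesis by simp
      qed
      then show ?thesis by blast
    qed
    then show ?thesis using xc unfolding cauchy_seqs_def by auto
  qed
  have "RC.conv (\<lambda>k. \<iota> (x k)) (cls x)" by (rule iota_conv_cls[OF xC])
  then have l: "(\<lambda>k. inverse (real (Suc k)) + nC (\<iota> (x k) \<ominus>\<^bsub>RC\<^esub> cls x)) \<longlonglongrightarrow> 0 + 0"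
    unfolding RC.conv_def by (intro tendsto_add LIMSEQ_inverse_real_of_nat)
  have "RC.conv \<sigma> (cls x)" unfolding RC.conv_def
  proof (rule metric_null[OF always_eventually l[unfolded add_0_left]], rule allI)
    fix k show "norm (nC (\<sigma> k \<ominus>\<^bsub>RC\<^esub> cls x)) \<le> inverse (real (Suc k)) + nC (\<iota> (x k) \<ominus>\<^bsub>RC\<^esub> cls x)"
      using RC.n_dist[OF \<sigma>c ixc cls_in[OF xC], of k k] x(2)[of k] \<sigma>c cls_in[OF xC] by (simp add: less_imp_le)
  qed
  moreover have "cls x \<in> seq_closure S"
    unfolding seq_closure_def using x(1) by (auto simp: cls_in xC cls_mem intro!: bexI[of _ x])
  ultimately show "\<exists>l\<in>seq_closure S. RC.conv \<sigma> l" by blast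
qed

lemma seq_closure_carrier: "seq_closure (carrier R) = carrier RC"
proof -
  have "\<exists>s\<in>c. range s \<subseteq> carrier R" if c: "c \<in> carrier RC" for c
  proof -
    obtain s where s: "s \<in> c" "s \<in> cauchy_seqs R n" using RC_elem[OF c] by metis
    then have "range s \<subseteq> carrier R" by (simp add: cauchy_seqs_def)
    with s(1) show ?thesis by (intro bexI)
  qed
  then show ?thesis unfolding seq_closure_def by (simp cong: conj_cong)
qed

lemma RC_complete: "RC.complete_on (carrier RC)"
  using RC_complete_on[of "carrier R"] seq_closure_carrier by simp

end

section \<open>Finite-dimensional normed spaces over complete fields\<close>

text \<open>In contrast to \<open>complete_on\<close>, nothing is assumed of \<open>n\<close>: the
  notion is applied to norms that are not multiplicative, and to fields on which only a subfield
  carries an absolute value.\<close>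

definition seq_complete :: "('a, 'b) ring_scheme \<Rightarrow> ('a \<Rightarrow> real) \<Rightarrow> 'a set \<Rightarrow> bool" where
  "seq_complete R n S \<longleftrightarrow> (\<forall>s. range s \<subseteq> S \<longrightarrow>
     (\<forall>e>0. \<exists>M. \<forall>i\<ge>M. \<forall>j\<ge>M. n (s i \<ominus>\<^bsub>R\<^esub> s j) < e) \<longrightarrow>
     (\<exists>l\<in>S. (\<lambda>k. n (s k \<ominus>\<^bsub>R\<^esub> l)) \<longlonglongrightarrow> 0))"

lemma (in valued_field) seq_complete_iff: "S \<subseteq> carrier R \<Longrightarrow> seq_complete R n S \<longleftrightarrow> complete_on S"
  unfolding seq_complete_def complete_on_def conv_def cauchy_seqs_def by (auto dest: subset_trans)

text \<open>Only the subfield \<open>K\<close> carries an absolute value. \<open>R\<close> is an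
  extension field, possibly of infinite dimension, on which an absolute value is to be constructed
  or two given ones are to be compared.\<close>

locale complete_subfield = field R for R (structure) +
  fixes K :: "'a set" and n :: "'a \<Rightarrow> real"
  assumes K: "subfield K R"
    and abs: "is_abs (R\<lparr>carrier := K\<rparr>) n"
    and complete: "seq_complete R n K"
begin

sublocale Kv: valued_field "R\<lparr>carrier := K\<rparr>" n
  using subfield_iff(2)[OF K] abs by (simp add: valued_field_def valued_field_axioms_def)

lemma K_carrier: "k \<in> K \<Longrightarrow> k \<in> carrier R"
  using subfieldE(3)[OF K] by blast

lemma K_uminus: "k \<in> K \<Longrightarrow> \<ominus> k \<in> K"
  using subringE(5)[OF subfieldE(1)[OF K]] .

lemma K_one: "\<one> \<in> K" and K_zero: "\<zero> \<in> K"
  using subringE(2,3)[OF subfieldE(1)[OF K]] by auto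

lemma K_add: "k \<in> K \<Longrightarrow> l \<in> K \<Longrightarrow> k \<oplus> l \<in> K" and K_mult: "k \<in> K \<Longrightarrow> l \<in> K \<Longrightarrow> k \<otimes> l \<in> K"
  using subringE(6,7)[OF subfieldE(1)[OF K]] by auto

lemma K_minus: "k \<in> K \<Longrightarrow> l \<in> K \<Longrightarrow> k \<ominus> l \<in> K"
  by (simp add: a_minus_def K_add K_uminus)

lemma K_inv: "k \<in> K \<Longrightarrow> k \<noteq> \<zero> \<Longrightarrow> inv k \<in> K"
  using subfield_m_inv(1)[OF K, of k] by simp

lemma n_K: "k \<in> K \<Longrightarrow> 0 \<le> n k" "k \<in> K \<Longrightarrow> n k = 0 \<longleftrightarrow> k = \<zero>"
  "k \<in> K \<Longrightarrow> l \<in> K \<Longrightarrow> n (k \<otimes> l) = n k * n l"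
  "k \<in> K \<Longrightarrow> l \<in> K \<Longrightarrow> n (k \<oplus> l) \<le> n k + n l"
  "n \<one> = 1" "n \<zero> = 0"
  using Kv.n_nonneg[of k] Kv.n_eq_0_iff[of k] Kv.n_mult[of k l] Kv.n_add[of k l] Kv.n_one Kv.n_zero by auto

lemma n_K_uminus: assumes "k \<in> K" shows "n (\<ominus> k) = n k"
proof -
  have "n (\<ominus> \<one>) * n (\<ominus> \<one>) = n (\<ominus> \<one> \<otimes> \<ominus> \<one>)" by (subst n_K) (auto intro: K_uminus K_one)
  also have "\<dots> = 1" by (simp add: l_minus n_K)
  finally have "(n (\<ominus> \<one>))\<^sup>2 = 1" by (simp add: power2_eq_square)
  then have "n (\<ominus> \<one>) = 1" using n_K(1)[OF K_uminus[OF K_one]] by (auto simp: power2_eq_1_iff)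
  moreover have "\<ominus> k = \<ominus> \<one> \<otimes> k" using K_carrier[OF assms] by (simp add: l_minus)
  ultimately show ?thesis using assms n_K(3)[OF K_uminus[OF K_one] assms] by simp
qed

lemma n_K_inv: assumes "k \<in> K" "k \<noteq> \<zero>" shows "n (inv k) = inverse (n k)"
proof -
  have "k \<in> Units R" using assms K_carrier field_Units by auto
  then have "n k * n (inv k) = 1" using n_K(3)[OF assms(1) K_inv[OF assms]] n_K(5) by simp
  moreover have "n k \<noteq> 0" using assms n_K(2) by simp
  ultimately show ?thesis by (simp add: field_simps)
qed

text \<open>A seminorm over \<open>K\<close>. Definiteness is stated separately where it is used,
  since in a comparison of two norms only the dominating one must be definite.\<close>

definition knorm :: "('a \<Rightarrow> real) \<Rightarrow> bool" where
  "knorm N \<longleftrightarrow> (\<forall>x\<in>carrier R. 0 \<le> N x) \<and>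
     (\<forall>x\<in>carrier R. \<forall>y\<in>carrier R. N (x \<oplus> y) \<le> N x + N y) \<and>
     (\<forall>k\<in>K. \<forall>x\<in>carrier R. N (k \<otimes> x) = n k * N x)"

lemma knormD:
  assumes "knorm N"
  shows "x \<in> carrier R \<Longrightarrow> 0 \<le> N x"
    "x \<in> carrier R \<Longrightarrow> y \<in> carrier R \<Longrightarrow> N (x \<oplus> y) \<le> N x + N y"
    "k \<in> K \<Longrightarrow> x \<in> carrier R \<Longrightarrow> N (k \<otimes> x) = n k * N x"
  using assms unfolding knorm_def by auto

lemma knorm_zero: "knorm N \<Longrightarrow> N \<zero> = 0"
  using knormD(3)[of N \<zero> \<zero>] K_zero n_K(6) by simp

lemma knorm_uminus: assumes "knorm N" "x \<in> carrier R" shows "N (\<ominus> x) = N x"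
proof -
  have "\<ominus> x = \<ominus> \<one> \<otimes> x" using assms by (simp add: l_minus)
  then show ?thesis using knormD(3)[OF assms(1) K_uminus[OF K_one] assms(2)] n_K_uminus[OF K_one] n_K(5) by simp
qed

lemma knorm_minus: "knorm N \<Longrightarrow> x \<in> carrier R \<Longrightarrow> y \<in> carrier R \<Longrightarrow> N (x \<ominus> y) \<le> N x + N y"
  using knormD(2)[of N x "\<ominus> y"] knorm_uminus[of N y] by (simp add: a_minus_def)

lemma dim_subspace:
  assumes "dimension m K E"
  shows "x \<in> E \<Longrightarrow> x \<in> carrier R" "\<zero> \<in> E" "x \<in> E \<Longrightarrow> y \<in> E \<Longrightarrow> x \<oplus> y \<in> E"
    "k \<in> K \<Longrightarrow> x \<in> E \<Longrightarrow> k \<otimes> x \<in> E" "x \<in> E \<Longrightarrow> \<ominus> x \<in> E" "x \<in> E \<Longrightarrow> y \<in> E \<Longrightarrow> x \<ominus> y \<in> E"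
proof -
  obtain Us where Us: "set Us \<subseteq> carrier R" "Span K Us = E" using exists_base[OF K assms] by blast
  show 1: "x \<in> E \<Longrightarrow> x \<in> carrier R" for x using space_subgroup_props(1)[OF K assms] by blast
  show "\<zero> \<in> E" using space_subgroup_props(2)[OF K assms] .
  show 3: "x \<in> E \<Longrightarrow> y \<in> E \<Longrightarrow> x \<oplus> y \<in> E" for x y using space_subgroup_props(3)[OF K assms] .
  show 4: "k \<in> K \<Longrightarrow> x \<in> E \<Longrightarrow> k \<otimes> x \<in> E" for k x using Span_smult_closed[OF K Us(1)] Us(2) by blast
  show 5: "\<ominus> x \<in> E" if "x \<in> E" for x
    using 4[OF K_uminus[OF K_one] that] 1[OF that] by (simp add: l_minus)
  show "x \<in> E \<Longrightarrow> y \<in> E \<Longrightarrow> x \<ominus> y \<in> E" using 3 5 by (simp add: a_minus_def)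
qed

text \<open>A vector outside a complete subspace has positive distance from it: vectors w k with v +
  w k tending to zero form a Cauchy sequence, and its limit l in \<open>E\<close> would give v = -l.
  The coefficient c enters by homogeneity, from c v + w = c (v + w/c).\<close>

lemma line_gap:
  assumes N: "knorm N" and pos: "\<And>x. x \<in> carrier R \<Longrightarrow> N x = 0 \<Longrightarrow> x = \<zero>"
    and E: "dimension m K E" "seq_complete R N E" and v: "v \<in> carrier R" "v \<notin> E"
  shows "\<exists>d>0. \<forall>c\<in>K. \<forall>w\<in>E. d * n c \<le> N (c \<otimes> v \<oplus> w)"
proof -
  note sp = dim_subspace[OF E(1)]
  have "\<exists>d>0. \<forall>w\<in>E. d \<le> N (v \<oplus> w)"
  proof (rule ccontr)
    assume "\<not> ?thesis"
    then have *: "\<exists>w\<in>E. N (v \<oplus> w) < d" if "d > 0" for d using that by (metis not_less)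
    have "\<forall>k. \<exists>w\<in>E. N (v \<oplus> w) < inverse (real (Suc k))" by (intro allI *) simp
    then obtain w where w: "\<And>k. w k \<in> E" "\<And>k. N (v \<oplus> w k) < inverse (real (Suc k))" by metis
    have wc: "w k \<in> carrier R" for k using sp(1)[OF w(1)] .
    have small: "\<exists>M. \<forall>k\<ge>M. inverse (real (Suc k)) < e" if epos: "e > 0" for e
      using order_tendstoD(2)[OF LIMSEQ_inverse_real_of_nat epos] by (simp add: eventually_sequentially)
    have "\<exists>M. \<forall>i\<ge>M. \<forall>j\<ge>M. N (w i \<ominus> w j) < e" if epos: "e > 0" for e
    proof -
      obtain M where M: "\<forall>k\<ge>M. inverse (real (Suc k)) < e/2" using small[of "e/2"] epos by auto
      have "N (w i \<ominus> w j) < e" if ij: "i \<ge> M" "j \<ge> M" for i j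
      proof -
        have "w i \<ominus> w j = (v \<oplus> w i) \<ominus> (v \<oplus> w j)" using wc[of i] wc[of j] v(1) by algebra
        then have "N (w i \<ominus> w j) \<le> N (v \<oplus> w i) + N (v \<oplus> w j)"
          using knorm_minus[OF N, of "v \<oplus> w i" "v \<oplus> w j"] wc v(1) by simp
        then show ?thesis using w(2)[of i] w(2)[of j] M[rule_format, OF ij(1)] M[rule_format, OF ij(2)] by linarith
      qed
      then show ?thesis by blast
    qed
    moreover have "range w \<subseteq> E" using w(1) by blast
    ultimately obtain l where l: "l \<in> E" "(\<lambda>k. N (w k \<ominus> l)) \<longlonglongrightarrow> 0"
      using E(2) unfolding seq_complete_def by blast
    have lc: "l \<in> carrier R" using sp(1)[OF l(1)] .
    have "(\<lambda>k. inverse (real (Suc k)) + N (w k \<ominus> l)) \<longlonglongrightarrow> 0 + 0"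
      by (intro tendsto_add l(2) LIMSEQ_inverse_real_of_nat)
    moreover have "N (v \<oplus> l) \<le> inverse (real (Suc k)) + N (w k \<ominus> l)" for k
    proof -
      have "v \<oplus> l = (v \<oplus> w k) \<ominus> (w k \<ominus> l)" using wc[of k] lc v(1) by algebra
      then have "N (v \<oplus> l) \<le> N (v \<oplus> w k) + N (w k \<ominus> l)"
        using knorm_minus[OF N, of "v \<oplus> w k" "w k \<ominus> l"] wc lc v(1) by simp
      then show ?thesis using w(2)[of k] by linarith
    qed
    ultimately have "N (v \<oplus> l) \<le> 0 + 0" by (intro LIMSEQ_le_const) blast+
    then have "N (v \<oplus> l) = 0" using knormD(1)[OF N, of "v \<oplus> l"] v(1) lc by simp
    then have "v \<oplus> l = \<zero>" using pos v(1) lc by simp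
    then have "v = \<ominus> l" using minus_equality[of v l] v(1) lc by simp
    then show False using sp(5)[OF l(1)] v(2) by simp
  qed
  then obtain d where d: "d > 0" "\<And>w. w \<in> E \<Longrightarrow> d \<le> N (v \<oplus> w)" by blast
  have "d * n c \<le> N (c \<otimes> v \<oplus> w)" if c: "c \<in> K" and w: "w \<in> E" for c w
  proof (cases "c = \<zero>")
    case True
    then show ?thesis using knormD(1)[OF N] n_K(6) sp(1)[OF w] v(1) by simp
  next
    case False
    note cc = K_carrier[OF c] and wc = sp(1)[OF w] and ic = K_inv[OF c False]
    have U: "c \<in> Units R" using cc False field_Units by auto
    have "c \<otimes> (v \<oplus> inv c \<otimes> w) = c \<otimes> v \<oplus> (c \<otimes> inv c) \<otimes> w"
      using cc wc v(1) K_carrier[OF ic] by algebra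
    then have "c \<otimes> v \<oplus> w = c \<otimes> (v \<oplus> inv c \<otimes> w)" using U wc by simp
    then have "N (c \<otimes> v \<oplus> w) = n c * N (v \<oplus> inv c \<otimes> w)"
      using knormD(3)[OF N c, of "v \<oplus> inv c \<otimes> w"] v(1) wc K_carrier[OF ic] by simp
    moreover have "n c * d \<le> n c * N (v \<oplus> inv c \<otimes> w)"
      by (intro mult_left_mono d(2) sp(4) ic w n_K(1) c)
    ultimately show ?thesis by (simp add: mult.commute)
  qed
  with d(1) show ?thesis by blast
qed

text \<open>Induction on the dimension, splitting off one vector v. By \<open>line_gap\<close> the
  coefficient of v is controlled by the norm of the whole vector, so the coefficients form a Cauchy
  sequence in the complete field \<open>K\<close>; the remaining components are then Cauchy in the
  smaller space.\<close>

lemma fd_complete: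
  assumes N: "knorm N" and pos: "\<And>x. x \<in> carrier R \<Longrightarrow> N x = 0 \<Longrightarrow> x = \<zero>"
  shows "dimension m K E \<Longrightarrow> seq_complete R N E"
proof (induction m arbitrary: E)
  case 0
  then have "E = {\<zero>}" using dimension_zero[OF K] by blast
  then show ?case unfolding seq_complete_def using knorm_zero[OF N]
    by (auto simp: image_subset_iff a_minus_def)
next
  case (Suc m)
  obtain v E' where v: "v \<in> carrier R" "v \<notin> E'" and E': "dimension m K E'" and E: "E = line_extension K v E'"
    using dimension_backwards[OF K Suc.prems] by blast
  note sp = dim_subspace[OF E'] and cE' = Suc.IH[OF E']
  obtain d where d: "d > 0" "\<And>c w. c \<in> K \<Longrightarrow> w \<in> E' \<Longrightarrow> d * n c \<le> N (c \<otimes> v \<oplus> w)"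
    using line_gap[OF N pos E' cE' v] by blast
  show ?case unfolding seq_complete_def
  proof (intro allI impI)
    fix s :: "nat \<Rightarrow> 'a" assume r: "range s \<subseteq> E" and cau: "\<forall>e>0. \<exists>M. \<forall>i\<ge>M. \<forall>j\<ge>M. N (s i \<ominus> s j) < e"
    have "\<forall>k. \<exists>c w. c \<in> K \<and> w \<in> E' \<and> s k = c \<otimes> v \<oplus> w"
    proof
      fix k have "s k \<in> line_extension K v E'" using r E by blast
      then show "\<exists>c w. c \<in> K \<and> w \<in> E' \<and> s k = c \<otimes> v \<oplus> w" unfolding line_extension_mem_iff by blast
    qed
    then obtain c w where cw: "\<And>k. c k \<in> K" "\<And>k. w k \<in> E'" "\<And>k. s k = c k \<otimes> v \<oplus> w k" by metis
    note cc = K_carrier[OF cw(1)] and wc = sp(1)[OF cw(2)]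
    have diff: "s i \<ominus> s j = (c i \<ominus> c j) \<otimes> v \<oplus> (w i \<ominus> w j)" for i j
      unfolding cw(3) using cc[of i] cc[of j] wc[of i] wc[of j] v(1) by algebra
    have nc: "n (c i \<ominus> c j) \<le> N (s i \<ominus> s j) / d" for i j
      using d(2)[OF K_minus[OF cw(1) cw(1)] sp(6)[OF cw(2) cw(2)], of i j i j] d(1)
      by (simp add: diff pos_le_divide_eq mult.commute)
    have cauc: "\<exists>M. \<forall>i\<ge>M. \<forall>j\<ge>M. n (c i \<ominus> c j) < e" if epos: "e > 0" for e
    proof -
      obtain M where M: "\<forall>i\<ge>M. \<forall>j\<ge>M. N (s i \<ominus> s j) < e * d"
        using cau[THEN spec, of "e * d"] epos d(1) by auto
      have "n (c i \<ominus> c j) < e" if "i \<ge> M" "j \<ge> M" for i j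
      proof -
        have "N (s i \<ominus> s j) / d < e" using M[rule_format, OF that] d(1) by (simp add: pos_divide_less_eq)
        then show ?thesis using nc[of i j] by linarith
      qed
      then show ?thesis by blast
    qed
    moreover have "range c \<subseteq> K" using cw(1) by blast
    ultimately obtain l where l: "l \<in> K" "(\<lambda>k. n (c k \<ominus> l)) \<longlonglongrightarrow> 0"
      using complete unfolding seq_complete_def by blast
    have "\<exists>M. \<forall>i\<ge>M. \<forall>j\<ge>M. N (w i \<ominus> w j) < e" if epos: "e > 0" for e
    proof -
      define D where "D = N v + 1"
      have D: "D > 0" using knormD(1)[OF N v(1)] by (simp add: D_def)
      obtain M1 where M1: "\<forall>i\<ge>M1. \<forall>j\<ge>M1. N (s i \<ominus> s j) < e/2" using cau[THEN spec, of "e/2"] epos by auto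
      obtain M2 where M2: "\<forall>i\<ge>M2. \<forall>j\<ge>M2. n (c i \<ominus> c j) < e/2/D" using cauc[of "e/2/D"] epos D by auto
      have "N (w i \<ominus> w j) < e" if ij: "i \<ge> max M1 M2" "j \<ge> max M1 M2" for i j
      proof -
        have "w i \<ominus> w j = (s i \<ominus> s j) \<ominus> (c i \<ominus> c j) \<otimes> v"
          unfolding diff using cc[of i] cc[of j] wc[of i] wc[of j] v(1) by algebra
        then have "N (w i \<ominus> w j) \<le> N (s i \<ominus> s j) + n (c i \<ominus> c j) * N v"
          using knorm_minus[OF N, of "s i \<ominus> s j" "(c i \<ominus> c j) \<otimes> v"] knormD(3)[OF N K_minus[OF cw(1) cw(1)] v(1), of i j]
            cw(3) cc wc v(1) by simp
        also have "\<dots> \<le> N (s i \<ominus> s j) + n (c i \<ominus> c j) * D"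
          using n_K(1)[OF K_minus[OF cw(1) cw(1)], of i j] by (intro add_left_mono mult_left_mono) (auto simp: D_def)
        also have "\<dots> < e/2 + e/2/D * D"
          using M1 M2 ij D by (intro add_strict_mono mult_strict_right_mono) auto
        also have "\<dots> = e" using D by simp
        finally show ?thesis .
      qed
      then show ?thesis by blast
    qed
    moreover have "range w \<subseteq> E'" using cw(2) by blast
    ultimately obtain u where u: "u \<in> E'" "(\<lambda>k. N (w k \<ominus> u)) \<longlonglongrightarrow> 0"
      using cE' unfolding seq_complete_def by blast
    note lc = K_carrier[OF l(1)] and uc = sp(1)[OF u(1)]
    have "(\<lambda>k. n (c k \<ominus> l) * N v + N (w k \<ominus> u)) \<longlonglongrightarrow> 0 * N v + 0" by (intro tendsto_intros l u)
    then have lim: "(\<lambda>k. n (c k \<ominus> l) * N v + N (w k \<ominus> u)) \<longlonglongrightarrow> 0" by simp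
    have "norm (N (s k \<ominus> (l \<otimes> v \<oplus> u))) \<le> n (c k \<ominus> l) * N v + N (w k \<ominus> u)" for k
    proof -
      have "s k \<ominus> (l \<otimes> v \<oplus> u) = (c k \<ominus> l) \<otimes> v \<oplus> (w k \<ominus> u)"
        unfolding cw(3) using cc[of k] wc[of k] lc uc v(1) by algebra
      then have "N (s k \<ominus> (l \<otimes> v \<oplus> u)) \<le> n (c k \<ominus> l) * N v + N (w k \<ominus> u)"
        using knormD(2)[OF N, of "(c k \<ominus> l) \<otimes> v" "w k \<ominus> u"] knormD(3)[OF N K_minus[OF cw(1) l(1)] v(1), of k]
          cc wc lc uc v(1) by simp
      moreover have "0 \<le> N (s k \<ominus> (l \<otimes> v \<oplus> u))" using cw(3) cc wc lc uc v(1) by (intro knormD(1)[OF N]) auto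
      ultimately show ?thesis by simp
    qed
    then have "(\<lambda>k. N (s k \<ominus> (l \<otimes> v \<oplus> u))) \<longlonglongrightarrow> 0"
      by (intro metric_null[OF always_eventually lim]) blast
    moreover have "l \<otimes> v \<oplus> u \<in> E" unfolding E line_extension_mem_iff using l(1) u(1) by blast
    ultimately show "\<exists>l\<in>E. (\<lambda>k. N (s k \<ominus> l)) \<longlonglongrightarrow> 0" by blast
  qed
qed

text \<open>The classical equivalence of norms, in one direction. The induction is that of
  \<open>fd_complete\<close>: \<open>line_gap\<close> bounds the coefficient of the new vector, and
  the induction hypothesis bounds the rest.\<close>

lemma norm_compare:
  assumes N: "knorm N" and pos: "\<And>x. x \<in> carrier R \<Longrightarrow> N x = 0 \<Longrightarrow> x = \<zero>" and N': "knorm N'"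
  shows "dimension m K E \<Longrightarrow> \<exists>C>0. \<forall>x\<in>E. N' x \<le> C * N x"
proof (induction m arbitrary: E)
  case 0
  then have "E = {\<zero>}" using dimension_zero[OF K] by blast
  then show ?case using knorm_zero[OF N] knorm_zero[OF N'] by (intro exI[of _ 1]) simp
next
  case (Suc m)
  obtain v E' where v: "v \<in> carrier R" "v \<notin> E'" and E': "dimension m K E'" and E: "E = line_extension K v E'"
    using dimension_backwards[OF K Suc.prems] by blast
  note sp = dim_subspace[OF E']
  obtain C where C: "C > 0" "\<And>x. x \<in> E' \<Longrightarrow> N' x \<le> C * N x" using Suc.IH[OF E'] by blast
  obtain d where d: "d > 0" "\<And>c w. c \<in> K \<Longrightarrow> w \<in> E' \<Longrightarrow> d * n c \<le> N (c \<otimes> v \<oplus> w)"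
    using line_gap[OF N pos E' fd_complete[OF N pos E'] v] by blast
  \<comment> \<open>The constant is what remains after inserting \<open>n c \<le> N x / d\<close>
    and \<open>N w \<le> N x + n c * N v\<close> into
    \<open>N' x \<le> n c * N' v + C * N w\<close>.\<close>
  define D where "D = (N' v + C * N v) / d + C"
  have D: "D > 0" using knormD(1)[OF N v(1)] knormD(1)[OF N' v(1)] d(1) C(1)
    unfolding D_def by (intro add_nonneg_pos divide_nonneg_pos add_nonneg_nonneg) auto
  have "N' x \<le> D * N x" if "x \<in> E" for x
  proof -
    obtain c w where cw: "c \<in> K" "w \<in> E'" "x = c \<otimes> v \<oplus> w" using \<open>x \<in> E\<close> unfolding E line_extension_mem_iff by blast
    note cc = K_carrier[OF cw(1)] and wc = sp(1)[OF cw(2)]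
    have w: "w = x \<ominus> c \<otimes> v" unfolding cw(3) using cc wc v(1) by algebra
    have xc: "x \<in> carrier R" using cw(3) cc wc v(1) by simp
    have "N w \<le> N x + n c * N v"
      using knorm_minus[OF N xc, of "c \<otimes> v"] knormD(3)[OF N cw(1) v(1)] cc v(1) by (simp add: w[symmetric])
    then have *: "C * N w \<le> C * (N x + n c * N v)" using C(1) by simp
    have nc: "n c \<le> N x / d" using d(2)[OF cw(1,2)] d(1) cw(3) by (simp add: pos_le_divide_eq mult.commute)
    have "N' x \<le> n c * N' v + N' w"
      using knormD(2)[OF N', of "c \<otimes> v" w] knormD(3)[OF N' cw(1) v(1)] cw(3) cc wc v(1) by simp
    also have "\<dots> \<le> n c * N' v + C * (N x + n c * N v)" using C(2)[OF cw(2)] * by linarith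
    also have "\<dots> = n c * (N' v + C * N v) + C * N x" by (simp add: algebra_simps)
    also have "\<dots> \<le> N x / d * (N' v + C * N v) + C * N x"
      using nc knormD(1)[OF N v(1)] knormD(1)[OF N' v(1)] C(1) by (intro add_right_mono mult_right_mono) auto
    also have "\<dots> = D * N x" by (simp add: D_def algebra_simps add_divide_distrib)
    finally show ?thesis .
  qed
  with D show ?case by blast
qed

text \<open>Complete subspaces are closed. This will show that the span of a number field over the
  p-adic numbers, being dense in the completion, is all of it.\<close>

lemma fd_closed:
  assumes N: "knorm N" and pos: "\<And>x. x \<in> carrier R \<Longrightarrow> N x = 0 \<Longrightarrow> x = \<zero>" and E: "dimension m K E"
    and s: "range s \<subseteq> E" and l: "l \<in> carrier R" "(\<lambda>k. N (s k \<ominus> l)) \<longlonglongrightarrow> 0"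
  shows "l \<in> E"
proof -
  note sp = dim_subspace[OF E]
  have sc: "s k \<in> carrier R" for k using sp(1) s by blast
  have "\<exists>M. \<forall>i\<ge>M. \<forall>j\<ge>M. N (s i \<ominus> s j) < e" if epos: "e > 0" for e
  proof -
    obtain M where M: "\<forall>k\<ge>M. N (s k \<ominus> l) < e/2"
      using order_tendstoD(2)[OF l(2), of "e/2"] epos by (auto simp: eventually_sequentially)
    have "N (s i \<ominus> s j) < e" if ij: "i \<ge> M" "j \<ge> M" for i j
    proof -
      have "s i \<ominus> s j = (s i \<ominus> l) \<ominus> (s j \<ominus> l)" using sc[of i] sc[of j] l(1) by algebra
      then have "N (s i \<ominus> s j) \<le> N (s i \<ominus> l) + N (s j \<ominus> l)"
        using knorm_minus[OF N, of "s i \<ominus> l" "s j \<ominus> l"] sc l(1) by simp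
      then show ?thesis using M[rule_format, OF ij(1)] M[rule_format, OF ij(2)] by linarith
    qed
    then show ?thesis by blast
  qed
  then obtain m where m: "m \<in> E" "(\<lambda>k. N (s k \<ominus> m)) \<longlonglongrightarrow> 0"
    using fd_complete[OF N pos E] s unfolding seq_complete_def by blast
  have mc: "m \<in> carrier R" using sp(1)[OF m(1)] .
  have "(\<lambda>k. N (s k \<ominus> m) + N (s k \<ominus> l)) \<longlonglongrightarrow> 0 + 0" by (intro tendsto_add m l)
  moreover have "N (l \<ominus> m) \<le> N (s k \<ominus> m) + N (s k \<ominus> l)" for k
  proof -
    have "l \<ominus> m = (s k \<ominus> m) \<ominus> (s k \<ominus> l)" using sc[of k] l(1) mc by algebra
    then show ?thesis using knorm_minus[OF N, of "s k \<ominus> m" "s k \<ominus> l"] sc l(1) mc by simp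
  qed
  ultimately have "N (l \<ominus> m) \<le> 0 + 0" by (intro LIMSEQ_le_const) blast+
  then have "N (l \<ominus> m) = 0" using knormD(1)[OF N, of "l \<ominus> m"] l(1) mc by simp
  then have "l \<ominus> m = \<zero>" using pos l(1) mc by simp
  then have "l = m" using l(1) mc by (simp add: r_right_minus_eq)
  with m(1) show ?thesis by simp
qed

end

lemma power_ratio_bound:
  assumes "0 \<le> x" "0 \<le> y" "\<And>k::nat. x ^ k \<le> C * (y::real) ^ k"
  shows "x \<le> y"
proof (rule ccontr)
  assume "\<not> x \<le> y"
  then have xy: "y < x" by simp
  show False
  proof (cases "y = 0")
    case True
    then show False using assms(3)[of 1] xy by simp
  next
    case False
    then have y: "y > 0" using assms by simp
    have "x / y > 1" using xy y by simp
    then obtain k where k: "C < (x / y) ^ k" using real_arch_pow by blast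
    have "(x / y) ^ k \<le> C" using assms(3)[of k] y by (simp add: power_divide pos_divide_le_eq)
    then show False using k by simp
  qed
qed

context complete_subfield
begin

text \<open>On the finite-dimensional algebra \<open>K(x)\<close> one norm is bounded by a multiple of the other;
  applying this to all powers of \<open>x\<close> makes the constant disappear.\<close>

lemma power_norm_le:
  assumes p: "knorm p" and q: "knorm q" and pos: "\<And>x. x \<in> carrier R \<Longrightarrow> q x = 0 \<Longrightarrow> x = \<zero>"
    and x: "x \<in> carrier R" "(algebraic over K) x"
    and pp: "\<And>k::nat. p (x [^] k) = p x ^ k" and qq: "\<And>k::nat. q (x [^] k) \<le> q x ^ k"
  shows "p x \<le> q x"
proof -
  let ?E = "simple_extension K x"
  have dim: "dimension (Polynomials.degree (Irr K x)) K ?E" using dimension_simple_extension[OF K x] .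
  have sr: "subring ?E R" using simple_extension_is_subring[OF subfieldE(1)[OF K] x(1)] .
  have xE: "x \<in> ?E" using simple_extension_mem[OF subfieldE(1)[OF K] x(1)] .
  have pw: "x [^] (k::nat) \<in> ?E" for k
    by (induction k) (auto simp: subringE(3)[OF sr] intro: subringE(6)[OF sr] xE)
  obtain C where C: "C > 0" "\<And>y. y \<in> ?E \<Longrightarrow> p y \<le> C * q y" using norm_compare[OF q pos p dim] by blast
  have "p x ^ k \<le> C * q x ^ k" for k
  proof -
    have "p x ^ k \<le> C * q (x [^] k)" using C(2)[OF pw[of k]] pp by simp
    also have "\<dots> \<le> C * q x ^ k" using qq C(1) by simp
    finally show ?thesis .
  qed
  then show ?thesis using power_ratio_bound[of "p x" "q x" C] knormD(1)[OF p x(1)] knormD(1)[OF q x(1)] by blast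
qed

lemma abs_knorm:
  assumes "is_abs R m" "\<And>k. k \<in> K \<Longrightarrow> m k = n k"
  shows "knorm m" "x \<in> carrier R \<Longrightarrow> m x = 0 \<Longrightarrow> x = \<zero>" "x \<in> carrier R \<Longrightarrow> m (x [^] (k::nat)) = m x ^ k"
proof -
  interpret m: valued_field R m using assms(1) by unfold_locales
  show "knorm m" unfolding knorm_def using assms(2) m.n_add K_carrier by simp
  show "x \<in> carrier R \<Longrightarrow> m x = 0 \<Longrightarrow> x = \<zero>" by simp
  show "x \<in> carrier R \<Longrightarrow> m (x [^] (k::nat)) = m x ^ k" by simp
qed

text \<open>An absolute value is multiplicative on powers and definite, so
  \<open>power_norm_le\<close> applies to the two extensions in both orders.\<close>

theorem abs_unique:
  assumes "is_abs R m1" "\<And>k. k \<in> K \<Longrightarrow> m1 k = n k" "is_abs R m2" "\<And>k. k \<in> K \<Longrightarrow> m2 k = n k"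
    and x: "x \<in> carrier R" "(algebraic over K) x"
  shows "m1 x = m2 x"
proof (rule antisym)
  note a = abs_knorm[OF assms(1,2)] and b = abs_knorm[OF assms(3,4)]
  show "m1 x \<le> m2 x" by (rule power_norm_le[OF a(1) b(1,2) x]) (simp_all add: a(3) b(3) x(1))
  show "m2 x \<le> m1 x" by (rule power_norm_le[OF b(1) a(1,2) x]) (simp_all add: a(3) b(3) x(1))
qed

end

section \<open>Extension of absolute values\<close>

lemma eps_mult_le:
  fixes x y z :: real
  assumes "\<And>e. e > 0 \<Longrightarrow> z \<le> (x + e) * (y + e)" shows "z \<le> x * y"
proof (rule LIMSEQ_le_const)
  have "(\<lambda>k. (x + inverse (real (Suc k))) * (y + inverse (real (Suc k)))) \<longlonglongrightarrow> (x + 0) * (y + 0)"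
    by (intro tendsto_intros LIMSEQ_inverse_real_of_nat)
  then show "(\<lambda>k. (x + inverse (real (Suc k))) * (y + inverse (real (Suc k)))) \<longlonglongrightarrow> x * y" by simp
qed (use assms in auto)

text \<open>\<open>comb_bound S A z\<close>: \<open>z\<close> is a \<open>K\<close>-linear combination of elements of \<open>S\<close> whose
  coefficients have absolute values of sum at most \<open>A\<close>.\<close>

inductive (in complete_subfield) comb_bound :: "'a set \<Rightarrow> real \<Rightarrow> 'a \<Rightarrow> bool" for S where
  comb_bound_zero: "comb_bound S 0 \<zero>"
| comb_bound_smult: "u \<in> S \<Longrightarrow> c \<in> K \<Longrightarrow> comb_bound S (n c) (c \<otimes> u)"
| comb_bound_add: "comb_bound S A z \<Longrightarrow> comb_bound S B w \<Longrightarrow> comb_bound S (A + B) (z \<oplus> w)"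
| comb_bound_weaken: "comb_bound S A z \<Longrightarrow> A \<le> B \<Longrightarrow> comb_bound S B z"

context complete_subfield
begin

lemma comb_bound_carrier: "comb_bound S A z \<Longrightarrow> S \<subseteq> carrier R \<Longrightarrow> z \<in> carrier R"
  by (induction rule: comb_bound.induct) (auto simp: K_carrier)

lemma comb_bound_nonneg: "comb_bound S A z \<Longrightarrow> 0 \<le> A"
  by (induction rule: comb_bound.induct) (auto simp: n_K)

lemma comb_bound_mono: "comb_bound S A z \<Longrightarrow> S \<subseteq> T \<Longrightarrow> comb_bound T A z"
proof (induction rule: comb_bound.induct)
  case (comb_bound_weaken A z B) then show ?case using comb_bound.comb_bound_weaken by blast
qed (auto intro: comb_bound.intros)

lemma comb_bound_scale: "comb_bound S A z \<Longrightarrow> S \<subseteq> carrier R \<Longrightarrow> k \<in> K \<Longrightarrow> comb_bound S (n k * A) (k \<otimes> z)"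
proof (induction rule: comb_bound.induct)
  case comb_bound_zero then show ?case using comb_bound.comb_bound_zero by (simp add: K_carrier)
next
  case (comb_bound_smult u c)
  then have "u \<in> carrier R" by blast
  then have "k \<otimes> (c \<otimes> u) = (k \<otimes> c) \<otimes> u" using comb_bound_smult by (simp add: K_carrier m_assoc)
  then show ?case using comb_bound.comb_bound_smult[OF comb_bound_smult(1) K_mult[OF \<open>k \<in> K\<close> \<open>c \<in> K\<close>]] n_K(3)[OF \<open>k \<in> K\<close> \<open>c \<in> K\<close>] by simp
next
  case (comb_bound_add A z B w)
  then have "k \<otimes> (z \<oplus> w) = k \<otimes> z \<oplus> k \<otimes> w" using comb_bound_carrier K_carrier by (simp add: r_distr)
  then show ?case using comb_bound.comb_bound_add comb_bound_add by (simp add: distrib_left)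
next
  case (comb_bound_weaken A z B)
  then have "n k * A \<le> n k * B" using n_K(1) by (intro mult_left_mono) auto
  then show ?case using comb_bound.comb_bound_weaken comb_bound_weaken by blast
qed

definition times_set :: "'a set \<Rightarrow> 'a set \<Rightarrow> 'a set" where
  "times_set S T = (\<lambda>(u, v). u \<otimes> v) ` (S \<times> T)"

lemma times_set_props: "finite S \<Longrightarrow> finite T \<Longrightarrow> finite (times_set S T)"
  "S \<subseteq> carrier R \<Longrightarrow> T \<subseteq> carrier R \<Longrightarrow> times_set S T \<subseteq> carrier R"
  by (auto simp: times_set_def subset_iff)

lemma comb_bound_mult_aux: "comb_bound T B w \<Longrightarrow> T \<subseteq> carrier R \<Longrightarrow> u \<in> S \<Longrightarrow> S \<subseteq> carrier R \<Longrightarrow> comb_bound (times_set S T) B (u \<otimes> w)"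
proof (induction rule: comb_bound.induct)
  case comb_bound_zero then show ?case using comb_bound.comb_bound_zero by (auto simp: subset_iff)
next
  case (comb_bound_smult v c)
  then have "u \<in> carrier R" "v \<in> carrier R" "c \<in> carrier R" using K_carrier by blast+
  then have "u \<otimes> (c \<otimes> v) = c \<otimes> (u \<otimes> v)" by algebra
  moreover have "u \<otimes> v \<in> times_set S T" using comb_bound_smult by (auto simp: times_set_def)
  ultimately show ?case using comb_bound.comb_bound_smult comb_bound_smult by simp
next
  case (comb_bound_add A z B w)
  moreover have "u \<in> carrier R" using comb_bound_add by blast
  ultimately have "u \<otimes> (z \<oplus> w) = u \<otimes> z \<oplus> u \<otimes> w" using comb_bound_carrier by (simp add: r_distr)
  then show ?case using comb_bound.comb_bound_add comb_bound_add by simp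
next
  case (comb_bound_weaken A z B) then show ?case using comb_bound.comb_bound_weaken by blast
qed

lemma comb_bound_mult: "comb_bound S A z \<Longrightarrow> comb_bound T B w \<Longrightarrow> S \<subseteq> carrier R \<Longrightarrow> T \<subseteq> carrier R \<Longrightarrow> comb_bound (times_set S T) (A * B) (z \<otimes> w)"
proof (induction rule: comb_bound.induct)
  case comb_bound_zero
  then show ?case using comb_bound.comb_bound_zero comb_bound_carrier[OF comb_bound_zero(1)] by simp
next
  case (comb_bound_smult u c)
  have c: "u \<in> carrier R" "w \<in> carrier R" "c \<in> carrier R" using comb_bound_smult comb_bound_carrier[of T B w] K_carrier by blast+
  have "comb_bound (times_set S T) (n c * B) (c \<otimes> (u \<otimes> w))"
    using comb_bound_mult_aux[of T B w u S] comb_bound_smult times_set_props(2) by (intro comb_bound_scale) auto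
  then show ?case using c by (simp add: m_assoc)
next
  case (comb_bound_add A z C v)
  then have "(z \<oplus> v) \<otimes> w = z \<otimes> w \<oplus> v \<otimes> w" using comb_bound_carrier by (simp add: l_distr)
  then show ?case using comb_bound.comb_bound_add[OF comb_bound_add.IH(1) comb_bound_add.IH(2)] comb_bound_add.prems by (simp add: distrib_right)
next
  case (comb_bound_weaken A z C)
  then have "A * B \<le> C * B" using comb_bound_nonneg by (intro mult_right_mono) auto
  then show ?case using comb_bound.comb_bound_weaken comb_bound_weaken by blast
qed

text \<open>The powers of \<open>x\<close> grow at most like the powers of \<open>a\<close>,
  measured by coefficients with respect to one finite set. The set may depend on \<open>x\<close>
  and \<open>a\<close>, and need not be independent, so sets for two elements can simply be
  multiplied.\<close>

definition power_bound :: "'a \<Rightarrow> real \<Rightarrow> bool" where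
  "power_bound x a \<longleftrightarrow> 0 < a \<and> (\<exists>S A. finite S \<and> S \<subseteq> carrier R \<and> 0 \<le> A \<and> (\<forall>k::nat. comb_bound S (A * a ^ k) (x [^] k)))"

lemma power_boundI: "0 < a \<Longrightarrow> finite S \<Longrightarrow> S \<subseteq> carrier R \<Longrightarrow> 0 \<le> A \<Longrightarrow> (\<And>k::nat. comb_bound S (A * a ^ k) (x [^] k)) \<Longrightarrow> power_bound x a"
  unfolding power_bound_def by blast

lemma power_bound_mono: assumes "power_bound x a" "a \<le> b" shows "power_bound x b"
proof -
  obtain S A where S: "0 < a" "finite S" "S \<subseteq> carrier R" "0 \<le> A" "\<And>k::nat. comb_bound S (A * a ^ k) (x [^] k)"
    using assms(1) unfolding power_bound_def by blast
  have "A * a ^ k \<le> A * b ^ k" for k using S(1,4) assms(2) by (intro mult_left_mono power_mono) auto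
  then show ?thesis using S assms(2) comb_bound_weaken[OF S(5)] by (intro power_boundI[OF _ S(2,3,4)]) auto
qed

lemma power_bound_mult:
  assumes "power_bound x a" "power_bound y b" and x: "x \<in> carrier R" and y: "y \<in> carrier R"
  shows "power_bound (x \<otimes> y) (a * b)"
proof -
  obtain S A where S: "0 < a" "finite S" "S \<subseteq> carrier R" "0 \<le> A" "\<And>k::nat. comb_bound S (A * a ^ k) (x [^] k)"
    using assms(1) unfolding power_bound_def by blast
  obtain T B where T: "0 < b" "finite T" "T \<subseteq> carrier R" "0 \<le> B" "\<And>k::nat. comb_bound T (B * b ^ k) (y [^] k)"
    using assms(2) unfolding power_bound_def by blast
  show ?thesis
  proof (rule power_boundI)
    show "comb_bound (times_set S T) ((A * B) * (a * b) ^ k) ((x \<otimes> y) [^] k)" for k :: nat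
      using comb_bound_mult[OF S(5) T(5) S(3) T(3), of k k] x y by (simp add: nat_pow_distrib power_mult_distrib mult_ac)
  qed (use S T times_set_props in auto)
qed

text \<open>By commutativity the powers of x + y are sums of terms x^i y^j, whose bounds A a^i and B
  b^j multiply with respect to the product set.\<close>

lemma power_bound_add:
  assumes "power_bound x a" "power_bound y b" and x: "x \<in> carrier R" and y: "y \<in> carrier R"
  shows "power_bound (x \<oplus> y) (a + b)"
proof -
  obtain S A where S: "0 < a" "finite S" "S \<subseteq> carrier R" "0 \<le> A" "\<And>k::nat. comb_bound S (A * a ^ k) (x [^] k)"
    using assms(1) unfolding power_bound_def by blast
  obtain T B where T: "0 < b" "finite T" "T \<subseteq> carrier R" "0 \<le> B" "\<And>k::nat. comb_bound T (B * b ^ k) (y [^] k)"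
    using assms(2) unfolding power_bound_def by blast
  \<comment> \<open>The extra factors x^i y^j let one factor x + y split into two expressions of the
    same shape with \<open>m\<close> lowered by one. The bounds add up to a power of a + b without
    any binomial coefficients.\<close>
  have *: "comb_bound (times_set S T) (A * B * a ^ i * b ^ j * (a + b) ^ m) (x [^] i \<otimes> y [^] j \<otimes> (x \<oplus> y) [^] m)" for i j m :: nat
  proof (induction m arbitrary: i j)
    case 0
    show ?case using comb_bound_mult[OF S(5) T(5) S(3) T(3), of i j] x y by (simp add: mult_ac)
  next
    case (Suc m)
    define P Q Z where "P = x [^] i" and "Q = y [^] j" and "Z = (x \<oplus> y) [^] m"
    have c: "P \<in> carrier R" "Q \<in> carrier R" "Z \<in> carrier R" using x y by (auto simp: P_def Q_def Z_def)
    have "P \<otimes> Q \<otimes> (Z \<otimes> (x \<oplus> y)) = (P \<otimes> x) \<otimes> Q \<otimes> Z \<oplus> P \<otimes> (Q \<otimes> y) \<otimes> Z" using c x y by algebra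
    then have e: "x [^] i \<otimes> y [^] j \<otimes> (x \<oplus> y) [^] Suc m = x [^] Suc i \<otimes> y [^] j \<otimes> (x \<oplus> y) [^] m \<oplus> x [^] i \<otimes> y [^] Suc j \<otimes> (x \<oplus> y) [^] m"
      by (simp add: P_def Q_def Z_def)
    show ?case unfolding e
      using comb_bound_add[OF Suc.IH[of "Suc i" j] Suc.IH[of i "Suc j"]] by (simp add: algebra_simps)
  qed
  show ?thesis
  proof (rule power_boundI)
    show "comb_bound (times_set S T) ((A * B) * (a + b) ^ k) ((x \<oplus> y) [^] k)" for k :: nat
      using *[of 0 0 k] x y by simp
  qed (use S T times_set_props in auto)
qed

lemma power_bound_scalar: assumes c: "c \<in> K" "c \<noteq> \<zero>" shows "power_bound c (n c)"
proof (rule power_boundI)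
  have pw: "c [^] k \<in> K \<and> n (c [^] k) = n c ^ k" for k :: nat
    by (induction k) (auto simp: K_one n_K c K_mult)
  show "comb_bound {\<one>} (1 * n c ^ k) (c [^] k)" for k :: nat
    using comb_bound_smult[of \<one> "{\<one>}" "c [^] k"] pw[of k] K_carrier[of "c [^] k"] by simp
  have "n c \<noteq> 0" "0 \<le> n c" using n_K(1,2)[OF c(1)] c(2) by auto
  then show "0 < n c" by simp
qed auto

text \<open>Were \<open>a\<close> smaller than 1, the element 1 would be a combination of a fixed
  finite set with arbitrarily small coefficients. The coordinate along 1 in a suitable basis is
  bounded in terms of the coefficients, yet it equals 1 for the element 1.\<close>

lemma power_bound_one_lower: assumes "power_bound \<one> a" shows "1 \<le> a"
proof (rule ccontr)
  assume "\<not> 1 \<le> a"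
  then have a1: "a < 1" by simp
  obtain S A where S: "0 < a" "finite S" "S \<subseteq> carrier R" "0 \<le> A" "\<And>k::nat. comb_bound S (A * a ^ k) (\<one> [^] k)"
    using assms(1) unfolding power_bound_def by blast
  obtain Us where Us: "set Us = insert \<one> S" using S(2) by (metis finite.insertI finite_list)
  then have Usc: "set Us \<subseteq> carrier R" using S(3) by simp
  obtain Vs0 where Vs0: "independent K Vs0" "Span K Vs0 = Span K Us" using filter_base[OF K Usc] by metis
  \<comment> \<open>A basis of the span is chosen that contains 1. The remaining basis vectors span
    a complement \<open>W\<close> of the line K, and coordinates along 1 are elements of
    \<open>K\<close> modulo \<open>W\<close>.\<close>
  have "\<one> \<notin> Span K []" by simp
  then have "independent K [\<one>]" by (intro li_Cons) auto
  moreover have "set [\<one>] \<subseteq> Span K Vs0" using Span_base_incl[OF K Usc] Us Vs0 by auto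
  ultimately obtain Vs where Vs: "independent K (Vs @ [\<one>])" "Span K (Vs @ [\<one>]) = Span K Vs0"
    using complete_base[OF K dimensionI[OF K Vs0(1) refl]] by blast
  have ind: "independent K (\<one> # Vs)" using independent_same_set[OF K _ _ Vs(1), of "\<one> # Vs"] by simp
  note Vsc = independent_in_carrier[OF independent_backwards(2)[OF ind]]
  define W where "W = Span K Vs"
  have W1: "\<one> \<notin> W" using independent_backwards(1)[OF ind] by (simp add: W_def)
  have W: "dimension (length Vs) K W" unfolding W_def using independent_backwards(2)[OF ind] by (rule dimension_independent)
  note sp = dim_subspace[OF W]
  have "Span K (\<one> # Vs) = Span K (Vs @ [\<one>])"
    using Span_same_set[OF K, of "\<one> # Vs" "Vs @ [\<one>]"] Vsc by simp
  then have SpE: "line_extension K \<one> W = Span K Us" using Vs(2) Vs0(2) by (simp add: W_def)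
  have "\<exists>c\<in>K. u \<ominus> c \<in> W" if "u \<in> S" for u
  proof -
    have "u \<in> line_extension K \<one> W" using SpE Span_base_incl[OF K Usc] Us \<open>u \<in> S\<close> by blast
    then obtain c w where c: "c \<in> K" and w: "w \<in> W" and u: "u = c \<otimes> \<one> \<oplus> w" unfolding line_extension_mem_iff by blast
    have "u \<ominus> c = w" unfolding u using sp(1)[OF w] K_carrier[OF c] by algebra
    with w have "u \<ominus> c \<in> W" by simp
    with c show ?thesis by (rule bexI[rotated])
  qed
  then obtain cu where cu: "\<And>u. u \<in> S \<Longrightarrow> cu u \<in> K" "\<And>u. u \<in> S \<Longrightarrow> u \<ominus> cu u \<in> W" by metis
  define M where "M = (\<Sum>u\<in>S. n (cu u))"
  have M: "n (cu u) \<le> M" if "u \<in> S" for u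
    unfolding M_def using n_K(1)[OF cu(1)] S(2) that by (intro member_le_sum) auto
  have M0: "0 \<le> M" unfolding M_def using n_K(1)[OF cu(1)] by (intro sum_nonneg) auto
  \<comment> \<open>\<open>M\<close> bounds the coordinates along 1 of all generators, so a
    combination with coefficient sum \<open>A\<close> has a coordinate of size at most
    \<open>A * M\<close>.\<close>
  have key: "comb_bound S A z \<Longrightarrow> \<exists>c\<in>K. z \<ominus> c \<in> W \<and> n c \<le> A * M" for A z
  proof (induction rule: comb_bound.induct)
    case comb_bound_zero
    then show ?case using K_zero sp(2) by (intro bexI[of _ \<zero>]) (auto simp: a_minus_def n_K(6))
  next
    case (comb_bound_smult u c)
    have uc: "u \<in> carrier R" "c \<in> carrier R" "cu u \<in> carrier R" using comb_bound_smult S(3) K_carrier cu(1) by blast+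
    have "c \<otimes> u \<ominus> c \<otimes> cu u = c \<otimes> (u \<ominus> cu u)" using uc by algebra
    then have "c \<otimes> u \<ominus> c \<otimes> cu u \<in> W" using sp(4)[OF comb_bound_smult(2) cu(2)[OF comb_bound_smult(1)]] by simp
    moreover have "n (c \<otimes> cu u) \<le> n c * M"
      using n_K(3)[OF comb_bound_smult(2) cu(1)[OF comb_bound_smult(1)]] M[OF comb_bound_smult(1)] n_K(1)[OF comb_bound_smult(2)] by (simp add: mult_left_mono)
    ultimately show ?case using K_mult[OF comb_bound_smult(2) cu(1)[OF comb_bound_smult(1)]] by blast
  next
    case (comb_bound_add A z B w)
    then obtain c d where cd: "c \<in> K" "d \<in> K" "z \<ominus> c \<in> W" "w \<ominus> d \<in> W" "n c \<le> A * M" "n d \<le> B * M" by blast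
    have zw: "z \<in> carrier R" "w \<in> carrier R" using comb_bound_add comb_bound_carrier S(3) by blast+
    have "(z \<oplus> w) \<ominus> (c \<oplus> d) = (z \<ominus> c) \<oplus> (w \<ominus> d)" using zw K_carrier[OF cd(1)] K_carrier[OF cd(2)] by algebra
    then have "(z \<oplus> w) \<ominus> (c \<oplus> d) \<in> W" using sp(3)[OF cd(3,4)] by simp
    moreover have "n (c \<oplus> d) \<le> (A + B) * M" using n_K(4)[OF cd(1,2)] cd(5,6) by (simp add: distrib_right)
    ultimately show ?case using K_add[OF cd(1,2)] by blast
  next
    case (comb_bound_weaken A z B)
    then obtain c where c: "c \<in> K" "z \<ominus> c \<in> W" "n c \<le> A * M" by blast
    have "A * M \<le> B * M" using comb_bound_weaken M0 by (intro mult_right_mono) auto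
    then show ?case using c by force
  qed
  have "1 \<le> A * a ^ k * M" for k :: nat
  proof -
    have "comb_bound S (A * a ^ k) \<one>" using S(5)[of k] by simp
    from key[OF this] obtain c where c: "c \<in> K" "\<one> \<ominus> c \<in> W" "n c \<le> A * a ^ k * M" by blast
    \<comment> \<open>Otherwise 1 - c would be a nonzero scalar in \<open>W\<close>, and dividing by
      it would place 1 in \<open>W\<close>.\<close>
    have "c = \<one>"
    proof (rule ccontr)
      assume "c \<noteq> \<one>"
      then have nz: "\<one> \<ominus> c \<noteq> \<zero>" using K_carrier[OF c(1)] by (metis one_closed r_right_minus_eq)
      have k1: "\<one> \<ominus> c \<in> K" using K_minus[OF K_one c(1)] .
      have "inv (\<one> \<ominus> c) \<otimes> (\<one> \<ominus> c) \<in> W" by (rule sp(4)[OF K_inv[OF k1 nz] c(2)])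
      moreover have "\<one> \<ominus> c \<in> Units R" using nz K_carrier[OF k1] field_Units by auto
      ultimately show False using W1 by simp
    qed
    then show ?thesis using c(3) n_K(5) by simp
  qed
  moreover have "(\<lambda>k. A * a ^ k * M) \<longlonglongrightarrow> A * 0 * M"
    using a1 S(1) by (intro tendsto_intros LIMSEQ_power_zero) auto
  ultimately have "1 \<le> A * 0 * M" by (intro LIMSEQ_le_const) blast+
  then show False by simp
qed

lemma Span_bd:
  assumes "set Us \<subseteq> carrier R" "z \<in> Span K Us" shows "\<exists>A. comb_bound (set Us) A z"
proof -
  have "\<exists>A. comb_bound (set Us) A (combine Ks Us)" if "set Ks \<subseteq> K" for Ks
    using that assms(1)
  proof (induction Ks Us rule: combine.induct)
    case (1 k Ks u Us)
    then obtain A where "comb_bound (set Us) A (combine Ks Us)" by auto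
    then have "comb_bound (set (u # Us)) A (combine Ks Us)" by (rule comb_bound_mono) auto
    then show ?case using comb_bound_add[OF comb_bound_smult[of u "set (u # Us)" k]] 1 by auto
  qed (auto intro: comb_bound_zero)
  then show ?thesis using assms Span_eq_combine_set[OF K assms(1)] by auto
qed

text \<open>Multiplication by \<open>x\<close> maps the finite-dimensional space K(x) to itself and
  enlarges coefficient sums with respect to the power basis by at most a constant factor; this is
  applied repeatedly, starting from 1.\<close>

lemma power_bound_exists: assumes x: "x \<in> carrier R" "(algebraic over K) x" shows "\<exists>a. power_bound x a"
proof -
  define Us where "Us = exp_base x (Polynomials.degree (Irr K x))"
  have E: "Span K Us = simple_extension K x" unfolding Us_def using Span_exp_base[OF K x] .
  have Usc: "set Us \<subseteq> carrier R" unfolding Us_def using x(1) by (auto simp: exp_base_def)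
  have sr: "subring (simple_extension K x) R" using simple_extension_is_subring[OF subfieldE(1)[OF K] x(1)] .
  have xE: "x \<in> simple_extension K x" using simple_extension_mem[OF subfieldE(1)[OF K] x(1)] .
  have "\<exists>A. comb_bound (set Us) A (x \<otimes> u)" if u: "u \<in> set Us" for u
  proof (rule Span_bd[OF Usc])
    have "u \<in> simple_extension K x" using Span_base_incl[OF K Usc] u E by blast
    then show "x \<otimes> u \<in> Span K Us" using subringE(6)[OF sr xE] E by simp
  qed
  then obtain Cu where Cu: "\<And>u. u \<in> set Us \<Longrightarrow> comb_bound (set Us) (Cu u) (x \<otimes> u)" by metis
  \<comment> \<open>The summand 1 only ensures positivity, which \<open>power_bound\<close>
    demands.\<close>
  define C where "C = (\<Sum>u\<in>set Us. Cu u) + 1"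
  have C: "Cu u \<le> C" if "u \<in> set Us" for u
    unfolding C_def using comb_bound_nonneg[OF Cu] member_le_sum[OF that, of Cu] by force
  have C0: "C > 0" unfolding C_def using comb_bound_nonneg[OF Cu] by (intro add_nonneg_pos sum_nonneg) auto
  have step: "comb_bound (set Us) A z \<Longrightarrow> comb_bound (set Us) (A * C) (x \<otimes> z)" for A z
  proof (induction rule: comb_bound.induct)
    case comb_bound_zero then show ?case using comb_bound.comb_bound_zero x(1) by simp
  next
    case (comb_bound_smult u c)
    have cc: "u \<in> carrier R" "c \<in> carrier R" using comb_bound_smult Usc K_carrier by blast+
    have "x \<otimes> (c \<otimes> u) = c \<otimes> (x \<otimes> u)" using cc x(1) by algebra
    then show ?case using comb_bound_scale[OF comb_bound_weaken[OF Cu C] Usc comb_bound_smult(2)] comb_bound_smult(1) by simp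
  next
    case (comb_bound_add A z B w)
    then have "x \<otimes> (z \<oplus> w) = x \<otimes> z \<oplus> x \<otimes> w" using comb_bound_carrier Usc x(1) by (simp add: r_distr)
    then show ?case using comb_bound.comb_bound_add[OF comb_bound_add.IH] by (simp add: distrib_right)
  next
    case (comb_bound_weaken A z B)
    have "A * C \<le> B * C" using comb_bound_weaken(2) C0 by simp
    then show ?case using comb_bound.comb_bound_weaken comb_bound_weaken.IH by blast
  qed
  have "\<one> \<in> Span K Us" unfolding E using subringE(3)[OF sr] .
  then obtain A where A: "comb_bound (set Us) A \<one>" using Span_bd[OF Usc] by blast
  have "comb_bound (set Us) (A * C ^ k) (x [^] k)" for k :: nat
  proof (induction k)
    case (Suc k)
    have "comb_bound (set Us) (A * C ^ k * C) (x \<otimes> x [^] k)" by (rule step[OF Suc])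
    then show ?case using x(1) by (simp add: mult_ac m_comm)
  qed (use A in simp)
  then show ?thesis using power_boundI[OF C0 _ Usc comb_bound_nonneg[OF A]] by blast
qed

text \<open>Division with remainder, m = j q + r, writes x^m as a power of x^j times one of the
  finitely many x^r with r < j. These remainders are added to the finite set, and \<open>D\<close>
  compensates for the missing factors a^r.\<close>

lemma power_bound_root:
  assumes x: "x \<in> carrier R" and j: "j > 0" and g: "power_bound (x [^] j) (a ^ j)" and a: "a > 0"
  shows "power_bound x a"
proof -
  obtain S A where S: "0 < a ^ j" "finite S" "S \<subseteq> carrier R" "0 \<le> A" "\<And>k::nat. comb_bound S (A * (a ^ j) ^ k) ((x [^] j) [^] k)"
    using g unfolding power_bound_def by blast
  define T where "T = (\<lambda>r. x [^] r) ` {..<j}"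
  define D where "D = (\<Sum>r<j. inverse (a ^ r))"
  have D: "inverse (a ^ r) \<le> D" if "r < j" for r
    unfolding D_def using that a by (intro member_le_sum) auto
  have D0: "D \<ge> 0" unfolding D_def using a by (intro sum_nonneg) auto
  show ?thesis
  proof (rule power_boundI)
    fix m :: nat
    define q r where "q = m div j" and "r = m mod j"
    have m: "m = j * q + r" and r: "r < j" using j by (auto simp: q_def r_def)
    have "x [^] r \<in> T" using r by (auto simp: T_def)
    from comb_bound_smult[OF this K_one] have T1: "comb_bound T 1 (x [^] r)" using n_K(5) x by simp
    have "comb_bound (times_set S T) (A * (a ^ j) ^ q * 1) ((x [^] j) [^] q \<otimes> x [^] r)"
      by (rule comb_bound_mult[OF S(5) T1 S(3)]) (use x in \<open>auto simp: T_def\<close>)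
    then have 1: "comb_bound (times_set S T) (A * a ^ (j * q)) (x [^] m)"
      using x by (simp add: m nat_pow_pow nat_pow_mult power_mult)
    have "A * a ^ (j * q) = A * a ^ m * inverse (a ^ r)" using a by (simp add: m power_add)
    also have "\<dots> \<le> A * a ^ m * D" using D[OF r] S(4) a by (intro mult_left_mono) auto
    finally have "A * a ^ (j * q) \<le> (A * D) * a ^ m" by (simp add: mult_ac)
    with 1 show "comb_bound (times_set S T) ((A * D) * a ^ m) (x [^] m)" by (rule comb_bound_weaken)
  qed (use S D0 a x times_set_props in \<open>auto simp: T_def times_set_def\<close>)
qed

text \<open>Measuring the growth of the powers of \<open>x\<close> by coefficients over arbitrary finite sets gives a
  spectral radius without choosing a norm on \<open>R\<close>, which may have infinite dimension over \<open>K\<close>.\<close>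

definition spectral_radius :: "'a \<Rightarrow> real" where
  "spectral_radius x = Inf {a. power_bound x a}"

end

section \<open>The spectral radius as an absolute value on an algebraic extension\<close>

locale complete_subfield_algebraic = complete_subfield +
  assumes algebraic_over: "\<And>x. x \<in> carrier R \<Longrightarrow> (algebraic over K) x"
begin

lemma power_bound_pos: "power_bound x a \<Longrightarrow> 0 < a"
  by (simp add: power_bound_def)

lemma spectral_radius_le: "power_bound x a \<Longrightarrow> spectral_radius x \<le> a"
  unfolding spectral_radius_def using power_bound_pos by (intro cInf_lower bdd_belowI[of _ 0]) (auto simp: less_imp_le)

lemma spectral_radius_nonneg: "x \<in> carrier R \<Longrightarrow> 0 \<le> spectral_radius x"
  unfolding spectral_radius_def using power_bound_pos power_bound_exists[OF _ algebraic_over] by (intro cInf_greatest) (auto simp: less_imp_le)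

lemma spectral_radius_good: assumes "x \<in> carrier R" "e > 0" shows "power_bound x (spectral_radius x + e)"
proof -
  have "Inf {a. power_bound x a} < spectral_radius x + e" using assms by (simp add: spectral_radius_def)
  moreover have "{a. power_bound x a} \<noteq> {}" using power_bound_exists[OF _ algebraic_over] assms by blast
  ultimately have "\<exists>a\<in>{a. power_bound x a}. a < spectral_radius x + e" by (intro cInf_lessD)
  then obtain a where a: "power_bound x a" "a < spectral_radius x + e" by blast
  show ?thesis by (rule power_bound_mono[OF a(1) less_imp_le[OF a(2)]])
qed

lemma spectral_radius_mult: assumes "x \<in> carrier R" "y \<in> carrier R" shows "spectral_radius (x \<otimes> y) \<le> spectral_radius x * spectral_radius y"
  by (rule eps_mult_le) (intro spectral_radius_le power_bound_mult spectral_radius_good assms)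

lemma spectral_radius_add: assumes "x \<in> carrier R" "y \<in> carrier R" shows "spectral_radius (x \<oplus> y) \<le> spectral_radius x + spectral_radius y"
proof (rule field_le_epsilon)
  fix e :: real assume "e > 0"
  then have "spectral_radius (x \<oplus> y) \<le> (spectral_radius x + e/2) + (spectral_radius y + e/2)" by (intro spectral_radius_le power_bound_add spectral_radius_good assms) auto
  then show "spectral_radius (x \<oplus> y) \<le> spectral_radius x + spectral_radius y + e" by simp
qed

lemma spectral_radius_scalar_le: assumes "c \<in> K" shows "spectral_radius c \<le> n c"
proof (cases "c = \<zero>")
  case True
  \<comment> \<open>For the zero scalar the claimed bound 0 is no admissible value of
    \<open>a\<close>, so it is reached as a limit of positive ones. The set {1} serves the exponent
    0, where the power of zero is 1.\<close>
  have "power_bound \<zero> e" if e: "e > 0" for e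
  proof (rule power_boundI[OF e, of "{\<one>}" 1])
    show "comb_bound {\<one>} (1 * e ^ k) (\<zero> [^] k)" for k :: nat
    proof (cases k)
      case 0
      then show ?thesis using comb_bound_smult[of \<one> "{\<one>}" \<one>] K_one n_K(5) by simp
    next
      case (Suc k')
      then show ?thesis using comb_bound_weaken[OF comb_bound_zero[of "{\<one>}"], of "e ^ k"] e by (simp add: nat_pow_zero)
    qed
  qed auto
  then have "spectral_radius \<zero> \<le> 0 + e" if "e > 0" for e using spectral_radius_le[of \<zero> e] that by simp
  then have "spectral_radius \<zero> \<le> 0" by (rule field_le_epsilon)
  then show ?thesis by (simp add: True n_K(6))
next
  case False
  then show ?thesis using spectral_radius_le power_bound_scalar assms by blast
qed

lemma spectral_radius_one: "spectral_radius \<one> = 1"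
proof (rule antisym)
  show "spectral_radius \<one> \<le> 1" using spectral_radius_scalar_le[OF K_one] n_K(5) by simp
  show "1 \<le> spectral_radius \<one>"
    unfolding spectral_radius_def using power_bound_one_lower power_bound_exists[OF one_closed algebraic_over[OF one_closed]] by (intro cInf_greatest) auto
qed

lemma spectral_radius_pos: assumes "x \<in> carrier R" "x \<noteq> \<zero>" shows "0 < spectral_radius x"
proof -
  have U: "x \<in> Units R" using assms field_Units by simp
  have "1 \<le> spectral_radius x * spectral_radius (inv x)" using spectral_radius_mult[OF assms(1), of "inv x"] U spectral_radius_one by simp
  then have "spectral_radius x \<noteq> 0" by auto
  then show ?thesis using spectral_radius_nonneg[OF assms(1)] by simp
qed

lemma spectral_radius_zero: "spectral_radius \<zero> = 0"
  using spectral_radius_scalar_le[OF K_zero] n_K(6) spectral_radius_nonneg[of \<zero>] by simp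

lemma spectral_radius_smult: assumes c: "c \<in> K" and x: "x \<in> carrier R" shows "spectral_radius (c \<otimes> x) = n c * spectral_radius x"
proof (cases "c = \<zero>")
  case True then show ?thesis using x spectral_radius_zero n_K(6) by simp
next
  case False
  note cc = K_carrier[OF c] and ic = K_inv[OF c False]
  have U: "c \<in> Units R" using cc False field_Units by simp
  have npos: "n c > 0" using n_K(1,2)[OF c] False by simp
  show ?thesis
  proof (rule antisym)
    show "spectral_radius (c \<otimes> x) \<le> n c * spectral_radius x"
      using spectral_radius_mult[OF cc x] mult_right_mono[OF spectral_radius_scalar_le[OF c] spectral_radius_nonneg[OF x]] by linarith
    have "x = inv c \<otimes> (c \<otimes> x)" using U x cc K_carrier[OF ic] by (simp add: m_assoc[symmetric])
    then have "spectral_radius x \<le> spectral_radius (inv c) * spectral_radius (c \<otimes> x)"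
      using spectral_radius_mult[OF K_carrier[OF ic], of "c \<otimes> x"] cc x by simp
    also have "\<dots> \<le> n (inv c) * spectral_radius (c \<otimes> x)"
      using cc x by (intro mult_right_mono spectral_radius_scalar_le ic spectral_radius_nonneg) auto
    also have "\<dots> = spectral_radius (c \<otimes> x) / n c" using n_K_inv[OF c False] by (simp add: field_simps)
    finally show "n c * spectral_radius x \<le> spectral_radius (c \<otimes> x)" using npos by (simp add: field_simps)
  qed
qed

text \<open>One inequality is submultiplicativity. For the other, the j-th root of a bound slightly
  above the radius of x^j is a bound for x by \<open>power_bound_root\<close>.\<close>

lemma spectral_radius_pow: assumes x: "x \<in> carrier R" shows "spectral_radius (x [^] (j::nat)) = spectral_radius x ^ j"
proof (cases "j = 0")
  case False
  then have j: "j > 0" by simp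
  show ?thesis
  proof (rule antisym)
    show "spectral_radius (x [^] j) \<le> spectral_radius x ^ j"
    proof (induction j)
      case (Suc j)
      have "spectral_radius (x [^] Suc j) \<le> spectral_radius (x [^] j) * spectral_radius x" using spectral_radius_mult[of "x [^] j" x] x by simp
      also have "\<dots> \<le> spectral_radius x ^ j * spectral_radius x" using Suc spectral_radius_nonneg[OF x] by (intro mult_right_mono) auto
      finally show ?case by (simp add: mult.commute)
    qed (simp add: spectral_radius_one)
    have "spectral_radius x ^ j \<le> spectral_radius (x [^] j) + e" if e: "e > 0" for e
    proof -
      define b where "b = spectral_radius (x [^] j) + e"
      have b: "b > 0" using spectral_radius_nonneg[of "x [^] j"] x e by (simp add: b_def add_nonneg_pos)
      define a where "a = root j b"
      have a: "a > 0" "a ^ j = b" using b j by (auto simp: a_def)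
      have "power_bound (x [^] j) (a ^ j)" unfolding a(2) b_def using x e by (intro spectral_radius_good) auto
      then have "spectral_radius x \<le> a" using power_bound_root[OF x j _ a(1)] spectral_radius_le by blast
      then have "spectral_radius x ^ j \<le> a ^ j" using spectral_radius_nonneg[OF x] by (intro power_mono)
      then show ?thesis using a(2) b_def by simp
    qed
    then show "spectral_radius x ^ j \<le> spectral_radius (x [^] j)" by (rule field_le_epsilon)
  qed
qed (simp add: spectral_radius_one)

lemma spectral_radius_knorm: "knorm spectral_radius"
  unfolding knorm_def using spectral_radius_nonneg spectral_radius_add spectral_radius_smult by simp

text \<open>The seminorm \<open>q\<close> below is dominated by \<open>spectral_radius\<close>, hence equal to it by \<open>power_norm_le\<close>;
  but \<open>q (x \<otimes> y) = spectral_radius x * q y\<close>.\<close>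

lemma spectral_radius_mult_ge: assumes x: "x \<in> carrier R" "x \<noteq> \<zero>" and y: "y \<in> carrier R" shows "spectral_radius x * spectral_radius y \<le> spectral_radius (x \<otimes> y)"
proof -
  \<comment> \<open>The smoothing procedure for power-multiplicative norms: by submultiplicativity
    \<open>D z\<close> decreases in \<open>k\<close>, and in the limit multiplication by
    \<open>x\<close> becomes exactly multiplicative.\<close>
  define D where "D = (\<lambda>z k. spectral_radius (x [^] (k::nat) \<otimes> z) / spectral_radius x ^ k)"
  have px: "spectral_radius x > 0" using spectral_radius_pos[OF x] .
  have D0: "0 \<le> D z k" if "z \<in> carrier R" for z k
    unfolding D_def using spectral_radius_nonneg px x that by (intro divide_nonneg_pos) auto
  have dec: "decseq (D z)" if z: "z \<in> carrier R" for z
  proof (rule decseq_SucI)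
    fix k
    have "x [^] Suc k \<otimes> z = x \<otimes> (x [^] k \<otimes> z)" using x z by (simp add: m_assoc m_comm m_lcomm)
    then have "spectral_radius (x [^] Suc k \<otimes> z) \<le> spectral_radius x * spectral_radius (x [^] k \<otimes> z)" using spectral_radius_mult x z by simp
    then show "D z (Suc k) \<le> D z k" unfolding D_def using px by (simp add: field_simps)
  qed
  define q where "q = (\<lambda>z. lim (D z))"
  have q: "D z \<longlonglongrightarrow> q z" if z: "z \<in> carrier R" for z
    unfolding q_def using decseq_convergent[OF dec[OF z], of 0] D0[OF z] limI by metis
  have q_le: "q z \<le> D z k" if z: "z \<in> carrier R" for z k
    using decseq_ge[OF dec[OF z] q[OF z]] .
  have q0: "0 \<le> q z" if z: "z \<in> carrier R" for z
    by (rule LIMSEQ_le_const[OF q[OF z]]) (use D0[OF z] in auto)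
  have q_add: "q (y \<oplus> z) \<le> q y + q z" if y: "y \<in> carrier R" and z: "z \<in> carrier R" for y z
  proof (rule LIMSEQ_le[OF q tendsto_add[OF q[OF y] q[OF z]]])
    have "D (y \<oplus> z) k \<le> D y k + D z k" for k
    proof -
      have "x [^] k \<otimes> (y \<oplus> z) = x [^] k \<otimes> y \<oplus> x [^] k \<otimes> z" using x y z by (simp add: r_distr)
      then have "spectral_radius (x [^] k \<otimes> (y \<oplus> z)) \<le> spectral_radius (x [^] k \<otimes> y) + spectral_radius (x [^] k \<otimes> z)" using spectral_radius_add x y z by simp
      then show ?thesis unfolding D_def using px by (simp add: add_divide_distrib[symmetric] divide_right_mono)
    qed
    then show "\<exists>N. \<forall>k\<ge>N. D (y \<oplus> z) k \<le> D y k + D z k" by blast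
  qed (use y z in auto)
  have q_smult: "q (c \<otimes> z) = n c * q z" if c: "c \<in> K" and z: "z \<in> carrier R" for c z
  proof (rule LIMSEQ_unique[OF q])
    have "D (c \<otimes> z) k = n c * D z k" for k
    proof -
      have "x [^] k \<otimes> (c \<otimes> z) = c \<otimes> (x [^] k \<otimes> z)" using x z K_carrier[OF c] by (simp add: m_lcomm)
      then show ?thesis unfolding D_def using spectral_radius_smult[OF c] x z by simp
    qed
    then have "D (c \<otimes> z) = (\<lambda>k. n c * D z k)" by (rule ext)
    then show "D (c \<otimes> z) \<longlonglongrightarrow> n c * q z" using tendsto_mult_left[OF q[OF z], of "n c"] by simp
  qed (use z K_carrier[OF c] in auto)
  have q_one: "q \<one> = 1"
  proof (rule LIMSEQ_unique[OF q])
    have "D \<one> k = 1" for k unfolding D_def using x px spectral_radius_pow[OF x(1)] by simp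
    then have "D \<one> = (\<lambda>_. 1)" by blast
    then show "D \<one> \<longlonglongrightarrow> 1" by simp
  qed simp
  have q_mult: "q (y \<otimes> z) \<le> q y * q z" if y: "y \<in> carrier R" and z: "z \<in> carrier R" for y z
  proof (rule LIMSEQ_le[OF _ tendsto_mult[OF q[OF y] q[OF z]]])
    \<comment> \<open>Passing to even indices provides enough factors x for both arguments: x^(2k) y
      z is the product of x^k y and x^k z.\<close>
    have "strict_mono (\<lambda>k::nat. 2 * k)" by (simp add: strict_mono_def)
    from LIMSEQ_subseq_LIMSEQ[OF q[OF m_closed[OF y z]] this]
    show "(\<lambda>k. D (y \<otimes> z) (2 * k)) \<longlonglongrightarrow> q (y \<otimes> z)" by (simp add: o_def)
    have "D (y \<otimes> z) (2 * k) \<le> D y k * D z k" for k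
    proof -
      have "x [^] (2 * k) = x [^] k \<otimes> x [^] k" using x by (simp add: nat_pow_mult mult_2)
      then have "x [^] (2 * k) \<otimes> (y \<otimes> z) = (x [^] k \<otimes> y) \<otimes> (x [^] k \<otimes> z)"
        using x y z by (simp add: m_ac)
      then have "spectral_radius (x [^] (2 * k) \<otimes> (y \<otimes> z)) \<le> spectral_radius (x [^] k \<otimes> y) * spectral_radius (x [^] k \<otimes> z)" using spectral_radius_mult x y z by simp
      moreover have "spectral_radius x ^ (2 * k) = spectral_radius x ^ k * spectral_radius x ^ k" by (simp add: mult_2 power_add)
      ultimately show ?thesis unfolding D_def using px by (simp add: divide_right_mono)
    qed
    then show "\<exists>N. \<forall>k\<ge>N. D (y \<otimes> z) (2 * k) \<le> D y k * D z k" by blast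
  qed
  have qn: "knorm q" unfolding knorm_def using q0 q_add q_smult by simp
  \<comment> \<open>Since q is submultiplicative and q of 1 is 1, it cannot vanish at an invertible
    element.\<close>
  have qpos: "z = \<zero>" if z: "z \<in> carrier R" "q z = 0" for z
  proof (rule ccontr)
    assume "z \<noteq> \<zero>"
    then have U: "z \<in> Units R" using z field_Units by simp
    then show False using q_mult[OF z(1), of "inv z"] z(2) q_one by simp
  qed
  have qpow: "q (z [^] (k::nat)) \<le> q z ^ k" if z: "z \<in> carrier R" for z k
  proof (induction k)
    case (Suc k)
    have "q (z [^] Suc k) \<le> q (z [^] k) * q z" using q_mult[of "z [^] k" z] z by simp
    also have "\<dots> \<le> q z ^ k * q z" using Suc q0[OF z] by (intro mult_right_mono) auto
    finally show ?case by (simp add: mult.commute)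
  qed (simp add: q_one)
  have "spectral_radius y \<le> q y"
    by (rule power_norm_le[OF spectral_radius_knorm qn qpos y algebraic_over[OF y]]) (auto simp: spectral_radius_pow qpow y)
  also have "q y \<le> D y 1" by (rule q_le[OF y])
  also have "D y 1 = spectral_radius (x \<otimes> y) / spectral_radius x" using x by (simp add: D_def)
  finally show ?thesis using px by (simp add: field_simps)
qed

theorem abs_extend: "\<exists>m. is_abs R m \<and> (\<forall>k\<in>K. m k = n k)"
proof (intro exI conjI ballI)
  show "is_abs R spectral_radius" unfolding is_abs_def
  proof (intro conjI ballI)
    fix x y assume xy: "x \<in> carrier R" "y \<in> carrier R"
    show "spectral_radius (x \<otimes> y) = spectral_radius x * spectral_radius y"
      using spectral_radius_mult[OF xy] spectral_radius_mult_ge[OF xy(1) _ xy(2)] spectral_radius_zero xy by (cases "x = \<zero>") auto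
  next
    fix x assume x: "x \<in> carrier R"
    show "spectral_radius x = 0 \<longleftrightarrow> x = \<zero>"
    proof (cases "x = \<zero>")
      case False
      then show ?thesis using spectral_radius_pos[OF x False] by simp
    qed (simp add: spectral_radius_zero)
  qed (use spectral_radius_nonneg spectral_radius_add in auto)
  show "spectral_radius k = n k" if "k \<in> K" for k
    using spectral_radius_smult[OF that one_closed] spectral_radius_one K_carrier[OF that] by simp
qed

end

section \<open>Counting embeddings\<close>

text \<open>Lists start with the leading coefficient, so the head of \<open>c # p\<close> belongs to
  the exponent \<open>length p\<close>. The result is not normalized; its head vanishes when the
  degree is zero in the field.\<close>

fun pderiv_list :: "('a, 'b) ring_scheme \<Rightarrow> 'a list \<Rightarrow> 'a list" where
  "pderiv_list R [] = []"
| "pderiv_list R (c # p) = (if p = [] then [] else ([length p] \<cdot>\<^bsub>R\<^esub> c) # pderiv_list R p)"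

text \<open>Evaluation at \<open>(z, 1)\<close> in the ring of dual numbers yields value and derivative at once,
  so that the product rule comes from the multiplicativity of evaluation.\<close>

definition dual_ring :: "('a, 'b) ring_scheme \<Rightarrow> ('a \<times> 'a) ring" where
  "dual_ring R = \<lparr>carrier = carrier R \<times> carrier R,
     mult = (\<lambda>(a, b) (c, d). (a \<otimes>\<^bsub>R\<^esub> c, a \<otimes>\<^bsub>R\<^esub> d \<oplus>\<^bsub>R\<^esub> b \<otimes>\<^bsub>R\<^esub> c)), one = (\<one>\<^bsub>R\<^esub>, \<zero>\<^bsub>R\<^esub>),
     zero = (\<zero>\<^bsub>R\<^esub>, \<zero>\<^bsub>R\<^esub>), add = (\<lambda>(a, b) (c, d). (a \<oplus>\<^bsub>R\<^esub> c, b \<oplus>\<^bsub>R\<^esub> d))\<rparr>"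

context cring
begin

lemma dual_cring: "cring (dual_ring R)"
proof (rule cringI)
  show "abelian_group (dual_ring R)"
  proof (rule abelian_groupI)
    fix x assume x: "x \<in> carrier (dual_ring R)"
    then show "\<exists>y\<in>carrier (dual_ring R). y \<oplus>\<^bsub>dual_ring R\<^esub> x = \<zero>\<^bsub>dual_ring R\<^esub>"
      by (intro bexI[of _ "(\<ominus> fst x, \<ominus> snd x)"]) (auto simp: dual_ring_def l_neg)
  qed (auto simp: dual_ring_def a_ac)
  show "comm_monoid (dual_ring R)"
  proof (rule comm_monoidI)
    fix x y z assume "x \<in> carrier (dual_ring R)" "y \<in> carrier (dual_ring R)" "z \<in> carrier (dual_ring R)"
    then obtain a a' b b' c c' where *: "x = (a, a')" "y = (b, b')" "z = (c, c')"
      "a \<in> carrier R" "a' \<in> carrier R" "b \<in> carrier R" "b' \<in> carrier R" "c \<in> carrier R" "c' \<in> carrier R"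
      by (auto simp: dual_ring_def)
    have "a \<otimes> b \<otimes> c' \<oplus> (a \<otimes> b' \<oplus> a' \<otimes> b) \<otimes> c = a \<otimes> (b \<otimes> c' \<oplus> b' \<otimes> c) \<oplus> a' \<otimes> (b \<otimes> c)"
      using *(4-) by algebra
    then show "x \<otimes>\<^bsub>dual_ring R\<^esub> y \<otimes>\<^bsub>dual_ring R\<^esub> z = x \<otimes>\<^bsub>dual_ring R\<^esub> (y \<otimes>\<^bsub>dual_ring R\<^esub> z)"
      using * by (simp add: dual_ring_def m_assoc)
    have "a \<otimes> b' \<oplus> a' \<otimes> b = b \<otimes> a' \<oplus> b' \<otimes> a" using *(4-) by algebra
    then show "x \<otimes>\<^bsub>dual_ring R\<^esub> y = y \<otimes>\<^bsub>dual_ring R\<^esub> x"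
      using * by (simp add: dual_ring_def m_comm)
  qed (auto simp: dual_ring_def)
  fix x y z assume "x \<in> carrier (dual_ring R)" "y \<in> carrier (dual_ring R)" "z \<in> carrier (dual_ring R)"
  then obtain a a' b b' c c' where *: "x = (a, a')" "y = (b, b')" "z = (c, c')"
      "a \<in> carrier R" "a' \<in> carrier R" "b \<in> carrier R" "b' \<in> carrier R" "c \<in> carrier R" "c' \<in> carrier R"
      by (auto simp: dual_ring_def)
  have "(a \<oplus> b) \<otimes> c = a \<otimes> c \<oplus> b \<otimes> c" "(a \<oplus> b) \<otimes> c' \<oplus> (a' \<oplus> b') \<otimes> c = (a \<otimes> c' \<oplus> a' \<otimes> c) \<oplus> (b \<otimes> c' \<oplus> b' \<otimes> c)"
    using *(4-) by algebra+
  then show "(x \<oplus>\<^bsub>dual_ring R\<^esub> y) \<otimes>\<^bsub>dual_ring R\<^esub> z = x \<otimes>\<^bsub>dual_ring R\<^esub> z \<oplus>\<^bsub>dual_ring R\<^esub> y \<otimes>\<^bsub>dual_ring R\<^esub> z"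
    using * by (simp add: dual_ring_def)
qed

lemma dual_emb_hom: "ring_hom_ring R (dual_ring R) (\<lambda>c. (c, \<zero>))"
proof -
  interpret D: cring "dual_ring R" by (rule dual_cring)
  show ?thesis
    by (intro ring_hom_ringI2 ring_axioms D.ring_axioms ring_hom_memI) (auto simp: dual_ring_def)
qed

lemma dual_pow: assumes "z \<in> carrier R"
  shows "(z, \<one>) [^]\<^bsub>dual_ring R\<^esub> (Suc k) = (z [^] Suc k, [Suc k] \<cdot> (z [^] k))"
proof -
  interpret D: cring "dual_ring R" by (rule dual_cring)
  show ?thesis
  proof (induction k)
    case 0
    have "(z, \<one>) \<in> carrier (dual_ring R)" using assms by (simp add: dual_ring_def)
    then have "(z, \<one>) [^]\<^bsub>dual_ring R\<^esub> Suc 0 = (z, \<one>)" by (subst D.nat_pow_Suc) simp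
    then show ?case using assms by (simp add: add_pow_def)
  next
    case (Suc k)
    have "z [^] Suc k \<oplus> ([Suc k] \<cdot> (z [^] k)) \<otimes> z = [Suc (Suc k)] \<cdot> (z [^] Suc k)"
      using assms by (simp add: add_pow_ldistr a_comm l_distr)
    moreover have "(z, \<one>) [^]\<^bsub>dual_ring R\<^esub> Suc (Suc k) = (z, \<one>) [^]\<^bsub>dual_ring R\<^esub> Suc k \<otimes>\<^bsub>dual_ring R\<^esub> (z, \<one>)"
      by (subst D.nat_pow_Suc) simp
    ultimately show ?case unfolding Suc.IH using assms by (simp add: dual_ring_def del: nat_pow_Suc)
  qed
qed

lemma pderiv_list_carrier: "set p \<subseteq> carrier R \<Longrightarrow> set (pderiv_list R p) \<subseteq> carrier R"
  by (induction p) auto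

lemma length_pderiv_list: "length (pderiv_list R p) = length p - 1"
  by (induction p) (auto simp: Suc_diff_Suc)

lemma dual_eval: assumes "z \<in> carrier R" "set p \<subseteq> carrier R"
  shows "ring.eval (dual_ring R) (map (\<lambda>c. (c, \<zero>)) p) (z, \<one>) = (eval p z, eval (pderiv_list R p) z)"
proof -
  interpret D: cring "dual_ring R" by (rule dual_cring)
  show ?thesis using assms(2)
  proof (induction p)
    case Nil
    show ?case unfolding list.map D.eval.simps by (simp add: dual_ring_def)
  next
    case (Cons c p)
    then have c: "c \<in> carrier R" "set p \<subseteq> carrier R" by auto
    have IH: "D.eval (map (\<lambda>c. (c, \<zero>)) p) (z, \<one>) = (eval p z, eval (pderiv_list R p) z)" using Cons.IH c by simp
    have ec: "eval p z \<in> carrier R" "eval (pderiv_list R p) z \<in> carrier R"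
      using eval_in_carrier c assms(1) pderiv_list_carrier by auto
    show ?case
    proof (cases "length p")
      case 0
      have "(c, \<zero>) \<in> carrier (dual_ring R)" using c by (simp add: dual_ring_def)
      then have "D.eval [(c, \<zero>)] (z, \<one>) = (c, \<zero>)" by simp
      then show ?thesis using 0 c by simp
    next
      case (Suc k)
      have pw: "(z, \<one>) [^]\<^bsub>dual_ring R\<^esub> length p = (z [^] Suc k, [Suc k] \<cdot> (z [^] k))"
        unfolding Suc by (rule dual_pow[OF assms(1)])
      have "p \<noteq> []" using Suc by auto
      then have "D.eval (map (\<lambda>c. (c, \<zero>)) (c # p)) (z, \<one>)
          = (c, \<zero>) \<otimes>\<^bsub>dual_ring R\<^esub> (z [^] Suc k, [Suc k] \<cdot> (z [^] k)) \<oplus>\<^bsub>dual_ring R\<^esub> (eval p z, eval (pderiv_list R p) z)"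
        using IH pw by simp
      also have "\<dots> = (c \<otimes> z [^] Suc k \<oplus> eval p z, c \<otimes> ([Suc k] \<cdot> (z [^] k)) \<oplus> eval (pderiv_list R p) z)"
        using c assms(1) ec by (simp add: dual_ring_def)
      also have "c \<otimes> ([Suc k] \<cdot> (z [^] k)) = ([length p] \<cdot> c) \<otimes> z [^] k"
        using c assms(1) unfolding Suc by (simp add: add_pow_ldistr add_pow_rdistr del: add.nat_pow_Suc)
      finally show ?thesis using \<open>p \<noteq> []\<close> Suc by (simp add: length_pderiv_list)
    qed
  qed
qed

text \<open>The linear factor takes the value (0, 1) at the dual number (z, 1). This element has
  square zero, so the product has value zero, and the derivative is its second component.\<close>

lemma eval_pderiv_double_root:
  assumes z: "z \<in> carrier R" and q: "set q \<subseteq> carrier R"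
  shows "eval (pderiv_list R (poly_mult (poly_mult [\<one>, \<ominus> z] [\<one>, \<ominus> z]) q)) z = \<zero>"
proof -
  interpret D: cring "dual_ring R" by (rule dual_cring)
  let ?e = "map (\<lambda>c. (c, \<zero>)) :: 'a list \<Rightarrow> _" and ?l = "[\<one>, \<ominus> z]" and ?w = "(z, \<one>)"
  have w: "?w \<in> carrier (dual_ring R)" using z by (simp add: dual_ring_def)
  have lc: "set ?l \<subseteq> carrier R" using z by simp
  have lc': "set (?e ?l) \<subseteq> carrier (dual_ring R)" using z by (auto simp: dual_ring_def)
  have ec: "set (?e p) \<subseteq> carrier (dual_ring R)" if "set p \<subseteq> carrier R" for p
    using that by (auto simp: dual_ring_def)
  have m: "D.eval (?e (poly_mult p r)) ?w = D.eval (?e p) ?w \<otimes>\<^bsub>dual_ring R\<^esub> D.eval (?e r) ?w"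
    if "set p \<subseteq> carrier R" "set r \<subseteq> carrier R" for p r
  proof -
    have "D.eval (?e (poly_mult p r)) ?w = D.eval (D.normalize (?e (poly_mult p r))) ?w"
      using D.eval_normalize[OF ec[OF poly_mult_in_carrier[OF that]] w] by simp
    also have "\<dots> = D.eval (D.poly_mult (?e p) (?e r)) ?w" using ring_hom_ring.poly_mult_hom'[OF dual_emb_hom that] by simp
    also have "\<dots> = D.eval (?e p) ?w \<otimes>\<^bsub>dual_ring R\<^esub> D.eval (?e r) ?w"
      using D.eval_poly_mult[OF ec[OF that(1)] ec[OF that(2)] w] .
    finally show ?thesis .
  qed
  have l: "D.eval (?e ?l) ?w = (\<zero>, \<one>)"
    unfolding dual_eval[OF z lc] using z by (simp add: r_neg add_pow_def)
  have ll: "set (poly_mult ?l ?l) \<subseteq> carrier R" using poly_mult_in_carrier[OF lc lc] .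
  have qe: "D.eval (?e q) ?w \<in> carrier (dual_ring R)" using D.eval_in_carrier[OF ec[OF q] w] .
  have "D.eval (?e (poly_mult (poly_mult ?l ?l) q)) ?w = ((\<zero>, \<one>) \<otimes>\<^bsub>dual_ring R\<^esub> (\<zero>, \<one>)) \<otimes>\<^bsub>dual_ring R\<^esub> D.eval (?e q) ?w"
    unfolding m[OF ll q] m[OF lc lc] l ..
  also have "(\<zero>, \<one>) \<otimes>\<^bsub>dual_ring R\<^esub> (\<zero>, \<one>) = \<zero>\<^bsub>dual_ring R\<^esub>" by (simp add: dual_ring_def)
  also have "\<zero>\<^bsub>dual_ring R\<^esub> \<otimes>\<^bsub>dual_ring R\<^esub> D.eval (?e q) ?w = \<zero>\<^bsub>dual_ring R\<^esub>" using qe by simp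
  finally have "D.eval (?e (poly_mult (poly_mult ?l ?l) q)) ?w = (\<zero>, \<zero>)" by (simp add: dual_ring_def)
  then show ?thesis using dual_eval[OF z poly_mult_in_carrier[OF ll q]] by simp
qed

end

lemma (in ring_hom_ring) pderiv_list_hom:
  "set p \<subseteq> carrier R \<Longrightarrow> map h (pderiv_list R p) = pderiv_list S (map h p)"
proof (induction p)
  case (Cons c p)
  have "h ([k] \<cdot> c) = [k] \<cdot>\<^bsub>S\<^esub> h c" if "c \<in> carrier R" for k :: nat
    using that by (induction k) auto
  with Cons show ?case by simp
qed simp

text \<open>A root of multiplicity at least 2 would also be a root of the derivative. So the
  multiset of roots, whose size is the degree because the polynomial splits, is a set.\<close>

lemma (in field) simple_roots_card:
  assumes p: "p \<in> carrier (poly_ring R)" "p \<noteq> []" and s: "splitted p"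
    and d: "\<And>z. z \<in> carrier R \<Longrightarrow> eval p z = \<zero> \<Longrightarrow> eval (pderiv_list R p) z \<noteq> \<zero>"
  shows "card {z \<in> carrier R. eval p z = \<zero>} = Polynomials.degree p"
proof -
  interpret UP: domain "poly_ring R" using univ_poly_is_domain[OF carrier_is_subring] .
  have "count (roots p) z \<le> 1" for z
  proof (cases "z \<in># roots p")
    case True
    then have z: "z \<in> carrier R" "eval p z = \<zero>" using roots_mem_iff_is_root[OF p(1)] by (auto simp: is_root_def)
    show ?thesis
    proof (rule ccontr)
      assume "\<not> count (roots p) z \<le> 1"
      then have "2 \<le> alg_mult p z" using alg_mult_eq_count_roots[OF p(1)] by simp
      then have dv: "[\<one>, \<ominus> z] [^]\<^bsub>poly_ring R\<^esub> (2::nat) pdivides p" using le_alg_mult_imp_pdivides[OF z(1) p(1)] by blast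
      have lin: "[\<one>, \<ominus> z] \<in> carrier (poly_ring R)"
        using z(1) by (auto simp: univ_poly_carrier[symmetric] polynomial_def)
      have "[\<one>, \<ominus> z] [^]\<^bsub>poly_ring R\<^esub> (2::nat) = [\<one>, \<ominus> z] \<otimes>\<^bsub>poly_ring R\<^esub> [\<one>, \<ominus> z]"
        using lin by (simp add: numeral_2_eq_2)
      also have "\<dots> = poly_mult [\<one>, \<ominus> z] [\<one>, \<ominus> z]" unfolding univ_poly_mult ..
      finally obtain q where q: "q \<in> carrier (poly_ring R)" "p = poly_mult (poly_mult [\<one>, \<ominus> z] [\<one>, \<ominus> z]) q"
        using dv unfolding pdivides_def factor_def by (auto simp: univ_poly_mult simp del: poly_mult.simps)
      have "set q \<subseteq> carrier R" using q(1) by (auto simp: univ_poly_carrier[symmetric] polynomial_def)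
      from eval_pderiv_double_root[OF z(1) this] show False using d[OF z] q(2) by simp
    qed
  next
    case False
    then show ?thesis by (simp add: not_in_iff)
  qed
  then have "\<forall>z\<in>#roots p. count (roots p) z = 1"
    by (metis One_nat_def Suc_leI count_greater_zero_iff le_antisym)
  then have "size (roots p) = card (set_mset (roots p))" by (simp add: size_multiset_overloaded_eq)
  moreover have "set_mset (roots p) = {z \<in> carrier R. eval p z = \<zero>}"
    using roots_mem_iff_is_root[OF p(1)] p(2) by (auto simp: is_root_def)
  ultimately show ?thesis using s by (simp add: splitted_def)
qed

lemma (in field) dimension_intermediate:
  assumes F: "subfield F R" and F': "subfield F' R" and E: "subfield E R" and sub: "F \<subseteq> F'" "F' \<subseteq> E" and dim: "dimension d F E"
  shows "\<exists>m. dimension m F' E"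
proof -
  obtain Us where Us: "set Us \<subseteq> carrier R" "Span F Us = E" using exists_base[OF F dim] by blast
  have "Span F' Us = E"
  proof
    have "Span F Us \<subseteq> Span F' Us"
      unfolding Span_eq_combine_set[OF F Us(1)] Span_eq_combine_set[OF F' Us(1)] using sub by auto
    then show "E \<subseteq> Span F' Us" using Us by simp
    have "set Us \<subseteq> E" using Span_base_incl[OF F Us(1)] Us(2) by simp
    have "combine Ks Us \<in> E" if "set Ks \<subseteq> F'" for Ks
      using that \<open>set Us \<subseteq> E\<close>
    proof (induction Ks Us rule: combine.induct)
      case (1 k Ks u Us)
      then show ?case using sub subringE(6,7)[OF subfieldE(1)[OF E]] by auto
    qed (auto simp: subringE(2)[OF subfieldE(1)[OF E]])
    then show "Span F' Us \<subseteq> E" unfolding Span_eq_combine_set[OF F' Us(1)] by blast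
  qed
  then show ?thesis using Span_finite_dimension[OF F' Us(1)] unfolding finite_dimension_def by auto
qed

text \<open>Characteristic zero makes minimal polynomials separable, and the algebraically closed
  target contains all their roots; together they make extensions of homomorphisms countable by
  degrees.\<close>

locale field_homs = R: field R + S: algebraically_closed S for R (structure) and S (structure) +
  assumes char0: "\<And>k::nat. k > 0 \<Longrightarrow> [k] \<cdot>\<^bsub>R\<^esub> \<one>\<^bsub>R\<^esub> \<noteq> \<zero>\<^bsub>R\<^esub>"
begin

text \<open>Extensionality identifies a homomorphism on \<open>E\<close> with a single function,
  without which cardinalities would be meaningless.\<close>

definition Ext :: "'a set \<Rightarrow> 'a set \<Rightarrow> ('a \<Rightarrow> 'c) \<Rightarrow> ('a \<Rightarrow> 'c) set" where
  "Ext F E \<tau> = {\<rho> \<in> ring_hom (R\<lparr>carrier := E\<rparr>) S. \<rho> \<in> extensional E \<and> (\<forall>k\<in>F. \<rho> k = \<tau> k)}"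

context
  fixes F :: "'a set" and \<tau> :: "'a \<Rightarrow> 'c" and x :: 'a
  assumes F: "subfield F R" and \<tau>: "\<tau> \<in> ring_hom (R\<lparr>carrier := F\<rparr>) S"
    and x: "x \<in> carrier R" "(R.algebraic over F) x"
begin

interpretation FF: field "R\<lparr>carrier := F\<rparr>" using R.subfield_iff(2)[OF F] .

interpretation t: ring_hom_ring "R\<lparr>carrier := F\<rparr>" S \<tau>
  by (intro ring_hom_ringI2 FF.ring_axioms S.ring_axioms \<tau>)

lemma F_poly_set: "p \<in> carrier (univ_poly R F) \<Longrightarrow> set p \<subseteq> F"
  by (auto simp: univ_poly_carrier[symmetric] polynomial_def)

lemma F_sub: "F \<subseteq> carrier R" and F_subring: "subring F R"
  using subfieldE(1,3)[OF F] by auto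

lemma FX_eq: "poly_ring (R\<lparr>carrier := F\<rparr>) = univ_poly R F"
  using R.univ_poly_consistent[OF F_subring] by simp

lemma map_tau_set: "set p \<subseteq> F \<Longrightarrow> set (map \<tau> p) \<subseteq> carrier S"
  using t.hom_closed by auto

lemma poly_mult_F: "set p \<subseteq> F \<Longrightarrow> set q \<subseteq> F \<Longrightarrow>
    S.eval (map \<tau> (R.poly_mult p q)) z = S.eval (map \<tau> p) z \<otimes>\<^bsub>S\<^esub> S.eval (map \<tau> q) z" if z: "z \<in> carrier S" for z
proof -
  assume pq: "set p \<subseteq> F" "set q \<subseteq> F"
  have e: "FF.poly_mult p q = R.poly_mult p q" using R.poly_mult_consistent[OF F_subring] by simp
  have c: "set (R.poly_mult p q) \<subseteq> F" using FF.poly_mult_in_carrier[of p q] pq e by simp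
  have "S.eval (map \<tau> (R.poly_mult p q)) z = S.eval (S.normalize (map \<tau> (FF.poly_mult p q))) z"
    using S.eval_normalize[OF map_tau_set[OF c] z] e by simp
  also have "\<dots> = S.eval (S.poly_mult (map \<tau> p) (map \<tau> q)) z" using t.poly_mult_hom'[of p q] pq by simp
  also have "\<dots> = S.eval (map \<tau> p) z \<otimes>\<^bsub>S\<^esub> S.eval (map \<tau> q) z"
    by (rule S.eval_poly_mult[OF map_tau_set[OF pq(1)] map_tau_set[OF pq(2)] z])
  finally show ?thesis .
qed

lemma poly_add_F: "set p \<subseteq> F \<Longrightarrow> set q \<subseteq> F \<Longrightarrow>
    S.eval (map \<tau> (R.poly_add p q)) z = S.eval (map \<tau> p) z \<oplus>\<^bsub>S\<^esub> S.eval (map \<tau> q) z" if z: "z \<in> carrier S" for z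
proof -
  assume pq: "set p \<subseteq> F" "set q \<subseteq> F"
  have e: "FF.poly_add p q = R.poly_add p q" using R.poly_add_consistent[OF F_subring] by simp
  have c: "set (R.poly_add p q) \<subseteq> F" using FF.poly_add_in_carrier[of p q] pq e by simp
  have "S.eval (map \<tau> (R.poly_add p q)) z = S.eval (S.normalize (map \<tau> (FF.poly_add p q))) z"
    using S.eval_normalize[OF map_tau_set[OF c] z] e by simp
  also have "\<dots> = S.eval (S.poly_add (map \<tau> p) (map \<tau> q)) z" using t.poly_add_hom'[of p q] pq by simp
  also have "\<dots> = S.eval (map \<tau> p) z \<oplus>\<^bsub>S\<^esub> S.eval (map \<tau> q) z"
    by (rule S.eval_poly_add[OF map_tau_set[OF pq(1)] map_tau_set[OF pq(2)] z])
  finally show ?thesis .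
qed

lemma eval_map_hom: assumes z: "z \<in> carrier S" shows "ring_hom_ring (univ_poly R F) S (\<lambda>p. S.eval (map \<tau> p) z)"
proof (intro ring_hom_ringI2 S.ring_axioms ring_hom_memI)
  show "ring (univ_poly R F)" using R.univ_poly_is_ring[OF F_subring] .
  show "S.eval (map \<tau> p) z \<in> carrier S" if "p \<in> carrier (univ_poly R F)" for p
    using S.eval_in_carrier[OF map_tau_set[OF F_poly_set[OF that]] z] .
  show "S.eval (map \<tau> (p \<otimes>\<^bsub>univ_poly R F\<^esub> q)) z = S.eval (map \<tau> p) z \<otimes>\<^bsub>S\<^esub> S.eval (map \<tau> q) z"
    if "p \<in> carrier (univ_poly R F)" "q \<in> carrier (univ_poly R F)" for p q
    using poly_mult_F[OF z F_poly_set[OF that(1)] F_poly_set[OF that(2)]] by (simp add: univ_poly_mult del: R.poly_mult.simps)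
  show "S.eval (map \<tau> (p \<oplus>\<^bsub>univ_poly R F\<^esub> q)) z = S.eval (map \<tau> p) z \<oplus>\<^bsub>S\<^esub> S.eval (map \<tau> q) z"
    if "p \<in> carrier (univ_poly R F)" "q \<in> carrier (univ_poly R F)" for p q
    using poly_add_F[OF z F_poly_set[OF that(1)] F_poly_set[OF that(2)]] by (simp add: univ_poly_add del: R.poly_add.simps)
  show "S.eval (map \<tau> \<one>\<^bsub>univ_poly R F\<^esub>) z = \<one>\<^bsub>S\<^esub>"
    using t.hom_one z by (simp add: univ_poly_one)
qed

text \<open>A polynomial vanishing at \<open>x\<close> is a multiple of the minimal polynomial,
  whose image under \<tau> vanishes at \<open>z\<close>.\<close>

lemma eval_map_kernel:
  assumes z: "z \<in> carrier S" "S.eval (map \<tau> (R.Irr F x)) z = \<zero>\<^bsub>S\<^esub>"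
    and p: "p \<in> carrier (univ_poly R F)" "R.eval p x = \<zero>\<^bsub>R\<^esub>"
  shows "S.eval (map \<tau> p) z = \<zero>\<^bsub>S\<^esub>"
proof -
  note Irr = R.IrrE[OF F x]
  have "R.Irr F x divides\<^bsub>univ_poly R F\<^esub> p"
    using R.Irr_minimal[OF F x p] R.pdivides_iff_shell[OF F Irr(1) p(1)] by simp
  then obtain q where q: "q \<in> carrier (univ_poly R F)" "p = R.Irr F x \<otimes>\<^bsub>univ_poly R F\<^esub> q" unfolding factor_def by blast
  interpret h: ring_hom_ring "univ_poly R F" S "\<lambda>p. S.eval (map \<tau> p) z" by (rule eval_map_hom[OF z(1)])
  show ?thesis unfolding q(2) using h.hom_mult[OF Irr(1) q(1)] h.hom_closed[OF q(1)] z(2) by simp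
qed

text \<open>Every element of F(x) is p(x) for some p over \<open>F\<close>, and it is sent to the
  value at \<open>z\<close> of p with coefficients mapped by \<tau>. By
  \<open>eval_map_kernel\<close> the choice of p is immaterial.\<close>

lemma hom_lift:
  assumes z: "z \<in> carrier S" "S.eval (map \<tau> (R.Irr F x)) z = \<zero>\<^bsub>S\<^esub>"
  shows "\<exists>\<rho>\<in>Ext F (R.simple_extension F x) \<tau>. \<rho> x = z"
proof -
  let ?E = "R.simple_extension F x" and ?P = "univ_poly R F"
  let ?\<phi> = "\<lambda>p. S.eval (map \<tau> p) z"
  interpret h: ring_hom_ring ?P S ?\<phi> by (rule eval_map_hom[OF z(1)])
  interpret ev: ring_hom_ring ?P R "\<lambda>p. R.eval p x" by (rule R.eval_ring_hom[OF F_subring x(1)])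
  have E: "?E = (\<lambda>p. R.eval p x) ` carrier ?P" by (rule R.simple_extension_as_eval_img[OF F_sub x(1)])
  have wd: "?\<phi> p = ?\<phi> q" if p: "p \<in> carrier ?P" and q: "q \<in> carrier ?P" and e: "R.eval p x = R.eval q x" for p q
  proof -
    have mc: "p \<ominus>\<^bsub>?P\<^esub> q \<in> carrier ?P" using p q by (rule h.R.minus_closed)
    have "R.eval (p \<ominus>\<^bsub>?P\<^esub> q) x = R.eval p x \<ominus>\<^bsub>R\<^esub> R.eval q x"
      using p q by (simp add: a_minus_def)
    also have "\<dots> = \<zero>\<^bsub>R\<^esub>" using e ev.hom_closed[OF q] by (simp add: R.r_right_minus_eq)
    finally have "?\<phi> (p \<ominus>\<^bsub>?P\<^esub> q) = \<zero>\<^bsub>S\<^esub>" using eval_map_kernel[OF z mc] by simp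
    then have "?\<phi> p \<ominus>\<^bsub>S\<^esub> ?\<phi> q = \<zero>\<^bsub>S\<^esub>" using p q by (simp add: a_minus_def)
    then show ?thesis using S.r_right_minus_eq[OF h.hom_closed[OF p] h.hom_closed[OF q]] by simp
  qed
  define \<rho> where "\<rho> = (\<lambda>y\<in>?E. ?\<phi> (SOME p. p \<in> carrier ?P \<and> R.eval p x = y))"
  have \<rho>: "\<rho> (R.eval p x) = ?\<phi> p" if p: "p \<in> carrier ?P" for p
  proof -
    have mem: "R.eval p x \<in> ?E" using p E by blast
    let ?q = "SOME q. q \<in> carrier ?P \<and> R.eval q x = R.eval p x"
    have "?q \<in> carrier ?P \<and> R.eval ?q x = R.eval p x" by (rule someI[of _ p]) (simp add: p)
    then have "?\<phi> ?q = ?\<phi> p" using wd[of ?q p] p by blast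
    then show ?thesis using mem by (simp add: \<rho>_def)
  qed
  have "\<rho> \<in> ring_hom (R\<lparr>carrier := ?E\<rparr>) S"
  proof (rule ring_hom_memI)
    fix a assume "a \<in> carrier (R\<lparr>carrier := ?E\<rparr>)"
    then obtain p where p: "p \<in> carrier ?P" "a = R.eval p x" using E by auto
    then show "\<rho> a \<in> carrier S" using \<rho> h.hom_closed by simp
  next
    fix a b assume "a \<in> carrier (R\<lparr>carrier := ?E\<rparr>)" "b \<in> carrier (R\<lparr>carrier := ?E\<rparr>)"
    then obtain p q where pq: "p \<in> carrier ?P" "a = R.eval p x" "q \<in> carrier ?P" "b = R.eval q x" using E by auto
    have "a \<otimes>\<^bsub>R\<^esub> b = R.eval (p \<otimes>\<^bsub>?P\<^esub> q) x" "a \<oplus>\<^bsub>R\<^esub> b = R.eval (p \<oplus>\<^bsub>?P\<^esub> q) x" using pq by auto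
    moreover have "\<rho> (R.eval (p \<otimes>\<^bsub>?P\<^esub> q) x) = \<rho> a \<otimes>\<^bsub>S\<^esub> \<rho> b"
      using \<rho>[OF h.R.m_closed[OF pq(1,3)]] \<rho>[OF pq(1)] \<rho>[OF pq(3)] pq(2,4) h.hom_mult[OF pq(1,3)] by simp
    moreover have "\<rho> (R.eval (p \<oplus>\<^bsub>?P\<^esub> q) x) = \<rho> a \<oplus>\<^bsub>S\<^esub> \<rho> b"
      using \<rho>[OF h.R.a_closed[OF pq(1,3)]] \<rho>[OF pq(1)] \<rho>[OF pq(3)] pq(2,4) h.hom_add[OF pq(1,3)] by simp
    ultimately show "\<rho> (a \<otimes>\<^bsub>R\<lparr>carrier := ?E\<rparr>\<^esub> b) = \<rho> a \<otimes>\<^bsub>S\<^esub> \<rho> b" "\<rho> (a \<oplus>\<^bsub>R\<lparr>carrier := ?E\<rparr>\<^esub> b) = \<rho> a \<oplus>\<^bsub>S\<^esub> \<rho> b"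
      by simp_all
  next
    have "\<one>\<^bsub>R\<^esub> = R.eval \<one>\<^bsub>?P\<^esub> x" using ev.hom_one by simp
    then show "\<rho> \<one>\<^bsub>R\<lparr>carrier := ?E\<rparr>\<^esub> = \<one>\<^bsub>S\<^esub>" using \<rho>[OF h.R.one_closed] h.hom_one by simp
  qed
  moreover have "\<rho> \<in> extensional ?E" by (simp add: \<rho>_def)
  moreover have "\<rho> k = \<tau> k" if k: "k \<in> F" for k
  \<comment> \<open>Polynomials are normalized lists: the zero constant is the empty list, and a
    singleton list is a polynomial only for a nonzero entry.\<close>
  proof (cases "k = \<zero>\<^bsub>R\<^esub>")
    case True
    have "\<rho> (R.eval [] x) = ?\<phi> []" by (rule \<rho>) (rule univ_poly_zero_closed)
    then show ?thesis using True t.hom_zero by simp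
  next
    case False
    have kc: "k \<in> carrier R" using k F_sub by blast
    have "[k] \<in> carrier ?P" using k False by (auto simp: univ_poly_carrier[symmetric] polynomial_def)
    from \<rho>[OF this] show ?thesis using kc t.hom_closed[of k] k z by simp
  qed
  moreover have "\<rho> x = z"
  proof -
    have "var R \<in> carrier ?P" using R.var_closed(1)[OF F_subring] .
    from \<rho>[OF this] show ?thesis using R.eval_var[OF x(1)] t.hom_zero t.hom_one z(1) by (simp add: var_def)
  qed
  ultimately show ?thesis unfolding Ext_def by blast
qed

lemma Ext_eval: assumes \<rho>: "\<rho> \<in> Ext F (R.simple_extension F x) \<tau>" and p: "p \<in> carrier (univ_poly R F)"
  shows "\<rho> (R.eval p x) = S.eval (map \<tau> p) (\<rho> x)"
proof -
  let ?E = "R.simple_extension F x"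
  have sr: "subring ?E R" using R.simple_extension_is_subring[OF F_subring x(1)] .
  interpret E: ring "R\<lparr>carrier := ?E\<rparr>" using R.subring_is_ring[OF sr] .
  interpret r: ring_hom_ring "R\<lparr>carrier := ?E\<rparr>" S \<rho>
    using \<rho> by (intro ring_hom_ringI2 E.ring_axioms S.ring_axioms) (simp add: Ext_def)
  have FE: "F \<subseteq> ?E" using R.simple_extension_incl[OF F_sub x(1)] .
  have "set p \<subseteq> F" using F_poly_set[OF p] .
  then have "set p \<subseteq> carrier (R\<lparr>carrier := ?E\<rparr>)" using FE by simp
  moreover have "x \<in> carrier (R\<lparr>carrier := ?E\<rparr>)" using R.simple_extension_mem[OF F_subring x(1)] by simp
  ultimately have "\<rho> (E.eval p x) = S.eval (map \<rho> p) (\<rho> x)" using r.eval_hom' by blast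
  moreover have "map \<rho> p = map \<tau> p" using \<rho> F_poly_set[OF p] by (auto simp: Ext_def)
  ultimately show ?thesis using R.eval_consistent[OF sr] by simp
qed

lemma Ext_x: assumes \<rho>: "\<rho> \<in> Ext F (R.simple_extension F x) \<tau>"
  shows "\<rho> x \<in> carrier S" "S.eval (map \<tau> (R.Irr F x)) (\<rho> x) = \<zero>\<^bsub>S\<^esub>"
proof -
  let ?E = "R.simple_extension F x"
  have sr: "subring ?E R" using R.simple_extension_is_subring[OF F_subring x(1)] .
  interpret E: ring "R\<lparr>carrier := ?E\<rparr>" using R.subring_is_ring[OF sr] .
  interpret r: ring_hom_ring "R\<lparr>carrier := ?E\<rparr>" S \<rho>
    using \<rho> by (intro ring_hom_ringI2 E.ring_axioms S.ring_axioms) (simp add: Ext_def)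
  show "\<rho> x \<in> carrier S" using r.hom_closed[of x] R.simple_extension_mem[OF F_subring x(1)] by simp
  show "S.eval (map \<tau> (R.Irr F x)) (\<rho> x) = \<zero>\<^bsub>S\<^esub>"
    using Ext_eval[OF \<rho> R.IrrE(1)[OF F x]] R.IrrE(4)[OF F x] r.hom_zero by simp
qed

lemma Ext_bij: "bij_betw (\<lambda>\<rho>. \<rho> x) (Ext F (R.simple_extension F x) \<tau>)
    {z \<in> carrier S. S.eval (map \<tau> (R.Irr F x)) z = \<zero>\<^bsub>S\<^esub>}"
proof (rule bij_betw_imageI)
  show "inj_on (\<lambda>\<rho>. \<rho> x) (Ext F (R.simple_extension F x) \<tau>)"
  proof (rule inj_onI)
    fix \<rho> \<sigma> assume r: "\<rho> \<in> Ext F (R.simple_extension F x) \<tau>" and s: "\<sigma> \<in> Ext F (R.simple_extension F x) \<tau>" and e: "\<rho> x = \<sigma> x"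
    show "\<rho> = \<sigma>"
    proof (rule extensionalityI[of _ "R.simple_extension F x"])
      fix y assume "y \<in> R.simple_extension F x"
      then obtain p where "p \<in> carrier (univ_poly R F)" "y = R.eval p x"
        using R.simple_extension_as_eval_img[OF F_sub x(1)] by auto
      then show "\<rho> y = \<sigma> y" using Ext_eval[OF r] Ext_eval[OF s] e by simp
    qed (use r s in \<open>auto simp: Ext_def\<close>)
  qed
  show "(\<lambda>\<rho>. \<rho> x) ` Ext F (R.simple_extension F x) \<tau> = {z \<in> carrier S. S.eval (map \<tau> (R.Irr F x)) z = \<zero>\<^bsub>S\<^esub>}"
    using hom_lift Ext_x by (auto simp: image_iff)
qed

lemma Irr_degree_pos: "Polynomials.degree (R.Irr F x) > 0"
proof (rule ccontr)
  assume "\<not> ?thesis"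
  then have "length (R.Irr F x) \<le> 1" by simp
  moreover have "R.Irr F x \<noteq> []" using R.IrrE(2)[OF F x] by (auto simp: ring_irreducible_def univ_poly_zero)
  ultimately obtain c where c: "R.Irr F x = [c]" by (cases "R.Irr F x") auto
  then have "c = \<one>\<^bsub>R\<^esub>" using R.IrrE(3)[OF F x] by simp
  then show False using R.IrrE(4)[OF F x] c by simp
qed

text \<open>Separability in characteristic zero. The derivative of the minimal polynomial has
  smaller degree, so it does not vanish at \<open>x\<close>. Each root z is the image of
  \<open>x\<close> under some extension of \<tau>, which is injective, so the mapped derivative does
  not vanish at z either.\<close>

lemma card_roots_Irr: "card {z \<in> carrier S. S.eval (map \<tau> (R.Irr F x)) z = \<zero>\<^bsub>S\<^esub>} = Polynomials.degree (R.Irr F x)"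
proof -
  note Irr = R.IrrE[OF F x]
  let ?p = "R.Irr F x"
  have setp: "set ?p \<subseteq> F" using F_poly_set[OF Irr(1)] .
  have pne: "?p \<noteq> []" using Irr_degree_pos by auto
  have pc: "map \<tau> ?p \<in> carrier (poly_ring S)"
    using polynomial_hom[OF \<tau> FF.field_axioms S.field_axioms, of ?p] Irr(1) FX_eq by simp
  have "S.eval (pderiv_list S (map \<tau> ?p)) z \<noteq> \<zero>\<^bsub>S\<^esub>" if z: "z \<in> carrier S" "S.eval (map \<tau> ?p) z = \<zero>\<^bsub>S\<^esub>" for z
  proof
    assume 0: "S.eval (pderiv_list S (map \<tau> ?p)) z = \<zero>\<^bsub>S\<^esub>"
    have pdF: "pderiv_list (R\<lparr>carrier := F\<rparr>) ?p = pderiv_list R ?p"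
    proof -
      have "[k] \<cdot>\<^bsub>R\<lparr>carrier := F\<rparr>\<^esub> c = [k] \<cdot>\<^bsub>R\<^esub> c" for k :: nat and c by (simp add: add_pow_def nat_pow_def)
      then have "pderiv_list (R\<lparr>carrier := F\<rparr>) q = pderiv_list R q" for q by (induction q) auto
      then show ?thesis .
    qed
    obtain c q where cq: "?p = c # q" using pne by (cases ?p) auto
    then have c1: "c = \<one>\<^bsub>R\<^esub>" using Irr(3) by simp
    have qne: "q \<noteq> []" using Irr_degree_pos cq by auto
    have dset: "set (pderiv_list R ?p) \<subseteq> F" using FF.pderiv_list_carrier[of ?p] setp pdF by simp
    \<comment> \<open>The minimal polynomial is monic, so the derivative has the degree, as a field
      element, for its leading coefficient. This is where characteristic zero enters.\<close>
    have "hd (pderiv_list R ?p) \<noteq> \<zero>\<^bsub>R\<^esub>" using cq c1 qne char0[of "length q"] by simp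
    then have dP: "pderiv_list R ?p \<in> carrier (univ_poly R F)"
      using dset by (auto simp: univ_poly_carrier[symmetric] polynomial_def)
    have dne: "pderiv_list R ?p \<noteq> []" using cq qne by simp
    have dx: "R.eval (pderiv_list R ?p) x \<noteq> \<zero>\<^bsub>R\<^esub>"
    proof
      assume "R.eval (pderiv_list R ?p) x = \<zero>\<^bsub>R\<^esub>"
      then have "?p pdivides\<^bsub>R\<^esub> pderiv_list R ?p" by (rule R.Irr_minimal[OF F x dP])
      then have "Polynomials.degree ?p \<le> Polynomials.degree (pderiv_list R ?p)"
        by (rule R.pdivides_imp_degree_le[OF F_subring Irr(1) dP dne])
      then show False using R.length_pderiv_list[of ?p] Irr_degree_pos by simp
    qed
    obtain \<rho> where \<rho>: "\<rho> \<in> Ext F (R.simple_extension F x) \<tau>" "\<rho> x = z" using hom_lift[OF z] by blast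
    have "\<rho> (R.eval (pderiv_list R ?p) x) = S.eval (map \<tau> (pderiv_list R ?p)) z"
      using Ext_eval[OF \<rho>(1) dP] \<rho>(2) by simp
    also have "map \<tau> (pderiv_list R ?p) = pderiv_list S (map \<tau> ?p)"
      using t.pderiv_list_hom[of ?p] setp pdF by simp
    finally have r0: "\<rho> (R.eval (pderiv_list R ?p) x) = \<zero>\<^bsub>S\<^esub>" using 0 by simp
    let ?E = "R.simple_extension F x"
    have sE: "subfield ?E R" using R.simple_extension_is_subfield[OF F x(1)] x(2) by simp
    interpret E: field "R\<lparr>carrier := ?E\<rparr>" using R.subfield_iff(2)[OF sE] .
    interpret r: ring_hom_ring "R\<lparr>carrier := ?E\<rparr>" S \<rho>
      using \<rho> by (intro ring_hom_ringI2 E.ring_axioms S.ring_axioms) (simp add: Ext_def)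
    have inj: "inj_on \<rho> ?E"
      using non_trivial_field_hom_is_inj[of \<rho> "R\<lparr>carrier := ?E\<rparr>" S] r.homh E.field_axioms S.field_axioms by simp
    have m: "R.eval (pderiv_list R ?p) x \<in> ?E" using R.simple_extension_as_eval_img[OF F_sub x(1)] dP by blast
    have m0: "\<zero>\<^bsub>R\<^esub> \<in> ?E" using subringE(2)[OF subfieldE(1)[OF sE]] .
    have "\<rho> \<zero>\<^bsub>R\<^esub> = \<zero>\<^bsub>S\<^esub>" using r.hom_zero by simp
    then show False using inj_onD[OF inj _ m m0] r0 dx by simp
  qed
  then have "card {z \<in> carrier S. S.eval (map \<tau> ?p) z = \<zero>\<^bsub>S\<^esub>} = Polynomials.degree (map \<tau> ?p)"
    using pne by (intro S.simple_roots_card[OF pc _ S.roots_over_carrier[OF pc]]) auto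
  then show ?thesis by simp
qed

lemma card_Ext_simple: "card (Ext F (R.simple_extension F x) \<tau>) = Polynomials.degree (R.Irr F x)"
  using bij_betw_same_card[OF Ext_bij] card_roots_Irr by simp

end

lemma Ext_refl: "subfield F R \<Longrightarrow> \<tau> \<in> ring_hom (R\<lparr>carrier := F\<rparr>) S \<Longrightarrow> Ext F F \<tau> = {restrict \<tau> F}"
proof -
  assume F: "subfield F R" and \<tau>: "\<tau> \<in> ring_hom (R\<lparr>carrier := F\<rparr>) S"
  have c: "x \<otimes>\<^bsub>R\<^esub> y \<in> F" "x \<oplus>\<^bsub>R\<^esub> y \<in> F" if "x \<in> F" "y \<in> F" for x y
    using subringE(6,7)[OF subfieldE(1)[OF F]] that by auto
  have "restrict \<tau> F \<in> ring_hom (R\<lparr>carrier := F\<rparr>) S"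
    using \<tau> c subringE(3)[OF subfieldE(1)[OF F]] by (auto simp: ring_hom_def)
  then have "restrict \<tau> F \<in> Ext F F \<tau>" by (simp add: Ext_def)
  moreover have "\<rho> = restrict \<tau> F" if "\<rho> \<in> Ext F F \<tau>" for \<rho>
    using that by (intro extensionalityI[of _ F]) (auto simp: Ext_def)
  ultimately show ?thesis by blast
qed

lemma ring_hom_subset: "\<rho> \<in> ring_hom (R\<lparr>carrier := E\<rparr>) S \<Longrightarrow> F \<subseteq> E \<Longrightarrow> \<rho> \<in> ring_hom (R\<lparr>carrier := F\<rparr>) S"
  by (simp add: ring_hom_def subset_iff Pi_iff)

lemma Ext_tower:
  assumes F': "subfield F' R" and sub: "F \<subseteq> F'" "F' \<subseteq> E"
  shows "Ext F E \<tau> = (\<Union>\<sigma>\<in>Ext F F' \<tau>. Ext F' E \<sigma>)"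
proof (intro equalityI subsetI)
  fix \<rho> assume \<rho>: "\<rho> \<in> Ext F E \<tau>"
  have "restrict \<rho> F' \<in> Ext F F' \<tau>"
  proof -
    have "\<rho> \<in> ring_hom (R\<lparr>carrier := F'\<rparr>) S" using ring_hom_subset[OF _ sub(2)] \<rho> by (simp add: Ext_def)
    then have "restrict \<rho> F' \<in> Ext F' F' \<rho>" using Ext_refl[OF F'] by simp
    then show ?thesis using \<rho> sub by (auto simp: Ext_def)
  qed
  moreover have "\<rho> \<in> Ext F' E (restrict \<rho> F')" using \<rho> by (simp add: Ext_def)
  ultimately show "\<rho> \<in> (\<Union>\<sigma>\<in>Ext F F' \<tau>. Ext F' E \<sigma>)" by blast
next
  fix \<rho> assume "\<rho> \<in> (\<Union>\<sigma>\<in>Ext F F' \<tau>. Ext F' E \<sigma>)"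
  then show "\<rho> \<in> Ext F E \<tau>" using sub by (auto simp: Ext_def subset_iff)
qed

lemma Ext_disjoint: "\<sigma> \<in> Ext F F' \<tau> \<Longrightarrow> \<sigma>' \<in> Ext F F' \<tau> \<Longrightarrow> \<sigma> \<noteq> \<sigma>' \<Longrightarrow> Ext F' E \<sigma> \<inter> Ext F' E \<sigma>' = {}"
proof (rule ccontr)
  assume a: "\<sigma> \<in> Ext F F' \<tau>" "\<sigma>' \<in> Ext F F' \<tau>" "\<sigma> \<noteq> \<sigma>'" and "Ext F' E \<sigma> \<inter> Ext F' E \<sigma>' \<noteq> {}"
  then obtain \<rho> where "\<rho> \<in> Ext F' E \<sigma>" "\<rho> \<in> Ext F' E \<sigma>'" by blast
  then have "\<sigma> = \<sigma>'" using a(1,2) by (intro extensionalityI[of _ F']) (auto simp: Ext_def)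
  then show False using a(3) by simp
qed

text \<open>Induction on the degree: adjoining an element outside \<open>F\<close> gives as many
  extensions as its minimal polynomial has roots, each of which extends further to \<open>E\<close>.
  Degrees and numbers of extensions multiply in the tower.\<close>

theorem card_Ext:
  assumes "subfield F R" "subfield E R" "F \<subseteq> E" "R.dimension d F E" "\<tau> \<in> ring_hom (R\<lparr>carrier := F\<rparr>) S"
  shows "finite (Ext F E \<tau>) \<and> card (Ext F E \<tau>) = d \<and> d > 0"
  using assms
proof (induction d arbitrary: F \<tau> rule: less_induct)
  case (less d)
  note F = less.prems(1) and E = less.prems(2) and FE = less.prems(3) and dim = less.prems(4) and \<tau> = less.prems(5)
  show ?case
  proof (cases "F = E")
    case True
    then have "d = 1" using R.dimension_is_inj[OF F dim] R.dimension_one[OF F] by simp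
    then show ?thesis using Ext_refl[OF F \<tau>] True by simp
  next
    case False
    then obtain x where x: "x \<in> E" "x \<notin> F" using FE by blast
    have xc: "x \<in> carrier R" using x subfieldE(3)[OF E] by blast
    have xa: "(R.algebraic over F) x"
      using R.finite_dimension_imp_algebraic[OF F subfieldE(1)[OF E] R.finite_dimensionI[OF dim] x(1)] .
    let ?F' = "R.simple_extension F x"
    have F': "subfield ?F' R" using R.simple_extension_is_subfield[OF F xc] xa by simp
    have F'E: "?F' \<subseteq> E" using R.simple_extension_subring_incl[OF subfieldE(1)[OF E] FE x(1)] .
    have FF': "F \<subseteq> ?F'" using R.simple_extension_incl[OF subfieldE(3)[OF F] xc] .
    define e where "e = Polynomials.degree (R.Irr F x)"
    have dF': "R.dimension e F ?F'" unfolding e_def using R.dimension_simple_extension[OF F xc xa] .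
    obtain m where m: "R.dimension m ?F' E"
      using R.dimension_intermediate[OF F F' E FF' F'E dim] by blast
    have d: "d = e * m"
      using R.dimension_is_inj[OF F dim R.telescopic_base[OF F F' dF' m]] .
    \<comment> \<open>The first step of the tower must be proper, so that the degree
      \<open>m\<close> of the remaining extension is smaller than \<open>d\<close>.\<close>
    have e1: "e \<noteq> 1"
    proof
      assume "e = 1"
      then have "R.dimension 1 F ?F'" using dF' by simp
      moreover have "R.independent F [\<one>\<^bsub>R\<^esub>]" by (intro R.li_Cons) auto
      moreover have "set [\<one>\<^bsub>R\<^esub>] \<subseteq> ?F'" using subringE(3)[OF subfieldE(1)[OF F']] by simp
      ultimately have "R.Span F [\<one>\<^bsub>R\<^esub>] = ?F'" using R.independent_length_eq_dimension[OF F, of 1 ?F' "[\<one>\<^bsub>R\<^esub>]"] by simp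
      moreover have "R.Span F [\<one>\<^bsub>R\<^esub>] \<subseteq> F"
      proof
        fix y assume "y \<in> R.Span F [\<one>\<^bsub>R\<^esub>]"
        then obtain k where "k \<in> F" "y = k \<otimes>\<^bsub>R\<^esub> \<one>\<^bsub>R\<^esub> \<oplus>\<^bsub>R\<^esub> \<zero>\<^bsub>R\<^esub>" by (auto simp: R.line_extension_mem_iff)
        then show "y \<in> F" using subfieldE(3)[OF F] by (auto simp: subset_iff)
      qed
      ultimately show False using x(2) R.simple_extension_mem[OF subfieldE(1)[OF F] xc] by blast
    qed
    have e0: "e > 0" unfolding e_def using Irr_degree_pos[OF F \<tau> xc xa] .
    have "m \<noteq> 0"
    proof
      assume "m = 0"
      then have "E = {\<zero>\<^bsub>R\<^esub>}" using m R.dimension_zero[OF F'] by simp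
      then show False using subringE(3)[OF subfieldE(1)[OF E]] by simp
    qed
    then have md: "m < d" and d0: "d > 0" using d e0 e1 by auto
    have fin1: "finite (Ext F ?F' \<tau>)" and c1: "card (Ext F ?F' \<tau>) = e"
      using card_Ext_simple[OF F \<tau> xc xa] e0 unfolding e_def by (auto intro: card_ge_0_finite)
    have IH: "finite (Ext ?F' E \<sigma>) \<and> card (Ext ?F' E \<sigma>) = m" if "\<sigma> \<in> Ext F ?F' \<tau>" for \<sigma>
      using less.IH[OF md F' E F'E m] that by (auto simp: Ext_def)
    have un: "Ext F E \<tau> = (\<Union>\<sigma>\<in>Ext F ?F' \<tau>. Ext ?F' E \<sigma>)" using Ext_tower[OF F' FF' F'E] .
    have "card (Ext F E \<tau>) = (\<Sum>\<sigma>\<in>Ext F ?F' \<tau>. card (Ext ?F' E \<sigma>))"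
      unfolding un using fin1 IH Ext_disjoint by (intro card_UN_disjoint) auto
    also have "\<dots> = e * m" using IH c1 by simp
    finally show ?thesis using d d0 fin1 IH un by auto
  qed
qed

end

section \<open>Absolute values of number fields\<close>

text \<open>With n = 2^j the factor E^j is at most a fixed power n^d. So the constant in the
  estimate for n-th powers grows only polynomially in n, whereas the ratio x/y would grow
  exponentially if it exceeded 1.\<close>

lemma root_trick:
  fixes x y C E :: real
  assumes x: "0 \<le> x" and y: "0 \<le> y" and C: "0 \<le> C" and E: "0 \<le> E"
    and le: "\<And>j::nat. x ^ (2 ^ j) \<le> C * E ^ j * y ^ (2 ^ j)"
  shows "x \<le> y"
proof (rule ccontr)
  assume "\<not> x \<le> y"
  then have xy: "y < x" by simp
  show False
  proof (cases "y = 0")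
    case True
    then show False using le[of 0] xy by simp
  next
    case False
    then have y0: "y > 0" using y by simp
    define t where "t = x / y"
    have t: "t > 1" using xy y0 by (simp add: t_def)
    have tle: "t ^ (2 ^ j) \<le> C * E ^ j" for j
      using le[of j] y0 by (simp add: t_def power_divide pos_divide_le_eq)
    obtain d :: nat where d: "E < 2 ^ d" using real_arch_pow[of 2 E] by auto
    \<comment> \<open>Bernoulli's inequality bounds s^n below linearly in n. Taking the (d+1)-st
      root first makes the lower bound for t^n of order n^(d+1), one degree above the upper bound C
      n^d.\<close>
    define s where "s = root (Suc d) t"
    have s: "s > 1" "s ^ Suc d = t" using t real_root_pow_pos2[of "Suc d" t] by (simp_all add: s_def)
    have "real n * (s - 1) ^ Suc d \<le> C" if n: "n = 2 ^ j" for n j :: nat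
    proof -
      have npos: "real n > 0" using n by simp
      have "real n * (s - 1) \<le> s ^ n" using Bernoulli_inequality[of "s - 1" n] s by simp
      then have "(real n * (s - 1)) ^ Suc d \<le> (s ^ n) ^ Suc d" using s npos by (intro power_mono) auto
      also have "\<dots> = t ^ n" using s(2) by (metis mult.commute power_mult)
      also have "\<dots> \<le> C * E ^ j" using tle n by simp
      also have "\<dots> \<le> C * (2 ^ d) ^ j" using d E C by (intro mult_left_mono power_mono) auto
      also have "C * (2 ^ d) ^ j = real n ^ d * C" using n by (simp add: power_mult[symmetric] mult.commute)
      finally have le: "(real n * (s - 1)) ^ Suc d \<le> real n ^ d * C" .
      have "(real n * (s - 1)) ^ Suc d = real n ^ d * (real n * (s - 1) ^ Suc d)"
        unfolding power_mult_distrib by (simp add: mult_ac)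
      then have "real n ^ d * (real n * (s - 1) ^ Suc d) \<le> real n ^ d * C" using le by (simp only:)
      then show ?thesis using npos by (simp add: mult_le_cancel_left)
    qed note key = this
    obtain j :: nat where "C / (s - 1) ^ Suc d < 2 ^ j" using real_arch_pow[of 2 "C / (s - 1) ^ Suc d"] by auto
    then have "C < 2 ^ j * (s - 1) ^ Suc d" using s by (simp add: pos_divide_less_eq del: power_Suc)
    then show False using key[of "2 ^ j" j] by simp
  qed
qed

section \<open>Subfields of the complex numbers\<close>

lemma num_ring_simps [simp]:
  "carrier (num_ring K) = K" "x \<otimes>\<^bsub>num_ring K\<^esub> y = x * y" "x \<oplus>\<^bsub>num_ring K\<^esub> y = x + y"
  "\<one>\<^bsub>num_ring K\<^esub> = 1" "\<zero>\<^bsub>num_ring K\<^esub> = 0"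
  by (simp_all add: num_ring_def)

lemma num_ring_carrier_update: "(num_ring L)\<lparr>carrier := K\<rparr> = num_ring K"
  by (simp add: num_ring_def)

lemma num_ring_pow [simp]: "x [^]\<^bsub>num_ring K\<^esub> (k::nat) = x ^ k"
  by (induction k) (auto simp: nat_pow_def num_ring_def)

lemma num_ring_field_UNIV: "field (num_ring UNIV)"
proof (rule cring.cring_fieldI2)
  show "cring (num_ring UNIV)"
  proof (rule cringI)
    show "abelian_group (num_ring UNIV)"
    proof (rule abelian_groupI)
      show "\<exists>y\<in>carrier (num_ring UNIV). y \<oplus>\<^bsub>num_ring UNIV\<^esub> x = \<zero>\<^bsub>num_ring UNIV\<^esub>" for x
        by (intro bexI[of _ "- x"]) auto
    qed auto
    show "comm_monoid (num_ring UNIV)" by (rule comm_monoidI) auto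
  qed (auto simp: algebra_simps)
  show "\<exists>b\<in>carrier (num_ring UNIV). a \<otimes>\<^bsub>num_ring UNIV\<^esub> b = \<one>\<^bsub>num_ring UNIV\<^esub>"
    if "a \<noteq> \<zero>\<^bsub>num_ring UNIV\<^esub>" for a
    using that by (intro bexI[of _ "inverse a"]) auto
qed auto

lemma CC_uminus: "\<ominus>\<^bsub>num_ring UNIV\<^esub> x = - x"
proof -
  interpret CC: field "num_ring UNIV" by (rule num_ring_field_UNIV)
  show ?thesis using CC.minus_equality[of "- x" x] by simp
qed

lemma CC_inv: "x \<noteq> 0 \<Longrightarrow> inv\<^bsub>num_ring UNIV\<^esub> x = inverse x"
proof -
  assume "x \<noteq> 0"
  interpret CC: field "num_ring UNIV" by (rule num_ring_field_UNIV)
  show ?thesis using CC.inv_char[of x "inverse x"] \<open>x \<noteq> 0\<close> by simp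
qed

abbreviation "csubfield K \<equiv> subfield K (num_ring UNIV)"

lemma csubfieldD:
  assumes "csubfield K"
  shows "0 \<in> K" "1 \<in> K" "x \<in> K \<Longrightarrow> y \<in> K \<Longrightarrow> x + y \<in> K" "x \<in> K \<Longrightarrow> y \<in> K \<Longrightarrow> x * y \<in> K"
    "x \<in> K \<Longrightarrow> - x \<in> K" "x \<in> K \<Longrightarrow> y \<in> K \<Longrightarrow> x - y \<in> K" "x \<in> K \<Longrightarrow> inverse x \<in> K" "x \<in> K \<Longrightarrow> y \<in> K \<Longrightarrow> x / y \<in> K"
    "x \<in> K \<Longrightarrow> x ^ k \<in> K" "of_nat k \<in> K" "of_int i \<in> K" "of_rat r \<in> K"
proof -
  interpret CC: field "num_ring UNIV" by (rule num_ring_field_UNIV)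
  note sr = subfieldE(1)[OF assms]
  show 0: "0 \<in> K" and 1: "1 \<in> K" using subringE(2,3)[OF sr] by auto
  show add: "x \<in> K \<Longrightarrow> y \<in> K \<Longrightarrow> x + y \<in> K" for x y using subringE(7)[OF sr, of x y] by simp
  show mult: "x \<in> K \<Longrightarrow> y \<in> K \<Longrightarrow> x * y \<in> K" for x y using subringE(6)[OF sr, of x y] by simp
  show um: "x \<in> K \<Longrightarrow> - x \<in> K" for x using subringE(5)[OF sr, of x] by (simp add: CC_uminus)
  show mi: "x \<in> K \<Longrightarrow> y \<in> K \<Longrightarrow> x - y \<in> K" for x y using add[of x "- y"] um by simp
  show inv: "x \<in> K \<Longrightarrow> inverse x \<in> K" for x
    using CC.subfield_m_inv(1)[OF assms, of x] CC_inv[of x] 0 by (cases "x = 0") auto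
  show dv: "x \<in> K \<Longrightarrow> y \<in> K \<Longrightarrow> x / y \<in> K" for x y using mult inv by (simp add: divide_inverse)
  show "x \<in> K \<Longrightarrow> x ^ k \<in> K" by (induction k) (auto simp: 1 mult)
  show nat: "of_nat k \<in> K" for k by (induction k) (auto simp: 0 1 add)
  show int: "of_int i \<in> K" for i
    using nat[of "nat i"] um[OF nat[of "nat (- i)"]] by (cases "i \<ge> 0") auto
  obtain a b where "r = Rat.Fract a b" "b > 0" by (cases r) blast
  then show "of_rat r \<in> K" using dv[OF int int, of a b] by (simp add: of_rat_rat)
qed

lemma csubfield_field: "csubfield K \<Longrightarrow> field (num_ring K)"
  using ring.subfield_iff(2)[OF field.is_ring[OF num_ring_field_UNIV], of K] by (simp add: num_ring_carrier_update)

lemma csubfield_Rats_sub: "csubfield K \<Longrightarrow> \<rat> \<subseteq> K"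
  using csubfieldD(12)[of K] by (auto simp: Rats_def)

lemma csubfield_uminus: "csubfield K \<Longrightarrow> x \<in> K \<Longrightarrow> \<ominus>\<^bsub>num_ring K\<^esub> x = - x"
proof -
  assume K: "csubfield K" and x: "x \<in> K"
  interpret field "num_ring K" by (rule csubfield_field[OF K])
  show ?thesis using minus_equality[of "- x" x] x csubfieldD(5)[OF K x] by simp
qed

lemma csubfield_minus: "csubfield K \<Longrightarrow> x \<in> K \<Longrightarrow> y \<in> K \<Longrightarrow> x \<ominus>\<^bsub>num_ring K\<^esub> y = x - y"
  by (simp add: a_minus_def csubfield_uminus)

lemma csubfield_Rats: "csubfield \<rat>"
proof -
  interpret CC: field "num_ring UNIV" by (rule num_ring_field_UNIV)
  show ?thesis
  proof (rule CC.subfieldI')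
  show "subring \<rat> (num_ring UNIV)"
    by (rule CC.subringI) (auto simp: CC_uminus)
  show "inv\<^bsub>num_ring UNIV\<^esub> k \<in> \<rat>" if "k \<in> \<rat> - {\<zero>\<^bsub>num_ring UNIV\<^esub>}" for k
    using that by (simp add: CC_inv)
  qed
qed

lemma csubfield_sub: assumes K: "csubfield K" and L: "csubfield L" and "L \<subseteq> K" shows "subfield L (num_ring K)"
proof -
  interpret field "num_ring K" by (rule csubfield_field[OF K])
  show ?thesis
  proof (rule subfieldI')
    show "subring L (num_ring K)"
      using assms(3) csubfieldD[OF L] by (intro subringI) (auto simp: csubfield_uminus[OF K] subset_iff)
    fix k assume k: "k \<in> L - {\<zero>\<^bsub>num_ring K\<^esub>}"
    then have "k \<in> K" "inverse k \<in> K" using assms(3) csubfieldD(7)[OF K] by auto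
    then have "inv\<^bsub>num_ring K\<^esub> k = inverse k" using k by (intro inv_char) auto
    then show "inv\<^bsub>num_ring K\<^esub> k \<in> L" using csubfieldD(7)[OF L] k by simp
  qed
qed

lemma pow_powr: "0 \<le> (x::real) \<Longrightarrow> (x ^ k) powr t = (x powr t) ^ k"
  by (induction k) (auto simp: powr_mult)

lemma multiplicity_int: "multiplicity (int q) i = multiplicity q (nat \<bar>i\<bar>)"
proof -
  have "int q ^ k dvd i \<longleftrightarrow> q ^ k dvd nat \<bar>i\<bar>" for k
  proof -
    have "int q ^ k dvd i \<longleftrightarrow> int (q ^ k) dvd int (nat \<bar>i\<bar>)" by simp
    then show ?thesis unfolding int_dvd_int_iff .
  qed
  then show ?thesis unfolding multiplicity_def by simp
qed

locale num_abs =
  fixes K :: "complex set" and n :: "complex \<Rightarrow> real"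
  assumes K: "csubfield K" and abs: "is_abs (num_ring K) n"
begin

sublocale valued_field "num_ring K" n
  using csubfield_field[OF K] abs by (simp add: valued_field_def valued_field_axioms_def)

lemma num_rules: "x \<in> K \<Longrightarrow> 0 \<le> n x" "x \<in> K \<Longrightarrow> n x = 0 \<longleftrightarrow> x = 0" "x \<in> K \<Longrightarrow> y \<in> K \<Longrightarrow> n (x * y) = n x * n y"
  "x \<in> K \<Longrightarrow> y \<in> K \<Longrightarrow> n (x + y) \<le> n x + n y" "n 0 = 0" "n 1 = 1" "x \<in> K \<Longrightarrow> n (- x) = n x"
  "x \<in> K \<Longrightarrow> n (x ^ k) = n x ^ k" "x \<in> K \<Longrightarrow> y \<in> K \<Longrightarrow> n (x - y) \<le> n x + n y"
  using abs n_zero n_one n_uminus[of x] n_pow[of x k] n_minus[of x y]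
  by (auto simp: is_abs_def csubfield_uminus[OF K] csubfield_minus[OF K])

lemma nn_inverse: "x \<in> K \<Longrightarrow> n (inverse x) = inverse (n x)"
proof (cases "x = 0")
  case False
  assume x: "x \<in> K"
  have "n x * n (inverse x) = 1" using num_rules(3)[OF x csubfieldD(7)[OF K x]] num_rules(6) False by simp
  then show ?thesis using num_rules(2)[OF x] False by (simp add: field_simps)
qed (simp add: num_rules(5))

lemma nn_divide: "x \<in> K \<Longrightarrow> y \<in> K \<Longrightarrow> n (x / y) = n x / n y"
  using num_rules(3)[of x "inverse y"] nn_inverse csubfieldD(7)[OF K] by (simp add: divide_inverse)

lemma nn_sum: "finite A \<Longrightarrow> (\<And>i. i \<in> A \<Longrightarrow> f i \<in> K) \<Longrightarrow> n (sum f A) \<le> (\<Sum>i\<in>A. n (f i)) \<and> sum f A \<in> K"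
proof (induction A rule: finite_induct)
  case (insert a A)
  then have "n (f a + sum f A) \<le> n (f a) + n (sum f A)" by (intro num_rules(4)) auto
  then show ?case using insert csubfieldD(3)[OF K] by force
qed (simp add: num_rules csubfieldD[OF K])

lemma nn_nat_le: "n (of_nat k) \<le> real k"
proof (induction k)
  case (Suc k)
  have "n (1 + of_nat k) \<le> n 1 + n (of_nat k)" using csubfieldD[OF K] by (intro num_rules(4)) auto
  then show ?case using Suc num_rules(6) by simp
qed (simp add: num_rules)

text \<open>For t > 1 a power of an absolute value may violate the triangle inequality, but the
  natural numbers are the only obstruction. Each of the m + 1 terms of the binomial expansion of (x
  + y)^m is at most Z^m, and \<open>root_trick\<close> removes the factor m + 1.\<close>

lemma abs_powr:
  assumes t: "t > 0" and le: "\<And>k::nat. n (of_nat k) powr t \<le> real k"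
  shows "is_abs (num_ring K) (\<lambda>x. n x powr t)"
  unfolding is_abs_def num_ring_simps
proof (intro conjI ballI)
  fix x y assume x: "x \<in> K" and y: "y \<in> K"
  define A B where "A = n x powr t" and "B = n y powr t"
  define Z where "Z = (A + B) powr (1 / t)"
  have A0: "A \<ge> 0" "B \<ge> 0" by (auto simp: A_def B_def)
  have xyK: "x + y \<in> K" using csubfieldD(3)[OF K x y] .
  have main: "n (x + y) ^ m \<le> real (m + 1) * Z ^ m" for m :: nat
  proof -
    define a where "a = (\<lambda>k. of_nat (m choose k) * x ^ k * y ^ (m - k))"
    have aK: "a k \<in> K" for k unfolding a_def using csubfieldD[OF K] x y by auto
    have na: "n (a k) = n (of_nat (m choose k)) * n x ^ k * n y ^ (m - k)" for k
      unfolding a_def using csubfieldD[OF K] x y by (simp add: num_rules(3,8))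
    have "n (a k) \<le> Z ^ m" if k: "k \<le> m" for k
    proof -
      have "n (a k) powr t = n (of_nat (m choose k)) powr t * A ^ k * B ^ (m - k)"
        unfolding na A_def B_def using num_rules(1)[OF x] num_rules(1)[OF y] num_rules(1)[OF csubfieldD(10)[OF K]]
        by (simp add: powr_mult pow_powr)
      also have "\<dots> \<le> real (m choose k) * A ^ k * B ^ (m - k)"
        using le A0 by (intro mult_right_mono) auto
      \<comment> \<open>After the hypothesis has replaced the absolute value of the binomial
        coefficient, the term is one summand of the real binomial expansion of (A + B)^m.\<close>
      also have "\<dots> \<le> (\<Sum>k\<le>m. real (m choose k) * A ^ k * B ^ (m - k))"
        using k A0 by (intro member_le_sum) auto
      also have "\<dots> = (A + B) ^ m" by (simp add: binomial_ring)
      finally have "(n (a k) powr t) powr (1 / t) \<le> ((A + B) ^ m) powr (1 / t)" using t by (intro powr_mono2) auto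
      also have "((A + B) ^ m) powr (1 / t) = Z ^ m"
        unfolding Z_def using A0 by (simp add: pow_powr)
      finally show ?thesis using t num_rules(1)[OF aK] by (simp add: powr_powr)
    qed
    then have "(\<Sum>k\<le>m. n (a k)) \<le> (\<Sum>k\<le>m. Z ^ m)" by (intro sum_mono) auto
    moreover have "n ((x + y) ^ m) \<le> (\<Sum>k\<le>m. n (a k))"
      unfolding binomial_ring a_def[symmetric] using nn_sum[of "{..m}" a] aK by (simp add: a_def)
    ultimately show ?thesis using num_rules(8)[OF xyK] by simp
  qed
  have "n (x + y) \<le> Z"
  proof (rule root_trick[of _ _ 2 2])
    fix j :: nat
    have "n (x + y) ^ 2 ^ j \<le> real (2 ^ j + 1) * Z ^ 2 ^ j" using main[of "2 ^ j"] by simp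
    also have "\<dots> \<le> (2 * 2 ^ j) * Z ^ 2 ^ j" by (intro mult_right_mono) (auto simp: Z_def)
    finally show "n (x + y) ^ 2 ^ j \<le> 2 * 2 ^ j * Z ^ 2 ^ j" .
  qed (use num_rules(1)[OF xyK] in \<open>auto simp: Z_def\<close>)
  then have "n (x + y) powr t \<le> Z powr t" using t num_rules(1)[OF xyK] by (intro powr_mono2) auto
  also have "Z powr t = A + B" unfolding Z_def using t A0 by (simp add: powr_powr)
  finally show "n (x + y) powr t \<le> n x powr t + n y powr t" by (simp add: A_def B_def)
next
  show "n (x * y) powr t = n x powr t * n y powr t" if "x \<in> K" "y \<in> K" for x y
    using that by (simp add: num_rules powr_mult)
  show "n x powr t = 0 \<longleftrightarrow> x = 0" if "x \<in> K" for x using num_rules(2)[OF that] by simp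
qed auto

subsection \<open>Ostrowski's theorem\<close>

text \<open>Expansion of \<open>N\<close> in base \<open>a\<close> with L digits, built up by
  Horner's scheme; a digit is below \<open>a\<close>, and its absolute value is at most the digit
  itself.\<close>

lemma digit_bound:
  fixes a :: nat
  assumes a: "a \<ge> 2" and M: "M \<ge> 1" "n (of_nat a) \<le> M"
  shows "N < a ^ L \<Longrightarrow> n (of_nat N) \<le> real a * real L * M ^ L"
proof (induction L arbitrary: N)
  case 0
  then show ?case by (simp add: num_rules)
next
  case (Suc L)
  define q r where "q = N div a" and "r = N mod a"
  have N: "N = a * q + r" and r: "r < a" using a by (auto simp: q_def r_def)
  have "q < a ^ L" using Suc.prems a unfolding q_def by (simp add: less_mult_imp_div_less mult.commute)
  then have IH: "n (of_nat q) \<le> real a * real L * M ^ L" by (rule Suc.IH)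
  have nK: "of_nat k \<in> K" for k using csubfieldD(10)[OF K] .
  have "n (of_nat N) = n (of_nat a * of_nat q + of_nat r)" by (simp add: N)
  also have "\<dots> \<le> n (of_nat a * of_nat q) + n (of_nat r)" using nK csubfieldD(4)[OF K nK nK] by (intro num_rules(4)) auto
  also have "n (of_nat a * of_nat q) = n (of_nat a) * n (of_nat q)" by (rule num_rules(3)[OF nK nK])
  also have "n (of_nat a) * n (of_nat q) + n (of_nat r) \<le> M * (real a * real L * M ^ L) + real a"
    using M IH num_rules(1)[OF nK] nn_nat_le[of r] r by (intro add_mono mult_mono) auto
  also have "\<dots> \<le> M * (real a * real L * M ^ L) + real a * M ^ Suc L"
    using mult_left_mono[OF one_le_power[OF M(1), of "Suc L"], of "real a"] by simp
  also have "\<dots> = real a * real (Suc L) * M ^ Suc L" by (simp add: algebra_simps)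
  finally show ?case .
qed

text \<open>Large powers b^m are written in base \<open>a\<close>, which takes about m ln b / ln a
  digits. The estimate of \<open>digit_bound\<close> then carries a factor linear in m, which
  \<open>root_trick\<close> removes.\<close>

lemma nat_compare:
  fixes a b :: nat
  assumes a: "a \<ge> 2" and b: "b \<ge> 2"
  shows "n (of_nat b) \<le> max 1 (n (of_nat a)) powr (ln b / ln a)"
proof -
  define M where "M = max 1 (n (of_nat a))"
  define c where "c = ln (real b) / ln (real a)"
  have M: "M \<ge> 1" "n (of_nat a) \<le> M" by (auto simp: M_def)
  have c: "c > 0" using a b by (simp add: c_def)
  have nK: "of_nat k \<in> K" for k using csubfieldD(10)[OF K] .
  show ?thesis unfolding M_def[symmetric] c_def[symmetric]
  \<comment> \<open>For m = 2^j the factor E^j with E = 2 is the linear factor m. The constant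
    collects the base \<open>a\<close>, the bound m (c + 2) for the number of digits, and one factor
    \<open>M\<close> lost in rounding that number up.\<close>
  proof (rule root_trick[of _ _ "real a * (c + 2) * M" 2])
    fix j :: nat
    define m :: nat where "m = 2 ^ j"
    define L where "L = nat \<lfloor>real m * c\<rfloor> + 1"
    have L1: "real L \<le> real m * c + 1" "real m * c < real L" unfolding L_def using c real_of_int_floor_add_one_gt[of "real m * c"] of_int_floor_le[of "real m * c"]
      by (simp_all add: of_nat_nat zero_le_mult_iff less_imp_le add.commute)
    have m1: "m \<ge> 1" by (simp add: m_def)
    have "ln (real b ^ m) = real m * c * ln a" using a b by (simp add: ln_realpow c_def)
    also have "\<dots> < real L * ln a" using L1(2) a by (intro mult_strict_right_mono) auto
    also have "\<dots> = ln (real a ^ L)" using a by (simp add: ln_realpow)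
    finally have "real b ^ m < real a ^ L" using a b by simp
    then have "b ^ m < a ^ L" by (metis of_nat_less_iff of_nat_power)
    from digit_bound[OF a M this] have "n (of_nat b ^ m) \<le> real a * real L * M ^ L" by simp
    then have "n (of_nat b) ^ m \<le> real a * real L * M ^ L" using num_rules(8)[OF nK] by simp
    also have "\<dots> \<le> real a * (real m * (c + 2)) * (M * (M powr c) ^ m)"
    proof (intro mult_mono)
      have "real m * c + 1 \<le> real m * (c + 2)" using m1 by (simp add: algebra_simps)
      then show "real L \<le> real m * (c + 2)" using L1 by linarith
      have "M ^ L = M powr real L" using M by (simp add: powr_realpow)
      also have "\<dots> \<le> M powr (1 + real m * c)" using L1 M by (intro powr_mono) auto
      also have "\<dots> = M * M powr (real m * c)" using M by (simp add: powr_add)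
      also have "M powr (real m * c) = (M powr c) ^ m"
        using M powr_realpow[of "M powr c" m] by (simp add: powr_powr mult.commute)
      finally show "M ^ L \<le> M * (M powr c) ^ m" .
    qed (use c M in auto)
    finally show "n (of_nat b) ^ 2 ^ j \<le> real a * (c + 2) * M * 2 ^ j * (M powr c) ^ 2 ^ j"
      unfolding m_def by (simp add: mult_ac)
  qed (use num_rules(1)[OF nK] c M in auto)
qed

text \<open>By \<open>nat_compare\<close> one large natural number forces all a \<ge> 2 to be large.
  The quotients ln (n a) / ln a then bound each other in both directions, so they agree, and their
  common value is the exponent.\<close>

lemma ostrowski_arch:
  assumes "n (of_nat k) > 1"
  shows "\<exists>s>0. \<forall>r. n (of_rat r) = \<bar>of_rat r\<bar> powr s"
proof -
  have nK: "of_nat k \<in> K" for k using csubfieldD(10)[OF K] .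
  have k: "k \<ge> 2"
  proof (rule ccontr)
    assume "\<not> k \<ge> 2"
    then have "k = 0 \<or> k = 1" by auto
    then show False using assms num_rules(5,6) by auto
  qed
  have gt: "n (of_nat a) > 1" if a: "a \<ge> 2" for a
  proof (rule ccontr)
    assume "\<not> n (of_nat a) > 1"
    then have "max 1 (n (of_nat a)) = 1" by simp
    then show False using nat_compare[OF a k] assms by simp
  qed
  have le: "ln (n (of_nat b)) / ln b \<le> ln (n (of_nat a)) / ln a" if a: "a \<ge> 2" and b: "b \<ge> 2" for a b
  proof -
    have "n (of_nat b) \<le> n (of_nat a) powr (ln b / ln a)" using nat_compare[OF a b] gt[OF a] by simp
    then have "ln (n (of_nat b)) \<le> ln (n (of_nat a) powr (ln b / ln a))" using gt[OF a] gt[OF b] by (subst ln_le_cancel_iff) auto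
    also have "\<dots> = ln b / ln a * ln (n (of_nat a))" using gt[OF a] by (simp add: ln_powr)
    finally show ?thesis using a b by (simp add: field_simps)
  qed
  define s where "s = ln (n (of_nat k)) / ln k"
  have s: "s > 0" using gt[OF k] k by (simp add: s_def)
  have nat: "n (of_nat a) = real a powr s" for a :: nat
  proof (cases "a \<ge> 2")
    case True
    have "ln (n (of_nat a)) / ln a = s" unfolding s_def using le[OF True k] le[OF k True] by simp
    then have "ln (n (of_nat a)) = s * ln a" using True by (simp add: field_simps)
    then have "n (of_nat a) = exp (s * ln a)" using gt[OF True] by (metis exp_ln less_trans zero_less_one)
    then show ?thesis using True by (simp add: powr_def)
  next
    case False
    then have "a = 0 \<or> a = 1" by auto
    then show ?thesis using num_rules(5,6) by auto
  qed
  have int: "n (of_int i) = \<bar>of_int i\<bar> powr s" for i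
  proof (cases "i \<ge> 0")
    case True
    then show ?thesis using nat[of "nat i"] by simp
  next
    case False
    then show ?thesis using nat[of "nat (- i)"] num_rules(7)[OF csubfieldD(11)[OF K], of i] by simp
  qed
  have "n (of_rat r) = \<bar>of_rat r\<bar> powr s" for r
  proof -
    obtain a b where r: "r = Rat.Fract a b" "b > 0" by (cases r) blast
    then show ?thesis
      using nn_divide[OF csubfieldD(11)[OF K] csubfieldD(11)[OF K], of a b] by (simp add: of_rat_rat int powr_divide abs_divide)
  qed
  with s show ?thesis by blast
qed

text \<open>The least positive integer of absolute value below 1 is prime, since both factors in a
  proper factorization would have absolute value 1. An integer prime to it must have absolute value
  1 by a Bezout identity.\<close>

lemma nonarch_prime:
  assumes le: "\<And>k::nat. n (of_nat k) \<le> 1" and k: "k > 0" "n (of_nat k) < 1"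
  obtains q where "Factorial_Ring.prime (q::nat)" "n (of_nat q) < 1" "\<And>m. \<not> q dvd m \<Longrightarrow> n (of_nat m) = 1"
proof -
  have nK: "of_nat k \<in> K" for k using csubfieldD(10)[OF K] .
  define q where "q = (LEAST k. k > 0 \<and> n (of_nat k) < 1)"
  have q: "q > 0" "n (of_nat q) < 1" using LeastI[of "\<lambda>k. k > 0 \<and> n (of_nat k) < 1" k] k by (auto simp: q_def)
  have min: "q \<le> m" if "m > 0" "n (of_nat m) < 1" for m
    unfolding q_def using that by (intro Least_le) auto
  have one: "n (of_nat m) = 1" if "m > 0" "m < q" for m
    using min[of m] le[of m] that by force
  have pr: "Factorial_Ring.prime q"
    unfolding prime_nat_iff
  proof (intro conjI allI impI)
    show "1 < q" using q num_rules(6) by (cases "q = 1") auto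
    fix m assume d: "m dvd q"
    show "m = 1 \<or> m = q"
    proof (rule ccontr)
      assume ne: "\<not> (m = 1 \<or> m = q)"
      obtain c where c: "q = m * c" using d by (rule dvdE)
      have "m > 0" "c > 0" "m < q" using q(1) c ne dvd_imp_le[OF d q(1)] by auto
      moreover have "c < q" using mult_less_mono1[of 1 m c] c ne \<open>m > 0\<close> \<open>c > 0\<close> by simp
      ultimately have "n (of_nat m) = 1" "n (of_nat c) = 1" using one by auto
      then have "n (of_nat q) = 1" using num_rules(3)[OF nK nK, of m c] c by simp
      then show False using q(2) by simp
    qed
  qed
  have int_le: "n (of_int i) \<le> 1" for i
  proof (cases "i \<ge> 0")
    case True
    then show ?thesis using le[of "nat i"] by simp
  next
    case False
    then show ?thesis using le[of "nat (- i)"] num_rules(7)[OF csubfieldD(11)[OF K], of i] by simp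
  qed
  have iK: "of_int i \<in> K" for i using csubfieldD(11)[OF K] .
  have "n (of_nat m) = 1" if m: "\<not> q dvd m" for m
  proof (rule ccontr)
    assume "n (of_nat m) \<noteq> 1"
    then have lt: "n (of_nat m) < 1" using le[of m] by simp
    \<comment> \<open>The Bezout identity is applied to m^j and q^j, not to m and q: with j large,
      the ordinary triangle inequality already bounds 1 by a quantity smaller than 1.\<close>
    have "(\<lambda>j. n (of_nat m) ^ j + n (of_nat q) ^ j) \<longlonglongrightarrow> 0 + 0"
      using lt q(2) num_rules(1)[OF nK] by (intro tendsto_add LIMSEQ_power_zero) auto
    then have "eventually (\<lambda>j. n (of_nat m) ^ j + n (of_nat q) ^ j < 1) sequentially"
      by (intro order_tendstoD(2)) auto
    then obtain j where j: "n (of_nat m) ^ j + n (of_nat q) ^ j < 1" by (auto simp: eventually_sequentially)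
    have "coprime (m ^ j) (q ^ j)" using prime_imp_coprime_nat[OF pr m] by (simp add: coprime_commute)
    then have "gcd (int (m ^ j)) (int (q ^ j)) = 1" by (metis coprime_iff_gcd_eq_1 coprime_int_iff)
    then obtain u v :: int where uv: "u * int (m ^ j) + v * int (q ^ j) = 1"
      using bezout_int[of "int (m ^ j)" "int (q ^ j)"] by auto
    have "(1::complex) = of_int (u * int (m ^ j) + v * int (q ^ j))" using uv by simp
    also have "\<dots> = of_int u * of_nat m ^ j + of_int v * of_nat q ^ j" by simp
    finally have "1 = n (of_int u * of_nat m ^ j + of_int v * of_nat q ^ j)" using num_rules(6) by simp
    also have "\<dots> \<le> n (of_int u * of_nat m ^ j) + n (of_int v * of_nat q ^ j)"
      using csubfieldD[OF K] by (intro num_rules(4)) auto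
    also have "\<dots> = n (of_int u) * n (of_nat m) ^ j + n (of_int v) * n (of_nat q) ^ j"
      using num_rules(3)[OF iK csubfieldD(9)[OF K nK]] num_rules(8)[OF nK] by simp
    also have "\<dots> \<le> 1 * n (of_nat m) ^ j + 1 * n (of_nat q) ^ j"
      using int_le num_rules(1)[OF nK] by (intro add_mono mult_right_mono) auto
    finally show False using j by simp
  qed
  with pr q(2) show ?thesis by (rule that)
qed

lemma ostrowski_nonarch:
  assumes le: "\<And>k::nat. n (of_nat k) \<le> 1" and k: "k > 0" "n (of_nat k) < 1"
  shows "\<exists>q s. Factorial_Ring.prime q \<and> s > 0 \<and> (\<forall>r. n (of_rat r) = padic_abs q r powr s)"
proof -
  obtain q where q: "Factorial_Ring.prime (q::nat)" "n (of_nat q) < 1" "\<And>m. \<not> q dvd m \<Longrightarrow> n (of_nat m) = 1"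
    using nonarch_prime[OF le k] by blast
  have nK: "of_nat k \<in> K" for k using csubfieldD(10)[OF K] .
  have q2: "q \<ge> 2" using prime_ge_2_nat[OF q(1)] .
  have nq0: "n (of_nat q) > 0" using num_rules(1,2)[OF nK, of q] q2 by (simp add: order_less_le)
  have nat: "n (of_nat m) = n (of_nat q) ^ multiplicity q m" if m: "m > 0" for m
  proof -
    obtain c where c: "m = q ^ multiplicity q m * c" "\<not> q dvd c"
      using multiplicity_decompose'[of m q] m q(1) prime_elem_not_unit[OF prime_imp_prime_elem[OF q(1)]] by auto
    have "n (of_nat m) = n (of_nat q ^ multiplicity q m * of_nat c)" by (subst c(1)) simp
    also have "\<dots> = n (of_nat q) ^ multiplicity q m * n (of_nat c)"
      using num_rules(3)[OF csubfieldD(9)[OF K nK] nK] num_rules(8)[OF nK] by simp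
    finally show ?thesis using q(3)[OF c(2)] by simp
  qed
  have int: "n (of_int i) = n (of_nat q) ^ multiplicity (int q) i" if i: "i \<noteq> 0" for i
  proof -
    have m: "multiplicity (int q) i = multiplicity q (nat \<bar>i\<bar>)" by (rule multiplicity_int)
    have "n (of_int i) = n (of_int \<bar>i\<bar>)" using num_rules(7)[OF csubfieldD(11)[OF K], of i] by (simp add: abs_if)
    also have "\<dots> = n (of_nat (nat \<bar>i\<bar>))" by simp
    finally show ?thesis using nat[of "nat \<bar>i\<bar>"] i m by simp
  qed
  define s where "s = - ln (n (of_nat q)) / ln q"
  have s: "s > 0" unfolding s_def using q2 q(2) nq0 by (intro divide_pos_pos) auto
  have qs: "n (of_nat q) = real q powr (- s)"
    using q2 nq0 by (simp add: s_def powr_def)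
  have "n (of_rat r) = padic_abs q r powr s" for r
  proof (cases "r = 0")
    case True
    then show ?thesis by (simp add: num_rules padic_abs_def)
  next
    case False
    obtain a b where ab: "quotient_of r = (a, b)" by (cases "quotient_of r")
    have b: "b > 0" using quotient_of_denom_pos[OF ab] .
    have r: "r = of_int a / of_int b" using quotient_of_div[OF ab] .
    have a: "a \<noteq> 0" using False r by auto
    have "n (of_rat r) = n (of_int a / of_int b)" by (simp add: r of_rat_divide)
    also have "\<dots> = n (of_nat q) ^ multiplicity (int q) a / n (of_nat q) ^ multiplicity (int q) b"
      using nn_divide[OF csubfieldD(11)[OF K] csubfieldD(11)[OF K]] int[OF a] int[of b] b by simp
    also have "\<dots> = real q powr (- s * real (multiplicity (int q) a)) / real q powr (- s * real (multiplicity (int q) b))"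
      unfolding qs using q2 by (simp add: powr_powr powr_power mult.commute)
    also have "\<dots> = real q powr ((real (multiplicity (int q) b) - real (multiplicity (int q) a)) * s)"
      by (simp add: powr_diff[symmetric] algebra_simps)
    also have "\<dots> = (real q powi (int (multiplicity (int q) b) - int (multiplicity (int q) a))) powr s"
      using q2 by (simp add: powr_powr powr_real_of_int'[symmetric] powr_int)
    finally show ?thesis using False ab by (simp add: padic_abs_def)
  qed
  with q(1) s show ?thesis by blast
qed

text \<open>Either some natural number is larger than 1, or all are at most 1. In the second case
  some positive natural number is smaller than 1, because otherwise every nonzero rational would
  have absolute value 1.\<close>

theorem ostrowski:
  assumes nt: "r \<noteq> 0" "n (of_rat r) \<noteq> 1"
  shows "\<exists>p s. rat_place p \<and> s > 0 \<and> (\<forall>r. n (of_rat r) = rat_abs p r powr s)"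
proof (cases "\<exists>k::nat. n (of_nat k) > 1")
  case True
  then obtain s where "s > 0" "\<forall>r. n (of_rat r) = \<bar>of_rat r\<bar> powr s" using ostrowski_arch by blast
  then show ?thesis by (intro exI[of _ \<infinity>] exI[of _ s]) (simp add: rat_place_def rat_abs_def)
next
  case False
  then have le: "n (of_nat k) \<le> 1" for k by (simp add: not_less)
  have "\<exists>k>0. n (of_nat k) < 1"
  proof (rule ccontr)
    assume no: "\<not> (\<exists>k>0. n (of_nat k) < 1)"
    have one: "n (of_nat k) = 1" if "k > 0" for k
    proof -
      have "\<not> n (of_nat k) < 1" using no that by blast
      then show ?thesis using le[of k] by linarith
    qed
    have int: "n (of_int i) = 1" if i: "i \<noteq> 0" for i
    proof -
      have "n (of_int i) = n (of_int \<bar>i\<bar>)" using num_rules(7)[OF csubfieldD(11)[OF K], of i] by (simp add: abs_if)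
      also have "\<dots> = n (of_nat (nat \<bar>i\<bar>))" by simp
      finally show ?thesis using one[of "nat \<bar>i\<bar>"] i by simp
    qed
    obtain a b where r: "r = Rat.Fract a b" "b > 0" by (cases r) blast
    have "a \<noteq> 0" using nt(1) r by (auto simp: Zero_rat_def eq_rat)
    then have "n (of_rat r) = 1"
      using nn_divide[OF csubfieldD(11)[OF K] csubfieldD(11)[OF K], of a b] int r by (simp add: of_rat_rat)
    then show False using nt by simp
  qed
  then obtain k where "k > 0" "n (of_nat k) < 1" by blast
  from ostrowski_nonarch[OF le this] obtain q s where
    "Factorial_Ring.prime q" "s > 0" "\<forall>r. n (of_rat r) = padic_abs q r powr s" by blast
  then show ?thesis by (intro exI[of _ "enat q"] exI[of _ s]) (simp add: rat_place_def rat_abs_def)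
qed

end

subsection \<open>The absolute values of the rational numbers\<close>

text \<open>\<open>padic_abs\<close> is defined through the reduced fraction; additivity of the
  multiplicity extends the formula to every representation, which the arithmetic of fractions
  requires.\<close>

lemma padic_abs_quot:
  assumes q: "Factorial_Ring.prime q" and a: "a \<noteq> 0" and b: "b \<noteq> 0"
  shows "padic_abs q (of_int a / of_int b) = real q powi (int (multiplicity (int q) b) - int (multiplicity (int q) a))"
proof -
  define r :: rat where "r = of_int a / of_int b"
  have pr: "Factorial_Ring.prime_elem (int q)" using q by (simp add: prime_imp_prime_elem)
  have r0: "r \<noteq> 0" using a b by (simp add: r_def)
  obtain c d where cd: "quotient_of r = (c, d)" by (cases "quotient_of r")
  have d: "d > 0" using quotient_of_denom_pos[OF cd] .
  have r: "r = of_int c / of_int d" using quotient_of_div[OF cd] .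
  have c: "c \<noteq> 0" using r0 r by auto
  have "(of_int (a * d) :: rat) = of_int (c * b)" using r b d unfolding r_def by (simp add: field_simps)
  then have "a * d = c * b" using of_int_eq_iff by blast
  then have "multiplicity (int q) (a * d) = multiplicity (int q) (c * b)" by simp
  then have "multiplicity (int q) a + multiplicity (int q) d = multiplicity (int q) c + multiplicity (int q) b"
    using a b c d by (simp add: prime_elem_multiplicity_mult_distrib[OF pr])
  then have "int (multiplicity (int q) d) - int (multiplicity (int q) c) = int (multiplicity (int q) b) - int (multiplicity (int q) a)"
    by linarith
  then show ?thesis using r0 cd unfolding r_def[symmetric] by (simp add: padic_abs_def)
qed

lemma rat_abs_nonneg: "0 \<le> rat_abs p r"
  by (cases p) (auto simp: rat_abs_def padic_abs_def split: prod.splits)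

lemma rat_abs_zero [simp]: "rat_abs p 0 = 0"
  by (cases p) (auto simp: rat_abs_def padic_abs_def)

lemma rat_abs_eq_0: assumes "rat_place p" shows "rat_abs p r = 0 \<longleftrightarrow> r = 0"
proof (cases "p = \<infinity>")
  case False
  then obtain q where q: "Factorial_Ring.prime q" "p = enat q" using assms by (auto simp: rat_place_def)
  have "q > 0" using prime_gt_0_nat[OF q(1)] .
  then show ?thesis using q(2) by (simp add: rat_abs_def padic_abs_def split: prod.splits)
qed (simp add: rat_abs_def)

lemma rat_abs_mult: assumes p: "rat_place p" shows "rat_abs p (r * s) = rat_abs p r * rat_abs p s"
proof (cases "p = \<infinity> \<or> r = 0 \<or> s = 0")
  case True
  then show ?thesis by (auto simp: rat_abs_def of_rat_mult abs_mult) (auto simp: padic_abs_def split: enat.splits)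
next
  case False
  then obtain q where q: "Factorial_Ring.prime q" "p = enat q" using p by (auto simp: rat_place_def)
  have pr: "Factorial_Ring.prime_elem (int q)" using q by (simp add: prime_imp_prime_elem)
  obtain a b where r: "r = Rat.Fract a b" "b > 0" by (cases r) blast
  obtain c d where s: "s = Rat.Fract c d" "d > 0" by (cases s) blast
  have ac: "a \<noteq> 0" "c \<noteq> 0" using False r s by (auto simp: Zero_rat_def eq_rat)
  have r': "r = of_int a / of_int b" "s = of_int c / of_int d" "r * s = of_int (a * c) / of_int (b * d)"
    using r s by (auto simp: Fract_of_int_quotient)
  have q0: "real q \<noteq> 0" using prime_gt_0_nat[OF q(1)] by simp
  have bd: "b \<noteq> 0" "d \<noteq> 0" using r(2) s(2) by auto
  let ?v = "\<lambda>i. int (multiplicity (int q) i)"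
  have "padic_abs q (r * s) = real q powi (?v (b * d) - ?v (a * c))"
    unfolding r'(3) using ac bd by (intro padic_abs_quot[OF q(1)]) auto
  also have "\<dots> = real q powi ((?v b - ?v a) + (?v d - ?v c))"
    using ac bd by (simp add: prime_elem_multiplicity_mult_distrib[OF pr] algebra_simps)
  also have "\<dots> = padic_abs q r * padic_abs q s"
    using q0 unfolding r'(1,2) padic_abs_quot[OF q(1) ac(1) bd(1)] padic_abs_quot[OF q(1) ac(2) bd(2)]
    by (simp add: power_int_add)
  finally have "padic_abs q (r * s) = padic_abs q r * padic_abs q s" .
  then show ?thesis using q(2) by (simp add: rat_abs_def)
qed

lemma rat_abs_add: assumes p: "rat_place p" shows "rat_abs p (r + s) \<le> rat_abs p r + rat_abs p s"
proof (cases "p = \<infinity> \<or> r = 0 \<or> s = 0 \<or> r + s = 0")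
  case True
  then consider "p = \<infinity>" | "r = 0" | "s = 0" | "r + s = 0" by blast
  then show ?thesis
  proof cases
    case 1
    have "\<bar>real_of_rat (r + s)\<bar> \<le> \<bar>real_of_rat r\<bar> + \<bar>real_of_rat s\<bar>" unfolding of_rat_add by (rule abs_triangle_ineq)
    then show ?thesis using 1 by (simp add: rat_abs_def)
  qed (use rat_abs_nonneg[of p r] rat_abs_nonneg[of p s] in auto)
next
  case False
  then obtain q where q: "Factorial_Ring.prime q" "p = enat q" using p by (auto simp: rat_place_def)
  have pr: "Factorial_Ring.prime_elem (int q)" using q by (simp add: prime_imp_prime_elem)
  obtain a b where r: "r = Rat.Fract a b" "b > 0" by (cases r) blast
  obtain c d where s: "s = Rat.Fract c d" "d > 0" by (cases s) blast
  have ac: "a \<noteq> 0" "c \<noteq> 0" using False r s by (auto simp: Zero_rat_def eq_rat)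
  have bd: "b \<noteq> 0" "d \<noteq> 0" "b * d \<noteq> 0" using r s by auto
  have r': "r = of_int (a * d) / of_int (b * d)" "s = of_int (c * b) / of_int (b * d)" "r + s = of_int (a * d + c * b) / of_int (b * d)"
    using r s by (auto simp: Fract_of_int_quotient field_simps)
  have "a * d + c * b \<noteq> 0"
  proof
    assume "a * d + c * b = 0"
    then have "r + s = 0" unfolding r'(3) by simp
    then show False using False by simp
  qed
  then have nz: "a * d \<noteq> 0" "c * b \<noteq> 0" "a * d + c * b \<noteq> 0" using ac bd by auto
  have q1: "real q > 1" using prime_gt_1_nat[OF q(1)] by simp
  let ?v = "multiplicity (int q)"
  have "min (?v (a * d)) (?v (c * b)) \<le> ?v (a * d + c * b)"
  proof (rule multiplicity_geI)
    show "int q ^ min (?v (a * d)) (?v (c * b)) dvd a * d + c * b"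
      by (intro dvd_add multiplicity_dvd') auto
  qed (use nz q1 in auto)
  then have "?v (a * d) \<le> ?v (a * d + c * b) \<or> ?v (c * b) \<le> ?v (a * d + c * b)" by (simp add: min_le_iff_disj)
  moreover have P: "padic_abs q r = real q powi (int (?v (b * d)) - int (?v (a * d)))"
    "padic_abs q s = real q powi (int (?v (b * d)) - int (?v (c * b)))"
    "padic_abs q (r + s) = real q powi (int (?v (b * d)) - int (?v (a * d + c * b)))"
    unfolding r'(3) unfolding r'(1,2) by (rule padic_abs_quot[OF q(1) _ bd(3)]; rule nz)+
  moreover have "real q powi i \<le> real q powi j" if "i \<le> j" for i j
    using power_int_increasing[OF that, of "real q"] q1 by simp
  ultimately have "padic_abs q (r + s) \<le> padic_abs q r \<or> padic_abs q (r + s) \<le> padic_abs q s"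
    unfolding P by auto
  then have "padic_abs q (r + s) \<le> max (padic_abs q r) (padic_abs q s)" by auto
  also have "\<dots> \<le> padic_abs q r + padic_abs q s"
    using rat_abs_nonneg[of p r] rat_abs_nonneg[of p s] q(2) by (simp add: rat_abs_def)
  finally show ?thesis using q(2) by (simp add: rat_abs_def)
qed

lemma rat_abs_one: "rat_place p \<Longrightarrow> rat_abs p 1 = 1"
  using rat_abs_mult[of p 1 1] rat_abs_eq_0[of p 1] by simp

lemma rat_abs_prime: assumes "Factorial_Ring.prime q" "Factorial_Ring.prime q'"
  shows "rat_abs (enat q) (of_nat q') = (if q = q' then inverse (real q) else 1)"
proof -
  have "multiplicity (int q) (int q') = (if q = q' then 1 else 0)"
    using assms prime_gt_0_nat[OF assms(2)] by (auto simp: prime_multiplicity_other multiplicity_int multiplicity_self)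
  then show ?thesis
    using padic_abs_quot[OF assms(1), of "int q'" 1] prime_gt_0_nat[OF assms(2)]
    by (auto simp: rat_abs_def power_int_minus)
qed

text \<open>Equivalent absolute values are smaller than 1 at the same rationals. At infinity no
  prime is small, and at a prime q the only small prime is q.\<close>

lemma rat_place_unique:
  assumes p: "rat_place p" and p': "rat_place p'" and s: "s > 0" "s' > 0"
    and eq: "\<And>r. rat_abs p r powr s = rat_abs p' r powr s'"
  shows "p = p'"
proof -
  have lt1: "rat_abs p r < 1 \<longleftrightarrow> rat_abs p' r < 1" for r
  proof -
    have *: "x < 1 \<longleftrightarrow> x powr u < 1" if "x \<ge> 0" "u > 0" for x u :: real
      using powr_less_mono2[of u x 1] powr_mono2[of u 1 x] that by (cases "x < 1") auto
    show ?thesis using *[OF rat_abs_nonneg s(1), of p r] *[OF rat_abs_nonneg s(2), of p' r] eq[of r] by simp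
  qed
  have inf: "\<not> rat_abs \<infinity> (of_nat q) < 1" if "Factorial_Ring.prime q" for q
    using prime_gt_0_nat[OF that] by (simp add: rat_abs_def)
  have fin: "rat_abs (enat q) (of_nat q) < 1" if "Factorial_Ring.prime q" for q
    using rat_abs_prime[OF that that] prime_gt_1_nat[OF that] by (simp add: inverse_less_1_iff)
  show ?thesis
  proof (cases "p = \<infinity>")
    case True
    then show ?thesis using lt1 inf fin p' by (auto simp: rat_place_def)
  next
    case False
    then obtain q where q: "Factorial_Ring.prime q" "p = enat q" using p by (auto simp: rat_place_def)
    then have l: "rat_abs p' (of_nat q) < 1" using lt1 fin by blast
    then obtain q' where q': "Factorial_Ring.prime q'" "p' = enat q'" using p' inf[OF q(1)] by (auto simp: rat_place_def)
    then show ?thesis using l rat_abs_prime[OF q'(1) q(1)] q(2) by (auto split: if_splits)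
  qed
qed

section \<open>Places\<close>

lemma cauchy_seqs_powr:
  assumes R: "ring R" and eq: "\<And>x. x \<in> carrier R \<Longrightarrow> 0 \<le> m x \<and> n x = m x powr s" and s: "s > 0"
  shows "cauchy_seqs R n = cauchy_seqs R m" "null_seqs R n = null_seqs R m"
proof -
  interpret ring R by (rule R)
  have lt: "x powr s < e powr s \<longleftrightarrow> x < e" if "x \<ge> 0" "e > 0" for x e :: real
    using powr_less_mono2[of s x e] powr_mono2[of s e x] s that by (cases "x < e") auto
  have *: "(\<forall>e>0. \<exists>M. \<forall>i\<ge>M. \<forall>j\<ge>M. n (t i \<ominus>\<^bsub>R\<^esub> t j) < e) \<longleftrightarrow> (\<forall>e>0. \<exists>M. \<forall>i\<ge>M. \<forall>j\<ge>M. m (t i \<ominus>\<^bsub>R\<^esub> t j) < e)"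
    if t: "range t \<subseteq> carrier R" for t
  proof -
    have d: "t i \<ominus>\<^bsub>R\<^esub> t j \<in> carrier R" for i j using t by (intro minus_closed) auto
    have 1: "n (t i \<ominus>\<^bsub>R\<^esub> t j) < e powr s \<longleftrightarrow> m (t i \<ominus>\<^bsub>R\<^esub> t j) < e" if "e > 0" for i j e
      using lt[of "m (t i \<ominus>\<^bsub>R\<^esub> t j)" e] eq[OF d[of i j]] that by simp
    show ?thesis
    proof (intro iffI allI impI)
      fix e :: real assume h: "\<forall>e>0. \<exists>M. \<forall>i\<ge>M. \<forall>j\<ge>M. n (t i \<ominus>\<^bsub>R\<^esub> t j) < e" and e: "e > 0"
      have "e powr s > 0" using e by simp
      from h[THEN spec, THEN mp, OF this] show "\<exists>M. \<forall>i\<ge>M. \<forall>j\<ge>M. m (t i \<ominus>\<^bsub>R\<^esub> t j) < e" unfolding 1[OF e] .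
    next
      fix e :: real assume h: "\<forall>e>0. \<exists>M. \<forall>i\<ge>M. \<forall>j\<ge>M. m (t i \<ominus>\<^bsub>R\<^esub> t j) < e" and e: "e > 0"
      have es: "(e powr (1 / s)) powr s = e" and e': "e powr (1 / s) > 0" using e s by (auto simp: powr_powr)
      from h[THEN spec, THEN mp, OF e'] show "\<exists>M. \<forall>i\<ge>M. \<forall>j\<ge>M. n (t i \<ominus>\<^bsub>R\<^esub> t j) < e"
        unfolding 1[OF e', symmetric] es .
    qed
  qed
  show "cauchy_seqs R n = cauchy_seqs R m" unfolding cauchy_seqs_def by (intro Collect_cong conj_cong refl *)
  have "(\<lambda>k. n (t k)) \<longlonglongrightarrow> 0 \<longleftrightarrow> (\<lambda>k. m (t k)) \<longlonglongrightarrow> 0" if t: "range t \<subseteq> carrier R" for t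
  proof -
    have tc: "t k \<in> carrier R" for k using t by auto
    have pw: "(\<lambda>k. f k powr u) \<longlonglongrightarrow> 0" if "f \<longlonglongrightarrow> 0" "u > 0" "\<And>k. f k \<ge> 0" for f :: "nat \<Rightarrow> real" and u
      using tendsto_powr'[OF that(1) tendsto_const[of u]] that by simp
    have mk: "m (t k) = n (t k) powr (1 / s)" and nk: "n (t k) = m (t k) powr s" "0 \<le> m (t k)" "0 \<le> n (t k)" for k
      using eq[OF tc[of k]] s by (auto simp: powr_powr)
    show ?thesis
    proof
      assume "(\<lambda>k. n (t k)) \<longlonglongrightarrow> 0"
      then have "(\<lambda>k. n (t k) powr (1 / s)) \<longlonglongrightarrow> 0" by (rule pw) (use s nk(3) in auto)
      then show "(\<lambda>k. m (t k)) \<longlonglongrightarrow> 0" by (simp only: mk[symmetric])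
    next
      assume "(\<lambda>k. m (t k)) \<longlonglongrightarrow> 0"
      then have "(\<lambda>k. m (t k) powr s) \<longlonglongrightarrow> 0" by (rule pw) (use s nk(2) in auto)
      then show "(\<lambda>k. n (t k)) \<longlonglongrightarrow> 0" by (simp only: nk(1)[symmetric])
    qed
  qed
  then show "null_seqs R n = null_seqs R m" unfolding null_seqs_def by (intro Collect_cong conj_cong refl)
qed

text \<open>Allows the arbitrarily chosen \<open>place_rep v\<close> to be replaced by an absolute
  value normalized on \<rat>, with literally the same completion.\<close>

lemma completion_powr:
  assumes R: "ring R" and eq: "\<And>x. x \<in> carrier R \<Longrightarrow> 0 \<le> m x \<and> n x = m x powr s" and s: "s > 0"
  shows "completion R n = completion R m" "to_completion R n = to_completion R m"
  using cauchy_seqs_powr[OF assms] by (auto simp: completion_def cauchy_ring_def to_completion_def fun_eq_iff)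

text \<open>Singles out, within its equivalence class, the absolute value that extends the p-adic or
  usual one with exponent 1.\<close>

definition normalized :: "complex set \<Rightarrow> enat \<Rightarrow> (complex \<Rightarrow> real) \<Rightarrow> bool" where
  "normalized K p \<nu> \<longleftrightarrow> is_abs (num_ring K) \<nu> \<and> (\<forall>r. \<nu> (of_rat r) = rat_abs p r)"

lemma equiv_abs: "ring R \<Longrightarrow> equiv (nontrivial_absolute_values R) (equivalent_absolute_values R)"
proof (rule equivI)
  have num_rules: "0 \<le> n x" if "n \<in> nontrivial_absolute_values R" "x \<in> carrier R" for n x
    using that by (auto simp: nontrivial_absolute_values_def absolute_values_iff is_abs_def)
  show "equivalent_absolute_values R \<subseteq> nontrivial_absolute_values R \<times> nontrivial_absolute_values R"
    by (auto simp: equivalent_absolute_values_def)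
  show "refl_on (nontrivial_absolute_values R) (equivalent_absolute_values R)"
    using num_rules by (auto simp: refl_on_def equivalent_absolute_values_def intro!: exI[of _ 1])
  show "sym (equivalent_absolute_values R)"
  proof (rule symI)
    fix m n assume "(m, n) \<in> equivalent_absolute_values R"
    then obtain s where s: "m \<in> nontrivial_absolute_values R" "n \<in> nontrivial_absolute_values R" "s > 0"
      "\<forall>x\<in>carrier R. n x = m x powr s" by (auto simp: equivalent_absolute_values_def)
    then have "\<forall>x\<in>carrier R. m x = n x powr (1 / s)" using num_rules[OF s(1)] by (simp add: powr_powr)
    then show "(n, m) \<in> equivalent_absolute_values R"
      unfolding equivalent_absolute_values_def using s by (auto intro!: exI[of _ "1 / s"])
  qed
  show "trans (equivalent_absolute_values R)"
  proof (rule transI)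
    fix l m n assume "(l, m) \<in> equivalent_absolute_values R" "(m, n) \<in> equivalent_absolute_values R"
    then obtain s t where "l \<in> nontrivial_absolute_values R" "n \<in> nontrivial_absolute_values R" "s > 0" "t > 0"
      "\<forall>x\<in>carrier R. m x = l x powr s" "\<forall>x\<in>carrier R. n x = m x powr t" by (auto simp: equivalent_absolute_values_def)
    then show "(l, n) \<in> equivalent_absolute_values R"
      unfolding equivalent_absolute_values_def by (auto simp: powr_powr intro!: exI[of _ "s * t"])
  qed
qed

lemma number_fieldD:
  assumes "number_field K"
  shows "csubfield K" "ring.finite_dimension (num_ring UNIV) \<rat> K"
    "x \<in> K \<Longrightarrow> \<not> ring.transcendental (num_ring K) \<rat> x"
proof -
  interpret CC: field "num_ring UNIV" by (rule num_ring_field_UNIV)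
  show K: "csubfield K" and fd: "CC.finite_dimension \<rat> K" using assms by (auto simp: number_field_def)
  assume "x \<in> K"
  then have "\<not> CC.transcendental \<rat> x"
    using CC.finite_dimension_imp_algebraic[OF csubfield_Rats subfieldE(1)[OF K] fd, of x] by (simp add: over_def)
  then show "\<not> ring.transcendental (num_ring K) \<rat> x"
    using CC.transcendental_consistent[OF subfieldE(1)[OF K]] by (simp add: num_ring_carrier_update)
qed

text \<open>Under the trivial absolute value Cauchy sequences are eventually constant, so \<rat> is
  complete. Uniqueness of extensions, \<open>abs_unique\<close>, then identifies \<open>n\<close>
  with the trivial absolute value on K. Hence a nontrivial absolute value of a number field is
  nontrivial on \<rat>, where Ostrowski's theorem applies.\<close>

lemma trivial_on_Rats:
  assumes K: "number_field K" and abs: "is_abs (num_ring K) n" and triv: "\<And>r. r \<noteq> 0 \<Longrightarrow> n (of_rat r) = 1"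
    and x: "x \<in> K" "x \<noteq> 0"
  shows "n x = 1"
proof -
  note Kf = number_fieldD[OF K]
  interpret n: num_abs K n by (rule num_abs.intro[OF Kf(1) abs])
  have tr: "n q = 1" if "q \<in> \<rat>" "q \<noteq> 0" for q using that triv by (auto simp: Rats_def)
  have sub: "\<rat> \<subseteq> K" by (rule csubfield_Rats_sub[OF Kf(1)])
  have comp: "seq_complete (num_ring K) n \<rat>"
    unfolding seq_complete_def
  proof (intro allI impI)
    fix s :: "nat \<Rightarrow> complex" assume r: "range s \<subseteq> \<rat>" and c: "\<forall>e>0. \<exists>M. \<forall>i\<ge>M. \<forall>j\<ge>M. n (s i \<ominus>\<^bsub>num_ring K\<^esub> s j) < e"
    obtain M where M: "\<forall>i\<ge>M. \<forall>j\<ge>M. n (s i \<ominus>\<^bsub>num_ring K\<^esub> s j) < 1" using c[rule_format, of 1] by auto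
    have sQ: "s i \<in> \<rat>" for i using r by auto
    have sK: "s i \<in> K" for i using sQ sub by blast
    have sM: "s i = s M" if "i \<ge> M" for i
    proof (rule ccontr)
      assume "s i \<noteq> s M"
      moreover have "s i - s M \<in> \<rat>" using sQ by simp
      ultimately have "n (s i - s M) = 1" using tr by simp
      then show False using M[rule_format, OF that, of M] csubfield_minus[OF Kf(1) sK sK] by simp
    qed
    have "n (s k \<ominus>\<^bsub>num_ring K\<^esub> s M) = 0" if "k \<ge> M" for k
      unfolding sM[OF that] using csubfield_minus[OF Kf(1) sK sK] n.num_rules(5) by simp
    then have "\<forall>\<^sub>F k in sequentially. n (s k \<ominus>\<^bsub>num_ring K\<^esub> s M) = 0"
      unfolding eventually_sequentially by blast
    then have "(\<lambda>k. n (s k \<ominus>\<^bsub>num_ring K\<^esub> s M)) \<longlonglongrightarrow> 0" by (rule tendsto_eventually)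
    then show "\<exists>l\<in>\<rat>. (\<lambda>k. n (s k \<ominus>\<^bsub>num_ring K\<^esub> l)) \<longlonglongrightarrow> 0" using sQ by blast
  qed
  interpret c: complete_subfield "num_ring K" \<rat> n
  proof (intro complete_subfield.intro complete_subfield_axioms.intro csubfield_field[OF Kf(1)])
    show "subfield \<rat> (num_ring K)" by (rule csubfield_sub[OF Kf(1) csubfield_Rats sub])
    show "is_abs ((num_ring K)\<lparr>carrier := \<rat>\<rparr>) n" unfolding num_ring_carrier_update
      using abs sub by (simp add: is_abs_def subset_iff)
  qed (rule comp)
  define t where "t = (\<lambda>x::complex. if x = 0 then 0 else (1::real))"
  have "is_abs (num_ring K) t" by (auto simp: is_abs_def t_def)
  moreover have "t q = n q" if "q \<in> \<rat>" for q using tr[OF that] n.num_rules(5) by (simp add: t_def)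
  ultimately have "n x = t x"
    using c.abs_unique[of n t x] abs x Kf(3)[OF x(1)] by (simp add: over_def)
  then show ?thesis using x by (simp add: t_def)
qed

lemma rat_abs_nat_le: assumes p: "rat_place p" shows "rat_abs p (of_nat k) \<le> real k"
proof (induction k)
  case (Suc k)
  have "rat_abs p (1 + of_nat k) \<le> rat_abs p 1 + rat_abs p (of_nat k)" by (rule rat_abs_add[OF p])
  then show ?case using Suc rat_abs_one[OF p] by simp
qed simp

lemma rat_abs_nontrivial: assumes p: "rat_place p" shows "\<exists>r. r \<noteq> 0 \<and> rat_abs p r \<noteq> 1"
proof (cases "p = \<infinity>")
  case True
  then show ?thesis by (intro exI[of _ 2]) (simp add: rat_abs_def)
next
  case False
  then obtain q where q: "Factorial_Ring.prime q" "p = enat q" using p by (auto simp: rat_place_def)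
  have "q > 1" using prime_gt_1_nat[OF q(1)] .
  then show ?thesis using rat_abs_prime[OF q(1) q(1)] q(2) by (intro exI[of _ "of_nat q"]) auto
qed

section \<open>Normalized representatives of places\<close>

lemma place_rep_props:
  assumes K: "csubfield K" and v: "v \<in> places K"
  shows "place_rep v \<in> v" "is_abs (num_ring K) (place_rep v)" "\<exists>x\<in>K - {0}. place_rep v x \<noteq> 1"
    "n \<in> v \<Longrightarrow> \<exists>s>0. \<forall>x\<in>K. n x = place_rep v x powr s"
    "n \<in> v \<Longrightarrow> (place_rep v, n) \<in> equivalent_absolute_values (num_ring K)"
proof -
  interpret field "num_ring K" by (rule csubfield_field[OF K])
  note eq = equiv_abs[OF ring_axioms]
  have "v \<noteq> {}" using in_quotient_imp_non_empty[OF eq] v by (simp add: places_def)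
  then show 1: "place_rep v \<in> v" unfolding place_rep_def by (rule some_in_eq[THEN iffD2])
  have "v \<subseteq> nontrivial_absolute_values (num_ring K)" using in_quotient_imp_subset[OF eq] v by (simp add: places_def)
  then show "is_abs (num_ring K) (place_rep v)" "\<exists>x\<in>K - {0}. place_rep v x \<noteq> 1"
    using 1 by (auto simp: nontrivial_absolute_values_def absolute_values_iff)
  show r: "n \<in> v \<Longrightarrow> (place_rep v, n) \<in> equivalent_absolute_values (num_ring K)"
    using quotient_eq_iff[OF eq, of v v "place_rep v" n] v 1 by (simp add: places_def)
  then show "n \<in> v \<Longrightarrow> \<exists>s>0. \<forall>x\<in>K. n x = place_rep v x powr s"
    by (auto simp: equivalent_absolute_values_def)
qed

text \<open>Ostrowski's theorem gives the exponent by which the representative differs from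
  \<open>rat_abs p\<close> on \<rat>; undoing it on all of K yields \<nu>. The prime is unique by
  \<open>rat_place_unique\<close>, so \<open>place_below\<close> is well defined.\<close>

lemma placeE:
  assumes K: "number_field K" and v: "v \<in> places K"
  obtains p \<nu> s where "rat_place p" "normalized K p \<nu>" "place_below v = p" "s > 0"
    "\<And>x. x \<in> K \<Longrightarrow> place_rep v x = \<nu> x powr s"
    "local_field K v = completion (num_ring K) \<nu>" "to_local_field K v = to_completion (num_ring K) \<nu>"
proof -
  note Kf = number_fieldD[OF K]
  note pr = place_rep_props[OF Kf(1) v]
  interpret n: num_abs K "place_rep v" by (rule num_abs.intro[OF Kf(1) pr(2)])
  have "\<exists>r. r \<noteq> 0 \<and> place_rep v (of_rat r) \<noteq> 1"
  proof (rule ccontr)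
    assume "\<not> ?thesis"
    then have "place_rep v x = 1" if "x \<in> K" "x \<noteq> 0" for x
      using trivial_on_Rats[OF K pr(2) _ that] by blast
    then show False using pr(3) by blast
  qed
  then obtain p s where p: "rat_place p" "s > 0" "\<And>r. place_rep v (of_rat r) = rat_abs p r powr s"
    using n.ostrowski by blast
  define \<nu> where "\<nu> = (\<lambda>x. place_rep v x powr (1 / s))"
  have \<nu>r: "\<nu> (of_rat r) = rat_abs p r" for r
    using p(2) rat_abs_nonneg by (simp add: \<nu>_def p(3) powr_powr)
  \<comment> \<open>The exponent 1/s may exceed 1, so the triangle inequality for \<nu> is not
    automatic. \<open>abs_powr\<close> reduces it to natural numbers, where \<nu> is
    \<open>rat_abs p\<close>.\<close>
  have "place_rep v (of_nat k) powr (1 / s) \<le> real k" for k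
    using \<nu>r[of "of_nat k"] rat_abs_nat_le[OF p(1), of k] by (simp add: \<nu>_def)
  then have "is_abs (num_ring K) \<nu>" unfolding \<nu>_def using p(2) by (intro n.abs_powr) auto
  then have norm: "normalized K p \<nu>" using \<nu>r by (simp add: normalized_def)
  have rep: "place_rep v x = \<nu> x powr s" if "x \<in> K" for x
    using p(2) n.num_rules(1)[OF that] by (simp add: \<nu>_def powr_powr)
  have below: "place_below v = p" unfolding place_below_def
  proof (rule the_equality)
    show "rat_place p \<and> place_divides v p" unfolding place_divides_def using p pr(1) by blast
    fix p' assume a: "rat_place p' \<and> place_divides v p'"
    then obtain n' s' where n': "n' \<in> v" "s' > 0" "\<And>r. n' (of_rat r) = rat_abs p' r powr s'" unfolding place_divides_def by blast
    obtain u where u: "u > 0" "\<forall>x\<in>K. n' x = place_rep v x powr u" using pr(4)[OF n'(1)] by blast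
    have "rat_abs p' r powr s' = rat_abs p r powr (s * u)" for r
      using n'(3)[of r] u(2) p(3)[of r] csubfieldD(12)[OF Kf(1), of r] by (simp add: powr_powr)
    then show "p' = p" using rat_place_unique[of p' p s' "s * u"] a p n'(2) u(1) by simp
  qed
  have R: "ring (num_ring K)" by (rule n.ring_axioms)
  have "0 \<le> \<nu> x \<and> place_rep v x = \<nu> x powr s" if "x \<in> carrier (num_ring K)" for x using rep that by (simp add: \<nu>_def)
  from completion_powr[OF R this p(2)] show ?thesis
    using that[OF p(1) norm below p(2) rep] by (simp add: local_field_def to_local_field_def)
qed

lemma place_eqI:
  assumes K: "number_field K" and v: "v \<in> places K" and w: "w \<in> places K"
    and s: "s > 0" "\<And>x. x \<in> K \<Longrightarrow> place_rep v x = \<nu> x powr s"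
    and t: "t > 0" "\<And>x. x \<in> K \<Longrightarrow> place_rep w x = \<nu> x powr t"
    and pos: "\<And>x. x \<in> K \<Longrightarrow> 0 \<le> \<nu> x"
  shows "v = w"
proof -
  note Kf = number_fieldD[OF K]
  note pr = place_rep_props[OF Kf(1) v] and pw = place_rep_props[OF Kf(1) w]
  interpret field "num_ring K" by (rule csubfield_field[OF Kf(1)])
  note eq = equiv_abs[OF ring_axioms]
  have "(place_rep v, place_rep v) \<in> equivalent_absolute_values (num_ring K)"
    "(place_rep w, place_rep w) \<in> equivalent_absolute_values (num_ring K)"
    using pr(5)[OF pr(1)] pw(5)[OF pw(1)] by auto
  moreover have "\<forall>x\<in>K. place_rep w x = place_rep v x powr (t / s)"
    using s t pos by (simp add: powr_powr)
  ultimately have "(place_rep v, place_rep w) \<in> equivalent_absolute_values (num_ring K)"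
    using s(1) t(1) by (auto simp: equivalent_absolute_values_def intro!: exI[of _ "t / s"])
  then show ?thesis using quotient_eq_iff[OF eq, of v w "place_rep v" "place_rep w"] v w pr(1) pw(1) by (simp add: places_def)
qed

text \<open>Every normalized absolute value comes from a place: it is nontrivial already on \<rat>,
  so its restriction to K generates an equivalence class. The prime below this class is p because
  the prime is determined by the values on \<rat>.\<close>

lemma place_exists:
  assumes K: "number_field K" and p: "rat_place p" and \<mu>: "normalized K p \<mu>"
  shows "\<exists>v\<in>places K. place_below v = p \<and> (\<exists>s>0. \<forall>x\<in>K. place_rep v x = \<mu> x powr s)"
proof -
  note Kf = number_fieldD[OF K]
  interpret n: num_abs K \<mu> using Kf(1) \<mu> by (intro num_abs.intro) (auto simp: normalized_def)
  define m where "m = restrict \<mu> K"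
  have mabs: "m \<in> absolute_values (num_ring K)"
    using is_abs_restrict[OF n.ring_axioms n.abs] by (simp add: m_def)
  obtain r where r: "r \<noteq> 0" "rat_abs p r \<noteq> 1" using rat_abs_nontrivial[OF p] by blast
  have rK: "of_rat r \<in> K" for r using csubfieldD(12)[OF Kf(1)] .
  have "m (of_rat r) \<noteq> 1" using r(2) \<mu> rK by (simp add: m_def normalized_def)
  then have mnt: "m \<in> nontrivial_absolute_values (num_ring K)"
    unfolding nontrivial_absolute_values_def using mabs rK[of r] r(1) by auto
  define v where "v = equivalent_absolute_values (num_ring K) `` {m}"
  have v: "v \<in> places K" unfolding v_def places_def using mnt by (rule quotientI)
  have "place_rep v \<in> v" using place_rep_props(1)[OF Kf(1) v] .
  then obtain a where a: "a > 0" "\<And>x. x \<in> K \<Longrightarrow> place_rep v x = \<mu> x powr a"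
    unfolding v_def by (auto simp: equivalent_absolute_values_def m_def)
  obtain p' \<nu> s where *: "rat_place p'" "normalized K p' \<nu>" "place_below v = p'" "s > 0"
    "\<And>x. x \<in> K \<Longrightarrow> place_rep v x = \<nu> x powr s" using placeE[OF K v] by metis
  have "rat_abs p' r powr s = rat_abs p r powr a" for r
  proof -
    have m: "\<mu> (of_rat r) = rat_abs p r" using \<mu> unfolding normalized_def by blast
    have n: "\<nu> (of_rat r) = rat_abs p' r" using *(2) unfolding normalized_def by blast
    show ?thesis using trans[OF *(5)[OF rK[of r], symmetric] a(2)[OF rK[of r]]] by (simp only: m n)
  qed
  then have "p' = p" using rat_place_unique[OF *(1) p *(4) a(1)] by simp
  then show ?thesis using v *(3) a by blast
qed

text \<open>Comparing values at a rational number whose absolute value is neither 0 nor 1 shows that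
  the two exponents agree.\<close>

lemma normalized_eq:
  assumes K: "csubfield K" and p: "rat_place p" and \<mu>: "normalized K p \<mu>" and \<nu>: "normalized K p \<nu>" and s: "s > 0" "t > 0"
    and eq: "\<And>x. x \<in> K \<Longrightarrow> \<mu> x powr s = \<nu> x powr t" and x: "x \<in> K"
  shows "\<mu> x = \<nu> x"
proof -
  have rK: "of_rat r \<in> K" for r using csubfieldD(12)[OF K] .
  obtain r where r: "r \<noteq> 0" "rat_abs p r \<noteq> 1" using rat_abs_nontrivial[OF p] by blast
  have pos: "rat_abs p r > 0" using rat_abs_nonneg[of p r] rat_abs_eq_0[OF p, of r] r(1) by simp
  have "rat_abs p r powr s = rat_abs p r powr t" using eq[OF rK[of r]] \<mu> \<nu> by (simp add: normalized_def)
  then have "s * ln (rat_abs p r) = t * ln (rat_abs p r)" using pos by (metis ln_powr)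
  then have st: "s = t" using r(2) pos by simp
  have "\<mu> x \<ge> 0" "\<nu> x \<ge> 0" using \<mu> \<nu> x by (auto simp: normalized_def is_abs_def)
  moreover from this have "\<mu> x = (\<mu> x powr s) powr (1 / s)" "\<nu> x = (\<nu> x powr t) powr (1 / t)" using s by (simp_all add: powr_powr)
  ultimately show ?thesis using eq[OF x] st by simp
qed

section \<open>The algebraic closure of a complete field\<close>

locale complete_valued_field = valued_field R n for R (structure) and n +
  assumes complete: "complete_on (carrier R)"
begin

definition closure_base :: "((('a list \<times> nat) multiset) \<Rightarrow> 'a) set" where
  "closure_base = indexed_const ` carrier R"

text \<open>The extension theory expects the base field as a subset of the larger one. The image of
  the constants plays that part, with the absolute value carried over along the injection
  \<open>indexed_const\<close>.\<close>

lemma alg_closure_complete: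
  "complete_subfield_algebraic alg_closure closure_base (\<lambda>z. n (the_inv_into (carrier R) indexed_const z))"
    (is "complete_subfield_algebraic ?L ?B ?m")
proof -
  interpret L: algebraic_closure ?L ?B unfolding closure_base_def by (rule alg_closureE(1))
  interpret h: ring_hom_ring R ?L indexed_const
    by (intro ring_hom_ringI2 ring_axioms L.ring_axioms alg_closureE(2))
  let ?ic = "indexed_const :: 'a \<Rightarrow> ('a list \<times> nat) multiset \<Rightarrow> 'a"
  have inj: "inj_on ?ic (carrier R)" by (rule indexed_const_inj_on)
  have m: "?m (indexed_const c) = n c" if "c \<in> carrier R" for c
    by (simp only: the_inv_into_f_f[OF inj that])
  show ?thesis
  proof (intro complete_subfield_algebraic.intro complete_subfield.intro complete_subfield_axioms.intro
      complete_subfield_algebraic_axioms.intro L.field_axioms)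
    show "subfield ?B ?L" by (rule L.subfield_axioms)
    show "(L.algebraic over ?B) x" if "x \<in> carrier ?L" for x by (rule L.algebraic_extension[OF that])
    show "is_abs (?L\<lparr>carrier := ?B\<rparr>) ?m"
      unfolding is_abs_def
    proof (intro conjI ballI)
      fix x assume "x \<in> carrier (?L\<lparr>carrier := ?B\<rparr>)"
      then obtain c where c: "c \<in> carrier R" "x = indexed_const c" by (auto simp: closure_base_def)
      show "0 \<le> ?m x" using c m by simp
      have "c = \<zero>" if "?ic c = \<zero>\<^bsub>?L\<^esub>"
      proof -
        have "?ic c = ?ic \<zero>" by (rule trans[OF that h.hom_zero[symmetric]])
        then show ?thesis by (rule inj_onD[OF inj _ c(1) zero_closed])
      qed
      then have "?ic c = \<zero>\<^bsub>?L\<^esub> \<longleftrightarrow> c = \<zero>" using h.hom_zero by blast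
      then show "?m x = 0 \<longleftrightarrow> x = \<zero>\<^bsub>?L\<lparr>carrier := ?B\<rparr>\<^esub>" using c m by simp
    next
      fix x y assume "x \<in> carrier (?L\<lparr>carrier := ?B\<rparr>)" "y \<in> carrier (?L\<lparr>carrier := ?B\<rparr>)"
      then obtain c d where c: "c \<in> carrier R" "x = indexed_const c" and d: "d \<in> carrier R" "y = indexed_const d"
        by (auto simp: closure_base_def)
      show "?m (x \<otimes>\<^bsub>?L\<lparr>carrier := ?B\<rparr>\<^esub> y) = ?m x * ?m y"
        using c d m[of "c \<otimes> d"] m by (simp flip: h.hom_mult)
      show "?m (x \<oplus>\<^bsub>?L\<lparr>carrier := ?B\<rparr>\<^esub> y) \<le> ?m x + ?m y"
        using c d m[of "c \<oplus> d"] m n_add[of c d] by (simp flip: h.hom_add)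
    qed
    show "seq_complete ?L ?m ?B"
      unfolding seq_complete_def
    proof (intro allI impI)
      fix s :: "nat \<Rightarrow> _" assume r: "range s \<subseteq> ?B" and cau: "\<forall>e>0. \<exists>M. \<forall>i\<ge>M. \<forall>j\<ge>M. ?m (s i \<ominus>\<^bsub>?L\<^esub> s j) < e"
      have "\<forall>k. \<exists>c\<in>carrier R. s k = indexed_const c" using r by (auto simp: closure_base_def)
      then obtain c where c: "\<And>k. c k \<in> carrier R" "\<And>k. s k = indexed_const (c k)" by metis
      have d: "?m (indexed_const a \<ominus>\<^bsub>?L\<^esub> indexed_const b) = n (a \<ominus> b)" if "a \<in> carrier R" "b \<in> carrier R" for a b
        using m[of "a \<ominus> b"] that by (simp add: a_minus_def)
      have "c \<in> cauchy_seqs R n" unfolding cauchy_seqs_def using c cau by (simp add: d image_subset_iff)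
      then obtain l where l: "l \<in> carrier R" "conv c l"
        using complete c(1) unfolding complete_on_def by (metis image_subset_iff)
      then show "\<exists>l\<in>?B. (\<lambda>k. ?m (s k \<ominus>\<^bsub>?L\<^esub> l)) \<longlonglongrightarrow> 0"
        using c by (intro bexI[of _ "indexed_const l"]) (auto simp: conv_def d closure_base_def)
    qed
  qed
qed

lemma alg_closure_abs_exists: "\<exists>m. is_abs alg_closure m \<and> (\<forall>c\<in>carrier R. m (indexed_const c) = n c)"
proof -
  interpret c: complete_subfield_algebraic alg_closure closure_base "\<lambda>z. n (the_inv_into (carrier R) indexed_const z)"
    by (rule alg_closure_complete)
  obtain m where m: "is_abs alg_closure m" "\<forall>k\<in>closure_base. m k = n (the_inv_into (carrier R) indexed_const k)"
    using c.abs_extend by (elim exE conjE)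
  have "m (indexed_const c) = n c" if "c \<in> carrier R" for c
    using m(2)[rule_format, of "indexed_const c"] that
    by (simp only: the_inv_into_f_f[OF indexed_const_inj_on that] closure_base_def imageI)
  with m(1) show ?thesis by (intro exI conjI ballI)
qed

lemma alg_closure_abs_unique:
  assumes "is_abs alg_closure m" "\<And>c. c \<in> carrier R \<Longrightarrow> m (indexed_const c) = n c"
    "is_abs alg_closure m'" "\<And>c. c \<in> carrier R \<Longrightarrow> m' (indexed_const c) = n c" "x \<in> carrier alg_closure"
  shows "m x = m' x"
proof -
  interpret c: complete_subfield_algebraic alg_closure closure_base "\<lambda>z. n (the_inv_into (carrier R) indexed_const z)"
    by (rule alg_closure_complete)
  have "m k = n (the_inv_into (carrier R) indexed_const k) \<and> m' k = n (the_inv_into (carrier R) indexed_const k)"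
    if k: "k \<in> closure_base" for k
  proof -
    obtain c where c: "c \<in> carrier R" "k = indexed_const c" using k by (auto simp: closure_base_def)
    show ?thesis unfolding c(2) by (simp only: the_inv_into_f_f[OF indexed_const_inj_on c(1)] assms(2,4)[OF c(1)])
  qed
  then show ?thesis by (intro c.abs_unique[OF assms(1) _ assms(3) _ assms(5)] c.algebraic_over assms(5)) simp_all
qed

end

text \<open>An algebraically closed valued field containing \<open>\<rat>\<^sub>p\<close>, which serves as a common target for the
  embeddings of all number fields.\<close>

definition is_Cp :: "enat \<Rightarrow> 'a ring \<Rightarrow> ('a \<Rightarrow> real) \<Rightarrow> (complex \<Rightarrow> 'a) \<Rightarrow> bool" where
  "is_Cp p C m h \<longleftrightarrow> algebraically_closed C \<and> is_abs C m \<and> h \<in> ring_hom (num_ring \<rat>) C \<and>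
     (\<forall>r. m (h (of_rat r)) = rat_abs p r) \<and>
     (\<forall>s :: nat \<Rightarrow> rat. (\<forall>e>0. \<exists>M. \<forall>i\<ge>M. \<forall>j\<ge>M. rat_abs p (s i - s j) < e) \<longrightarrow>
        (\<exists>l\<in>carrier C. (\<lambda>k. m (h (of_rat (s k)) \<ominus>\<^bsub>C\<^esub> l)) \<longlonglongrightarrow> 0))"

lemma rat_abs_normalized:
  assumes p: "rat_place p"
  shows "\<exists>\<mu>. normalized \<rat> p \<mu>"
proof
  define \<mu> where "\<mu> = (\<lambda>x::complex. rat_abs p (inv_into UNIV of_rat x))"
  have [simp]: "\<mu> (of_rat r) = rat_abs p r" for r
    unfolding \<mu>_def by (simp add: inv_f_f inj_def)
  show "normalized \<rat> p \<mu>"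
    unfolding normalized_def is_abs_def
    by (auto simp: Rats_def rat_abs_nonneg rat_abs_eq_0[OF p] rat_abs_mult[OF p] rat_abs_add[OF p]
        simp flip: of_rat_mult of_rat_add)
qed

text \<open>\<open>is_Cp\<close> asks for limits of rational Cauchy sequences, and these lie in the
  completion of \<rat>; so an algebraic closure of it, with the extended absolute value, qualifies.
  The element type is that of \<open>local_closure\<close>, since the completion again consists of
  classes of complex sequences.\<close>

lemma Cp_exists:
  assumes p: "rat_place p"
  shows "\<exists>(C :: local_closure_elem ring) m h. is_Cp p C m h"
proof -
  obtain \<mu> where \<mu>: "normalized \<rat> p \<mu>" using rat_abs_normalized[OF p] by blast
  interpret q: num_abs \<rat> \<mu> using csubfield_Rats \<mu> by (intro num_abs.intro) (auto simp: normalized_def)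
  let ?F = "completion (num_ring \<rat>) \<mu>" and ?n = "completion_abs (num_ring \<rat>) \<mu>"
  interpret F: complete_valued_field ?F ?n
    by (intro complete_valued_field.intro complete_valued_field_axioms.intro q.RC_valued_field q.RC_complete)
  obtain m where m: "is_abs F.alg_closure m" "\<And>c. c \<in> carrier ?F \<Longrightarrow> m (ring.indexed_const ?F c) = ?n c"
    using F.alg_closure_abs_exists by blast
  interpret L: algebraic_closure F.alg_closure "ring.indexed_const ?F ` carrier ?F" by (rule field.alg_closureE(1)[OF q.RC_field])
  interpret g: ring_hom_ring ?F F.alg_closure "ring.indexed_const ?F"
    by (intro ring_hom_ringI2 field.is_ring[OF q.RC_field] L.ring_axioms field.alg_closureE(2)[OF q.RC_field])
  let ?h = "\<lambda>x. ring.indexed_const ?F (q.\<iota> x)"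
  have "?h \<in> ring_hom (num_ring \<rat>) F.alg_closure"
    using ring_hom_trans[OF q.iota_hom field.alg_closureE(2)[OF q.RC_field]] by (simp add: o_def)
  moreover have "m (?h (of_rat r)) = rat_abs p r" for r
    using m(2)[OF q.iota_closed] q.nC_iota \<mu> by (simp add: normalized_def)
  moreover have "\<exists>l\<in>carrier F.alg_closure. (\<lambda>k. m (?h (of_rat (s k)) \<ominus>\<^bsub>F.alg_closure\<^esub> l)) \<longlonglongrightarrow> 0"
    if s: "\<forall>e>0. \<exists>M. \<forall>i\<ge>M. \<forall>j\<ge>M. rat_abs p (s i - s j) < e" for s :: "nat \<Rightarrow> rat"
  proof -
    have c: "(\<lambda>k. of_rat (s k)) \<in> cauchy_seqs (num_ring \<rat>) \<mu>"
      unfolding cauchy_seqs_def using s \<mu> csubfield_minus[OF csubfield_Rats]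
      by (simp add: image_subset_iff normalized_def flip: of_rat_diff)
    let ?l = "q.cls (\<lambda>k. of_rat (s k))"
    have lc: "?l \<in> carrier ?F" by (rule q.cls_in[OF c])
    have "(\<lambda>k. ?n (q.\<iota> (of_rat (s k)) \<ominus>\<^bsub>?F\<^esub> ?l)) \<longlonglongrightarrow> 0"
      using q.iota_conv_cls[OF c] by (simp add: valued_field.conv_def[OF q.RC_valued_field])
    moreover have "m (?h (of_rat (s k)) \<ominus>\<^bsub>F.alg_closure\<^esub> ring.indexed_const ?F ?l) = ?n (q.\<iota> (of_rat (s k)) \<ominus>\<^bsub>?F\<^esub> ?l)" for k
    proof -
      have i: "q.\<iota> (of_rat (s k)) \<in> carrier ?F" by (rule q.iota_closed) simp
      have "?h (of_rat (s k)) \<ominus>\<^bsub>F.alg_closure\<^esub> ring.indexed_const ?F ?l = ring.indexed_const ?F (q.\<iota> (of_rat (s k)) \<ominus>\<^bsub>?F\<^esub> ?l)"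
        using i lc by (simp add: a_minus_def)
      then show ?thesis using m(2)[OF abelian_group.minus_closed[OF ring.is_abelian_group[OF field.is_ring[OF q.RC_field]], OF i lc]] by simp
    qed
    ultimately show ?thesis using lc by (intro bexI[of _ "ring.indexed_const ?F ?l"]) auto
  qed
  ultimately have "is_Cp p F.alg_closure m ?h"
    unfolding is_Cp_def using m(1) L.algebraically_closed_axioms by blast
  then show ?thesis by blast
qed

section \<open>Local degrees\<close>

lemma (in valued_field) conv_inv:
  assumes "conv s l" and s: "\<And>k. s k \<in> carrier R" and l: "l \<in> carrier R" "l \<noteq> \<zero>"
  shows "conv (\<lambda>k. inv (s k)) (inv l)"
proof -
  have l0: "n l > 0" using n_pos[OF l] .
  have lim: "(\<lambda>k. n (s k)) \<longlonglongrightarrow> n l" by (rule conv_n[OF assms(1)]) (use s l in auto)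
  have "(\<lambda>k. n (s k \<ominus> l) * inverse (n (s k) * n l)) \<longlonglongrightarrow> 0 * inverse (n l * n l)"
    using assms(1) l0 unfolding conv_def by (intro tendsto_intros lim) auto
  then have lim0: "(\<lambda>k. n (s k \<ominus> l) * inverse (n (s k) * n l)) \<longlonglongrightarrow> 0" by simp
  have "\<forall>\<^sub>F k in sequentially. n (s k) > 0" using order_tendstoD(1)[OF lim l0] .
  then have "\<forall>\<^sub>F k in sequentially. norm (n (inv (s k) \<ominus> inv l)) \<le> n (s k \<ominus> l) * inverse (n (s k) * n l)"
  proof (rule eventually_mono)
    fix k assume k: "n (s k) > 0"
    then have sk: "s k \<noteq> \<zero>" by auto
    have u: "s k \<in> Units R" "l \<in> Units R" using sk s l field_Units by auto
    define a b where "a = inv (s k)" and "b = inv l"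
    have ab: "a \<in> carrier R" "b \<in> carrier R" using u by (auto simp: a_def b_def)
    have e: "s k \<otimes> a = \<one>" "l \<otimes> b = \<one>" using u by (auto simp: a_def b_def)
    have "(s k \<otimes> l) \<otimes> (a \<ominus> b) = (s k \<otimes> a) \<otimes> l \<ominus> s k \<otimes> (l \<otimes> b)" using s[of k] l(1) ab by algebra
    also have "\<dots> = l \<ominus> s k" using e s[of k] l(1) by simp
    finally have "n (s k) * n l * n (a \<ominus> b) = n (l \<ominus> s k)" using s[of k] l(1) ab by (metis m_closed minus_closed n_mult)
    then have "n (a \<ominus> b) = n (s k \<ominus> l) * inverse (n (s k) * n l)"
      using n_minus_commute[OF l(1) s[of k]] k l0 by (simp add: field_simps)
    moreover have "0 \<le> n (a \<ominus> b)" using ab by simp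
    ultimately show "norm (n (inv (s k) \<ominus> inv l)) \<le> n (s k \<ominus> l) * inverse (n (s k) * n l)" by (simp add: a_def b_def)
  qed
  then show ?thesis unfolding conv_def by (rule metric_null[OF _ lim0])
qed

text \<open>An abstract form of \<open>K\<^sub>v\<close>: an isometric embedding \<kappa> with dense
  image such that the closure of \<rat> is complete. The arguments below thus speak of limits and
  not of classes of sequences.\<close>

locale place_completion = valued_field F nF for F (structure) and nF +
  fixes K :: "complex set" and \<nu> :: "complex \<Rightarrow> real" and \<kappa> :: "complex \<Rightarrow> 'a" and p :: enat
    and C :: "'c ring" and m :: "'c \<Rightarrow> real" and h :: "complex \<Rightarrow> 'c"
  assumes nf: "number_field K" and rp: "rat_place p" and norm: "normalized K p \<nu>" and cp: "is_Cp p C m h"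
    and iota: "\<kappa> \<in> ring_hom (num_ring K) F" and n_iota: "\<And>x. x \<in> K \<Longrightarrow> nF (\<kappa> x) = \<nu> x"
    and dense: "\<And>c. c \<in> carrier F \<Longrightarrow> \<exists>s. range s \<subseteq> K \<and> conv (\<lambda>k. \<kappa> (s k)) c"
    and complete_Q: "complete_on {c \<in> carrier F. \<exists>s. range s \<subseteq> \<rat> \<and> conv (\<lambda>k. \<kappa> (s k)) c}"
begin

text \<open>The copy of \<open>\<rat>\<^sub>p\<close> in \<open>F\<close>.\<close>

definition Q where "Q = {c \<in> carrier F. \<exists>s. range s \<subseteq> \<rat> \<and> conv (\<lambda>k. \<kappa> (s k)) c}"

lemma csK: "csubfield K" and QK: "\<rat> \<subseteq> K"
  using number_fieldD(1)[OF nf] csubfield_Rats_sub by auto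

sublocale S: algebraically_closed C using cp by (simp add: is_Cp_def)
sublocale S: valued_field C m
  using cp S.field_axioms by (simp add: is_Cp_def valued_field_def valued_field_axioms_def)

lemma num_abs: "num_abs K \<nu>"
  using csK norm by (intro num_abs.intro) (auto simp: normalized_def)

lemma nu_minus: "x \<in> K \<Longrightarrow> y \<in> K \<Longrightarrow> nF (\<kappa> x \<ominus> \<kappa> y) = \<nu> (x - y)"
proof -
  assume x: "x \<in> K" and y: "y \<in> K"
  interpret q: num_abs K \<nu> by (rule num_abs)
  interpret i: ring_hom_ring "num_ring K" F \<kappa> by (intro ring_hom_ringI2 q.ring_axioms ring_axioms iota)
  have "\<kappa> x \<ominus> \<kappa> y = \<kappa> (x - y)"
    using x y i.hom_add[of x "- y"] i.hom_a_inv[of y] csubfieldD(5)[OF csK y] by (simp add: a_minus_def csubfield_uminus[OF csK])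
  then show ?thesis using n_iota csubfieldD(6)[OF csK x y] by simp
qed

lemma iota_closed: "x \<in> K \<Longrightarrow> \<kappa> x \<in> carrier F"
  using iota by (auto simp: ring_hom_def)

lemma range_iota: "range s \<subseteq> K \<Longrightarrow> range (\<lambda>k. \<kappa> (s k)) \<subseteq> carrier F"
  using iota_closed by blast

text \<open>The graph of the extension of \<psi> by continuity: c and l are the limits of the images
  of one and the same sequence in S. As a relation it can be studied before the existence of limits
  in C is known.\<close>

definition conv_pair :: "complex set \<Rightarrow> (complex \<Rightarrow> 'c) \<Rightarrow> 'a \<Rightarrow> 'c \<Rightarrow> bool" where
  "conv_pair S \<psi> c l \<longleftrightarrow> c \<in> carrier F \<and> l \<in> carrier C \<and>
     (\<exists>s. range s \<subseteq> S \<and> conv (\<lambda>k. \<kappa> (s k)) c \<and> S.conv (\<lambda>k. \<psi> (s k)) l)"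

definition isom :: "complex set \<Rightarrow> (complex \<Rightarrow> 'c) \<Rightarrow> bool" where
  "isom S \<psi> \<longleftrightarrow> csubfield S \<and> S \<subseteq> K \<and> \<psi> \<in> ring_hom (num_ring S) C \<and> (\<forall>x\<in>S. m (\<psi> x) = \<nu> x)"

lemma isom_closed: "isom S \<psi> \<Longrightarrow> x \<in> S \<Longrightarrow> \<psi> x \<in> carrier C"
  by (auto simp: isom_def ring_hom_def)

lemma isom_minus: assumes "isom S \<psi>" "x \<in> S" "y \<in> S" shows "m (\<psi> x \<ominus>\<^bsub>C\<^esub> \<psi> y) = \<nu> (x - y)"
proof -
  have cS: "csubfield S" using assms by (simp add: isom_def)
  interpret q: field "num_ring S" by (rule csubfield_field[OF cS])
  interpret i: ring_hom_ring "num_ring S" C \<psi>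
    using assms(1) by (intro ring_hom_ringI2 q.ring_axioms S.ring_axioms) (simp add: isom_def)
  have "\<psi> x \<ominus>\<^bsub>C\<^esub> \<psi> y = \<psi> (x - y)"
    using assms i.hom_add[of x "- y"] i.hom_a_inv[of y] csubfieldD(5)[OF cS assms(3)] by (simp add: a_minus_def csubfield_uminus[OF cS])
  then show ?thesis using assms csubfieldD(6)[OF cS assms(2,3)] by (simp add: isom_def)
qed

text \<open>If two sequences have the same limit in F, their differences tend to zero there, and
  hence also in C because \<psi> preserves absolute values.\<close>

lemma conv_pair_unique:
  assumes i: "isom S \<psi>" and "conv_pair S \<psi> c l" "conv_pair S \<psi> c l'"
  shows "l = l'"
proof -
  obtain s where s: "range s \<subseteq> S" "conv (\<lambda>k. \<kappa> (s k)) c" "S.conv (\<lambda>k. \<psi> (s k)) l" using assms(2) by (auto simp: conv_pair_def)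
  obtain t where t: "range t \<subseteq> S" "conv (\<lambda>k. \<kappa> (t k)) c" "S.conv (\<lambda>k. \<psi> (t k)) l'" using assms(3) by (auto simp: conv_pair_def)
  have cl: "c \<in> carrier F" "l \<in> carrier C" "l' \<in> carrier C" using assms by (auto simp: conv_pair_def)
  have sS: "s k \<in> S" and tS: "t k \<in> S" for k using s(1) t(1) by auto
  have SK: "S \<subseteq> K" using i by (simp add: isom_def)
  have sK: "s k \<in> K" and tK: "t k \<in> K" for k using sS tS SK by auto
  note sc = isom_closed[OF i sS] and tc = isom_closed[OF i tS]
  have "(\<lambda>k. (nF (\<kappa> (s k) \<ominus> c) + nF (\<kappa> (t k) \<ominus> c)) + m (\<psi> (t k) \<ominus>\<^bsub>C\<^esub> l')) \<longlonglongrightarrow> (0 + 0) + 0"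
    using s(2) t(2,3) unfolding conv_def S.conv_def by (intro tendsto_add)
  then have lim: "(\<lambda>k. (nF (\<kappa> (s k) \<ominus> c) + nF (\<kappa> (t k) \<ominus> c)) + m (\<psi> (t k) \<ominus>\<^bsub>C\<^esub> l')) \<longlonglongrightarrow> 0" by simp
  have "norm (m (\<psi> (s k) \<ominus>\<^bsub>C\<^esub> l')) \<le> (nF (\<kappa> (s k) \<ominus> c) + nF (\<kappa> (t k) \<ominus> c)) + m (\<psi> (t k) \<ominus>\<^bsub>C\<^esub> l')" for k
  proof -
    have "m (\<psi> (s k) \<ominus>\<^bsub>C\<^esub> l') \<le> m (\<psi> (s k) \<ominus>\<^bsub>C\<^esub> \<psi> (t k)) + m (\<psi> (t k) \<ominus>\<^bsub>C\<^esub> l')" by (rule S.n_dist[OF sc tc cl(3)])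
    moreover have "m (\<psi> (s k) \<ominus>\<^bsub>C\<^esub> \<psi> (t k)) = nF (\<kappa> (s k) \<ominus> \<kappa> (t k))"
      using isom_minus[OF i sS tS] nu_minus[OF sK tK] by simp
    moreover have "nF (\<kappa> (s k) \<ominus> \<kappa> (t k)) \<le> nF (\<kappa> (s k) \<ominus> c) + nF (c \<ominus> \<kappa> (t k))"
      by (rule n_dist[OF iota_closed[OF sK] cl(1) iota_closed[OF tK]])
    moreover have "nF (c \<ominus> \<kappa> (t k)) = nF (\<kappa> (t k) \<ominus> c)" by (rule n_minus_commute[OF cl(1) iota_closed[OF tK]])
    moreover have "0 \<le> m (\<psi> (s k) \<ominus>\<^bsub>C\<^esub> l')" using sc cl(3) by simp
    ultimately show ?thesis by simp
  qed
  then have "(\<lambda>k. m (\<psi> (s k) \<ominus>\<^bsub>C\<^esub> l')) \<longlonglongrightarrow> 0" by (intro metric_null[OF always_eventually lim]) blast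
  then have l'lim: "S.conv (\<lambda>k. \<psi> (s k)) l'" by (simp add: S.conv_def)
  have "range (\<lambda>k. \<psi> (s k)) \<subseteq> carrier C" using sc by blast
  then show ?thesis by (rule S.conv_unique[OF s(3) l'lim _ cl(2,3)])
qed

lemma conv_pair_norm:
  assumes i: "isom S \<psi>" and "conv_pair S \<psi> c l" shows "m l = nF c"
proof -
  obtain s where s: "range s \<subseteq> S" "conv (\<lambda>k. \<kappa> (s k)) c" "S.conv (\<lambda>k. \<psi> (s k)) l" using assms(2) by (auto simp: conv_pair_def)
  have cl: "c \<in> carrier F" "l \<in> carrier C" using assms by (auto simp: conv_pair_def)
  have sS: "s k \<in> S" for k using s(1) by auto
  have sK: "s k \<in> K" for k using sS i by (auto simp: isom_def)
  have r: "range (\<lambda>k. \<psi> (s k)) \<subseteq> carrier C" "range (\<lambda>k. \<kappa> (s k)) \<subseteq> carrier F" using isom_closed[OF i sS] iota_closed[OF sK] by auto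
  have "m (\<psi> (s k)) = nF (\<kappa> (s k))" for k using i sS[of k] n_iota[OF sK[of k]] by (simp add: isom_def)
  then have "(\<lambda>k. nF (\<kappa> (s k))) \<longlonglongrightarrow> m l" using S.conv_n[OF s(3) r(1) cl(2)] by simp
  then show ?thesis using conv_n[OF s(2) r(2) cl(1)] by (rule LIMSEQ_unique)
qed

lemma conv_pair_const:
  assumes i: "isom S \<psi>" and x: "x \<in> S" shows "conv_pair S \<psi> (\<kappa> x) (\<psi> x)"
proof -
  have xK: "x \<in> K" using i x by (auto simp: isom_def)
  show ?thesis unfolding conv_pair_def
    using iota_closed[OF xK] isom_closed[OF i x] conv_const[OF iota_closed[OF xK]] S.conv_const[OF isom_closed[OF i x]] x
    by (intro conjI exI[of _ "\<lambda>k. x"]) auto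
qed

lemma conv_pair_arith:
  assumes i: "isom S \<psi>" and "conv_pair S \<psi> c l" "conv_pair S \<psi> d l'"
  shows "conv_pair S \<psi> (c \<oplus> d) (l \<oplus>\<^bsub>C\<^esub> l')" "conv_pair S \<psi> (c \<otimes> d) (l \<otimes>\<^bsub>C\<^esub> l')"
proof -
  obtain s where s: "range s \<subseteq> S" "conv (\<lambda>k. \<kappa> (s k)) c" "S.conv (\<lambda>k. \<psi> (s k)) l" using assms(2) by (auto simp: conv_pair_def)
  obtain t where t: "range t \<subseteq> S" "conv (\<lambda>k. \<kappa> (t k)) d" "S.conv (\<lambda>k. \<psi> (t k)) l'" using assms(3) by (auto simp: conv_pair_def)
  have cl: "c \<in> carrier F" "d \<in> carrier F" "l \<in> carrier C" "l' \<in> carrier C" using assms by (auto simp: conv_pair_def)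
  have sS: "s k \<in> S" and tS: "t k \<in> S" for k using s(1) t(1) by auto
  have cS: "csubfield S" and SK: "S \<subseteq> K" using i by (auto simp: isom_def)
  have sK: "s k \<in> K" and tK: "t k \<in> K" for k using sS tS SK by auto
  have r: "range (\<lambda>k. \<psi> (s k)) \<subseteq> carrier C" "range (\<lambda>k. \<kappa> (s k)) \<subseteq> carrier F"
    "range (\<lambda>k. \<psi> (t k)) \<subseteq> carrier C" "range (\<lambda>k. \<kappa> (t k)) \<subseteq> carrier F"
    using isom_closed[OF i sS] iota_closed[OF sK] isom_closed[OF i tS] iota_closed[OF tK] by auto
  have ia: "\<kappa> (s k + t k) = \<kappa> (s k) \<oplus> \<kappa> (t k)" "\<kappa> (s k * t k) = \<kappa> (s k) \<otimes> \<kappa> (t k)" for k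
    using iota sK[of k] tK[of k] by (auto simp: ring_hom_def)
  have sa: "\<psi> (s k + t k) = \<psi> (s k) \<oplus>\<^bsub>C\<^esub> \<psi> (t k)" "\<psi> (s k * t k) = \<psi> (s k) \<otimes>\<^bsub>C\<^esub> \<psi> (t k)" for k
    using i sS[of k] tS[of k] by (auto simp: isom_def ring_hom_def)
  have rs: "range (\<lambda>k. s k + t k) \<subseteq> S" "range (\<lambda>k. s k * t k) \<subseteq> S"
    using csubfieldD(3,4)[OF cS sS tS] by auto
  have "conv (\<lambda>k. \<kappa> (s k + t k)) (c \<oplus> d)" unfolding ia by (rule conv_add[OF s(2) t(2) r(2,4) cl(1,2)])
  moreover have "S.conv (\<lambda>k. \<psi> (s k + t k)) (l \<oplus>\<^bsub>C\<^esub> l')" unfolding sa by (rule S.conv_add[OF s(3) t(3) r(1,3) cl(3,4)])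
  ultimately show "conv_pair S \<psi> (c \<oplus> d) (l \<oplus>\<^bsub>C\<^esub> l')" unfolding conv_pair_def using cl rs(1)
    by (intro conjI exI[of _ "\<lambda>k. s k + t k"]) auto
  have "conv (\<lambda>k. \<kappa> (s k * t k)) (c \<otimes> d)" unfolding ia by (rule conv_mult[OF s(2) t(2) r(2,4) cl(1,2)])
  moreover have "S.conv (\<lambda>k. \<psi> (s k * t k)) (l \<otimes>\<^bsub>C\<^esub> l')" unfolding sa by (rule S.conv_mult[OF s(3) t(3) r(1,3) cl(3,4)])
  ultimately show "conv_pair S \<psi> (c \<otimes> d) (l \<otimes>\<^bsub>C\<^esub> l')" unfolding conv_pair_def using cl rs(2)
    by (intro conjI exI[of _ "\<lambda>k. s k * t k"]) auto
qed

text \<open>Extension of \<psi> by continuity to D. With S = \<rat> it embeds the p-adic field into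
  C; with S = K it extends an embedding of K to all of F.\<close>

definition lim_ext :: "complex set \<Rightarrow> (complex \<Rightarrow> 'c) \<Rightarrow> 'a set \<Rightarrow> 'a \<Rightarrow> 'c" where
  "lim_ext S \<psi> D = (\<lambda>c\<in>D. THE l. conv_pair S \<psi> c l)"

lemma lim_ext_eq:
  assumes "isom S \<psi>" "c \<in> D" "conv_pair S \<psi> c l" shows "lim_ext S \<psi> D c = l"
proof -
  have "(THE l. conv_pair S \<psi> c l) = l"
    by (rule the_equality, rule assms(3), erule conv_pair_unique[OF assms(1) _ assms(3)])
  then show ?thesis by (simp only: lim_ext_def restrict_apply'[OF assms(2)])
qed

lemma lim_ext_hom:
  assumes i: "isom S \<psi>" and D: "subring D F" and ex: "\<And>c. c \<in> D \<Longrightarrow> \<exists>l. conv_pair S \<psi> c l"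
  shows "lim_ext S \<psi> D \<in> ring_hom (F\<lparr>carrier := D\<rparr>) C"
proof (rule ring_hom_memI)
  have cp: "conv_pair S \<psi> c (lim_ext S \<psi> D c)" if c: "c \<in> D" for c
  proof -
    obtain l where "conv_pair S \<psi> c l" using ex[OF c] by blast
    then show ?thesis using lim_ext_eq[OF i c] by simp
  qed
  show "lim_ext S \<psi> D c \<in> carrier C" if "c \<in> carrier (F\<lparr>carrier := D\<rparr>)" for c
    using cp[of c] that by (simp add: conv_pair_def)
  show "lim_ext S \<psi> D (c \<otimes>\<^bsub>F\<lparr>carrier := D\<rparr>\<^esub> d) = lim_ext S \<psi> D c \<otimes>\<^bsub>C\<^esub> lim_ext S \<psi> D d"
    if "c \<in> carrier (F\<lparr>carrier := D\<rparr>)" "d \<in> carrier (F\<lparr>carrier := D\<rparr>)" for c d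
    using that subringE(6)[OF D, of c d] by (auto intro!: lim_ext_eq[OF i] conv_pair_arith[OF i] cp)
  show "lim_ext S \<psi> D (c \<oplus>\<^bsub>F\<lparr>carrier := D\<rparr>\<^esub> d) = lim_ext S \<psi> D c \<oplus>\<^bsub>C\<^esub> lim_ext S \<psi> D d"
    if "c \<in> carrier (F\<lparr>carrier := D\<rparr>)" "d \<in> carrier (F\<lparr>carrier := D\<rparr>)" for c d
    using that subringE(7)[OF D, of c d] by (auto intro!: lim_ext_eq[OF i] conv_pair_arith[OF i] cp)
  have "\<kappa> 1 = \<one>" "\<psi> 1 = \<one>\<^bsub>C\<^esub>" "1 \<in> S"
    using iota i csubfieldD(2) by (auto simp: ring_hom_def isom_def)
  then have "conv_pair S \<psi> \<one> \<one>\<^bsub>C\<^esub>" using conv_pair_const[OF i, of 1] by simp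
  then show "lim_ext S \<psi> D \<one>\<^bsub>F\<lparr>carrier := D\<rparr>\<^esub> = \<one>\<^bsub>C\<^esub>"
    using subringE(3)[OF D] by (simp add: lim_ext_eq[OF i])
qed

section \<open>The p-adic subfield of the completion and finiteness over it\<close>

lemma Q_subfield: "subfield Q F"
proof (rule subfieldI')
  note csQ = csubfield_Rats
  have i1: "\<kappa> 1 = \<one>" using iota by (auto simp: ring_hom_def)
  have arith: "\<kappa> (x + y) = \<kappa> x \<oplus> \<kappa> y" "\<kappa> (x * y) = \<kappa> x \<otimes> \<kappa> y" if "x \<in> K" "y \<in> K" for x y
    using iota that by (auto simp: ring_hom_def)
  have constQ: "\<kappa> x \<in> Q" if "x \<in> \<rat>" for x
  proof -
    have "\<kappa> x \<in> carrier F" using iota_closed QK that by blast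
    then show ?thesis unfolding Q_def using that conv_const by (auto intro!: exI[of _ "\<lambda>k. x"])
  qed
  have "\<kappa> (-1) \<oplus> \<kappa> 1 = \<kappa> 0" using arith(1)[of "-1" 1] csubfieldD[OF csK] by simp
  moreover have "\<kappa> 0 \<oplus> \<kappa> 0 = \<kappa> 0" using arith(1)[of 0 0] csubfieldD[OF csK] by simp
  then have "\<kappa> 0 = \<zero>" using iota_closed[of 0] csubfieldD(1)[OF csK] by (metis add.l_cancel_one')
  ultimately have im1: "\<kappa> (-1) = \<ominus> \<one>" using iota_closed[of "-1"] csubfieldD(2,5)[OF csK] i1 by (simp add: minus_equality)
  have ops: "c \<oplus> d \<in> Q" "c \<otimes> d \<in> Q" if c: "c \<in> Q" and d: "d \<in> Q" for c d
  proof -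
    obtain s where s: "range s \<subseteq> \<rat>" "conv (\<lambda>k. \<kappa> (s k)) c" using c by (auto simp: Q_def)
    obtain t where t: "range t \<subseteq> \<rat>" "conv (\<lambda>k. \<kappa> (t k)) d" using d by (auto simp: Q_def)
    have cd: "c \<in> carrier F" "d \<in> carrier F" using c d by (auto simp: Q_def)
    have sK: "s k \<in> \<rat>" "t k \<in> \<rat>" "s k \<in> K" "t k \<in> K" for k using s(1) t(1) QK by auto
    have r: "range (\<lambda>k. \<kappa> (s k)) \<subseteq> carrier F" "range (\<lambda>k. \<kappa> (t k)) \<subseteq> carrier F" using iota_closed sK by auto
    have "conv (\<lambda>k. \<kappa> (s k + t k)) (c \<oplus> d)" unfolding arith(1)[OF sK(3,4)] by (rule conv_add[OF s(2) t(2) r cd])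
    then show "c \<oplus> d \<in> Q" unfolding Q_def using cd sK by (auto intro!: exI[of _ "\<lambda>k. s k + t k"])
    have "conv (\<lambda>k. \<kappa> (s k * t k)) (c \<otimes> d)" unfolding arith(2)[OF sK(3,4)] by (rule conv_mult[OF s(2) t(2) r cd])
    then show "c \<otimes> d \<in> Q" unfolding Q_def using cd sK by (auto intro!: exI[of _ "\<lambda>k. s k * t k"])
  qed
  have Qc: "c \<in> carrier F" if "c \<in> Q" for c using that by (simp add: Q_def)
  show "subring Q F"
  proof (rule subringI)
    show "Q \<subseteq> carrier F" using Qc by blast
    show "\<one> \<in> Q" using constQ[of 1] i1 by simp
    fix c assume c: "c \<in> Q"
    have "\<ominus> c = \<ominus> \<one> \<otimes> c" using Qc[OF c] by (simp add: l_minus)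
    moreover have "\<ominus> \<one> \<in> Q" using constQ[of "-1"] im1 by simp
    ultimately show "\<ominus> c \<in> Q" using ops(2) c by simp
  qed (use ops in auto)
  fix c assume c: "c \<in> Q - {\<zero>}"
  obtain s where s: "range s \<subseteq> \<rat>" "conv (\<lambda>k. \<kappa> (s k)) c" using c by (auto simp: Q_def)
  have cc: "c \<in> carrier F" "c \<noteq> \<zero>" using c Qc by auto
  have sK: "s k \<in> \<rat>" "s k \<in> K" for k using s(1) QK by auto
  have "conv (\<lambda>k. inv (\<kappa> (s k))) (inv c)" by (rule conv_inv[OF s(2) iota_closed[OF sK(2)] cc])
  \<comment> \<open>The absolute values tend to a positive limit, so the terms of s are eventually
    nonzero; for those the inverse in F is the image of the rational inverse.\<close>
  moreover have "\<forall>\<^sub>F k in sequentially. inv (\<kappa> (s k)) = \<kappa> (inverse (s k))"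
  proof -
    have "range (\<lambda>k. \<kappa> (s k)) \<subseteq> carrier F" using iota_closed sK by auto
    then have "(\<lambda>k. nF (\<kappa> (s k))) \<longlonglongrightarrow> nF c" by (rule conv_n[OF s(2) _ cc(1)])
    then have "\<forall>\<^sub>F k in sequentially. 0 < nF (\<kappa> (s k))" by (rule order_tendstoD(1)) (rule n_pos[OF cc])
    then show ?thesis
    proof (rule eventually_mono)
      fix k assume k: "0 < nF (\<kappa> (s k))"
      have "s k \<noteq> 0" using k \<open>\<kappa> 0 = \<zero>\<close> by auto
      then have "\<kappa> (s k) \<otimes> \<kappa> (inverse (s k)) = \<one>"
        using arith(2)[OF sK(2) csubfieldD(7)[OF csK sK(2)], of k k] i1 by simp
      then show "inv (\<kappa> (s k)) = \<kappa> (inverse (s k))"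
        using iota_closed sK csubfieldD(7)[OF csK sK(2)] by (intro comm_inv_char) auto
    qed
  qed
  ultimately have lim: "conv (\<lambda>k. \<kappa> (inverse (s k))) (inv c)"
    unfolding conv_def by (elim Lim_transform_eventually) (auto elim!: eventually_mono)
  have "c \<in> Units F" using cc field_Units by simp
  then have "inv c \<in> carrier F" by simp
  then show "inv c \<in> Q" unfolding Q_def using lim sK(1) by (auto intro!: exI[of _ "\<lambda>k. inverse (s k)"])
qed

lemma Q_complete_subfield: "complete_subfield F Q nF"
proof (intro complete_subfield.intro complete_subfield_axioms.intro field_axioms Q_subfield)
  show "is_abs (F\<lparr>carrier := Q\<rparr>) nF" using abs_subfield[OF Q_subfield] by (simp add: valued_field_def valued_field_axioms_def)
  show "seq_complete F nF Q" using complete_Q seq_complete_iff[of Q] by (auto simp: Q_def)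
qed

lemma nF_knorm: "complete_subfield.knorm F Q nF nF"
  using complete_subfield.abs_knorm(1)[OF Q_complete_subfield abs] by simp

lemma Span_mono_scalars: "A \<subseteq> B \<Longrightarrow> Span A Us \<subseteq> Span B Us"
proof (induction Us)
  case (Cons u Us)
  then show ?case by (auto simp: line_extension_mem_iff subset_iff)
qed simp

text \<open>A basis of K over \<rat> spans over \<open>Q\<close> a finite-dimensional subspace,
  which is closed by \<open>fd_closed\<close>. It contains the image of K, which is dense, so it is
  the whole of F.\<close>

lemma finite_span:
  obtains Bs where "set Bs \<subseteq> K" "Span Q (map \<kappa> Bs) = carrier F"
proof -
  interpret CC: field "num_ring UNIV" by (rule num_ring_field_UNIV)
  interpret q: num_abs K \<nu> by (rule num_abs)
  interpret i: ring_hom_ring "num_ring K" F \<kappa> by (intro ring_hom_ringI2 q.ring_axioms ring_axioms iota)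
  obtain d where d: "CC.dimension d \<rat> K" using number_fieldD(2)[OF nf] by (auto simp: CC.finite_dimension_def)
  obtain Bs where Bs: "CC.Span \<rat> Bs = K" "set Bs \<subseteq> UNIV" using CC.exists_base[OF csubfield_Rats d] by auto
  have BK: "set Bs \<subseteq> K" using CC.Span_base_incl[OF csubfield_Rats, of Bs] Bs by simp
  have "ring.Span (num_ring K) \<rat> Bs = K"
    using CC.Span_consistent[OF subfieldE(1)[OF csK]] Bs(1) by (simp only: num_ring_carrier_update)
  then have "Span (\<kappa> ` \<rat>) (map \<kappa> Bs) = \<kappa> ` K" using i.Span_hom[of \<rat> Bs] QK BK by simp
  moreover have "\<kappa> ` \<rat> \<subseteq> Q"
  proof
    fix y assume "y \<in> \<kappa> ` \<rat>"
    then obtain x where x: "x \<in> \<rat>" "y = \<kappa> x" by blast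
    have "\<kappa> x \<in> carrier F" using iota_closed QK x(1) by blast
    then show "y \<in> Q" unfolding Q_def using x conv_const by (auto intro!: exI[of _ "\<lambda>k. x"])
  qed
  ultimately have iK: "\<kappa> ` K \<subseteq> Span Q (map \<kappa> Bs)" using Span_mono_scalars by metis
  have Bc: "set (map \<kappa> Bs) \<subseteq> carrier F" using iota_closed BK by auto
  obtain e where e: "dimension e Q (Span Q (map \<kappa> Bs))"
    using Span_finite_dimension[OF Q_subfield Bc] by (auto simp: finite_dimension_def)
  have "c \<in> Span Q (map \<kappa> Bs)" if c: "c \<in> carrier F" for c
  proof -
    obtain s where s: "range s \<subseteq> K" "conv (\<lambda>k. \<kappa> (s k)) c" using dense[OF c] by blast
    have "range (\<lambda>k. \<kappa> (s k)) \<subseteq> Span Q (map \<kappa> Bs)" using s(1) iK by blast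
    then show ?thesis
      using complete_subfield.fd_closed[OF Q_complete_subfield nF_knorm _ e, of "\<lambda>k. \<kappa> (s k)" c] c s(2) by (simp add: conv_def)
  qed
  moreover have "Span Q (map \<kappa> Bs) \<subseteq> carrier F" using Span_in_carrier[OF _ Bc] subfieldE(3)[OF Q_subfield] by blast
  ultimately have "Span Q (map \<kappa> Bs) = carrier F" by blast
  with BK show ?thesis by (rule that)
qed

lemma Q_dimension: "\<exists>d. dimension d Q (carrier F)"
proof -
  obtain Bs where "set Bs \<subseteq> K" "Span Q (map \<kappa> Bs) = carrier F" by (rule finite_span)
  then show ?thesis using Span_finite_dimension[OF Q_subfield, of "map \<kappa> Bs"] iota_closed
    by (auto simp: finite_dimension_def subset_iff)
qed

lemma algebraic_over_Q: "c \<in> carrier F \<Longrightarrow> (algebraic over Q) c"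
  using Q_dimension finite_dimension_imp_algebraic[OF Q_subfield carrier_is_subring, of c] by (auto simp: finite_dimension_def)

lemma abs_unique_Q:
  assumes "is_abs F n1" "\<And>c. c \<in> Q \<Longrightarrow> n1 c = nF c" "c \<in> carrier F"
  shows "n1 c = nF c"
  using complete_subfield.abs_unique[OF Q_complete_subfield assms(1,2) abs _ assms(3) algebraic_over_Q[OF assms(3)]] by simp

section \<open>Embeddings of the completion and embeddings of the number field\<close>

lemma h_isom: "isom \<rat> h"
proof -
  have "m (h x) = \<nu> x" if "x \<in> \<rat>" for x
    using that cp norm by (auto simp: Rats_def is_Cp_def normalized_def)
  then show ?thesis unfolding isom_def using csubfield_Rats QK cp by (simp add: is_Cp_def)
qed

lemma Q_conv_pair: assumes c: "c \<in> Q" shows "\<exists>l. conv_pair \<rat> h c l"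
proof -
  obtain s where s: "range s \<subseteq> \<rat>" "conv (\<lambda>k. \<kappa> (s k)) c" using c by (auto simp: Q_def)
  have cc: "c \<in> carrier F" using c by (simp add: Q_def)
  have "\<forall>k. \<exists>r. s k = of_rat r" using s(1) by (auto simp: Rats_def)
  then obtain r where r: "\<And>k. s k = of_rat (r k)" by metis
  have sK: "of_rat (r k) \<in> K" for k using csubfieldD(12)[OF csK] .
  have cau: "(\<lambda>k. \<kappa> (of_rat (r k))) \<in> cauchy_seqs F nF"
    using conv_imp_cauchy[OF s(2) _ cc] iota_closed[OF sK] by (auto simp: r)
  have "\<exists>M. \<forall>i\<ge>M. \<forall>j\<ge>M. rat_abs p (r i - r j) < e" if e: "e > 0" for e
  proof -
    have "nF (\<kappa> (of_rat (r i)) \<ominus> \<kappa> (of_rat (r j))) = rat_abs p (r i - r j)" for i j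
      using nu_minus[OF sK sK] norm by (simp add: normalized_def flip: of_rat_diff)
    then show ?thesis using cauchy_seqsD2[OF cau e] by simp
  qed
  then obtain l where l: "l \<in> carrier C" "(\<lambda>k. m (h (of_rat (r k)) \<ominus>\<^bsub>C\<^esub> l)) \<longlonglongrightarrow> 0"
    using cp unfolding is_Cp_def by blast
  have "S.conv (\<lambda>k. h (s k)) l" using l(2) by (simp add: S.conv_def r)
  then show ?thesis unfolding conv_pair_def using cc l(1) s by blast
qed

text \<open>The embedding of the p-adic subfield into C that is continuous and agrees with h on
  \<rat>.\<close>

definition j where "j = lim_ext \<rat> h Q"

lemma j_hom: "j \<in> ring_hom (F\<lparr>carrier := Q\<rparr>) C"
  unfolding j_def by (rule lim_ext_hom[OF h_isom subfieldE(1)[OF Q_subfield] Q_conv_pair])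

lemma j_pair: "c \<in> Q \<Longrightarrow> conv_pair \<rat> h c (j c)"
  using Q_conv_pair[of c] lim_ext_eq[OF h_isom, of c Q] by (auto simp: j_def)

lemma char0_F: fixes k :: nat assumes "k > 0" shows "[k] \<cdot> \<one> \<noteq> \<zero>"
proof -
  have i1: "\<kappa> 1 = \<one>" and i0: "\<kappa> 0 = \<zero>"
  proof -
    interpret q: num_abs K \<nu> by (rule num_abs)
    interpret i: ring_hom_ring "num_ring K" F \<kappa> by (intro ring_hom_ringI2 q.ring_axioms ring_axioms iota)
    show "\<kappa> 1 = \<one>" "\<kappa> 0 = \<zero>" using i.hom_one i.hom_zero by auto
  qed
  have kK: "of_nat k \<in> K" for k using csubfieldD(10)[OF csK] .
  have e: "\<kappa> (of_nat k) = [k] \<cdot> \<one>" for k :: nat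
  proof (induction k)
    case (Suc k)
    have "\<kappa> (of_nat k + 1) = \<kappa> (of_nat k) \<oplus> \<kappa> 1" using iota kK csubfieldD(2)[OF csK] by (auto simp: ring_hom_def)
    then show ?case using Suc i1 by (simp add: add.commute)
  qed (simp add: i0)
  interpret q: num_abs K \<nu> by (rule num_abs)
  have "nF (\<kappa> (of_nat k)) \<noteq> 0" using n_iota[OF kK] q.num_rules(2)[OF kK] assms by simp
  then show ?thesis using e by auto
qed

sublocale FC: field_homs F C
  by (intro field_homs.intro field_axioms S.algebraically_closed_axioms field_homs_axioms.intro char0_F)

text \<open>The embeddings of K that induce the given place; their number will be the local
  degree.\<close>

definition H where "H = {\<psi> \<in> ring_hom (num_ring K) C. \<psi> \<in> extensional K \<and> (\<forall>x\<in>\<rat>. \<psi> x = h x) \<and> (\<forall>x\<in>K. m (\<psi> x) = \<nu> x)}"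

lemma H_isom: "\<psi> \<in> H \<Longrightarrow> isom K \<psi>"
  using csK by (simp add: H_def isom_def)

text \<open>Completeness of C is not among the assumptions, so limits are obtained algebraically:
  elements of F are combinations of images of elements of K with coefficients in \<open>Q\<close>.
  Limits exist for the coefficients through \<open>j\<close>, for the images through \<psi>, and
  they are compatible with sums and products.\<close>

lemma H_conv_pair:
  assumes \<psi>: "\<psi> \<in> H" and c: "c \<in> carrier F" shows "\<exists>l. conv_pair K \<psi> c l"
proof -
  note i = H_isom[OF \<psi>]
  obtain Bs where Bs: "set Bs \<subseteq> K" "Span Q (map \<kappa> Bs) = carrier F" by (rule finite_span)
  have Qp: "conv_pair K \<psi> c (j c)" if "c \<in> Q" for c
  proof -
    obtain s where s: "range s \<subseteq> \<rat>" "conv (\<lambda>k. \<kappa> (s k)) c" "S.conv (\<lambda>k. h (s k)) (j c)" "c \<in> carrier F" "j c \<in> carrier C"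
      using j_pair[OF \<open>c \<in> Q\<close>] by (auto simp: conv_pair_def)
    have "h (s k) = \<psi> (s k)" for k
    proof -
      have "s k \<in> \<rat>" using s(1) by (rule subsetD) simp
      then show ?thesis using \<psi> by (simp add: H_def)
    qed
    moreover have "range s \<subseteq> K" using s(1) QK by blast
    ultimately show ?thesis unfolding conv_pair_def using s(2-5) by auto
  qed
  have zero: "conv_pair K \<psi> \<zero> (\<psi> 0)"
  proof -
    interpret q: num_abs K \<nu> by (rule num_abs)
    interpret i: ring_hom_ring "num_ring K" F \<kappa> by (intro ring_hom_ringI2 q.ring_axioms ring_axioms iota)
    show ?thesis using conv_pair_const[OF i csubfieldD(1)[OF csK]] i.hom_zero by simp
  qed
  have "set Us \<subseteq> K \<Longrightarrow> c \<in> Span Q (map \<kappa> Us) \<Longrightarrow> \<exists>l. conv_pair K \<psi> c l" for Us c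
  proof (induction Us arbitrary: c)
    case Nil
    then show ?case using zero by auto
  next
    case (Cons u Us)
    then obtain k w where kw: "k \<in> Q" "w \<in> Span Q (map \<kappa> Us)" "c = k \<otimes> \<kappa> u \<oplus> w" by (auto simp: line_extension_mem_iff)
    obtain l where l: "conv_pair K \<psi> w l" using Cons.IH[of w] Cons.prems kw(2) by auto
    have "u \<in> K" using Cons.prems by simp
    then show ?case unfolding kw(3)
      using conv_pair_arith(1)[OF i conv_pair_arith(2)[OF i Qp[OF kw(1)] conv_pair_const[OF i]] l] by blast
  qed
  then show ?thesis using Bs c by blast
qed

text \<open>Pulling m back along \<rho> gives an absolute value on F that agrees with nF on
  \<open>Q\<close>, and over the complete field \<open>Q\<close> there is only one such.\<close>

lemma Ext_isometric: assumes \<rho>: "\<rho> \<in> FC.Ext Q (carrier F) j" and c: "c \<in> carrier F" shows "m (\<rho> c) = nF c"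
proof (rule abs_unique_Q[OF _ _ c])
  interpret r: ring_hom_ring F C \<rho>
    using \<rho> by (intro ring_hom_ringI2 ring_axioms S.ring_axioms) (simp add: FC.Ext_def)
  have inj: "inj_on \<rho> (carrier F)"
    using non_trivial_field_hom_is_inj[OF r.homh field_axioms S.field_axioms] .
  show "is_abs F (\<lambda>c. m (\<rho> c))"
    unfolding is_abs_def
  proof (intro conjI ballI)
    fix x assume x: "x \<in> carrier F"
    show "0 \<le> m (\<rho> x)" using x by simp
    have "x = \<zero>" if "\<rho> x = \<zero>\<^bsub>C\<^esub>" using inj_onD[OF inj, of x \<zero>] that x r.hom_zero by simp
    then show "m (\<rho> x) = 0 \<longleftrightarrow> x = \<zero>" using x r.hom_zero by auto
  next
    fix x y assume "x \<in> carrier F" "y \<in> carrier F"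
    then show "m (\<rho> (x \<otimes> y)) = m (\<rho> x) * m (\<rho> y)" "m (\<rho> (x \<oplus> y)) \<le> m (\<rho> x) + m (\<rho> y)"
      using S.n_add by simp_all
  qed
  show "m (\<rho> c) = nF c" if "c \<in> Q" for c
    using \<rho> that conv_pair_norm[OF h_isom j_pair[OF that]] by (simp add: FC.Ext_def)
qed

lemma Ext_conv:
  assumes \<rho>: "\<rho> \<in> FC.Ext Q (carrier F) j" and s: "range s \<subseteq> K" "conv (\<lambda>k. \<kappa> (s k)) c" and c: "c \<in> carrier F"
  shows "S.conv (\<lambda>k. \<rho> (\<kappa> (s k))) (\<rho> c)"
proof -
  interpret r: ring_hom_ring F C \<rho>
    using \<rho> by (intro ring_hom_ringI2 ring_axioms S.ring_axioms) (simp add: FC.Ext_def)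
  have "m (\<rho> (\<kappa> (s k)) \<ominus>\<^bsub>C\<^esub> \<rho> c) = nF (\<kappa> (s k) \<ominus> c)" for k
  proof -
    have i: "\<kappa> (s k) \<in> carrier F" using s(1) iota_closed by blast
    have "\<rho> (\<kappa> (s k)) \<ominus>\<^bsub>C\<^esub> \<rho> c = \<rho> (\<kappa> (s k) \<ominus> c)" using i c by (simp add: a_minus_def)
    then show ?thesis using Ext_isometric[OF \<rho>] i c by simp
  qed
  then show ?thesis using s(2) by (simp add: conv_def S.conv_def)
qed

text \<open>Restriction to K and extension by continuity are inverse to each other. The extensions
  on the left were counted by \<open>card_Ext\<close>, so this equates the local degree with the
  number of embeddings of K inducing the place.\<close>

lemma H_bij: "bij_betw (\<lambda>\<rho>. restrict (\<lambda>x. \<rho> (\<kappa> x)) K) (FC.Ext Q (carrier F) j) H"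
proof (rule bij_betw_imageI)
  let ?r = "\<lambda>\<rho>. restrict (\<lambda>x. \<rho> (\<kappa> x)) K"
  show "inj_on ?r (FC.Ext Q (carrier F) j)"
  proof (rule inj_onI)
    fix \<rho> \<rho>' assume a: "\<rho> \<in> FC.Ext Q (carrier F) j" and b: "\<rho>' \<in> FC.Ext Q (carrier F) j" and e: "?r \<rho> = ?r \<rho>'"
    have e': "\<rho> (\<kappa> x) = \<rho>' (\<kappa> x)" if "x \<in> K" for x using fun_cong[OF e, of x] that by simp
    show "\<rho> = \<rho>'"
    proof (rule extensionalityI[of _ "carrier F"])
      show "\<rho> \<in> extensional (carrier F)" "\<rho>' \<in> extensional (carrier F)" using a b by (auto simp: FC.Ext_def)
      fix c assume c: "c \<in> carrier F"
      obtain s where s: "range s \<subseteq> K" "conv (\<lambda>k. \<kappa> (s k)) c" using dense[OF c] by blast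
      have cl: "\<rho> x \<in> carrier C" "\<rho>' x \<in> carrier C" if "x \<in> carrier F" for x
        using a b that by (auto simp: FC.Ext_def ring_hom_def)
      have "\<rho> (\<kappa> (s k)) = \<rho>' (\<kappa> (s k))" for k using e' s(1) by blast
      then have "S.conv (\<lambda>k. \<rho> (\<kappa> (s k))) (\<rho>' c)" using Ext_conv[OF b s c] by simp
      moreover have "range (\<lambda>k. \<rho> (\<kappa> (s k))) \<subseteq> carrier C" using cl(1) range_iota[OF s(1)] by blast
      ultimately show "\<rho> c = \<rho>' c" using S.conv_unique[OF Ext_conv[OF a s c]] cl c by blast
    qed
  qed
  show "?r ` FC.Ext Q (carrier F) j = H"
  proof (intro equalityI subsetI)
    fix \<psi> assume "\<psi> \<in> ?r ` FC.Ext Q (carrier F) j"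
    then obtain \<rho> where \<rho>: "\<rho> \<in> FC.Ext Q (carrier F) j" "\<psi> = ?r \<rho>" by blast
    have "\<rho> \<in> ring_hom F C" using \<rho>(1) by (simp add: FC.Ext_def)
    from ring_hom_trans[OF iota this] have "(\<lambda>x. \<rho> (\<kappa> x)) \<in> ring_hom (num_ring K) C" by (simp add: o_def)
    then have "\<psi> \<in> ring_hom (num_ring K) C"
      using csubfieldD(2,3,4)[OF csK] by (auto simp: ring_hom_def \<rho>(2))
    moreover have "\<psi> x = h x" if x: "x \<in> \<rat>" for x
    proof -
      have "conv_pair \<rat> h (\<kappa> x) (h x)" by (rule conv_pair_const[OF h_isom x])
      moreover have iQ: "\<kappa> x \<in> Q"
      proof -
        have "\<kappa> x \<in> carrier F" using iota_closed QK x by blast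
        then show ?thesis unfolding Q_def using x conv_const by (auto intro!: exI[of _ "\<lambda>k. x"])
      qed
      ultimately have "j (\<kappa> x) = h x" unfolding j_def by (intro lim_ext_eq[OF h_isom])
      then show ?thesis using \<rho> iQ x QK by (auto simp: FC.Ext_def)
    qed
    moreover have "m (\<psi> x) = \<nu> x" if "x \<in> K" for x
      using Ext_isometric[OF \<rho>(1) iota_closed[OF that]] n_iota[OF that] \<rho>(2) that by simp
    ultimately show "\<psi> \<in> H" unfolding H_def using \<rho>(2) by simp
  next
    fix \<psi> assume \<psi>: "\<psi> \<in> H"
    note i = H_isom[OF \<psi>]
    define \<rho> where "\<rho> = lim_ext K \<psi> (carrier F)"
    have hom: "\<rho> \<in> ring_hom (F\<lparr>carrier := carrier F\<rparr>) C"
      unfolding \<rho>_def by (rule lim_ext_hom[OF i carrier_is_subring H_conv_pair[OF \<psi>]])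
    have "\<rho> c = j c" if c: "c \<in> Q" for c
    proof -
      have cc: "c \<in> carrier F" using c by (simp add: Q_def)
      obtain s where s: "range s \<subseteq> \<rat>" "conv (\<lambda>k. \<kappa> (s k)) c" "S.conv (\<lambda>k. h (s k)) (j c)" "c \<in> carrier F" "j c \<in> carrier C"
        using j_pair[OF c] by (auto simp: conv_pair_def)
      have "h (s k) = \<psi> (s k)" for k
    proof -
      have "s k \<in> \<rat>" using s(1) by (rule subsetD) simp
      then show ?thesis using \<psi> by (simp add: H_def)
    qed
      moreover have "range s \<subseteq> K" using s(1) QK by blast
      ultimately have "conv_pair K \<psi> c (j c)" unfolding conv_pair_def using s(2-5) by auto
      then show ?thesis unfolding \<rho>_def by (rule lim_ext_eq[OF i cc])
    qed
    moreover have "\<rho> \<in> extensional (carrier F)" by (simp add: \<rho>_def lim_ext_def)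
    ultimately have mem: "\<rho> \<in> FC.Ext Q (carrier F) j" using hom by (simp add: FC.Ext_def)
    have "\<psi> = ?r \<rho>"
    proof (rule extensionalityI[of _ K])
      show "\<psi> \<in> extensional K" "?r \<rho> \<in> extensional K" using \<psi> by (auto simp: H_def)
      fix x assume x: "x \<in> K"
      have "\<rho> (\<kappa> x) = \<psi> x" unfolding \<rho>_def by (rule lim_ext_eq[OF i iota_closed[OF x] conv_pair_const[OF i x]])
      then show "\<psi> x = ?r \<rho> x" using x by simp
    qed
    with mem show "\<psi> \<in> ?r ` FC.Ext Q (carrier F) j" by blast
  qed
qed

theorem local_degree_H: "dim Q (carrier F) = card H \<and> finite H \<and> card H > 0"
proof -
  obtain d where d: "dimension d Q (carrier F)" using Q_dimension by blast
  have "finite (FC.Ext Q (carrier F) j) \<and> card (FC.Ext Q (carrier F) j) = d \<and> d > 0"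
    using FC.card_Ext[OF Q_subfield carrier_is_subfield _ d j_hom] subfieldE(3)[OF Q_subfield] by blast
  moreover have "dim Q (carrier F) = d" using dimI[OF Q_subfield d] by (simp add: over_def)
  ultimately show ?thesis using bij_betw_same_card[OF H_bij] bij_betw_finite[OF H_bij] by simp
qed

end

section \<open>Sums over the places above a prime\<close>

text \<open>Reconciles two descriptions of the p-adic subfield: \<open>local_rationals\<close>
  speaks of classes that contain a rational sequence, the locale \<open>place_completion\<close> of
  limits of rational sequences.\<close>

lemma (in valued_field) seq_closure_iff:
  assumes S: "S \<subseteq> carrier R"
  shows "seq_closure S = {c \<in> carrier RC. \<exists>s. range s \<subseteq> S \<and> valued_field.conv RC nC (\<lambda>k. to_completion R n (s k)) c}"
proof (intro equalityI subsetI)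
  interpret F: valued_field RC nC by (rule RC_valued_field)
  fix c assume "c \<in> seq_closure S"
  then show "c \<in> {c \<in> carrier RC. \<exists>s. range s \<subseteq> S \<and> F.conv (\<lambda>k. to_completion R n (s k)) c}"
    using iota_dense by (auto simp: seq_closure_def)
next
  interpret F: valued_field RC nC by (rule RC_valued_field)
  fix c assume "c \<in> {c \<in> carrier RC. \<exists>s. range s \<subseteq> S \<and> F.conv (\<lambda>k. to_completion R n (s k)) c}"
  then obtain s where c: "c \<in> carrier RC" and s: "range s \<subseteq> S" "F.conv (\<lambda>k. to_completion R n (s k)) c" by blast
  have sR: "s k \<in> carrier R" for k using s(1) S by blast
  have ri: "range (\<lambda>k. to_completion R n (s k)) \<subseteq> carrier RC" using iota_closed[OF sR] by blast
  have cau: "(\<lambda>k. to_completion R n (s k)) \<in> cauchy_seqs RC nC" by (rule F.conv_imp_cauchy[OF s(2) ri c])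
  interpret i: ring_hom_ring R RC "to_completion R n" by (intro ring_hom_ringI2 ring_axioms RC.ring_axioms iota_hom)
  have d: "nC (to_completion R n (s i) \<ominus>\<^bsub>RC\<^esub> to_completion R n (s j)) = n (s i \<ominus> s j)" for i j
    using nC_iota[of "s i \<ominus> s j"] sR by (simp add: a_minus_def)
  have sc: "s \<in> cauchy_seqs R n"
    using cau sR unfolding cauchy_seqs_def mem_Collect_eq d by blast
  have "c = cls s" by (rule F.conv_unique[OF s(2) iota_conv_cls[OF sc] ri c cls_in[OF sc]])
  then have "s \<in> c" using cls_mem[OF sc] sc by simp
  then show "c \<in> seq_closure S" unfolding seq_closure_def using c s(1) by blast
qed

lemma place_completionI:
  assumes K: "number_field K" and p: "rat_place p" and \<nu>: "normalized K p \<nu>" and cp: "is_Cp p C m h"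
  shows "place_completion (completion (num_ring K) \<nu>) (completion_abs (num_ring K) \<nu>) K \<nu> (to_completion (num_ring K) \<nu>) p C m h"
proof -
  note Kf = number_fieldD[OF K]
  interpret q: num_abs K \<nu> using Kf(1) \<nu> by (intro num_abs.intro) (auto simp: normalized_def)
  have QK: "\<rat> \<subseteq> carrier (num_ring K)" using csubfield_Rats_sub[OF Kf(1)] by simp
  show ?thesis
  proof (intro place_completion.intro place_completion_axioms.intro q.RC_valued_field K p \<nu> cp q.iota_hom)
    show "completion_abs (num_ring K) \<nu> (to_completion (num_ring K) \<nu> x) = \<nu> x" if "x \<in> K" for x
      using q.nC_iota[of x] that by simp
    show "\<exists>s. range s \<subseteq> K \<and> valued_field.conv (completion (num_ring K) \<nu>) (completion_abs (num_ring K) \<nu>)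
        (\<lambda>k. to_completion (num_ring K) \<nu> (s k)) c" if c: "c \<in> carrier (completion (num_ring K) \<nu>)" for c
    proof -
      obtain s where "s \<in> c" "s \<in> cauchy_seqs (num_ring K) \<nu>" using q.RC_elem[OF c] by metis
      then show ?thesis using q.iota_dense[OF c] by (intro exI[of _ s]) (auto simp: cauchy_seqs_def)
    qed
    show "valued_field.complete_on (completion (num_ring K) \<nu>) (completion_abs (num_ring K) \<nu>)
      {c \<in> carrier (completion (num_ring K) \<nu>). \<exists>s. range s \<subseteq> \<rat> \<and>
        valued_field.conv (completion (num_ring K) \<nu>) (completion_abs (num_ring K) \<nu>) (\<lambda>k. to_completion (num_ring K) \<nu> (s k)) c}"
      using q.RC_complete_on[OF QK] unfolding q.seq_closure_iff[OF QK] .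
  qed
qed

text \<open>\<open>place_abs K v\<close> is \<open>\<parallel>\<cdot>\<parallel>\<^sub>v\<close> restricted to \<open>K\<close>.\<close>

definition place_abs :: "complex set \<Rightarrow> place \<Rightarrow> complex \<Rightarrow> real" where
  "place_abs K v x = local_norm K v (to_local_field K v x)"

text \<open>Resolves the definitions of the local objects once and for all: with \<nu> from
  \<open>placeE\<close>, \<open>local_norm\<close> is the absolute value of the completion at \<nu>,
  and \<open>local_degree\<close> is a number of embeddings for every admissible target.\<close>

lemma place_local:
  assumes K: "number_field K" and v: "v \<in> places K"
  shows "rat_place (place_below v)" "normalized K (place_below v) (place_abs K v)"
    "\<exists>s>0. \<forall>x\<in>K. place_rep v x = place_abs K v x powr s"
    "complete_valued_field (local_field K v) (local_norm K v)"
    "local_norm K v \<in> absolute_values (local_field K v)"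
    "to_local_field K v \<in> ring_hom (num_ring K) (local_field K v)"
    "is_Cp (place_below v) C m h \<Longrightarrow>
      local_degree K v = card {\<psi> \<in> ring_hom (num_ring K) C. \<psi> \<in> extensional K \<and> (\<forall>x\<in>\<rat>. \<psi> x = h x) \<and> (\<forall>x\<in>K. m (\<psi> x) = place_abs K v x)}"
    "is_Cp (place_below v) C m h \<Longrightarrow> 0 < local_degree K v"
    "is_Cp (place_below v) C m h \<Longrightarrow>
      finite {\<psi> \<in> ring_hom (num_ring K) C. \<psi> \<in> extensional K \<and> (\<forall>x\<in>\<rat>. \<psi> x = h x) \<and> (\<forall>x\<in>K. m (\<psi> x) = place_abs K v x)}"
proof -
  note Kf = number_fieldD[OF K]
  obtain p \<nu> s where *: "rat_place p" "normalized K p \<nu>" "place_below v = p" "s > 0"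
    "\<And>x. x \<in> K \<Longrightarrow> place_rep v x = \<nu> x powr s"
    "local_field K v = completion (num_ring K) \<nu>" "to_local_field K v = to_completion (num_ring K) \<nu>"
    using placeE[OF K v] by metis
  interpret q: num_abs K \<nu> using Kf(1) *(2) by (intro num_abs.intro) (auto simp: normalized_def)
  have QK: "\<rat> \<subseteq> carrier (num_ring K)" using csubfield_Rats_sub[OF Kf(1)] by simp
  let ?F = "completion (num_ring K) \<nu>" and ?n = "completion_abs (num_ring K) \<nu>"
  have rats: "local_rationals K v = q.seq_closure \<rat>"
  proof -
    have "(\<exists>s::nat \<Rightarrow> rat. (\<lambda>k. of_rat (s k)) \<in> c) \<longleftrightarrow> (\<exists>s\<in>c. range s \<subseteq> \<rat>)" for c :: "(nat \<Rightarrow> complex) set"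
    proof
      assume "\<exists>s\<in>c. range s \<subseteq> \<rat>"
      then obtain s where s: "s \<in> c" "range s \<subseteq> \<rat>" by blast
      then have "\<forall>k. \<exists>r. s k = of_rat r" by (auto simp: Rats_def)
      then obtain r where "\<And>k. s k = of_rat (r k)" by metis
      then have "s = (\<lambda>k. of_rat (r k))" by blast
      then show "\<exists>s::nat \<Rightarrow> rat. (\<lambda>k. of_rat (s k)) \<in> c" using s(1) by auto
    next
      assume "\<exists>s::nat \<Rightarrow> rat. (\<lambda>k. of_rat (s k)) \<in> c"
      then obtain s :: "nat \<Rightarrow> rat" where s: "(\<lambda>k. of_rat (s k)) \<in> c" by (elim exE)
      show "\<exists>s\<in>c. range s \<subseteq> \<rat>" by (rule bexI[OF _ s]) auto
    qed
    then show ?thesis by (simp add: local_rationals_def q.seq_closure_def *(6))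
  qed
  \<comment> \<open>Uniqueness over \<open>Q\<close> is proved inside
    \<open>place_completion\<close>, which includes a target field. An arbitrary one is inserted
    here; the facts taken from this interpretation do not mention it.\<close>
  obtain C0 :: "local_closure_elem ring" and m0 h0
    where cp0: "is_Cp p C0 m0 h0" using Cp_exists[OF *(1)] by blast
  interpret L: place_completion ?F ?n K \<nu> "to_completion (num_ring K) \<nu>" p C0 m0 h0
    by (rule place_completionI[OF K *(1,2) cp0])
  have LQ: "L.Q = local_rationals K v" unfolding rats q.seq_closure_iff[OF QK] L.Q_def ..
  have lim: "(\<lambda>k. rat_abs p (s k)) \<longlonglongrightarrow> ?n c" if "c \<in> carrier ?F" "(\<lambda>k. of_rat (s k)) \<in> c" for c and s :: "nat \<Rightarrow> rat"
    using q.nC_tendsto[OF that] *(2) by (simp add: normalized_def)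
  \<comment> \<open>The description prescribes values only on classes of rational sequences. These
    classes form the p-adic subfield, and \<open>abs_unique_Q\<close> determines the rest.\<close>
  have ln: "local_norm K v = ?n"
    unfolding local_norm_def *(3,6)
  proof (rule the_equality)
    show "?n \<in> absolute_values ?F \<and>
      (\<forall>c\<in>carrier ?F. \<forall>s :: nat \<Rightarrow> rat. (\<lambda>k. of_rat (s k)) \<in> c \<longrightarrow> (\<lambda>k. rat_abs p (s k)) \<longlonglongrightarrow> ?n c)"
      using q.nC_abs lim by blast
    fix n' assume n': "n' \<in> absolute_values ?F \<and>
      (\<forall>c\<in>carrier ?F. \<forall>s :: nat \<Rightarrow> rat. (\<lambda>k. of_rat (s k)) \<in> c \<longrightarrow> (\<lambda>k. rat_abs p (s k)) \<longlonglongrightarrow> n' c)"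
    have "n' c = ?n c" if c: "c \<in> L.Q" for c
    proof -
      obtain s :: "nat \<Rightarrow> rat" where s: "c \<in> carrier ?F" "(\<lambda>k. of_rat (s k)) \<in> c"
        using c unfolding LQ by (auto simp: local_rationals_def *(6))
      then have "(\<lambda>k. rat_abs p (s k)) \<longlonglongrightarrow> n' c" using n' by blast
      then show ?thesis using lim[OF s] by (rule LIMSEQ_unique)
    qed
    then have "n' c = ?n c" if "c \<in> carrier ?F" for c
      using L.abs_unique_Q[of n' c] n' that by (simp add: absolute_values_iff)
    then show "n' = ?n" using n' q.nC_abs by (intro extensionalityI[of _ "carrier ?F"]) (auto simp: absolute_values_iff)
  qed
  have place_abs: "place_abs K v x = \<nu> x" if "x \<in> K" for x
    using L.n_iota[OF that] by (simp add: place_abs_def ln *(7))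
  show "rat_place (place_below v)" using *(1,3) by simp
  have "is_abs (num_ring K) (place_abs K v) \<longleftrightarrow> is_abs (num_ring K) \<nu>"
    by (rule is_abs_cong) (use place_abs q.ring_axioms in auto)
  then show "normalized K (place_below v) (place_abs K v)"
    using *(2,3) place_abs[OF csubfieldD(12)[OF Kf(1)]] by (simp add: normalized_def)
  show "\<exists>s>0. \<forall>x\<in>K. place_rep v x = place_abs K v x powr s" using *(4,5) place_abs by auto
  show "complete_valued_field (local_field K v) (local_norm K v)"
    unfolding *(6) ln by (intro complete_valued_field.intro complete_valued_field_axioms.intro q.RC_valued_field q.RC_complete)
  show "local_norm K v \<in> absolute_values (local_field K v)" unfolding *(6) ln by (rule q.nC_abs)
  show "to_local_field K v \<in> ring_hom (num_ring K) (local_field K v)" unfolding *(6,7) by (rule q.iota_hom)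
  have "local_degree K v = card {\<psi> \<in> ring_hom (num_ring K) C. \<psi> \<in> extensional K \<and> (\<forall>x\<in>\<rat>. \<psi> x = h x) \<and> (\<forall>x\<in>K. m (\<psi> x) = place_abs K v x)}
    \<and> 0 < local_degree K v \<and> finite {\<psi> \<in> ring_hom (num_ring K) C. \<psi> \<in> extensional K \<and> (\<forall>x\<in>\<rat>. \<psi> x = h x) \<and> (\<forall>x\<in>K. m (\<psi> x) = place_abs K v x)}"
    if cp: "is_Cp (place_below v) C m h"
  proof -
    have cp': "is_Cp p C m h" using cp *(3) by simp
    interpret M: place_completion ?F ?n K \<nu> "to_completion (num_ring K) \<nu>" p C m h
      by (rule place_completionI[OF K *(1,2) cp'])
    have MQ: "M.Q = local_rationals K v" unfolding rats q.seq_closure_iff[OF QK] M.Q_def ..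
    have "M.H = {\<psi> \<in> ring_hom (num_ring K) C. \<psi> \<in> extensional K \<and> (\<forall>x\<in>\<rat>. \<psi> x = h x) \<and> (\<forall>x\<in>K. m (\<psi> x) = place_abs K v x)}"
      unfolding M.H_def using place_abs by auto
    then show ?thesis using M.local_degree_H unfolding MQ by (simp add: local_degree_def *(6))
  qed
  then show "is_Cp (place_below v) C m h \<Longrightarrow>
      local_degree K v = card {\<psi> \<in> ring_hom (num_ring K) C. \<psi> \<in> extensional K \<and> (\<forall>x\<in>\<rat>. \<psi> x = h x) \<and> (\<forall>x\<in>K. m (\<psi> x) = place_abs K v x)}"
    "is_Cp (place_below v) C m h \<Longrightarrow> 0 < local_degree K v"
    "is_Cp (place_below v) C m h \<Longrightarrow>
      finite {\<psi> \<in> ring_hom (num_ring K) C. \<psi> \<in> extensional K \<and> (\<forall>x\<in>\<rat>. \<psi> x = h x) \<and> (\<forall>x\<in>K. m (\<psi> x) = place_abs K v x)}"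
    by blast+
qed

text \<open>One root at a time is split off as a monic linear factor, so the leading coefficient is
  unchanged and the multiset of roots loses one element.\<close>

lemma (in valued_field) eval_splitted:
  assumes "q \<in> carrier (poly_ring R)" "q \<noteq> []" "splitted q" and w: "w \<in> carrier R"
  shows "n (eval q w) = n (hd q) * (\<Prod>a\<in>#roots q. n (w \<ominus> a))"
  using assms(1-3)
proof (induction "Polynomials.degree q" arbitrary: q)
  case 0
  then obtain c where q: "q = [c]" by (cases q) auto
  have "c \<in> carrier R" using 0(2) q by (auto simp: univ_poly_carrier[symmetric] polynomial_def)
  moreover have "roots q = {#}" using 0 by (simp add: splitted_def)
  ultimately show ?case using q by simp
next
  case (Suc d)
  then have "roots q \<noteq> {#}" by (auto simp: splitted_def)
  then obtain a where a: "a \<in># roots q" by blast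
  then have ra: "is_root q a" using roots_mem_iff_is_root[OF Suc.prems(1)] by simp
  then have ac: "a \<in> carrier R" by (simp add: is_root_def)
  let ?l = "[\<one>, \<ominus> a]"
  have lP: "?l \<in> carrier (poly_ring R)" using ac by (auto simp: univ_poly_carrier[symmetric] polynomial_def)
  obtain r where r: "r \<in> carrier (poly_ring R)" "q = ?l \<otimes>\<^bsub>poly_ring R\<^esub> r"
    using is_root_imp_pdivides[OF Suc.prems(1) ra] unfolding pdivides_def factor_def by blast
  have r0: "r \<noteq> []" using r(2) Suc.prems(2) univ_poly_mult[of R "carrier R"] poly_mult_zero(2)[of ?l] ac by (auto simp del: poly_mult.simps)
  have rts: "roots q = add_mset a (roots r)" unfolding r(2) by (rule poly_mult_degree_one_monic_imp_same_roots[OF ac r(1) r0])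
  have deg: "Polynomials.degree q = 1 + Polynomials.degree r"
    using poly_mult_degree_eq[OF carrier_is_subring, of ?l r] lP r r0 by (simp add: univ_poly_carrier univ_poly_mult del: poly_mult.simps)
  have hd: "hd q = hd r"
  proof -
    have "hd (poly_mult ?l r) = hd ?l \<otimes> hd r"
      using lP r(1) r0 by (intro poly_mult_lead_coeff[OF carrier_is_subring]) (auto simp: univ_poly_carrier)
    moreover have "hd r \<in> carrier R" using r(1) r0 by (cases r) (auto simp: univ_poly_carrier[symmetric] polynomial_def)
    ultimately show ?thesis using r(2) by (simp add: univ_poly_mult del: poly_mult.simps)
  qed
  have IH: "n (eval r w) = n (hd r) * (\<Prod>a\<in>#roots r. n (w \<ominus> a))"
    using Suc.hyps(1)[of r] Suc.hyps(2) deg r(1) r0 Suc.prems(3) rts by (simp add: splitted_def)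
  have rset: "set r \<subseteq> carrier R" using r(1) by (auto simp: univ_poly_carrier[symmetric] polynomial_def)
  have "eval q w = eval ?l w \<otimes> eval r w"
    unfolding r(2) univ_poly_mult using ac by (intro eval_poly_mult[OF _ rset w]) auto
  also have "eval ?l w = w \<ominus> a" using ac w by (simp add: a_minus_def)
  finally have "n (eval q w) = n (w \<ominus> a) * n (eval r w)" using ac w eval_in_carrier[OF rset w] by simp
  then show ?case by (simp add: IH rts hd)
qed

lemma mset_eq_mset_set: "size M = card (set_mset M) \<Longrightarrow> M = mset_set (set_mset M)"
proof (rule ccontr)
  assume s: "size M = card (set_mset M)" and ne: "M \<noteq> mset_set (set_mset M)"
  have "mset_set (set_mset M) \<subset># M" using mset_set_set_mset_msubset[of M] ne by (simp add: subset_mset.less_le)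
  then have "size (mset_set (set_mset M)) < size M" by (rule mset_subset_size)
  then show False using s by simp
qed

section \<open>Embeddings of number fields above a fixed prime\<close>

locale embeddings =
  fixes p :: enat and C :: "'c ring" and m :: "'c \<Rightarrow> real" and h :: "complex \<Rightarrow> 'c"
  assumes rp: "rat_place p" and cp: "is_Cp p C m h"
begin

sublocale S: algebraically_closed C using cp by (simp add: is_Cp_def)
sublocale S: valued_field C m
  using cp S.field_axioms by (simp add: is_Cp_def valued_field_def valued_field_axioms_def)

lemma CC_field: "field (num_ring UNIV)" by (rule num_ring_field_UNIV)

lemma field_homs: "field_homs (num_ring UNIV) C"
proof (intro field_homs.intro CC_field S.algebraically_closed_axioms field_homs_axioms.intro)
  interpret CC: field "num_ring UNIV" by (rule num_ring_field_UNIV)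
  fix k :: nat assume "k > 0"
  have "[k] \<cdot>\<^bsub>num_ring UNIV\<^esub> \<one>\<^bsub>num_ring UNIV\<^esub> = of_nat k" for k :: nat by (induction k) auto
  then show "[k] \<cdot>\<^bsub>num_ring UNIV\<^esub> \<one>\<^bsub>num_ring UNIV\<^esub> \<noteq> \<zero>\<^bsub>num_ring UNIV\<^esub>" using \<open>k > 0\<close> by simp
qed

definition Hom :: "complex set \<Rightarrow> (complex \<Rightarrow> 'c) set" where
  "Hom K = {\<psi> \<in> ring_hom (num_ring K) C. \<psi> \<in> extensional K \<and> (\<forall>x\<in>\<rat>. \<psi> x = h x)}"

lemma Hom_Ext: "Hom K = field_homs.Ext (num_ring UNIV) C \<rat> K h"
  unfolding Hom_def field_homs.Ext_def[OF field_homs] num_ring_carrier_update ..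

lemma h_hom: "h \<in> ring_hom ((num_ring UNIV)\<lparr>carrier := \<rat>\<rparr>) C"
  using cp unfolding num_ring_carrier_update by (simp add: is_Cp_def)

lemma card_Hom:
  assumes K: "number_field K"
  shows "finite (Hom K)" "card (Hom K) = field_degree K" "field_degree K > 0"
proof -
  interpret CC: field "num_ring UNIV" by (rule num_ring_field_UNIV)
  note Kf = number_fieldD[OF K]
  obtain d where d: "CC.dimension d \<rat> K" using Kf(2) by (auto simp: CC.finite_dimension_def)
  have "field_degree K = d" using CC.dimI[OF csubfield_Rats d] by (simp add: field_degree_def over_def)
  then show "finite (Hom K)" "card (Hom K) = field_degree K" "field_degree K > 0"
    using field_homs.card_Ext[OF field_homs csubfield_Rats Kf(1) csubfield_Rats_sub[OF Kf(1)] d h_hom] by (auto simp: Hom_Ext)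
qed

definition fibre :: "complex set \<Rightarrow> place \<Rightarrow> (complex \<Rightarrow> 'c) set" where
  "fibre K v = {\<psi> \<in> Hom K. \<forall>x\<in>K. m (\<psi> x) = place_abs K v x}"

definition over_p :: "complex set \<Rightarrow> place set" where
  "over_p K = {v \<in> places K. place_below v = p}"

lemma fibre_card:
  assumes K: "number_field K" and v: "v \<in> over_p K"
  shows "finite (fibre K v)" "card (fibre K v) = local_degree K v" "local_degree K v > 0"
proof -
  have v': "v \<in> places K" and cp': "is_Cp (place_below v) C m h" using v cp by (auto simp: over_p_def)
  have "fibre K v = {\<psi> \<in> ring_hom (num_ring K) C. \<psi> \<in> extensional K \<and> (\<forall>x\<in>\<rat>. \<psi> x = h x) \<and> (\<forall>x\<in>K. m (\<psi> x) = place_abs K v x)}"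
    by (auto simp: fibre_def Hom_def)
  then show "finite (fibre K v)" "card (fibre K v) = local_degree K v" "local_degree K v > 0"
    using place_local(7-9)[OF K v' cp'] by auto
qed

lemma Hom_normalized: assumes K: "number_field K" and \<psi>: "\<psi> \<in> Hom K" shows "normalized K p (\<lambda>x. m (\<psi> x))"
proof -
  note Kf = number_fieldD[OF K]
  interpret q: field "num_ring K" by (rule csubfield_field[OF Kf(1)])
  have hom: "\<psi> \<in> ring_hom (num_ring K) C" using \<psi> by (simp add: Hom_def)
  interpret r: ring_hom_ring "num_ring K" C \<psi> by (intro ring_hom_ringI2 q.ring_axioms S.ring_axioms hom)
  have inj: "inj_on \<psi> K" using non_trivial_field_hom_is_inj[OF hom q.field_axioms S.field_axioms] by simp
  have "m (\<psi> x) = 0 \<longleftrightarrow> x = 0" if x: "x \<in> K" for x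
  proof -
    have "\<psi> 0 = \<zero>\<^bsub>C\<^esub>" using r.hom_zero by simp
    then have "\<psi> x = \<zero>\<^bsub>C\<^esub> \<longleftrightarrow> x = 0" using inj_onD[OF inj, of x 0] x csubfieldD(1)[OF Kf(1)] by auto
    then show ?thesis using S.n_eq_0_iff[of "\<psi> x"] r.hom_closed[of x] x by simp
  qed
  moreover have "m (\<psi> (x * y)) = m (\<psi> x) * m (\<psi> y)" "m (\<psi> (x + y)) \<le> m (\<psi> x) + m (\<psi> y)" if "x \<in> K" "y \<in> K" for x y
    using that r.hom_mult[of x y] r.hom_add[of x y] r.hom_closed[of x] r.hom_closed[of y] S.n_add[of "\<psi> x" "\<psi> y"] by auto
  moreover have "0 \<le> m (\<psi> x)" if "x \<in> K" for x using r.hom_closed[of x] that by simp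
  moreover have "m (\<psi> (of_rat r)) = rat_abs p r" for r
    using \<psi> cp by (simp add: Hom_def is_Cp_def)
  ultimately show ?thesis unfolding normalized_def is_abs_def by simp
qed

text \<open>Every embedding pulls m back to a normalized absolute value, whose class is a place
  above p; \<open>normalized_eq\<close> identifies that absolute value with \<open>place_abs\<close>
  of the place.\<close>

lemma Hom_fibres: assumes K: "number_field K" shows "Hom K = (\<Union>v\<in>over_p K. fibre K v)"
proof (intro equalityI subsetI)
  fix \<psi> assume \<psi>: "\<psi> \<in> Hom K"
  note n = Hom_normalized[OF K \<psi>]
  obtain v s where v: "v \<in> places K" "place_below v = p" "s > 0" "\<forall>x\<in>K. place_rep v x = m (\<psi> x) powr s"
    using place_exists[OF K rp n] by blast
  note pl = place_local[OF K v(1)]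
  obtain t where t: "t > 0" "\<forall>x\<in>K. place_rep v x = place_abs K v x powr t" using pl(3) by blast
  have "m (\<psi> x) = place_abs K v x" if "x \<in> K" for x
    by (rule normalized_eq[OF number_fieldD(1)[OF K] rp n _ v(3) t(1) _ that]) (use pl(2) v t in auto)
  then have "\<psi> \<in> fibre K v" using \<psi> by (simp add: fibre_def)
  then show "\<psi> \<in> (\<Union>v\<in>over_p K. fibre K v)" using v by (auto simp: over_p_def)
qed (auto simp: fibre_def)

lemma fibre_disjoint:
  assumes K: "number_field K" and "v \<in> over_p K" "w \<in> over_p K" "v \<noteq> w" shows "fibre K v \<inter> fibre K w = {}"
proof (rule ccontr)
  assume "fibre K v \<inter> fibre K w \<noteq> {}"
  then obtain \<psi> where \<psi>: "\<psi> \<in> fibre K v" "\<psi> \<in> fibre K w" by blast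
  have eq: "place_abs K w x = place_abs K v x" if "x \<in> K" for x using \<psi> that by (simp add: fibre_def)
  have vw: "v \<in> places K" "w \<in> places K" using assms by (auto simp: over_p_def)
  obtain s where s: "s > 0" "\<And>x. x \<in> K \<Longrightarrow> place_rep v x = place_abs K v x powr s" using place_local(3)[OF K vw(1)] by blast
  obtain t where t: "t > 0" "\<And>x. x \<in> K \<Longrightarrow> place_rep w x = place_abs K w x powr t" using place_local(3)[OF K vw(2)] by blast
  have pos: "0 \<le> place_abs K v x" if "x \<in> K" for x using place_local(2)[OF K vw(1)] that by (auto simp: normalized_def is_abs_def)
  have "v = w" by (rule place_eqI[OF K vw s t(1) _ pos]) (use t(2) eq in auto)
  then show False using assms by simp
qed

text \<open>The fibres are nonempty, because their cardinality is a positive local degree, and they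
  are disjoint. One embedding from each fibre gives an injection into the finite set
  \<open>Hom K\<close>.\<close>

lemma finite_over_p: assumes K: "number_field K" shows "finite (over_p K)"
proof (rule inj_on_finite)
  define f where "f = (\<lambda>v. SOME \<psi>. \<psi> \<in> fibre K v)"
  have f: "f v \<in> fibre K v" if v: "v \<in> over_p K" for v
  proof -
    have "fibre K v \<noteq> {}" using fibre_card[OF K v] by auto
    then show ?thesis unfolding f_def by (rule some_in_eq[THEN iffD2])
  qed
  show "inj_on f (over_p K)"
  proof (rule inj_onI, rule ccontr)
    fix v w assume a: "v \<in> over_p K" "w \<in> over_p K" "f v = f w" "v \<noteq> w"
    then show False using fibre_disjoint[OF K a(1,2,4)] f[OF a(1)] f[OF a(2)] by auto
  qed
  show "f ` over_p K \<subseteq> Hom K" using f by (auto simp: fibre_def)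
  show "finite (Hom K)" by (rule card_Hom(1)[OF K])
qed

lemma sum_over_p:
  assumes K: "number_field K" and x: "x \<in> K"
  shows "(\<Sum>v\<in>over_p K. real (local_degree K v) * f (place_abs K v x)) = (\<Sum>\<psi>\<in>Hom K. f (m (\<psi> x)))"
proof -
  have "(\<Sum>\<psi>\<in>Hom K. f (m (\<psi> x))) = (\<Sum>v\<in>over_p K. \<Sum>\<psi>\<in>fibre K v. f (m (\<psi> x)))"
    unfolding Hom_fibres[OF K] using finite_over_p[OF K] fibre_card(1)[OF K] fibre_disjoint[OF K]
    by (intro sum.UNION_disjoint) blast+
  also have "\<dots> = (\<Sum>v\<in>over_p K. real (local_degree K v) * f (place_abs K v x))"
  proof (rule sum.cong[OF refl])
    fix v assume v: "v \<in> over_p K"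
    have "(\<Sum>\<psi>\<in>fibre K v. f (m (\<psi> x))) = (\<Sum>\<psi>\<in>fibre K v. f (place_abs K v x))"
      using x by (intro sum.cong) (auto simp: fibre_def)
    then show "(\<Sum>\<psi>\<in>fibre K v. f (m (\<psi> x))) = real (local_degree K v) * f (place_abs K v x)"
      using fibre_card(2)[OF K v] by simp
  qed
  finally show ?thesis by simp
qed

text \<open>Needed later for the exponent in \<open>local_abs\<close> to be at most 1, without which
  the power could violate the triangle inequality.\<close>

lemma local_degree_le: assumes K: "number_field K" and v: "v \<in> over_p K" shows "local_degree K v \<le> field_degree K"
proof -
  have "fibre K v \<subseteq> Hom K" by (auto simp: fibre_def)
  from card_mono[OF card_Hom(1)[OF K] this] show ?thesis unfolding fibre_card(2)[OF K v] card_Hom(2)[OF K] .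
qed

definition irr :: "complex \<Rightarrow> complex list" where
  "irr x = ring.Irr (num_ring UNIV) \<rat> x"

definition conj :: "complex \<Rightarrow> 'c set" where
  "conj x = {z \<in> carrier C. S.eval (map h (irr x)) z = \<zero>\<^bsub>C\<^esub>}"

lemma algebraic_in: assumes K: "number_field K" and x: "x \<in> K"
  shows "(ring.algebraic (num_ring UNIV) over \<rat>) x"
proof -
  interpret CC: field "num_ring UNIV" by (rule num_ring_field_UNIV)
  show ?thesis using CC.finite_dimension_imp_algebraic[OF csubfield_Rats subfieldE(1) _ x] number_fieldD[OF K] by blast
qed

text \<open>Embeddings of \<rat>(x) correspond to the roots of the minimal polynomial, and each
  extends to K in [K : \<rat>(x)] ways. This multiplicity is \<open>e'\<close>; it cancels on
  forming means.\<close>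

lemma sum_Hom_conj:
  assumes K: "number_field K" and x: "x \<in> K"
  shows "finite (conj x)" "card (conj x) > 0"
    "(\<Sum>\<psi>\<in>Hom K. f (\<psi> x)) / real (field_degree K) = (\<Sum>z\<in>conj x. f z :: real) / real (card (conj x))"
proof -
  interpret CC: field "num_ring UNIV" by (rule num_ring_field_UNIV)
  interpret fh: field_homs "num_ring UNIV" C by (rule field_homs)
  note Kf = number_fieldD[OF K]
  have xc: "x \<in> carrier (num_ring UNIV)" by simp
  note xa = algebraic_in[OF K x]
  let ?M = "CC.simple_extension \<rat> x"
  have M: "csubfield ?M" using CC.simple_extension_is_subfield[OF csubfield_Rats xc] xa by simp
  have QK: "\<rat> \<subseteq> K" by (rule csubfield_Rats_sub[OF Kf(1)])
  have MK: "?M \<subseteq> K" using CC.simple_extension_subring_incl[OF subfieldE(1)[OF Kf(1)] QK x] .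
  have QM: "\<rat> \<subseteq> ?M" by (rule csubfield_Rats_sub[OF M])
  obtain d where d: "CC.dimension d \<rat> K" using Kf(2) by (auto simp: CC.finite_dimension_def)
  obtain e' where e': "CC.dimension e' ?M K" using CC.dimension_intermediate[OF csubfield_Rats M Kf(1) QM MK d] by blast
  have bij: "bij_betw (\<lambda>\<rho>. \<rho> x) (fh.Ext \<rat> ?M h) (conj x)"
    using fh.Ext_bij[OF csubfield_Rats h_hom xc xa] by (simp add: conj_def irr_def)
  have cpos: "finite (conj x) \<and> card (conj x) > 0"
  proof -
    have "card (conj x) = Polynomials.degree (irr x)" using fh.card_roots_Irr[OF csubfield_Rats h_hom xc xa] by (simp add: conj_def irr_def)
    then have "card (conj x) > 0" using fh.Irr_degree_pos[OF csubfield_Rats h_hom xc xa] by (simp add: irr_def)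
    then show ?thesis by (auto intro: card_ge_0_finite)
  qed
  then show "finite (conj x)" "card (conj x) > 0" by auto
  have finM: "finite (fh.Ext \<rat> ?M h)" using bij_betw_finite[OF bij] cpos by simp
  have ext: "finite (fh.Ext ?M K \<tau>) \<and> card (fh.Ext ?M K \<tau>) = e' \<and> e' > 0" if \<tau>: "\<tau> \<in> fh.Ext \<rat> ?M h" for \<tau>
  proof -
    have t: "\<tau> \<in> ring_hom (num_ring UNIV\<lparr>carrier := ?M\<rparr>) C" using \<tau> by (simp add: fh.Ext_def)
    show ?thesis using fh.card_Ext[OF M Kf(1) MK e' t] by simp
  qed
  have un: "Hom K = (\<Union>\<tau>\<in>fh.Ext \<rat> ?M h. fh.Ext ?M K \<tau>)" unfolding Hom_Ext by (rule fh.Ext_tower[OF M QM MK])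
  have xM: "x \<in> ?M" using CC.simple_extension_mem[OF subfieldE(1)[OF csubfield_Rats] xc] .
  have sum: "(\<Sum>\<psi>\<in>Hom K. g (\<psi> x)) = real e' * (\<Sum>z\<in>conj x. g z)" for g :: "'c \<Rightarrow> real"
  proof -
    have "(\<Sum>\<psi>\<in>Hom K. g (\<psi> x)) = (\<Sum>\<tau>\<in>fh.Ext \<rat> ?M h. \<Sum>\<psi>\<in>fh.Ext ?M K \<tau>. g (\<psi> x))"
      unfolding un using finM ext fh.Ext_disjoint by (intro sum.UNION_disjoint) blast+
    also have "\<dots> = (\<Sum>\<tau>\<in>fh.Ext \<rat> ?M h. real e' * g (\<tau> x))"
    proof (rule sum.cong[OF refl])
      fix \<tau> assume \<tau>: "\<tau> \<in> fh.Ext \<rat> ?M h"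
      have "(\<Sum>\<psi>\<in>fh.Ext ?M K \<tau>. g (\<psi> x)) = (\<Sum>\<psi>\<in>fh.Ext ?M K \<tau>. g (\<tau> x))"
        using xM by (intro sum.cong) (auto simp: fh.Ext_def)
      then show "(\<Sum>\<psi>\<in>fh.Ext ?M K \<tau>. g (\<psi> x)) = real e' * g (\<tau> x)" using ext[OF \<tau>] by simp
    qed
    also have "\<dots> = real e' * (\<Sum>\<tau>\<in>fh.Ext \<rat> ?M h. g (\<tau> x))" by (simp add: sum_distrib_left)
    also have "(\<Sum>\<tau>\<in>fh.Ext \<rat> ?M h. g (\<tau> x)) = (\<Sum>z\<in>conj x. g z)" by (rule sum.reindex_bij_betw[OF bij])
    finally show ?thesis .
  qed
  have "real (field_degree K) = real e' * real (card (conj x))"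
    using sum[of "\<lambda>_. 1"] card_Hom(2)[OF K] by simp
  moreover have "e' > 0"
    using calculation card_Hom(3)[OF K] by (intro gr0I) auto
  ultimately show "(\<Sum>\<psi>\<in>Hom K. f (\<psi> x)) / real (field_degree K) = (\<Sum>z\<in>conj x. f z :: real) / real (card (conj x))"
    unfolding sum by simp
qed

lemma local_sum:
  assumes K: "number_field K" and x: "x \<in> K"
  shows "(\<Sum>v\<in>over_p K. real (local_degree K v) / real (field_degree K) * f (place_abs K v x)) = (\<Sum>z\<in>conj x. f (m z)) / real (card (conj x))"
proof -
  have "(\<Sum>v\<in>over_p K. real (local_degree K v) / real (field_degree K) * f (place_abs K v x))
      = (\<Sum>v\<in>over_p K. real (local_degree K v) * f (place_abs K v x)) / real (field_degree K)"
    by (simp add: sum_divide_distrib)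
  then show ?thesis using sum_over_p[OF K x] sum_Hom_conj(3)[OF K x, of "\<lambda>z. f (m z)"] by simp
qed

text \<open>The minimal polynomial is monic and splits in C, so its value r at 0 is up to sign the
  product of its roots. A nonzero x has nonzero conjugates because each is the image of x under an
  injective homomorphism.\<close>

lemma prod_conj:
  assumes K: "number_field K" and x: "x \<in> K" and r: "of_rat r = ring.eval (num_ring UNIV) (irr x) 0"
  shows "(\<Prod>z\<in>conj x. m z) = rat_abs p r" "x \<noteq> 0 \<Longrightarrow> r \<noteq> 0" "x \<noteq> 0 \<Longrightarrow> z \<in> conj x \<Longrightarrow> m z > 0"
proof -
  interpret CC: field "num_ring UNIV" by (rule num_ring_field_UNIV)
  interpret fh: field_homs "num_ring UNIV" C by (rule field_homs)
  interpret qq: field "num_ring \<rat>" by (rule csubfield_field[OF csubfield_Rats])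
  have hq: "h \<in> ring_hom (num_ring \<rat>) C" using cp by (simp add: is_Cp_def)
  interpret hh: ring_hom_ring "num_ring \<rat>" C h by (intro ring_hom_ringI2 qq.ring_axioms S.ring_axioms hq)
  have xc: "x \<in> carrier (num_ring UNIV)" by simp
  note xa = algebraic_in[OF K x]
  note Irr = CC.IrrE[OF csubfield_Rats xc xa]
  have QX: "univ_poly (num_ring UNIV) \<rat> = poly_ring (num_ring \<rat>)"
    using CC.univ_poly_consistent[OF subfieldE(1)[OF csubfield_Rats]] by (simp add: num_ring_carrier_update)
  have iP: "irr x \<in> carrier (poly_ring (num_ring \<rat>))" using Irr(1) QX by (simp add: irr_def)
  have iset: "set (irr x) \<subseteq> \<rat>" using iP by (auto simp: univ_poly_carrier[symmetric] polynomial_def)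
  have mP: "map h (irr x) \<in> carrier (poly_ring C)" by (rule polynomial_hom[OF hq qq.field_axioms S.field_axioms iP])
  have deg: "card (conj x) = Polynomials.degree (irr x)" "Polynomials.degree (irr x) > 0"
    using fh.card_roots_Irr[OF csubfield_Rats h_hom xc xa] fh.Irr_degree_pos[OF csubfield_Rats h_hom xc xa] by (auto simp: conj_def irr_def)
  have ne: "irr x \<noteq> []" using deg(2) by auto
  have sp: "S.splitted (map h (irr x))" by (rule S.roots_over_carrier[OF mP])
  have setr: "set_mset (S.roots (map h (irr x))) = conj x"
    using S.roots_mem_iff_is_root[OF mP] ne by (auto simp: conj_def S.is_root_def)
  \<comment> \<open>There are as many distinct roots as the degree, so no root is repeated and the
    product over the multiset is one over \<open>conj x\<close>.\<close>
  have rts: "S.roots (map h (irr x)) = mset_set (conj x)"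
    using mset_eq_mset_set[of "S.roots (map h (irr x))"] sp deg(1) by (simp add: S.splitted_def setr)
  have hd: "hd (map h (irr x)) = \<one>\<^bsub>C\<^esub>" using Irr(3) ne hh.hom_one by (simp add: irr_def hd_map)
  have cc: "z \<in> carrier C" if "z \<in> conj x" for z using that by (simp add: conj_def)
  have "m (S.eval (map h (irr x)) \<zero>\<^bsub>C\<^esub>) = m (hd (map h (irr x))) * (\<Prod>a\<in>#S.roots (map h (irr x)). m (\<zero>\<^bsub>C\<^esub> \<ominus>\<^bsub>C\<^esub> a))"
    using ne by (intro S.eval_splitted[OF mP _ sp]) auto
  also have "\<dots> = (\<Prod>z\<in>conj x. m (\<zero>\<^bsub>C\<^esub> \<ominus>\<^bsub>C\<^esub> z))" unfolding hd rts by (simp add: prod_unfold_prod_mset)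
  also have "\<dots> = (\<Prod>z\<in>conj x. m z)"
    using cc by (intro prod.cong) (auto simp: a_minus_def)
  finally have 1: "m (S.eval (map h (irr x)) \<zero>\<^bsub>C\<^esub>) = (\<Prod>z\<in>conj x. m z)" .
  have "h (qq.eval (irr x) 0) = S.eval (map h (irr x)) (h 0)" using iset by (intro hh.eval_hom') auto
  moreover have "qq.eval (irr x) 0 = of_rat r"
    using r CC.eval_consistent[OF subfieldE(1)[OF csubfield_Rats]] by (simp add: num_ring_carrier_update)
  moreover have "h 0 = \<zero>\<^bsub>C\<^esub>" using hh.hom_zero by simp
  ultimately have "S.eval (map h (irr x)) \<zero>\<^bsub>C\<^esub> = h (of_rat r)" by simp
  then show prod: "(\<Prod>z\<in>conj x. m z) = rat_abs p r" using 1 cp by (simp add: is_Cp_def)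
  show pos: "m z > 0" if x0: "x \<noteq> 0" and z: "z \<in> conj x" for z
  proof -
    let ?M = "CC.simple_extension \<rat> x"
    have M: "csubfield ?M" using CC.simple_extension_is_subfield[OF csubfield_Rats xc] xa by simp
    obtain \<rho> where \<rho>: "\<rho> \<in> fh.Ext \<rat> ?M h" "\<rho> x = z"
      using fh.hom_lift[OF csubfield_Rats h_hom xc xa, of z] z by (auto simp: conj_def irr_def)
    have rh: "\<rho> \<in> ring_hom (num_ring ?M) C" using \<rho>(1) by (simp add: fh.Ext_def num_ring_carrier_update)
    interpret Mf: field "num_ring ?M" by (rule csubfield_field[OF M])
    interpret r: ring_hom_ring "num_ring ?M" C \<rho> by (intro ring_hom_ringI2 Mf.ring_axioms S.ring_axioms rh)
    have inj: "inj_on \<rho> ?M" using non_trivial_field_hom_is_inj[OF rh Mf.field_axioms S.field_axioms] by simp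
    have xM: "x \<in> ?M" using CC.simple_extension_mem[OF subfieldE(1)[OF csubfield_Rats] xc] .
    have "z \<noteq> \<zero>\<^bsub>C\<^esub>"
    proof
      assume "z = \<zero>\<^bsub>C\<^esub>"
      then have "\<rho> x = \<rho> 0" using \<rho>(2) r.hom_zero by simp
      then show False using inj_onD[OF inj _ xM csubfieldD(1)[OF M]] x0 by simp
    qed
    then show ?thesis using S.n_pos[OF cc[OF z]] by simp
  qed
  show "r \<noteq> 0" if "x \<noteq> 0"
  proof
    assume "r = 0"
    then have "(\<Prod>z\<in>conj x. m z) = 0" using prod by simp
    moreover have "(\<Prod>z\<in>conj x. m z) > 0" by (intro prod_pos pos[OF that])
    ultimately show False by simp
  qed
qed

end

section \<open>Heights and the product formula\<close>

lemma CC_eval: "ring.eval (num_ring UNIV) p x = poly (Poly (rev p)) x"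
proof -
  interpret CC: field "num_ring UNIV" by (rule num_ring_field_UNIV)
  show ?thesis
  proof (induction p)
    case (Cons a p)
    then show ?case by (simp add: Poly_append poly_monom mult.commute)
  qed simp
qed

lemma number_field_algebraic:
  assumes K: "number_field K" and x: "x \<in> K" shows "algebraic x"
proof -
  interpret CC: field "num_ring UNIV" by (rule num_ring_field_UNIV)
  have "(CC.algebraic over \<rat>) x"
    using CC.finite_dimension_imp_algebraic[OF csubfield_Rats subfieldE(1) _ x] number_fieldD[OF K] by blast
  then obtain p where p: "p \<in> carrier (univ_poly (num_ring UNIV) \<rat>)" "p \<noteq> []" "CC.eval p x = 0"
    using CC.algebraicE[OF subfieldE(1)[OF csubfield_Rats], of x] by auto
  have lead: "hd p \<noteq> 0" "set p \<subseteq> \<rat>" using p(1,2) by (auto simp: univ_poly_carrier[symmetric] polynomial_def)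
  have "Poly (rev p) \<noteq> 0"
  proof
    assume "Poly (rev p) = 0"
    then obtain k where "rev p = replicate k 0" by (auto simp: Poly_eq_0)
    then have "set (rev p) \<subseteq> {0}" by (metis set_replicate_Suc replicate_0 set_empty2 empty_subsetI order_refl not0_implies_Suc)
    then have "set p \<subseteq> {0}" by simp
    then show False using lead(1) p(2) by (cases p) auto
  qed
  moreover have "Polynomial.coeff (Poly (rev p)) i \<in> \<rat>" for i
    using lead(2) nth_mem[of i "rev p"] by (auto simp: nth_default_def)
  moreover have "poly (Poly (rev p)) x = 0" using p(3) by (simp add: CC_eval)
  ultimately show ?thesis unfolding algebraic_altdef by blast
qed

section \<open>Triviality of a number at almost all places\<close>

lemma padic_abs_int: assumes q: "Factorial_Ring.prime q" shows "padic_abs q (of_int i) \<le> 1" "i \<noteq> 0 \<Longrightarrow> \<not> int q dvd i \<Longrightarrow> padic_abs q (of_int i) = 1"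
proof -
  have q1: "real q > 1" using prime_gt_1_nat[OF q] by simp
  have m: "multiplicity (int q) 1 = 0" using q by (intro multiplicity_unit_right) auto
  have *: "padic_abs q (of_int i) = inverse (real q ^ multiplicity (int q) i)" if "i \<noteq> 0"
    using padic_abs_quot[OF q that, of 1] m by (simp add: power_int_minus)
  have ge1: "real q ^ k \<ge> 1" for k using q1 by (simp add: one_le_power)
  show "padic_abs q (of_int i) \<le> 1"
  proof (cases "i = 0")
    case False
    show ?thesis unfolding *[OF False] using ge1 by (simp add: inverse_le_1_iff)
  qed (simp add: padic_abs_def)
  show "padic_abs q (of_int i) = 1" if "i \<noteq> 0" "\<not> int q dvd i"
    using *[OF that(1)] not_dvd_imp_multiplicity_0[OF that(2)] by simp
qed

text \<open>Raising the absolute value to a large power turns the triangle inequality into a contradiction.\<close>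

lemma normalized_le_1:
  assumes q: "Factorial_Ring.prime q" and K: "csubfield K" and x: "x \<in> K" and \<nu>: "normalized K (enat q) \<nu>"
    and f: "f \<noteq> 0" "\<And>i. Polynomial.coeff f i \<in> \<int>" "poly f x = 0"
    and a: "Polynomial.lead_coeff f = of_int a" "\<not> int q dvd a"
  shows "\<nu> x \<le> 1"
proof (rule ccontr)
  assume "\<not> \<nu> x \<le> 1"
  then have x1: "\<nu> x > 1" by simp
  interpret n: num_abs K \<nu> using K \<nu> by (intro num_abs.intro) (auto simp: normalized_def)
  define d where "d = Polynomial.degree f"
  have int1: "\<nu> (of_int i) = padic_abs q (of_int i)" for i
    using \<nu> by (metis normalized_def of_rat_of_int_eq rat_abs_def enat.simps(4))
  \<comment> \<open>Chosen so that \<nu>(x)^t = d + 1. The d lower terms of the equation f(x) = 0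
    can together reach only d (d + 1)^(d-1), less than the leading term (d + 1)^d.\<close>
  define t where "t = ln (real d + 1) / ln (\<nu> x)"
  have a0: "a \<noteq> 0" using a(2) by auto
  have d0: "d > 0"
  proof (rule ccontr)
    assume "\<not> d > 0"
    then obtain c where "f = [:c:]" using degree_eq_zeroE[of f] by (auto simp: d_def)
    then show False using f(1,3) by simp
  qed
  have t0: "t > 0" using d0 x1 by (simp add: t_def)
  have nat1: "\<nu> (of_nat k) \<le> 1" for k :: nat using int1[of "int k"] padic_abs_int(1)[OF q, of "int k"] by simp
  have le: "\<nu> (of_nat k) powr t \<le> real k" for k :: nat
  proof (cases "k = 0")
    case False
    have "\<nu> (of_nat k) powr t \<le> 1" using powr_mono2[of t "\<nu> (of_nat k)" 1] t0 nat1[of k] n.num_rules(1)[OF csubfieldD(10)[OF K]] by simp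
    then show ?thesis using False by simp
  qed (simp add: n.num_rules)
  interpret m: num_abs K "\<lambda>x. \<nu> x powr t" using n.abs_powr[OF t0 le] K by (intro num_abs.intro)
  define y where "y = \<nu> x powr t"
  have y: "y = real d + 1" using x1 d0 by (simp add: y_def t_def powr_def)
  have cK: "Polynomial.coeff f i \<in> K" for i using f(2)[of i] csubfieldD(11)[OF K] by (auto elim!: Ints_cases)
  have c1: "\<nu> (Polynomial.coeff f i) powr t \<le> 1" for i
  proof -
    obtain b where b: "Polynomial.coeff f i = of_int b" using f(2)[of i] by (auto elim: Ints_cases)
    have "\<nu> (Polynomial.coeff f i) \<le> 1" unfolding b int1 by (rule padic_abs_int(1)[OF q])
    then show ?thesis using powr_mono2[of t "\<nu> (Polynomial.coeff f i)" 1] t0 n.num_rules(1)[OF cK[of i]] by simp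
  qed
  have pw: "x ^ i \<in> K" for i by (rule csubfieldD(9)[OF K x])
  have "poly f x = (\<Sum>i\<le>d. Polynomial.coeff f i * x ^ i)" by (simp add: poly_altdef d_def)
  also have "\<dots> = (\<Sum>i<d. Polynomial.coeff f i * x ^ i) + of_int a * x ^ d"
    using a(1) by (simp add: d_def lessThan_Suc_atMost[symmetric])
  finally have eq: "of_int a * x ^ d = - (\<Sum>i<d. Polynomial.coeff f i * x ^ i)" using f(3) by (simp add: add_eq_0_iff2)
  have sm: "\<nu> (\<Sum>i<d. Polynomial.coeff f i * x ^ i) powr t \<le> (\<Sum>i<d. \<nu> (Polynomial.coeff f i * x ^ i) powr t) \<and>
      (\<Sum>i<d. Polynomial.coeff f i * x ^ i) \<in> K"
    by (intro m.nn_sum finite_lessThan csubfieldD(4)[OF K cK pw])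
  have aK: "of_int a \<in> K" by (rule csubfieldD(11)[OF K])
  have "y ^ d = \<nu> (of_int a * x ^ d) powr t"
    using m.num_rules(3)[OF aK pw] m.num_rules(8)[OF x] padic_abs_int(2)[OF q a0 a(2)] int1 by (simp add: y_def)
  also have "\<dots> = \<nu> (\<Sum>i<d. Polynomial.coeff f i * x ^ i) powr t" unfolding eq using m.num_rules(7) sm by simp
  also have "\<dots> \<le> (\<Sum>i<d. \<nu> (Polynomial.coeff f i * x ^ i) powr t)" using sm by simp
  also have "\<dots> \<le> (\<Sum>i<d. y ^ (d - 1))"
  proof (rule sum_mono)
    fix i assume i: "i \<in> {..<d}"
    have "\<nu> (Polynomial.coeff f i * x ^ i) powr t = \<nu> (Polynomial.coeff f i) powr t * y ^ i"
      using m.num_rules(3)[OF cK pw] m.num_rules(8)[OF x] by (simp add: y_def)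
    also have "\<dots> \<le> 1 * y ^ i" by (rule mult_right_mono[OF c1]) (simp add: y)
    also have "y ^ i \<le> y ^ (d - 1)" using i y by (intro power_increasing) auto
    finally show "\<nu> (Polynomial.coeff f i * x ^ i) powr t \<le> y ^ (d - 1)" by simp
  qed
  finally have "y * y ^ (d - 1) \<le> real d * y ^ (d - 1)" using d0 by (simp add: power_eq_if)
  moreover have "y ^ (d - 1) > 0" using y by simp
  ultimately have "y \<le> real d" by simp
  then show False using y by simp
qed

text \<open>An integral equation for x bounds x at every prime not dividing its leading coefficient.
  The exceptional set depends on x alone and not on K, so that sums over different number fields can
  be compared term by term.\<close>

lemma finite_bad:
  assumes x: "algebraic x"
  shows "\<exists>P. finite P \<and> (\<forall>p\<in>P. rat_place p) \<and>
    (\<forall>p K \<nu>. rat_place p \<longrightarrow> p \<notin> P \<longrightarrow> number_field K \<longrightarrow> x \<in> K \<longrightarrow> normalized K p \<nu> \<longrightarrow> \<nu> x \<le> 1)"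
proof -
  obtain f where f: "\<And>i. Polynomial.coeff f i \<in> \<int>" "f \<noteq> 0" "poly f x = 0" using x unfolding algebraic_def by blast
  obtain a where a: "Polynomial.lead_coeff f = of_int a" using f(1) by (auto elim: Ints_cases)
  have a0: "a \<noteq> 0" using a f(2) by auto
  define P where "P = insert \<infinity> (enat ` {q. Factorial_Ring.prime q \<and> int q dvd a})"
  have "{q. Factorial_Ring.prime q \<and> int q dvd a} \<subseteq> {..nat \<bar>a\<bar>}"
    using a0 by (auto dest!: dvd_imp_le_int)
  then have "finite P" unfolding P_def using finite_subset by blast
  moreover have "rat_place p" if "p \<in> P" for p using that by (auto simp: P_def rat_place_def)
  moreover have "\<nu> x \<le> 1" if h: "rat_place p" "p \<notin> P" "number_field K" "x \<in> K" "normalized K p \<nu>" for p K \<nu>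
  proof -
    obtain q where q: "Factorial_Ring.prime q" "p = enat q" using h(1,2) by (auto simp: rat_place_def P_def)
    have "\<not> int q dvd a" using q h(2) by (auto simp: P_def)
    then show ?thesis using normalized_le_1[OF q(1) number_fieldD(1)[OF h(3)] h(4) _ f(2,1,3) a] h(5) q(2) by simp
  qed
  ultimately show ?thesis by blast
qed

text \<open>\<open>finite_bad\<close> is applied to x and to its inverse.\<close>

lemma finite_bad_eq:
  assumes K: "number_field K" and x: "x \<in> K" "x \<noteq> 0"
  shows "\<exists>P. finite P \<and> (\<forall>p\<in>P. rat_place p) \<and>
    (\<forall>p K \<nu>. rat_place p \<longrightarrow> p \<notin> P \<longrightarrow> number_field K \<longrightarrow> x \<in> K \<longrightarrow> normalized K p \<nu> \<longrightarrow> \<nu> x = 1)"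
proof -
  have ix: "inverse x \<in> L" if "number_field L" "x \<in> L" for L
    using csubfieldD(7)[OF number_fieldD(1)[OF that(1)]] that(2) x(2) by blast
  obtain P where P: "finite P" "\<forall>p\<in>P. rat_place p"
    "\<And>p K \<nu>. rat_place p \<Longrightarrow> p \<notin> P \<Longrightarrow> number_field K \<Longrightarrow> x \<in> K \<Longrightarrow> normalized K p \<nu> \<Longrightarrow> \<nu> x \<le> 1"
    using finite_bad[OF number_field_algebraic[OF K x(1)]] by metis
  obtain P' where P': "finite P'" "\<forall>p\<in>P'. rat_place p"
    "\<And>p K \<nu>. rat_place p \<Longrightarrow> p \<notin> P' \<Longrightarrow> number_field K \<Longrightarrow> inverse x \<in> K \<Longrightarrow> normalized K p \<nu> \<Longrightarrow> \<nu> (inverse x) \<le> 1"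
    using finite_bad[OF number_field_algebraic[OF K ix[OF K x(1)]]] by metis
  have "\<nu> x = 1" if a: "rat_place p" "p \<notin> P \<union> P'" "number_field L" "x \<in> L" "normalized L p \<nu>" for p L \<nu>
  proof -
    interpret n: num_abs L \<nu> using number_fieldD(1)[OF a(3)] a(5) by (intro num_abs.intro) (auto simp: normalized_def)
    have "\<nu> x \<le> 1" using P(3)[OF a(1) _ a(3,4,5)] a(2) by simp
    moreover have "inverse (\<nu> x) \<le> 1" using P'(3)[OF a(1) _ a(3) ix[OF a(3,4)] a(5)] a(2) n.nn_inverse[OF a(4)] by simp
    moreover have "\<nu> x > 0" using n.num_rules(1,2)[OF a(4)] x(2) by simp
    ultimately show ?thesis by (simp add: inverse_le_1_iff)
  qed
  then show ?thesis using P(1,2) P'(1,2) by (intro exI[of _ "P \<union> P'"]) auto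
qed

text \<open>The product formula for one rational number, in terms of finite sums. Quantifying over
  all larger finite sets of places lets two such statements be combined over the union of their
  exceptional sets, and a later argument add further places.\<close>

definition rat_product :: "rat \<Rightarrow> bool" where
  "rat_product r \<longleftrightarrow> (\<exists>P0. finite P0 \<and> (\<forall>p\<in>P0. rat_place p) \<and>
     (\<forall>P. finite P \<longrightarrow> P0 \<subseteq> P \<longrightarrow> (\<forall>p\<in>P. rat_place p) \<longrightarrow> (\<Sum>p\<in>P. ln (rat_abs p r)) = 0))"

lemma rat_product_mult:
  assumes "rat_product r" "rat_product s" "r \<noteq> 0" "s \<noteq> 0" shows "rat_product (r * s)"
proof -
  obtain P where P: "finite P" "\<forall>p\<in>P. rat_place p" "\<And>A. finite A \<Longrightarrow> P \<subseteq> A \<Longrightarrow> \<forall>p\<in>A. rat_place p \<Longrightarrow> (\<Sum>p\<in>A. ln (rat_abs p r)) = 0"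
    using assms(1) unfolding rat_product_def by metis
  obtain Q where Q: "finite Q" "\<forall>p\<in>Q. rat_place p" "\<And>A. finite A \<Longrightarrow> Q \<subseteq> A \<Longrightarrow> \<forall>p\<in>A. rat_place p \<Longrightarrow> (\<Sum>p\<in>A. ln (rat_abs p s)) = 0"
    using assms(2) unfolding rat_product_def by metis
  have "(\<Sum>p\<in>A. ln (rat_abs p (r * s))) = 0" if A: "finite A" "P \<union> Q \<subseteq> A" "\<forall>p\<in>A. rat_place p" for A
  proof -
    have "(\<Sum>p\<in>A. ln (rat_abs p (r * s))) = (\<Sum>p\<in>A. ln (rat_abs p r) + ln (rat_abs p s))"
      using A(3) assms(3,4) rat_abs_eq_0 by (intro sum.cong) (auto simp: rat_abs_mult ln_mult rat_abs_nonneg order_less_le)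
    then show ?thesis using P(3)[of A] Q(3)[of A] A by (simp add: sum.distrib)
  qed
  then show ?thesis unfolding rat_product_def using P(1,2) Q(1,2) by (intro exI[of _ "P \<union> Q"]) auto
qed

lemma rat_product_one: "rat_product 1" "rat_product (-1)"
proof -
  have "rat_abs p (-1) = 1" if p: "rat_place p" for p
  proof -
    have "rat_abs p (-1) * rat_abs p (-1) = 1" using rat_abs_mult[OF p, of "-1" "-1"] rat_abs_one[OF p] by simp
    then show ?thesis using rat_abs_nonneg[of p "-1"] by (metis abs_of_nonneg abs_square_eq_1 power2_eq_square)
  qed
  then show "rat_product 1" "rat_product (-1)" unfolding rat_product_def by (auto simp: rat_abs_one intro!: exI[of _ "{}"])
qed

lemma rat_product_prime: assumes q: "Factorial_Ring.prime q" shows "rat_product (of_nat q)"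
proof -
  have q0: "real q > 0" using prime_gt_0_nat[OF q] by simp
  have "(\<Sum>p\<in>A. ln (rat_abs p (of_nat q))) = 0" if A: "finite A" "{\<infinity>, enat q} \<subseteq> A" "\<forall>p\<in>A. rat_place p" for A
  proof -
    have "(\<Sum>p\<in>A. ln (rat_abs p (of_nat q))) = (\<Sum>p\<in>{\<infinity>, enat q}. ln (rat_abs p (of_nat q)))"
    proof (rule sum.mono_neutral_right[OF A(1,2)], rule ballI)
      fix p assume p: "p \<in> A - {\<infinity>, enat q}"
      then obtain q' where q': "Factorial_Ring.prime q'" "p = enat q'" using A(3) by (auto simp: rat_place_def)
      show "ln (rat_abs p (of_nat q)) = 0" using rat_abs_prime[OF q'(1) q] p q'(2) by auto
    qed
    also have "\<dots> = 0" using rat_abs_prime[OF q q] q0 by (simp add: rat_abs_def ln_inverse)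
    finally show ?thesis .
  qed
  then show ?thesis unfolding rat_product_def using q by (intro exI[of _ "{\<infinity>, enat q}"]) (auto simp: rat_place_def)
qed

lemma rat_product_inverse: assumes "rat_product r" "r \<noteq> 0" shows "rat_product (inverse r)"
proof -
  have "ln (rat_abs p (inverse r)) = - ln (rat_abs p r)" if p: "rat_place p" for p
  proof -
    have "rat_abs p r * rat_abs p (inverse r) = 1" using rat_abs_mult[OF p, of r "inverse r"] rat_abs_one[OF p] assms(2) by simp
    then have "rat_abs p (inverse r) = inverse (rat_abs p r)" by (simp add: inverse_unique)
    moreover have "rat_abs p r > 0" using rat_abs_nonneg[of p r] rat_abs_eq_0[OF p] assms(2) by (simp add: order_less_le)
    ultimately show ?thesis by (simp add: ln_inverse)
  qed
  then have *: "(\<Sum>p\<in>A. ln (rat_abs p (inverse r))) = - (\<Sum>p\<in>A. ln (rat_abs p r))" if "\<forall>p\<in>A. rat_place p" for A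
    using that by (simp add: sum_negf[symmetric])
  obtain P where P: "finite P" "\<forall>p\<in>P. rat_place p" "\<And>A. finite A \<Longrightarrow> P \<subseteq> A \<Longrightarrow> \<forall>p\<in>A. rat_place p \<Longrightarrow> (\<Sum>p\<in>A. ln (rat_abs p r)) = 0"
    using assms(1) unfolding rat_product_def by metis
  show ?thesis unfolding rat_product_def using P * by (intro exI[of _ P]) auto
qed

text \<open>The formula is multiplicative, so prime factorization reduces it to a prime q, where
  only the places q and infinity contribute and cancel, and to the sign.\<close>

lemma rat_product: assumes r: "r \<noteq> 0" shows "rat_product r"
proof -
  have nat: "k > 0 \<Longrightarrow> rat_product (of_nat k)" for k :: nat
  proof (induction k rule: less_induct)
    case (less k)
    show ?case
    proof (cases "k = 1")
      case False
      then obtain q where q: "Factorial_Ring.prime q" "q dvd k" using prime_factor_nat by blast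
      then obtain l where l: "k = q * l" by blast
      have "l > 0" "l < k" using l less.prems prime_gt_1_nat[OF q(1)] by (auto intro: Nat.gr0I)
      then have "rat_product (of_nat q * of_nat l)"
        using prime_gt_0_nat[OF q(1)] by (intro rat_product_mult rat_product_prime[OF q(1)] less.IH) auto
      then show ?thesis by (simp add: l)
    qed (simp add: rat_product_one)
  qed
  have int: "rat_product (of_int i)" if "i \<noteq> 0" for i :: int
  proof (cases "i > 0")
    case True
    then show ?thesis using nat[of "nat i"] by simp
  next
    case False
    then have "rat_product (-1 * of_nat (nat (- i)))" using nat[of "nat (- i)"] that by (intro rat_product_mult rat_product_one) auto
    then show ?thesis using False by simp
  qed
  obtain a b where ab: "r = Rat.Fract a b" "b > 0" by (cases r) blast
  have "a \<noteq> 0" using ab r by (auto simp: Zero_rat_def eq_rat)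
  then have "rat_product (of_int a * inverse (of_int b))" using ab(2) int by (intro rat_product_mult rat_product_inverse) auto
  then show ?thesis using ab(1) by (simp add: Fract_of_int_quotient divide_inverse)
qed

context embeddings
begin

lemma card_conj:
  assumes K: "number_field K" and x: "x \<in> K" shows "card (conj x) = Polynomials.degree (irr x)"
proof -
  interpret fh: field_homs "num_ring UNIV" C by (rule field_homs)
  show ?thesis using fh.card_roots_Irr[OF csubfield_Rats h_hom _ algebraic_in[OF K x]] by (simp add: conj_def irr_def)
qed

lemma irr_const:
  assumes K: "number_field K" and x: "x \<in> K" shows "\<exists>r. of_rat r = ring.eval (num_ring UNIV) (irr x) 0"
proof -
  interpret CC: field "num_ring UNIV" by (rule num_ring_field_UNIV)
  have "irr x \<in> carrier (univ_poly (num_ring UNIV) \<rat>)" 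
    using CC.IrrE(1)[OF csubfield_Rats _ algebraic_in[OF K x]] by (simp add: irr_def)
  then have "CC.eval (irr x) 0 \<in> \<rat>"
    using CC.eval_in_carrier[of "irr x" 0] ring.eval_in_carrier[of "num_ring \<rat>" "irr x" 0] csubfield_field[OF csubfield_Rats]
    by (auto simp: univ_poly_carrier[symmetric] polynomial_def field_def domain_def cring_def num_ring_carrier_update
      CC.eval_consistent[OF subfieldE(1)[OF csubfield_Rats], symmetric])
  then show ?thesis by (auto simp: Rats_def)
qed

end

section \<open>Weighted sums over all places of a number field\<close>

definition local_exp :: "complex set \<Rightarrow> place \<Rightarrow> real" where
  "local_exp K v = real (local_degree K v) / real (field_degree K)"

lemma local_exp:
  assumes K: "number_field K" and v: "v \<in> places K" shows "0 < local_exp K v" "local_exp K v \<le> 1"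
proof -
  obtain C :: "local_closure_elem ring" and m h
    where cp: "is_Cp (place_below v) C m h" using Cp_exists[OF place_local(1)[OF K v]] by blast
  interpret e: embeddings "place_below v" C m h using place_local(1)[OF K v] cp by (rule embeddings.intro)
  have v': "v \<in> e.over_p K" using v by (simp add: e.over_p_def)
  show "0 < local_exp K v" "local_exp K v \<le> 1"
    using e.fibre_card(3)[OF K v'] e.card_Hom(3)[OF K] e.local_degree_le[OF K v'] by (auto simp: local_exp_def)
qed

lemma place_abs_nonneg: "number_field K \<Longrightarrow> v \<in> places K \<Longrightarrow> x \<in> K \<Longrightarrow> 0 \<le> place_abs K v x"
  and place_abs_eq_0: "number_field K \<Longrightarrow> v \<in> places K \<Longrightarrow> x \<in> K \<Longrightarrow> place_abs K v x = 0 \<longleftrightarrow> x = 0"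
  using place_local(2)[of K v] by (auto simp: normalized_def is_abs_def)

lemma local_abs_eq:
  assumes K: "number_field K" and v: "v \<in> places K" and x: "x \<in> K"
  shows "local_abs K v (to_local_field K v x) = place_abs K v x powr local_exp K v"
proof -
  have "to_local_field K v x \<in> carrier (local_field K v)"
    using place_local(6)[OF K v] x by (auto simp: ring_hom_def)
  then show ?thesis by (simp add: local_abs_def place_abs_def local_exp_def)
qed

text \<open>Each rational place has only finitely many places above it. So a function supported
  above a finite set P has a finite sum, which can be grouped by the place below and compared with
  means over conjugates.\<close>

lemma infsum_places:
  assumes K: "number_field K" and P: "finite P" "\<And>p. p \<in> P \<Longrightarrow> rat_place p"
    and out: "\<And>v. v \<in> places K \<Longrightarrow> place_below v \<notin> P \<Longrightarrow> f v = 0"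
  shows "infsum f (places K) = (\<Sum>p\<in>P. \<Sum>v\<in>{v\<in>places K. place_below v = p}. f v :: real)"
    "finite {v \<in> places K. f v \<noteq> 0}"
proof -
  have fin: "finite {v\<in>places K. place_below v = p}" if p: "p \<in> P" for p
  proof -
    obtain C :: "local_closure_elem ring" and m h
      where cp: "is_Cp p C m h" using Cp_exists[OF P(2)[OF p]] by blast
    interpret e: embeddings p C m h using P(2)[OF p] cp by (rule embeddings.intro)
    show ?thesis using e.finite_over_p[OF K] by (simp add: e.over_p_def)
  qed
  define V where "V = (\<Union>p\<in>P. {v\<in>places K. place_below v = p})"
  have V: "finite V" using P(1) fin by (auto simp: V_def)
  have "infsum f (places K) = infsum f V"
    by (rule infsum_cong_neutral) (use out in \<open>auto simp: V_def\<close>)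
  also have "\<dots> = sum f V" using V by simp
  also have "\<dots> = (\<Sum>p\<in>P. \<Sum>v\<in>{v\<in>places K. place_below v = p}. f v)"
    unfolding V_def using P(1) fin by (intro sum.UNION_disjoint) auto
  finally show "infsum f (places K) = (\<Sum>p\<in>P. \<Sum>v\<in>{v\<in>places K. place_below v = p}. f v)" .
  show "finite {v \<in> places K. f v \<noteq> 0}" by (rule finite_subset[OF _ V]) (use out in \<open>auto simp: V_def\<close>)
qed

lemma height_over_exp:
  assumes K: "number_field K" and x: "x \<in> K"
  shows "height_over K x = infsum (\<lambda>v. local_exp K v * max 0 (ln (place_abs K v x))) (places K)"
  unfolding height_over_def
proof (rule infsum_cong)
  fix v assume v: "v \<in> places K"
  note e = local_exp[OF K v]
  have "ln (place_abs K v x powr local_exp K v) = local_exp K v * ln (place_abs K v x)"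
    using place_abs_nonneg[OF K v x] by (cases "place_abs K v x = 0") (auto simp: ln_powr)
  then show "max 0 (ln (local_abs K v (to_local_field K v x))) = local_exp K v * max 0 (ln (place_abs K v x))"
    unfolding local_abs_eq[OF K v x] using e by (simp add: max_def mult_le_0_iff zero_le_mult_iff)
qed

theorem height_independent:
  assumes K: "number_field K" and L: "number_field L" and x: "x \<in> K" "x \<in> L"
  shows "height_over K x = height_over L x"
proof (cases "x = 0")
  \<comment> \<open>Zero has no finite exceptional set in the sense of \<open>finite_bad_eq\<close>;
    all its absolute values are 0, and every term vanishes since \<open>ln 0 = 0\<close>.\<close>
  case True
  have "height_over M x = 0" if M: "number_field M" "x \<in> M" for M
    unfolding height_over_exp[OF M] by (rule infsum_0) (use place_abs_eq_0[OF M(1) _ M(2)] True in simp)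
  then show ?thesis using K L x by simp
next
  case False
  obtain P where P: "finite P" "\<And>p. p \<in> P \<Longrightarrow> rat_place p"
    "\<And>p K \<nu>. rat_place p \<Longrightarrow> p \<notin> P \<Longrightarrow> number_field K \<Longrightarrow> x \<in> K \<Longrightarrow> normalized K p \<nu> \<Longrightarrow> \<nu> x = 1"
    using finite_bad_eq[OF K x(1) False] by metis
  have ht: "height_over M x = (\<Sum>p\<in>P. \<Sum>v\<in>{v\<in>places M. place_below v = p}. local_exp M v * max 0 (ln (place_abs M v x)))"
    if M: "number_field M" "x \<in> M" for M
    unfolding height_over_exp[OF M]
  proof (rule infsum_places(1)[OF M(1) P(1,2)])
    fix v assume v: "v \<in> places M" "place_below v \<notin> P"
    show "local_exp M v * max 0 (ln (place_abs M v x)) = 0"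
      using P(3)[OF place_local(1)[OF M(1) v(1)] v(2) M place_local(2)[OF M(1) v(1)]] by simp
  qed
  show ?thesis unfolding ht[OF K x(1)] ht[OF L x(2)]
  proof (rule sum.cong[OF refl])
    fix p assume p: "p \<in> P"
    obtain C :: "local_closure_elem ring" and m h
      where cp: "is_Cp p C m h" using Cp_exists[OF P(2)[OF p]] by blast
    interpret e: embeddings p C m h using P(2)[OF p] cp by (rule embeddings.intro)
    show "(\<Sum>v\<in>{v\<in>places K. place_below v = p}. local_exp K v * max 0 (ln (place_abs K v x)))
        = (\<Sum>v\<in>{v\<in>places L. place_below v = p}. local_exp L v * max 0 (ln (place_abs L v x)))"
      using e.local_sum[OF K x(1), of "\<lambda>t. max 0 (ln t)"] e.local_sum[OF L x(2), of "\<lambda>t. max 0 (ln t)"]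
      by (simp add: e.over_p_def local_exp_def)
  qed
qed

corollary weil_height_eq: assumes "number_field K" "x \<in> K" shows "weil_height x = height_over K x"
  unfolding weil_height_def using assms height_independent by (intro the_equality) blast+

lemma finite_support:
  assumes K: "number_field K" and x: "x \<in> K" "x \<noteq> 0" and f: "f 1 = (0::real)"
  shows "finite {v\<in>places K. f (place_abs K v x) \<noteq> 0}"
proof -
  obtain P where P: "finite P" "\<And>p. p \<in> P \<Longrightarrow> rat_place p"
    "\<And>p K \<nu>. rat_place p \<Longrightarrow> p \<notin> P \<Longrightarrow> number_field K \<Longrightarrow> x \<in> K \<Longrightarrow> normalized K p \<nu> \<Longrightarrow> \<nu> x = 1"
    using finite_bad_eq[OF K x] by metis
  show ?thesis
    by (rule infsum_places(2)[OF K P(1,2)]) (use P(3)[OF place_local(1)[OF K] _ K x(1) place_local(2)[OF K]] f in auto)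
qed

theorem product_formula:
  assumes K: "number_field K" and x: "x \<in> K" "x \<noteq> 0"
  shows "infsum (\<lambda>v. local_exp K v * ln (place_abs K v x)) (places K) = 0"
proof -
  obtain P where P: "finite P" "\<And>p. p \<in> P \<Longrightarrow> rat_place p"
    "\<And>p K \<nu>. rat_place p \<Longrightarrow> p \<notin> P \<Longrightarrow> number_field K \<Longrightarrow> x \<in> K \<Longrightarrow> normalized K p \<nu> \<Longrightarrow> \<nu> x = 1"
    using finite_bad_eq[OF K x] by metis
  obtain C0 :: "local_closure_elem ring" and m0 h0
    where cp0: "is_Cp \<infinity> C0 m0 h0" using Cp_exists[of \<infinity>] by (auto simp: rat_place_def)
  interpret e0: embeddings \<infinity> C0 m0 h0 using cp0 by (intro embeddings.intro) (simp add: rat_place_def)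
  \<comment> \<open>The minimal polynomial does not depend on the target C, so the rational number
    read off at the infinite place serves at all the others.\<close>
  obtain r where r: "of_rat r = ring.eval (num_ring UNIV) (e0.irr x) 0" using e0.irr_const[OF K x(1)] by blast
  have r0: "r \<noteq> 0" by (rule e0.prod_conj(2)[OF K x(1) r x(2)])
  obtain P' where P': "finite P'" "\<And>p. p \<in> P' \<Longrightarrow> rat_place p"
    "\<And>A. finite A \<Longrightarrow> P' \<subseteq> A \<Longrightarrow> \<forall>p\<in>A. rat_place p \<Longrightarrow> (\<Sum>p\<in>A. ln (rat_abs p r)) = 0"
    using rat_product[OF r0] unfolding rat_product_def by metis
  define A where "A = P \<union> P'"
  have A: "finite A" "\<And>p. p \<in> A \<Longrightarrow> rat_place p" using P P' by (auto simp: A_def)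
  have "infsum (\<lambda>v. local_exp K v * ln (place_abs K v x)) (places K)
      = (\<Sum>p\<in>A. \<Sum>v\<in>{v\<in>places K. place_below v = p}. local_exp K v * ln (place_abs K v x))"
  proof (rule infsum_places(1)[OF K A])
    fix v assume v: "v \<in> places K" "place_below v \<notin> A"
    show "local_exp K v * ln (place_abs K v x) = 0"
      using P(3)[OF place_local(1)[OF K v(1)] _ K x(1) place_local(2)[OF K v(1)]] v(2) by (simp add: A_def)
  qed
  also have "\<dots> = (\<Sum>p\<in>A. ln (rat_abs p r) / real (Polynomials.degree (e0.irr x)))"
  proof (rule sum.cong[OF refl])
    fix p assume p: "p \<in> A"
    obtain C :: "local_closure_elem ring" and m h
      where cp: "is_Cp p C m h" using Cp_exists[OF A(2)[OF p]] by blast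
    interpret e: embeddings p C m h using A(2)[OF p] cp by (rule embeddings.intro)
    have irr: "e.irr x = e0.irr x" by (simp add: e.irr_def e0.irr_def)
    have r': "of_rat r = ring.eval (num_ring UNIV) (e.irr x) 0" using r irr by simp
    have "(\<Sum>v\<in>{v\<in>places K. place_below v = p}. local_exp K v * ln (place_abs K v x))
        = (\<Sum>z\<in>e.conj x. ln (m z)) / real (Polynomials.degree (e0.irr x))"
      using e.local_sum[OF K x(1), of ln] e.card_conj[OF K x(1)] irr by (simp add: e.over_p_def local_exp_def)
    also have "(\<Sum>z\<in>e.conj x. ln (m z)) = ln (\<Prod>z\<in>e.conj x. m z)"
      using e.sum_Hom_conj(1)[OF K x(1)] e.prod_conj(3)[OF K x(1) r' x(2)] by (intro ln_prod[symmetric]) fastforce+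
    also have "(\<Prod>z\<in>e.conj x. m z) = rat_abs p r" by (rule e.prod_conj(1)[OF K x(1) r'])
    finally show "(\<Sum>v\<in>{v\<in>places K. place_below v = p}. local_exp K v * ln (place_abs K v x))
        = ln (rat_abs p r) / real (Polynomials.degree (e0.irr x))" .
  qed
  also have "\<dots> = 0" using P'(3)[of A] A by (simp add: sum_divide_distrib[symmetric] A_def)
  finally show ?thesis .
qed

section \<open>The local extremal problem\<close>

text \<open>For coefficients listed in ascending order, \<open>alternate as\<close> and
  \<open>alternate (tl as)\<close> hold those of the even and of the odd part.\<close>

fun alternate :: "'a list \<Rightarrow> 'a list" where
  "alternate [] = []"
| "alternate [a] = [a]"
| "alternate (a # b # as) = a # alternate as"

lemma alternate_Cons: "alternate (b # as) = b # alternate (tl as)"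
  by (cases as) auto

lemma alternate_set: "set as = set (alternate as) \<union> set (alternate (tl as))"
  by (induction as rule: alternate.induct) (auto simp: alternate_Cons)

lemma alternate_length: "2 * length (alternate as) \<le> length as + 1 \<and> 2 * length (alternate (tl as)) \<le> length as"
  by (induction as rule: alternate.induct) (auto simp: alternate_Cons)

lemma (in ring) eval_snoc:
  assumes "set p \<subseteq> carrier R" "c \<in> carrier R" "z \<in> carrier R"
  shows "eval (p @ [c]) z = eval p z \<otimes> z \<oplus> c"
  using eval_append[of p "[c]" z] assms by simp

text \<open>The decomposition p(z) = p0(z^2) + z p1(z^2). The reversal is needed because
  \<open>eval\<close> expects the leading coefficient first.\<close>

lemma (in cring) eval_alternate:
  assumes "set as \<subseteq> carrier R" "z \<in> carrier R"
  shows "eval (rev as) z = eval (rev (alternate as)) (z \<otimes> z) \<oplus> z \<otimes> eval (rev (alternate (tl as))) (z \<otimes> z)"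
  using assms(1)
proof (induction as rule: alternate.induct)
  case 1
  then show ?case using assms(2) by simp
next
  case (2 a)
  then show ?case using assms(2) by simp
next
  case (3 a b as)
  have ab: "a \<in> carrier R" "b \<in> carrier R" "set as \<subseteq> carrier R" using 3 by auto
  have s: "set (alternate as) \<subseteq> carrier R" "set (alternate (tl as)) \<subseteq> carrier R" using ab alternate_set[of as] by auto
  have zz: "z \<otimes> z \<in> carrier R" using assms by simp
  have "set (rev as @ [b]) \<subseteq> carrier R" using ab by auto
  then have 1: "eval (rev (a # b # as)) z = (eval (rev as) z \<otimes> z \<oplus> b) \<otimes> z \<oplus> a"
    using eval_snoc[of "rev as @ [b]" a z] eval_snoc[of "rev as" b z] ab assms(2) by simp
  have 2: "eval (rev (alternate (a # b # as))) (z \<otimes> z) = eval (rev (alternate as)) (z \<otimes> z) \<otimes> (z \<otimes> z) \<oplus> a"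
    using eval_snoc[of "rev (alternate as)" a "z \<otimes> z"] s ab zz by simp
  have h3: "eval (rev (alternate (tl (a # b # as)))) (z \<otimes> z) = eval (rev (alternate (tl as))) (z \<otimes> z) \<otimes> (z \<otimes> z) \<oplus> b"
    using eval_snoc[of "rev (alternate (tl as))" b "z \<otimes> z"] s ab zz by (simp add: alternate_Cons)
  define A B where "A = eval (rev (alternate as)) (z \<otimes> z)" and "B = eval (rev (alternate (tl as))) (z \<otimes> z)"
  have AB: "A \<in> carrier R" "B \<in> carrier R" unfolding A_def B_def using s zz by (auto intro!: eval_in_carrier)
  have IH: "eval (rev as) z = A \<oplus> z \<otimes> B" using "3.IH" ab(3) by (simp add: A_def B_def)
  show ?case unfolding 1 2 h3 IH A_def[symmetric] B_def[symmetric]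
    using AB ab assms(2) by algebra
qed

text \<open>\<open>W\<close> is a part of the unit circle in which square roots can be taken, and
  may be smaller than the circle: for \<open>\<Omega>\<^sub>v\<close> it will be the image of the
  unit circle of the algebraic closure. The assumption \<open>two\<close> permits averaging over z
  and -z.\<close>

locale circle_field = valued_field R n for R (structure) and n +
  fixes W
  assumes W: "W \<subseteq> carrier R" "\<one> \<in> W" and W_abs: "w \<in> W \<Longrightarrow> n w = 1"
    and W_minus: "w \<in> W \<Longrightarrow> \<ominus> w \<in> W" and W_sqrt: "w \<in> W \<Longrightarrow> \<exists>z\<in>W. z \<otimes> z = w"
    and two: "\<one> \<oplus> \<one> \<noteq> \<zero>"
begin

lemma n2: "n (\<one> \<oplus> \<one>) > 0" "n (\<one> \<oplus> \<one>) \<le> 2"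
  using n_pos[of "\<one> \<oplus> \<one>"] two n_add[of \<one> \<one>] by auto

text \<open>Averaging over square roots \<open>\<plusminus>z\<close> isolates the even and odd parts, so each halving of the
  number of coefficients costs a factor \<open>2 / |2|\<close>.\<close>

lemma coeff_bound:
  assumes "length p \<le> 2 ^ k" "set p \<subseteq> carrier R" "\<And>z. z \<in> W \<Longrightarrow> n (eval (rev p) z) \<le> M" "a \<in> set p"
  shows "n a \<le> (2 / n (\<one> \<oplus> \<one>)) ^ k * M"
  using assms
proof (induction k arbitrary: p M a)
  case 0
  then have "p = [a]" by (cases p) auto
  then show ?case using "0.prems"(3)[of \<one>] "0.prems"(2) W by simp
next
  case (Suc k)
  let ?t = "\<one> \<oplus> \<one>"
  have s: "set (alternate p) \<subseteq> carrier R" "set (alternate (tl p)) \<subseteq> carrier R" using Suc.prems(2) alternate_set[of p] by auto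
  have le: "n (eval (rev (alternate p)) w) \<le> 2 / n ?t * M \<and> n (eval (rev (alternate (tl p))) w) \<le> 2 / n ?t * M"
    if w: "w \<in> W" for w
  proof -
    obtain z where z: "z \<in> W" "z \<otimes> z = w" using W_sqrt[OF w] by blast
    have zc: "z \<in> carrier R" "w \<in> carrier R" using z w W by auto
    define A B where "A = eval (rev (alternate p)) w" and "B = eval (rev (alternate (tl p))) w"
    have AB: "A \<in> carrier R" "B \<in> carrier R" unfolding A_def B_def using s zc by (auto intro!: eval_in_carrier)
    have mz: "\<ominus> z \<otimes> \<ominus> z = w" using z(2) zc by algebra
    have e1: "eval (rev p) z = A \<oplus> z \<otimes> B" using eval_alternate[OF Suc.prems(2) zc(1)] z(2) by (simp add: A_def B_def)
    have e2: "eval (rev p) (\<ominus> z) = A \<oplus> \<ominus> z \<otimes> B" using eval_alternate[OF Suc.prems(2), of "\<ominus> z"] mz zc by (simp add: A_def B_def)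
    have m: "n (A \<oplus> z \<otimes> B) \<le> M" "n (A \<oplus> \<ominus> z \<otimes> B) \<le> M"
      using Suc.prems(3)[OF z(1)] Suc.prems(3)[OF W_minus[OF z(1)]] unfolding e1 e2 by auto
    have t: "?t \<otimes> x = x \<oplus> x" if "x \<in> carrier R" for x using that by (simp add: l_distr)
    have "A \<oplus> A = (A \<oplus> z \<otimes> B) \<oplus> (A \<oplus> \<ominus> z \<otimes> B)" using AB zc by algebra
    then have "?t \<otimes> A = (A \<oplus> z \<otimes> B) \<oplus> (A \<oplus> \<ominus> z \<otimes> B)" using t[OF AB(1)] by simp
    then have "n (?t \<otimes> A) \<le> 2 * M" using n_add[of "A \<oplus> z \<otimes> B" "A \<oplus> \<ominus> z \<otimes> B"] m AB zc by simp
    then have 1: "n A \<le> 2 / n ?t * M" using AB n2 by (simp add: field_simps)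
    have "z \<otimes> B \<oplus> z \<otimes> B = (A \<oplus> z \<otimes> B) \<ominus> (A \<oplus> \<ominus> z \<otimes> B)" using AB zc by algebra
    then have "?t \<otimes> (z \<otimes> B) = (A \<oplus> z \<otimes> B) \<ominus> (A \<oplus> \<ominus> z \<otimes> B)" using t[of "z \<otimes> B"] AB zc by simp
    then have "n (?t \<otimes> (z \<otimes> B)) \<le> 2 * M" using n_minus[of "A \<oplus> z \<otimes> B" "A \<oplus> \<ominus> z \<otimes> B"] m AB zc by simp
    then have 2: "n B \<le> 2 / n ?t * M" using AB zc n2 W_abs[OF z(1)] by (simp add: field_simps)
    show ?thesis using 1 2 by (simp add: A_def B_def)
  qed
  have len: "length (alternate p) \<le> 2 ^ k" "length (alternate (tl p)) \<le> 2 ^ k"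
    using alternate_length[of p] Suc.prems(1) by auto
  consider "a \<in> set (alternate p)" | "a \<in> set (alternate (tl p))" using Suc.prems(4) alternate_set[of p] by blast
  then have "n a \<le> (2 / n ?t) ^ k * (2 / n ?t * M)"
  proof cases
    case 1
    show ?thesis by (rule Suc.IH[OF len(1) s(1) _ 1]) (use le in blast)
  next
    case 2
    show ?thesis by (rule Suc.IH[OF len(2) s(2) _ 2]) (use le in blast)
  qed
  then show ?case by (simp add: algebra_simps)
qed

lemma eval_le_sum:
  assumes "set p \<subseteq> carrier R" "z \<in> carrier R" "\<And>a. a \<in> set p \<Longrightarrow> n a \<le> B" "length p \<le> Suc d" "0 \<le> B"
  shows "n (eval p z) \<le> real (length p) * (B * max 1 (n z) ^ d)"
  using assms(1,3,4)
proof (induction p)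
  case (Cons a p)
  have a: "a \<in> carrier R" "set p \<subseteq> carrier R" "eval p z \<in> carrier R" using Cons.prems assms(2) by (auto intro!: eval_in_carrier)
  have "n (a \<otimes> z [^] length p) \<le> B * max 1 (n z) ^ d"
  proof -
    have "n z ^ length p \<le> max 1 (n z) ^ length p" using assms(2) by (intro power_mono) auto
    also have "\<dots> \<le> max 1 (n z) ^ d" using Cons.prems(3) by (intro power_increasing) auto
    finally show ?thesis using Cons.prems(2)[of a] a assms(2,5) by (simp add: mult_mono)
  qed
  moreover have "n (eval p z) \<le> real (length p) * (B * max 1 (n z) ^ d)" using Cons.IH a(2) Cons.prems by simp
  ultimately have "n (a \<otimes> z [^] length p \<oplus> eval p z) \<le> B * max 1 (n z) ^ d + real (length p) * (B * max 1 (n z) ^ d)"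
    using n_add[of "a \<otimes> z [^] length p" "eval p z"] a assms(2) by simp
  then show ?case by (simp add: algebra_simps)
qed simp

text \<open>The constants lost in \<open>coeff_bound\<close> disappear when the estimate is applied to \<open>g ^ 2 ^ j\<close>
  and \<open>j\<close> tends to infinity.\<close>

lemma eval_le_max:
  assumes g: "g \<in> carrier (poly_ring R)" and deg: "Polynomials.degree g \<le> N" and \<alpha>: "\<alpha> \<in> carrier R"
    and S: "\<And>z. z \<in> W \<Longrightarrow> n (eval g z) \<le> S"
  shows "n (eval g \<alpha>) \<le> max 1 (n \<alpha>) ^ N * S"
proof -
  interpret P: domain "poly_ring R" by (rule univ_poly_is_domain[OF carrier_is_subring])
  have gset: "set g \<subseteq> carrier R" using g by (auto simp: univ_poly_carrier[symmetric] polynomial_def)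
  define E where "E = 4 / n (\<one> \<oplus> \<one>)"
  define D where "D = 2 / n (\<one> \<oplus> \<one>)"
  have E0: "E \<ge> 0" "D \<ge> 0" using n2 by (auto simp: E_def D_def)
  \<comment> \<open>Chosen so that g has at most 2^m0 coefficients; its power with exponent 2^j then
    has at most 2^(m0 + j).\<close>
  obtain m0 where m0: "N + 1 \<le> 2 ^ m0" using real_arch_pow[of 2 "real (N + 1)"] by (metis less_exp less_or_eq_imp_le)
  have S0: "0 \<le> S" using S[OF W(2)] n_nonneg[OF eval_in_carrier[OF gset], of \<one>] by auto
  show ?thesis
  proof (rule root_trick[where C = "E ^ m0" and E = E])
    show "0 \<le> n (eval g \<alpha>)" using eval_in_carrier[OF gset \<alpha>] by simp
    show "0 \<le> max 1 (n \<alpha>) ^ N * S" using S0 by simp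
    fix j :: nat
    define G where "G = g [^]\<^bsub>poly_ring R\<^esub> (2 ^ j :: nat)"
    have G: "G \<in> carrier (poly_ring R)" using g by (simp add: G_def)
    have Gset: "set G \<subseteq> carrier R" using G by (auto simp: univ_poly_carrier[symmetric] polynomial_def)
    have ev: "eval G z = eval g z [^] (2 ^ j :: nat)" if z: "z \<in> carrier R" for z
    proof -
      interpret e: ring_hom_cring "poly_ring R" R "\<lambda>p. eval p z" by (rule eval_cring_hom[OF carrier_is_subring z])
      have "eval (g [^]\<^bsub>poly_ring R\<^esub> k) z = eval g z [^] k" for k :: nat
        by (induction k) (use g in auto)
      then show ?thesis unfolding G_def .
    qed
    have "Polynomials.degree G = 2 ^ j * Polynomials.degree g" unfolding G_def by (rule polynomial_pow_degree[OF g])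
    then have dG: "Polynomials.degree G \<le> 2 ^ j * N" using deg by simp
    have "2 ^ j * N + 1 \<le> 2 ^ j * (N + 1)" by simp
    also have "\<dots> \<le> 2 ^ j * 2 ^ m0" using m0 by (intro mult_le_mono) auto
    finally have L: "2 ^ j * N + 1 \<le> 2 ^ (m0 + j)" by (simp add: power_add mult.commute)
    have lG: "length G \<le> 2 ^ (m0 + j)" "length G \<le> Suc (2 ^ j * N)" using dG L by auto
    have cb: "n a \<le> D ^ (m0 + j) * S ^ (2 ^ j)" if a: "a \<in> set G" for a
      unfolding D_def
    proof (rule coeff_bound[of "rev G"])
      fix z assume z: "z \<in> W"
      have zc: "z \<in> carrier R" using z W by auto
      have "n (eval g z) ^ 2 ^ j \<le> S ^ 2 ^ j" by (rule power_mono[OF S[OF z]]) (use eval_in_carrier[OF gset zc] in simp)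
      then show "n (eval (rev (rev G)) z) \<le> S ^ 2 ^ j" using ev[OF zc] eval_in_carrier[OF gset zc] by simp
    qed (use lG Gset a in auto)
    have "n (eval g \<alpha>) ^ 2 ^ j = n (eval G \<alpha>)" using ev[OF \<alpha>] eval_in_carrier[OF gset \<alpha>] by simp
    also have "\<dots> \<le> real (length G) * (D ^ (m0 + j) * S ^ (2 ^ j) * max 1 (n \<alpha>) ^ (2 ^ j * N))"
      by (rule eval_le_sum[OF Gset \<alpha> cb lG(2)]) (use E0 S0 in auto)
    also have "\<dots> \<le> real (2 ^ (m0 + j)) * (D ^ (m0 + j) * S ^ (2 ^ j) * max 1 (n \<alpha>) ^ (2 ^ j * N))"
      using E0 S0 by (intro mult_right_mono of_nat_mono[OF lG(1)]) auto
    also have "\<dots> = (2 * D) ^ (m0 + j) * (max 1 (n \<alpha>) ^ N * S) ^ 2 ^ j"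
      by (simp add: power_mult_distrib power_mult[symmetric] mult.commute)
    also have "2 * D = E" by (simp add: D_def E_def)
    finally show "n (eval g \<alpha>) ^ 2 ^ j \<le> E ^ m0 * E ^ j * (max 1 (n \<alpha>) ^ N * S) ^ 2 ^ j" by (simp add: power_add)
  qed (use E0 in auto)
qed

theorem extremal_value:
  assumes T: "T \<in> carrier (poly_ring R)" and deg: "int (Polynomials.degree T) \<le> N" and \<alpha>: "\<alpha> \<in> carrier R"
    and nz: "eval T \<alpha> \<noteq> \<zero>"
  shows "(INF f\<in>{f \<in> carrier (poly_ring R). eval f \<alpha> = \<zero> \<and> (f = [] \<or> int (Polynomials.degree f) \<le> N)}.
      ext_log (SUP z\<in>{z \<in> carrier R. n z = 1}. n (eval (T \<ominus>\<^bsub>poly_ring R\<^esub> f) z)))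
    = ereal (ln (n (eval T \<alpha>)) - of_int N * max 0 (ln (n \<alpha>)))" (is "(INF f\<in>?F. ?\<nu> f) = ereal ?v")
proof -
  interpret P: domain "poly_ring R" by (rule univ_poly_is_domain[OF carrier_is_subring])
  define c where "c = eval T \<alpha>"
  have Tset: "set T \<subseteq> carrier R" using T by (auto simp: univ_poly_carrier[symmetric] polynomial_def)
  have c: "c \<in> carrier R" "c \<noteq> \<zero>" using eval_in_carrier[OF Tset \<alpha>] nz by (auto simp: c_def)
  have nc: "n c > 0" using n_pos[OF c] .
  \<comment> \<open>The degree of T is a natural number, so the hypothesis on degrees forces N to be
    nonnegative.\<close>
  define M where "M = nat N"
  have N: "N = int M" using deg by (simp add: M_def)
  have degd: "Polynomials.degree (p \<ominus>\<^bsub>poly_ring R\<^esub> q) \<le> M"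
    if pq: "p \<in> carrier (poly_ring R)" "q \<in> carrier (poly_ring R)" "Polynomials.degree p \<le> M" "Polynomials.degree q \<le> M" for p q
  proof -
    have "Polynomials.degree (\<ominus>\<^bsub>poly_ring R\<^esub> q) = Polynomials.degree q"
      by (rule univ_poly_a_inv_degree[OF carrier_is_subring pq(2)])
    then show ?thesis using poly_add_degree[of p "\<ominus>\<^bsub>poly_ring R\<^esub> q"] pq(3,4) by (simp add: a_minus_def univ_poly_add del: poly_add.simps)
  qed
  have ev_minus: "eval (p \<ominus>\<^bsub>poly_ring R\<^esub> q) z = eval p z \<ominus> eval q z"
    if pq: "p \<in> carrier (poly_ring R)" "q \<in> carrier (poly_ring R)" and z: "z \<in> carrier R" for p q z
  proof -
    interpret e: ring_hom_cring "poly_ring R" R "\<lambda>p. eval p z" by (rule eval_cring_hom[OF carrier_is_subring z])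
    show ?thesis using e.hom_add[of p "\<ominus>\<^bsub>poly_ring R\<^esub> q"] e.hom_a_inv[of q] pq by (simp add: a_minus_def)
  qed
  have lnmax: "ln (max 1 (n \<alpha>) ^ M) = of_int N * max 0 (ln (n \<alpha>))"
  proof -
    have "ln (max 1 (n \<alpha>)) = max 0 (ln (n \<alpha>))"
    proof (cases "n \<alpha> \<le> 1")
      case True
      \<comment> \<open>The case n \<alpha> = 0 relies on \<open>ln 0 = 0\<close>, which gives the
        right value of the positive part.\<close>
      have "ln (n \<alpha>) \<le> 0" using True n_nonneg[OF \<alpha>] by (cases "n \<alpha> = 0") (simp_all del: n_eq_0_iff)
      then show ?thesis using True by (simp add: max_def)
    next
      case False
      then have "ln (n \<alpha>) > 0" by simp
      then show ?thesis using False by (simp add: max_def)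
    qed
    then show ?thesis by (simp add: ln_realpow N)
  qed
  have vexp: "?v = ln (n c / max 1 (n \<alpha>) ^ M)" using nc by (simp add: ln_div lnmax c_def)
  show ?thesis
  proof (rule antisym)
    have "\<exists>q\<in>carrier (poly_ring R). eval q \<alpha> = c \<and> Polynomials.degree q \<le> M \<and>
      (\<forall>z\<in>carrier R. n z = 1 \<longrightarrow> n (eval q z) = n c / max 1 (n \<alpha>) ^ M)"
    proof (cases "n \<alpha> \<le> 1")
      case True
      have "[c] \<in> carrier (poly_ring R)" using c by (simp add: univ_poly_carrier[symmetric] polynomial_def)
      then show ?thesis using True c by (intro bexI[of _ "[c]"]) (auto simp: max_def \<alpha>)
    next
      case False
      then have a0: "\<alpha> \<noteq> \<zero>" by auto
      define c' where "c' = c \<otimes> inv (\<alpha> [^] M)"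
      have "n (\<alpha> [^] M) > 0" using n_pow[OF \<alpha>, of M] n_pos[OF \<alpha> a0] by simp
      then have aM0: "\<alpha> [^] M \<noteq> \<zero>" using n_zero by (metis less_irrefl)
      have aM: "\<alpha> [^] M \<in> carrier R" "\<alpha> [^] M \<noteq> \<zero>" using \<alpha> aM0 by simp_all
      have iM: "inv (\<alpha> [^] M) \<in> carrier R" "inv (\<alpha> [^] M) \<otimes> \<alpha> [^] M = \<one>" using aM field_Units by auto
      have c': "c' \<in> carrier R" using c iM by (simp add: c'_def)
      have c'a: "c' \<otimes> \<alpha> [^] M = c" unfolding c'_def using c iM aM by (simp add: m_assoc)
      then have c'0: "c' \<noteq> \<zero>" using c aM by auto
      have mon: "monom c' M \<in> carrier (poly_ring R)"
        using monom_is_polynomial[OF carrier_is_subring, of c' M] c' c'0 by (simp add: univ_poly_carrier)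
      have nc': "n c' = n c / n \<alpha> ^ M" using c iM aM \<alpha> by (simp add: c'_def divide_inverse)
      show ?thesis
      proof (rule bexI[OF _ mon], intro conjI ballI impI)
        show "eval (monom c' M) \<alpha> = c" using eval_monom[OF c' \<alpha>] c'a by simp
        show "Polynomials.degree (monom c' M) \<le> M" by (simp add: monom_def)
        fix z assume "z \<in> carrier R" "n z = 1"
        then show "n (eval (monom c' M) z) = n c / max 1 (n \<alpha>) ^ M" using eval_monom[OF c'] c' nc' False by (simp add: max_def)
      qed
    qed
    then obtain q where q: "q \<in> carrier (poly_ring R)" "eval q \<alpha> = c" "Polynomials.degree q \<le> M"
      "\<And>z. z \<in> carrier R \<Longrightarrow> n z = 1 \<Longrightarrow> n (eval q z) = n c / max 1 (n \<alpha>) ^ M" by blast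
    define f where "f = T \<ominus>\<^bsub>poly_ring R\<^esub> q"
    have "f \<in> ?F"
    proof (intro CollectI conjI disjI2)
      show "f \<in> carrier (poly_ring R)" using T q by (simp add: f_def)
      show "eval f \<alpha> = \<zero>" unfolding f_def using ev_minus[OF T q(1) \<alpha>] q(2) c by (simp add: c_def)
      have "Polynomials.degree f \<le> M" unfolding f_def using deg q(3) by (intro degd T q(1)) (auto simp: N)
      then show "int (Polynomials.degree f) \<le> N" by (simp add: N)
    qed
    moreover have "?\<nu> f = ereal ?v"
    proof -
      have Tf: "T \<ominus>\<^bsub>poly_ring R\<^esub> f = q" unfolding f_def using T q(1) by algebra
      have "(\<lambda>z. n (eval q z)) ` {z \<in> carrier R. n z = 1} = {n c / max 1 (n \<alpha>) ^ M}"
        using q(4) one_closed n_one by fastforce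
      then have "(SUP z\<in>{z \<in> carrier R. n z = 1}. n (eval q z)) = n c / max 1 (n \<alpha>) ^ M" by simp
      moreover have "n c / max 1 (n \<alpha>) ^ M \<noteq> 0" using nc by (simp add: max_def)
      ultimately show ?thesis unfolding Tf ext_log_def vexp by simp
    qed
    ultimately show "(INF f\<in>?F. ?\<nu> f) \<le> ereal ?v" by (rule INF_lower2[OF _ eq_refl])
  next
    show "ereal ?v \<le> (INF f\<in>?F. ?\<nu> f)"
    proof (rule INF_greatest)
      fix f assume "f \<in> ?F"
      then have f: "f \<in> carrier (poly_ring R)" "eval f \<alpha> = \<zero>" "f = [] \<or> int (Polynomials.degree f) \<le> N" by auto
      define g where "g = T \<ominus>\<^bsub>poly_ring R\<^esub> f"
      have g: "g \<in> carrier (poly_ring R)" using T f by (simp add: g_def)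
      have gset: "set g \<subseteq> carrier R" using g by (auto simp: univ_poly_carrier[symmetric] polynomial_def)
      \<comment> \<open>The empty list has degree 0 here, so the bound on the degree of g holds for
        f = 0 as well.\<close>
      have dg: "Polynomials.degree g \<le> M" unfolding g_def using deg f(3) by (intro degd T f(1)) (auto simp: N)
      have ga: "eval g \<alpha> = c" unfolding g_def using ev_minus[OF T f(1) \<alpha>] f(2) c by (simp add: c_def a_minus_def)
      define S where "S = (SUP z\<in>{z \<in> carrier R. n z = 1}. n (eval g z))"
      \<comment> \<open>A real supremum bounds its members only over a set that is bounded above. On
        the unit circle a crude bound by the coefficients suffices.\<close>
      have bdd: "bdd_above ((\<lambda>z. n (eval g z)) ` {z \<in> carrier R. n z = 1})"
      proof (rule bdd_aboveI2)
        fix z assume z: "z \<in> {z \<in> carrier R. n z = 1}"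
        have B: "n a \<le> (\<Sum>b\<in>set g. n b)" if "a \<in> set g" for a
          using that gset by (intro member_le_sum) auto
        have B0: "0 \<le> (\<Sum>b\<in>set g. n b)" using gset by (intro sum_nonneg) auto
        show "n (eval g z) \<le> real (length g) * ((\<Sum>b\<in>set g. n b) * max 1 1 ^ length g)"
          using eval_le_sum[OF gset _ B le_SucI[OF order_refl] B0, of z] z by simp
      qed
      have up: "n (eval g z) \<le> S" if "z \<in> carrier R" "n z = 1" for z
        unfolding S_def by (rule cSUP_upper[OF _ bdd]) (use that in simp)
      \<comment> \<open>\<open>eval_le_max\<close> asks for bounds on \<open>W\<close> only, and
        \<open>W\<close> lies in the unit circle.\<close>
      have "n c \<le> max 1 (n \<alpha>) ^ M * S"
        using eval_le_max[OF g dg \<alpha>, of S] up W W_abs unfolding ga by blast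
      then have le: "n c / max 1 (n \<alpha>) ^ M \<le> S" by (simp add: field_simps)
      have pos: "n c / max 1 (n \<alpha>) ^ M > 0" using nc by (simp add: max_def)
      have "ln (n c / max 1 (n \<alpha>) ^ M) \<le> ln S" using le pos by simp
      then show "ereal ?v \<le> ?\<nu> f" unfolding g_def[symmetric] S_def[symmetric] ext_log_def vexp using le pos by simp
    qed
  qed
qed

end

section \<open>The fields \<open>\<Omega>\<^sub>v\<close>\<close>

text \<open>With c = a + b, the fractions a/c and b/c lie between 0 and 1, so a power with exponent
  s \<le> 1 does not decrease them; their sum is 1.\<close>

lemma powr_add_le:
  fixes a b s :: real
  assumes "0 \<le> a" "0 \<le> b" "0 < s" "s \<le> 1" shows "(a + b) powr s \<le> a powr s + b powr s"
proof (cases "a + b = 0")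
  case False
  define c where "c = a + b"
  have c: "c > 0" using False assms by (simp add: c_def)
  have le: "x / c * c powr s \<le> x powr s" if x: "0 \<le> x" "x \<le> c" for x
  proof (cases "x = 0")
    case False
    have "(x / c) powr 1 \<le> (x / c) powr s" using x c assms(4) False by (intro powr_mono') auto
    then have "x / c \<le> x powr s / c powr s" using x c by (simp add: powr_divide)
    then show ?thesis using c by (simp add: pos_le_divide_eq)
  qed simp
  have "a / c + b / c = 1" using c by (simp add: c_def add_divide_distrib[symmetric])
  then have "c powr s = a / c * c powr s + b / c * c powr s" by (metis distrib_right mult_1)
  also have "\<dots> \<le> a powr s + b powr s" using assms by (intro add_mono le) (auto simp: c_def)
  finally show ?thesis by (simp add: c_def)
qed (use assms in auto)

section \<open>The local field, its algebraic closure and the completion of that\<close>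

locale number_place =
  fixes K v
  assumes K: "number_field K" and v: "v \<in> places K"
begin

text \<open>The exponent \<open>local_exp K v\<close> lies between 0 and 1, so the triangle
  inequality passes from \<open>local_norm\<close> to \<open>local_abs\<close> by
  \<open>powr_add_le\<close>. Cauchy and null sequences stay the same under a positive power, so
  completeness passes as well.\<close>

sublocale F: complete_valued_field "local_field K v" "local_abs K v"
proof -
  let ?F = "local_field K v" and ?n = "local_norm K v" and ?s = "local_exp K v"
  interpret n: complete_valued_field ?F ?n by (rule place_local(4)[OF K v])
  note s = local_exp[OF K v]
  have eq: "local_abs K v x = ?n x powr ?s" if "x \<in> carrier ?F" for x
    using that by (simp add: local_abs_def local_exp_def)
  have eq': "0 \<le> ?n x \<and> local_abs K v x = ?n x powr ?s" if "x \<in> carrier ?F" for x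
    using that eq by simp
  have abs: "is_abs ?F (local_abs K v)"
    unfolding is_abs_def
  proof (intro conjI ballI)
    fix x y assume x: "x \<in> carrier ?F" and y: "y \<in> carrier ?F"
    show "0 \<le> local_abs K v x" "local_abs K v x = 0 \<longleftrightarrow> x = \<zero>\<^bsub>?F\<^esub>" using eq[OF x] x s by auto
    show "local_abs K v (x \<otimes>\<^bsub>?F\<^esub> y) = local_abs K v x * local_abs K v y"
      using eq x y n.m_closed[OF x y] by (simp add: powr_mult)
    have "?n (x \<oplus>\<^bsub>?F\<^esub> y) powr ?s \<le> (?n x + ?n y) powr ?s"
      using n.n_add[OF x y] s x y by (intro powr_mono2) auto
    also have "\<dots> \<le> ?n x powr ?s + ?n y powr ?s" using x y s by (intro powr_add_le) auto
    finally show "local_abs K v (x \<oplus>\<^bsub>?F\<^esub> y) \<le> local_abs K v x + local_abs K v y" using eq x y n.a_closed[OF x y] by simp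
  qed
  have vf: "valued_field ?F (local_abs K v)"
    by (rule valued_field.intro[OF n.field_axioms valued_field_axioms.intro[OF abs]])
  note co = valued_field.complete_on_def[OF vf] and cv = valued_field.conv_def[OF vf]
  note cs = cauchy_seqs_powr[OF n.ring_axioms eq' s(1)]
  have "valued_field.complete_on ?F (local_abs K v) (carrier ?F)"
    unfolding co
  proof (intro ballI impI)
    fix t assume t: "t \<in> cauchy_seqs ?F (local_abs K v)" "range t \<subseteq> carrier ?F"
    have tn: "t \<in> cauchy_seqs ?F ?n" using t(1) by (simp only: cs(1))
    obtain l where l: "l \<in> carrier ?F" "n.conv t l"
      using mp[OF bspec[OF n.complete[unfolded n.complete_on_def] tn] t(2)] by (elim bexE)
    have "(\<lambda>k. t k \<ominus>\<^bsub>?F\<^esub> l) \<in> null_seqs ?F ?n"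
      using l t(2) n.minus_closed[OF _ l(1)] by (auto simp: null_seqs_def n.conv_def image_subset_iff)
    then have "(\<lambda>k. t k \<ominus>\<^bsub>?F\<^esub> l) \<in> null_seqs ?F (local_abs K v)" by (simp only: cs(2))
    then have "valued_field.conv ?F (local_abs K v) t l" by (simp add: null_seqs_def cv)
    with l(1) show "\<exists>l\<in>carrier ?F. valued_field.conv ?F (local_abs K v) t l" by (rule bexI[rotated])
  qed
  then show "complete_valued_field ?F (local_abs K v)"
    by (intro complete_valued_field.intro complete_valued_field_axioms.intro vf)
qed

lemma local_closure_alt: "local_closure K v = F.alg_closure" "to_local_closure K v = F.indexed_const"
  by (simp_all add: local_closure_def to_local_closure_def)

sublocale L: algebraic_closure "local_closure K v" "to_local_closure K v ` carrier (local_field K v)"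
  unfolding local_closure_alt by (rule F.alg_closureE(1))

lemma to_local_closure_hom: "to_local_closure K v \<in> ring_hom (local_field K v) (local_closure K v)"
  unfolding local_closure_alt by (rule F.alg_closureE(2))

text \<open>\<open>local_closure_abs\<close> is a definite description: an extension exists by the
  spectral radius, it is unique on the closure, and restricting it to the carrier makes it unique as
  a function.\<close>

lemma local_closure_abs:
  "is_abs (local_closure K v) (local_closure_abs K v)"
  "c \<in> carrier (local_field K v) \<Longrightarrow> local_closure_abs K v (to_local_closure K v c) = local_abs K v c"
proof -
  let ?P = "\<lambda>n. n \<in> absolute_values (local_closure K v) \<and>
     (\<forall>c\<in>carrier (local_field K v). n (to_local_closure K v c) = local_abs K v c)"
  obtain m where m: "is_abs (local_closure K v) m" "\<And>c. c \<in> carrier (local_field K v) \<Longrightarrow> m (to_local_closure K v c) = local_abs K v c"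
    using F.alg_closure_abs_exists unfolding local_closure_alt by blast
  have cl: "to_local_closure K v c \<in> carrier (local_closure K v)" if "c \<in> carrier (local_field K v)" for c
    using to_local_closure_hom that by (rule ring_hom_closed)
  have P: "?P (restrict m (carrier (local_closure K v)))"
    using is_abs_restrict[OF L.ring_axioms m(1)] m(2) cl by simp
  have "local_closure_abs K v = restrict m (carrier (local_closure K v))"
    unfolding local_closure_abs_def
  proof (rule the_equality[where P = ?P, OF P])
    fix m' assume m': "?P m'"
    have "m' x = m x" if x: "x \<in> carrier (local_closure K v)" for x
    proof (rule F.alg_closure_abs_unique)
      show "is_abs F.alg_closure m'" using m' by (simp add: absolute_values_iff local_closure_alt)
      show "is_abs F.alg_closure m" using m(1) by (simp only: local_closure_alt)
      show "x \<in> carrier F.alg_closure" using x by (simp only: local_closure_alt)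
      show "m' (F.indexed_const c) = local_abs K v c" "m (F.indexed_const c) = local_abs K v c" if "c \<in> carrier (local_field K v)" for c
        using m' m(2) that by (simp_all only: local_closure_alt)
    qed
    then show "m' = restrict m (carrier (local_closure K v))"
      using m' by (intro extensionalityI[of _ "carrier (local_closure K v)"]) (auto simp: absolute_values_iff)
  qed
  from arg_cong[where f = ?P, OF this] have P': "?P (local_closure_abs K v)" using P by (rule iffD2)
  show "is_abs (local_closure K v) (local_closure_abs K v)"
    using P' by (simp only: absolute_values_iff)
  show "c \<in> carrier (local_field K v) \<Longrightarrow> local_closure_abs K v (to_local_closure K v c) = local_abs K v c"
    by (rule P'[THEN conjunct2, THEN bspec])
qed

sublocale V: valued_field "local_closure K v" "local_closure_abs K v"
  by (intro valued_field.intro valued_field_axioms.intro L.field_axioms local_closure_abs(1))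

lemma Omega_alt: "Omega K v = completion (local_closure K v) (local_closure_abs K v)"
  "Omega_abs K v = completion_abs (local_closure K v) (local_closure_abs K v)"
  by (simp_all add: Omega_def Omega_abs_def)

lemma Omega_valued_field: "valued_field (Omega K v) (Omega_abs K v)"
  unfolding Omega_alt by (rule V.RC_valued_field)

lemma num_ring_field: "field (num_ring K)"
  by (rule csubfield_field[OF number_fieldD(1)[OF K]])

lemma to_Omega_hom: "to_Omega K v \<in> ring_hom (num_ring K) (Omega K v)"
proof -
  have "to_completion (local_closure K v) (local_closure_abs K v) \<circ> (to_local_closure K v \<circ> to_local_field K v)
      \<in> ring_hom (num_ring K) (Omega K v)"
    unfolding Omega_alt by (intro ring_hom_trans[OF _ V.iota_hom] ring_hom_trans[OF _ to_local_closure_hom] place_local(6)[OF K v])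
  then show ?thesis by (simp add: o_def to_Omega_def[abs_def])
qed

lemma to_local_field_closed: "x \<in> K \<Longrightarrow> to_local_field K v x \<in> carrier (local_field K v)"
  using ring_hom_closed[OF place_local(6)[OF K v]] by simp

lemma Omega_abs_to_Omega: assumes x: "x \<in> K" shows "Omega_abs K v (to_Omega K v x) = place_abs K v x powr local_exp K v"
proof -
  have c: "to_local_closure K v (to_local_field K v x) \<in> carrier (local_closure K v)"
    by (rule ring_hom_closed[OF to_local_closure_hom to_local_field_closed[OF x]])
  show ?thesis
    unfolding Omega_alt to_Omega_def V.nC_iota[OF c] local_closure_abs(2)[OF to_local_field_closed[OF x]]
    by (rule local_abs_eq[OF K v x])
qed

lemma circle_sqrt:
  assumes w: "w \<in> carrier (local_closure K v)" "local_closure_abs K v w = 1"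
  shows "\<exists>z\<in>carrier (local_closure K v). local_closure_abs K v z = 1 \<and> z \<otimes>\<^bsub>local_closure K v\<^esub> z = w"
proof -
  let ?L = "local_closure K v"
  let ?p = "[\<one>\<^bsub>?L\<^esub>, \<zero>\<^bsub>?L\<^esub>, \<ominus>\<^bsub>?L\<^esub> w]"
  have p: "?p \<in> carrier (poly_ring ?L)" using w by (simp add: univ_poly_carrier[symmetric] polynomial_def)
  then have "L.splitted ?p" by (rule L.roots_over_carrier)
  then have "L.roots ?p \<noteq> {#}" by (auto simp: L.splitted_def)
  then obtain z where "z \<in># L.roots ?p" by blast
  then have "L.is_root ?p z" using L.roots_mem_iff_is_root[OF p] by simp
  then have z: "z \<in> carrier ?L" and e: "L.eval ?p z = \<zero>\<^bsub>?L\<^esub>" by (auto simp: L.is_root_def)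
  have "z \<otimes>\<^bsub>?L\<^esub> z \<ominus>\<^bsub>?L\<^esub> w = \<zero>\<^bsub>?L\<^esub>"
    using e z w by (simp add: numeral_2_eq_2 a_minus_def)
  then have zz: "z \<otimes>\<^bsub>?L\<^esub> z = w" using z w by simp
  have "local_closure_abs K v z * local_closure_abs K v z = 1" using V.n_mult[OF z z] zz w by simp
  then have "local_closure_abs K v z = 1" using V.n_nonneg[OF z] by (metis abs_of_nonneg abs_square_eq_1 power2_eq_square)
  then show ?thesis using z zz by blast
qed

text \<open>Square roots exist in the algebraic closure and are carried into its completion by the
  isometric embedding. That 2 is nonzero follows from the embedding of K.\<close>

lemma circle_field_Omega:
  "circle_field (Omega K v) (Omega_abs K v)
     (to_completion (local_closure K v) (local_closure_abs K v) ` {z \<in> carrier (local_closure K v). local_closure_abs K v z = 1})"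
proof -
  let ?L = "local_closure K v" and ?i = "to_completion (local_closure K v) (local_closure_abs K v)"
  interpret O: valued_field "Omega K v" "Omega_abs K v" by (rule Omega_valued_field)
  have ih: "?i \<in> ring_hom ?L (Omega K v)" unfolding Omega_alt by (rule V.iota_hom)
  interpret i: ring_hom_ring ?L "Omega K v" ?i by (intro ring_hom_ringI2 L.ring_axioms O.ring_axioms ih)
  interpret k: field "num_ring K" by (rule num_ring_field)
  interpret t: ring_hom_ring "num_ring K" "Omega K v" "to_Omega K v" by (intro ring_hom_ringI2 k.ring_axioms O.ring_axioms to_Omega_hom)
  have n: "Omega_abs K v (?i z) = local_closure_abs K v z" if "z \<in> carrier ?L" for z
    unfolding Omega_alt by (rule V.nC_iota[OF that])
  show ?thesis
  proof (intro circle_field.intro circle_field_axioms.intro Omega_valued_field)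
    show "?i ` {z \<in> carrier ?L. local_closure_abs K v z = 1} \<subseteq> carrier (Omega K v)" by auto
    show "\<one>\<^bsub>Omega K v\<^esub> \<in> ?i ` {z \<in> carrier ?L. local_closure_abs K v z = 1}"
      by (rule image_eqI[of _ _ "\<one>\<^bsub>?L\<^esub>"]) (simp_all add: i.hom_one)
    fix w assume "w \<in> ?i ` {z \<in> carrier ?L. local_closure_abs K v z = 1}"
    then obtain w' where w': "w' \<in> carrier ?L" "local_closure_abs K v w' = 1" "w = ?i w'" by blast
    show "Omega_abs K v w = 1" using n w' by simp
    show "\<ominus>\<^bsub>Omega K v\<^esub> w \<in> ?i ` {z \<in> carrier ?L. local_closure_abs K v z = 1}"
      by (rule image_eqI[of _ _ "\<ominus>\<^bsub>?L\<^esub> w'"]) (use w' in \<open>simp_all add: i.hom_a_inv\<close>)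
    obtain z where z: "z \<in> carrier ?L" "local_closure_abs K v z = 1" "z \<otimes>\<^bsub>?L\<^esub> z = w'" using circle_sqrt[OF w'(1,2)] by blast
    show "\<exists>z\<in>?i ` {z \<in> carrier ?L. local_closure_abs K v z = 1}. z \<otimes>\<^bsub>Omega K v\<^esub> z = w"
      by (rule bexI[of _ "?i z"]) (use z w' i.hom_mult[OF z(1) z(1)] in auto)
  next
    note Kf = csubfieldD[OF number_fieldD(1)[OF K]]
    have inj: "inj_on (to_Omega K v) K"
      using non_trivial_field_hom_is_inj[OF to_Omega_hom k.field_axioms O.field_axioms] by simp
    have "to_Omega K v 2 = \<one>\<^bsub>Omega K v\<^esub> \<oplus>\<^bsub>Omega K v\<^esub> \<one>\<^bsub>Omega K v\<^esub>"
      using t.hom_add[of 1 1] t.hom_one Kf(2) by simp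
    moreover have "to_Omega K v 2 \<noteq> to_Omega K v 0"
      using inj_onD[OF inj, of 2 0] Kf(1) Kf(3)[OF Kf(2) Kf(2)] by auto
    ultimately show "\<one>\<^bsub>Omega K v\<^esub> \<oplus>\<^bsub>Omega K v\<^esub> \<one>\<^bsub>Omega K v\<^esub> \<noteq> \<zero>\<^bsub>Omega K v\<^esub>"
      using t.hom_zero by simp
  qed
qed

lemma poly_to_Omega:
  assumes T: "\<And>i. Polynomial.coeff T i \<in> K" and T0: "T \<noteq> 0"
  shows "poly_to_Omega K v T \<in> carrier (poly_ring (Omega K v))"
    "Polynomials.degree (poly_to_Omega K v T) = Polynomial.degree T"
    "\<alpha> \<in> K \<Longrightarrow> ring.eval (Omega K v) (poly_to_Omega K v T) (to_Omega K v \<alpha>) = to_Omega K v (poly T \<alpha>)"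
    "\<alpha> \<in> K \<Longrightarrow> poly T \<alpha> \<in> K"
proof -
  interpret O: valued_field "Omega K v" "Omega_abs K v" by (rule Omega_valued_field)
  interpret k: field "num_ring K" by (rule num_ring_field)
  interpret CC: field "num_ring UNIV" by (rule num_ring_field_UNIV)
  interpret t: ring_hom_ring "num_ring K" "Omega K v" "to_Omega K v" by (intro ring_hom_ringI2 k.ring_axioms O.ring_axioms to_Omega_hom)
  let ?p = "rev (coeffs T)"
  have set: "set ?p \<subseteq> K" using T by (auto simp: coeffs_def)
  have "hd ?p \<noteq> 0" using T0 by (simp add: hd_rev last_coeffs_eq_coeff_degree)
  then have "?p \<in> carrier (poly_ring (num_ring K))" using set by (simp add: univ_poly_carrier[symmetric] polynomial_def)
  then show "poly_to_Omega K v T \<in> carrier (poly_ring (Omega K v))"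
    unfolding poly_to_Omega_def by (rule polynomial_hom[OF to_Omega_hom k.field_axioms O.field_axioms])
  show "Polynomials.degree (poly_to_Omega K v T) = Polynomial.degree T"
    by (simp add: poly_to_Omega_def degree_eq_length_coeffs)
  have "k.eval ?p \<alpha> = CC.eval ?p \<alpha>"
    using CC.eval_consistent[OF subfieldE(1)[OF number_fieldD(1)[OF K]]] by (simp add: num_ring_carrier_update)
  then have e: "k.eval ?p \<alpha> = poly T \<alpha>" by (simp add: CC_eval)
  show "ring.eval (Omega K v) (poly_to_Omega K v T) (to_Omega K v \<alpha>) = to_Omega K v (poly T \<alpha>)" if "\<alpha> \<in> K"
    using t.eval_hom'[of \<alpha> ?p] that set e by (simp add: poly_to_Omega_def)
  show "poly T \<alpha> \<in> K" if "\<alpha> \<in> K" using k.eval_in_carrier[of ?p \<alpha>] that set e by simp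
qed

lemma U_local_eq:
  assumes T: "\<And>i. Polynomial.coeff T i \<in> K" and \<alpha>: "\<alpha> \<in> K" and deg: "int (Polynomial.degree T) \<le> N" and nz: "poly T \<alpha> \<noteq> 0"
  shows "U_local K v N (to_Omega K v \<alpha>) (poly_to_Omega K v T)
    = ereal (local_exp K v * ln (place_abs K v (poly T \<alpha>)) - of_int N * (local_exp K v * max 0 (ln (place_abs K v \<alpha>))))"
proof -
  interpret c: circle_field "Omega K v" "Omega_abs K v"
    "to_completion (local_closure K v) (local_closure_abs K v) ` {z \<in> carrier (local_closure K v). local_closure_abs K v z = 1}"
    by (rule circle_field_Omega)
  have T0: "T \<noteq> 0" using nz by auto
  note pT = poly_to_Omega[OF T T0]
  have tc: "to_Omega K v x \<in> carrier (Omega K v)" if "x \<in> K" for x using ring_hom_closed[OF to_Omega_hom] that by simp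
  have TK: "poly T \<alpha> \<in> K" by (rule pT(4)[OF \<alpha>])
  have pos: "place_abs K v (poly T \<alpha>) > 0"
    using place_abs_nonneg[OF K v TK] place_abs_eq_0[OF K v TK] nz by simp
  have ne: "to_Omega K v (poly T \<alpha>) \<noteq> \<zero>\<^bsub>Omega K v\<^esub>"
  proof
    assume "to_Omega K v (poly T \<alpha>) = \<zero>\<^bsub>Omega K v\<^esub>"
    then have "place_abs K v (poly T \<alpha>) powr local_exp K v = 0" using Omega_abs_to_Omega[OF TK] by simp
    then show False using pos by simp
  qed
  have ln: "ln (place_abs K v \<alpha> powr local_exp K v) = local_exp K v * ln (place_abs K v \<alpha>)"
    using place_abs_nonneg[OF K v \<alpha>] by (cases "place_abs K v \<alpha> = 0") (auto simp: ln_powr)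
  have mx: "max 0 (ln (place_abs K v \<alpha> powr local_exp K v)) = local_exp K v * max 0 (ln (place_abs K v \<alpha>))"
    unfolding ln using local_exp[OF K v] by (simp add: max_def mult_le_0_iff zero_le_mult_iff)
  have deg': "int (Polynomials.degree (poly_to_Omega K v T)) \<le> N" unfolding pT(2) by (rule deg)
  have nz': "ring.eval (Omega K v) (poly_to_Omega K v T) (to_Omega K v \<alpha>) \<noteq> \<zero>\<^bsub>Omega K v\<^esub>"
    unfolding pT(3)[OF \<alpha>] by (rule ne)
  show ?thesis
    unfolding U_local_def nu_def c.extremal_value[OF pT(1) deg' tc[OF \<alpha>] nz'] pT(3)[OF \<alpha>] Omega_abs_to_Omega[OF TK] Omega_abs_to_Omega[OF \<alpha>] mx
    using pos by (simp add: ln_powr)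
qed

end

section \<open>Summation of the local values\<close>

theorem U_over_eq:
  assumes K: "number_field K" and T: "\<And>i. Polynomial.coeff T i \<in> K" and \<alpha>: "\<alpha> \<in> K"
    and deg: "int (Polynomial.degree T) \<le> N" and nz: "poly T \<alpha> \<noteq> 0"
  shows "U_over K N \<alpha> T = ereal (- (of_int N * weil_height \<alpha>))"
\<comment> \<open>That T(\<alpha>) lies in K is taken from \<open>number_place\<close>, which can be
  interpreted only at an existing place. If there were none, both sides would be empty sums.\<close>
proof (cases "places K = {}")
  case True
  then show ?thesis using weil_height_eq[OF K \<alpha>] by (simp add: U_over_def height_over_def)
next
  case False
  then obtain v0 where v0: "v0 \<in> places K" by blast
  have TK: "poly T \<alpha> \<in> K"
  proof -
    interpret number_place K v0 using K v0 by (rule number_place.intro)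
    show ?thesis by (rule poly_to_Omega(4)[OF T _ \<alpha>]) (use nz in auto)
  qed
  define f where "f = (\<lambda>v. local_exp K v * ln (place_abs K v (poly T \<alpha>)))"
  define g where "g = (\<lambda>v. local_exp K v * max 0 (ln (place_abs K v \<alpha>)))"
  define A where "A = {v\<in>places K. ln (place_abs K v (poly T \<alpha>)) \<noteq> 0} \<union> {v\<in>places K. max 0 (ln (place_abs K v \<alpha>)) \<noteq> 0}"
  have "finite {v\<in>places K. max 0 (ln (place_abs K v \<alpha>)) \<noteq> 0}"
  \<comment> \<open>\<open>finite_support\<close> concerns nonzero numbers; for \<alpha> = 0 every
    term vanishes by the convention \<open>ln 0 = 0\<close>.\<close>
  proof (cases "\<alpha> = 0")
    case True
    then have "place_abs K v \<alpha> = 0" if "v \<in> places K" for v using place_abs_eq_0[OF K that \<alpha>] by simp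
    then have "{v\<in>places K. max 0 (ln (place_abs K v \<alpha>)) \<noteq> 0} = {}" by auto
    then show ?thesis by (simp only: finite.emptyI)
  qed (rule finite_support[OF K \<alpha>, of "\<lambda>t. max 0 (ln t)"], simp_all)
  then have A: "finite A" using finite_support[OF K TK nz, of ln] by (simp add: A_def)
  have Asub: "A \<subseteq> places K" by (auto simp: A_def)
  have out: "f v = 0" "g v = 0" if "v \<in> places K - A" for v using that by (auto simp: A_def f_def g_def)
  have ul: "U_local K v N (to_Omega K v \<alpha>) (poly_to_Omega K v T) = ereal (f v - of_int N * g v)" if v: "v \<in> places K" for v
  proof -
    interpret number_place K v using K v by (rule number_place.intro)
    show ?thesis using U_local_eq[OF T \<alpha> deg nz] by (simp add: f_def g_def)
  qed
  \<comment> \<open>The extended reals form no group, so the sum is cut down to a finite set that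
    supports both f and g before it is split into real sums.\<close>
  have "U_over K N \<alpha> T = infsum (\<lambda>v. ereal (f v - of_int N * g v)) A"
    unfolding U_over_def by (rule infsum_cong_neutral) (use Asub out ul in auto)
  also have "\<dots> = ereal (sum f A - of_int N * sum g A)"
    using A by (simp add: sum_subtractf sum_distrib_left)
  also have "sum f A = infsum f A" using A by simp
  also have "\<dots> = infsum f (places K)" by (rule infsum_cong_neutral) (use Asub out in auto)
  also have "\<dots> = 0" unfolding f_def by (rule product_formula[OF K TK nz])
  also have "sum g A = infsum g A" using A by simp
  also have "\<dots> = infsum g (places K)" by (rule infsum_cong_neutral) (use Asub out in auto)
  also have "\<dots> = weil_height \<alpha>" unfolding g_def weil_height_eq[OF K \<alpha>] height_over_exp[OF K \<alpha>] ..
  finally show ?thesis by simp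
qed

lemma number_field_exists:
  assumes "finite A" "\<And>x. x \<in> A \<Longrightarrow> algebraic x"
  shows "\<exists>K. number_field K \<and> A \<subseteq> K"
proof -
  interpret CC: field "num_ring UNIV" by (rule num_ring_field_UNIV)
  obtain xs where xs: "set xs = A" using finite_list[OF assms(1)] by blast
  have xc: "set xs \<subseteq> carrier (num_ring UNIV)" by simp
  have alg: "(CC.algebraic over \<rat>) x" if x: "x \<in> set xs" for x
  proof -
    obtain p where p: "\<And>i. Polynomial.coeff p i \<in> \<rat>" "p \<noteq> 0" "poly p x = 0"
      using assms(2)[of x] x xs unfolding algebraic_altdef by blast
    have "set (rev (coeffs p)) \<subseteq> \<rat>" using p(1) by (auto simp: coeffs_def)
    moreover have "hd (rev (coeffs p)) \<noteq> 0" using p(2) by (simp add: hd_rev last_coeffs_eq_coeff_degree)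
    ultimately have "rev (coeffs p) \<in> carrier (univ_poly (num_ring UNIV) \<rat>)" by (simp add: univ_poly_carrier[symmetric] polynomial_def)
    moreover have "CC.eval (rev (coeffs p)) x = \<zero>\<^bsub>num_ring UNIV\<^esub>" using p(3) by (simp add: CC_eval)
    ultimately show ?thesis using p(2) by (intro CC.algebraicI[of "rev (coeffs p)"]) auto
  qed
  have "number_field (CC.finite_extension \<rat> xs)"
    unfolding number_field_def
    using CC.finite_extension_is_subfield[OF csubfield_Rats xc alg] CC.finite_extension_finite_dimension(1)[OF csubfield_Rats xc alg] by blast
  moreover have "A \<subseteq> CC.finite_extension \<rat> xs"
    using CC.finite_extension_mem[OF subfieldE(1)[OF csubfield_Rats] xc] xs by simp
  ultimately show ?thesis by blast
qed

text \<open>\<open>U\<close> denotes the common value of \<open>U_over\<close> for all admissible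
  number fields. Such a value is unique only if an admissible field exists; one is generated by
  \<alpha> and the finitely many nonzero coefficients.\<close>

lemma U_eq:
  assumes \<alpha>: "algebraic \<alpha>" and T: "\<forall>i. algebraic (Polynomial.coeff T i)" and deg: "int (Polynomial.degree T) \<le> N"
    and nz: "poly T \<alpha> \<noteq> 0"
  shows "U N \<alpha> T = ereal (- (of_int N * weil_height \<alpha>))"
proof -
  have "finite (insert \<alpha> (Polynomial.coeff T ` {..Polynomial.degree T}))" by simp
  then obtain K where K: "number_field K" "insert \<alpha> (Polynomial.coeff T ` {..Polynomial.degree T}) \<subseteq> K"
    using number_field_exists[of "insert \<alpha> (Polynomial.coeff T ` {..Polynomial.degree T})"] \<alpha> T by blast
  have cK: "Polynomial.coeff T i \<in> K" for i
  proof (cases "i \<le> Polynomial.degree T")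
    case False
    then show ?thesis using csubfieldD(1)[OF number_fieldD(1)[OF K(1)]] by (simp add: coeff_eq_0)
  qed (use K(2) in auto)
  show ?thesis unfolding U_def
  proof (rule the_equality)
    show "\<forall>K. number_field K \<and> \<alpha> \<in> K \<and> (\<forall>i. Polynomial.coeff T i \<in> K) \<longrightarrow>
      U_over K N \<alpha> T = ereal (- (of_int N * weil_height \<alpha>))"
      using U_over_eq[OF _ _ _ deg nz] by blast
    fix u assume "\<forall>K. number_field K \<and> \<alpha> \<in> K \<and> (\<forall>i. Polynomial.coeff T i \<in> K) \<longrightarrow> U_over K N \<alpha> T = u"
    then have "U_over K N \<alpha> T = u" using K cK by simp
    then show "u = ereal (- (of_int N * weil_height \<alpha>))" using U_over_eq[OF K(1) cK _ deg nz] K(2) by simp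
  qed
qed

theorem theorem2p2:
  fixes N :: int and \<alpha> :: complex and T :: "complex poly"
  assumes "algebraic \<alpha>"
    and "\<forall>i. algebraic (Polynomial.coeff T i)"
    and "int (Polynomial.degree T) \<le> N"
    and "poly T \<alpha> \<noteq> 0"
  shows "U N \<alpha> T = U N \<alpha> 1 \<and> U N \<alpha> 1 = ereal (- (of_int N * weil_height \<alpha>))"
proof -
  have "algebraic (Polynomial.coeff (1 :: complex poly) i)" for i
    by (cases i) simp_all
  \<comment> \<open>The degree condition for the polynomial 1 reads 0 \<le> N, which follows from
    the bound on the degree of T.\<close>
  then have "U N \<alpha> 1 = ereal (- (of_int N * weil_height \<alpha>))"
    using assms(1,3) by (intro U_eq) auto
  then show ?thesis using U_eq[OF assms] by simp
qed

end
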